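(* Let $\boldsymbol{\mu}=[T,d,\rho,\mu]$ and $\boldsymbol{\mu}_n=[T_n,d_n,\rho_n,\mu_n]$, $n\in\mathbb{N}$, be isometry classes in $\mathbb{T}_{\rm min}^{\rm di}$ (with the indicated representatives). Let $r_k\to\infty$ be an increasing sequence of $\boldsymbol{\mu}$-nice radii. For each $n$ and $k$, let $\Diamond_n^{r_k}$ be $\bullet^{r_k}(\mu)$-compatible cut-off points in $\partial B_{T_n}(\rho_n,r_k)$. Let $h_0>0$. Then the following are equivalent: (a) $\boldsymbol{\mu}_n\to\boldsymbol{\mu}$ Gromov-vaguely and $\big(\mu_n|_{{\rm Cut}(T_n,\Diamond_n^{r_k})}\big)_{n\in\mathbb{N}}$ is b-tight for all $k$. (b) $\boldsymbol{\mu}_n\to\boldsymbol{\mu}$ Gromov-vaguely in the sense of mass erasure, $\big((\mathscr{E}_h\mu_n)|_{{\rm Cut}(T_n,\Diamond_n^{r_k})}\big)_{n\in\mathbb{N}}$ is b-tight for all $h>0$ and all $k$, and the height measures satisfy $\lambda_{{\rm cut}^{h_0}_{\Diamond_n^{r_k}}\boldsymbol{\mu}_n}\to\lambda_{{\rm cut}^{h_0}_{\bullet^{r_k}(\mu)}\boldsymbol{\mu}}$ weakly (as finite measures on $[0,\infty)$) as $n\to\infty$ for all $k$.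
   Context: Trees and measures. An $\mathbb{R}$-tree is a pointed metric space $(T,d,\rho)$ (root $\rho$) such that any $\sigma_1,\sigma_2\in T$ are the end points of a unique segment $[\sigma_1,\sigma_2]$ (isometric image of a compact real interval), and whenever two segments satisfy $[\sigma_1,\sigma_0]\cap[\sigma_0,\sigma_2]=\{\sigma_0\}$, their union is a segment with end points $\sigma_1,\sigma_2$. It is Polish if $(T,d)$ is complete and separable. $\theta_\sigma T=\{\sigma'\in T:\sigma\in[\rho,\sigma']\}$. For $r>0$, $\overline B_T(\rho,r)=\{\sigma: d(\rho,\sigma)\le r\}$, $\partial B_T(\rho,r)=\{\sigma:d(\rho,\sigma)=r\}$. $n(\sigma,T)$ is the number of connected components of $T\setminus\{\sigma\}$; ${\rm Lf}(T)=\{\sigma\ne\rho:n(\sigma,T)=1\}$, ${\rm Bp}(T)=\{\sigma\ne\rho: n(\sigma,T)\ge 3\}$. $T$ is discrete if it is complete and $n(\rho,T)+\sum_{\sigma\in{\rm Bp}(T)\cap\overline B_T(\rho,r)}n(\sigma,T)<\infty$ for all $r>0$. A Borel measure is boundedly finite if finite on bounded sets; $\mathscr{M}_{\rm bf}(T)$, $\mathscr{M}_{\rm fin}(T)$ are the sets of boundedly finite and finite Borel measures. ${\rm Skel}(T,\mu)=\{\rho\}\cup\{\sigma:\mu(\theta_\sigma T)=+\infty\}$, $F_\mu(T)=T\setminus{\rm Skel}(T,\mu)$. $\mu\in\mathscr{M}_{\rm bf}(T)$ is discretely infinite if $\mu(T)=+\infty$, ${\rm Skel}(T,\mu)$ is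 a discrete $\mathbb{R}$-tree, and $\mu\big(\bigcup_{\sigma\in\partial B_T(\rho,r)\cap F_\mu(T)}\theta_\sigma T\big)<\infty$ for all $r>0$. $\mathscr{M}_{\rm di}(T)$ is the set of finite or discretely infinite measures. Mass erasure. For a closed rooted subtree $T'\subseteq T$ (closed, connected, containing $\rho$), $f_{T'}(\sigma)$ is the unique point with $[\rho,\sigma]\cap T'=[\rho,f_{T'}(\sigma)]$ and ${\rm Pr}_{T'}\mu=\mu\circ f_{T'}^{-1}$. $R_{\mu,h}(T)=\{\rho\}\cup\{\sigma:\mu(\theta_\sigma T)\ge h\}$ and $R_{\mu,h+}(T)=\overline{\bigcup_{h'>h}R_{\mu,h'}(T)}$. For $h>0$, $\mu\in\mathscr{M}_{\rm di}(T)$ and $R=R_{\mu,h}(T)$: $\mathscr{E}_h\mu=0$ if $\mu(T)<h$, and otherwise $$\mathscr{E}_h\mu={\rm Pr}_R\mu(\,\cdot\cap(R\setminus{\rm Lf}(R)))+\sum_{\sigma\in{\rm Lf}(R)}(\mu(\theta_\sigma T)-h)\delta_\sigma+h(n(\rho,R)-1)\delta_\rho+h\sum_{\sigma\in{\rm Bp}(R)}(n(\sigma,R)-2)\delta_\sigma ,$$ an element of $\mathscr{M}_{\rm di}(T)$. Isometry classes. ${\rm Span}(A)=\{\rho\}\cup\bigcup_{\sigma\in A}[\rho,\sigma]$. $(T,d,\rho,\mu)$ is minimal if $T=\overline{{\rm Span}({\rm supp}(\mu))}$. Two measured trees are isometric if there is a root-preserving bijective isometry pushing one measure to the other. $\mathbb{T}_{\rm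 min}^{\rm fin}$, $\mathbb{T}_{\rm min}^{\rm di}$, $\mathbb{T}_{\rm min}^{\rm bf}$ are the sets of isometry classes $[T,d,\rho,\mu]$ of minimal Polish $\mathbb{R}$-trees with $\mu$ in $\mathscr{M}_{\rm fin}(T)$, $\mathscr{M}_{\rm di}(T)$, $\mathscr{M}_{\rm bf}(T)$. For $\boldsymbol\mu=[T,d,\rho,\mu]\in\mathbb{T}_{\rm min}^{\rm di}$ and $h>0$, $\mathscr{E}_h\boldsymbol\mu=[R_{\mu,h+}(T),d,\rho,\mathscr{E}_h\mu]$. The height measure $\lambda_{\boldsymbol\mu}=\lambda_\mu$ is the pushforward of $\mu$ under $\sigma\mapsto d(\rho,\sigma)\in[0,\infty)$. Gromov-type convergences. $d_{\rm GP}$ on $\mathbb{T}_{\rm min}^{\rm fin}$ is the infimum of the Prokhorov distances $\delta_{\rm P}(\mu_1\circ\phi_1^{-1},\mu_2\circ\phi_2^{-1})$ over pointed metric spaces $(\mathscr{Z},\delta,\varrho)$ and root-preserving isometric embeddings $\phi_i:T_i\to\mathscr{Z}$, where $\delta_{\rm P}(\mu,\nu)=\inf\{\varepsilon>0:\mu(A)\le\nu(A^\varepsilon)+\varepsilon,\ \nu(A)\le\mu(A^\varepsilon)+\varepsilon\ \forall A\text{ closed}\}$, $A^\varepsilon=\{x:\delta(x,A)\le\varepsilon\}$. With $\mu^{\restriction r}=\mu|_{\overline B_T(\rho,r)}$ and $\boldsymbol\mu^{\restriction r}=[\overline{{\rm Span}({\rm supp}(\mu^{\restriction r}))},d,\rho,\mu^{\restriction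 r}]$, $d_{\rm GV}(\boldsymbol\mu_1,\boldsymbol\mu_2)=\int_0^\infty e^{-r}(1\wedge d_{\rm GP}(\boldsymbol\mu_1^{\restriction r},\boldsymbol\mu_2^{\restriction r}))\,dr$. Gromov-vague convergence means $d_{\rm GV}\to0$. $\boldsymbol\mu_n\to\boldsymbol\mu$ Gromov-vaguely in the sense of mass erasure if $\mathscr{E}_h\boldsymbol\mu_n\to\mathscr{E}_h\boldsymbol\mu$ Gromov-vaguely for all $h>0$. Cut-off. $\bullet^r(\mu)=\partial B_T(\rho,r)\cap{\rm Skel}(T,\mu)$ (a finite set). Cut-off points at level $r$ are a finite subset $\Diamond^r\subseteq\partial B_T(\rho,r)$; ${\rm Cut}(T,\Diamond^r)=\overline B_T(\rho,r)\cup\bigcup_{\sigma\in\partial B_T(\rho,r)\setminus\Diamond^r}\theta_\sigma T$, ${\rm cut}_{\Diamond^r}^{h_0}\mu=\mu|_{{\rm Cut}(T,\Diamond^r)}+h_0\sum_{\sigma\in\Diamond^r}\delta_\sigma$, and ${\rm cut}_{\Diamond^r}^{h_0}\boldsymbol\mu=[\overline{{\rm Span}({\rm supp}({\rm cut}_{\Diamond^r}^{h_0}\mu))},d,\rho,{\rm cut}_{\Diamond^r}^{h_0}\mu]$. $\Diamond_n^r\subseteq\partial B_{T_n}(\rho_n,r)$ is $\bullet^r(\mu)$-compatible if $|\Diamond_n^r|=|\bullet^r(\mu)|\wedge|\partial B_{T_n}(\rho_n,r)|$. $r>0$ is $\boldsymbol\mu$-nice if $\mu(\partial B_T(\rho,r))=0$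 and $\partial B_T(\rho,r)\cap{\rm Bp}(T)=\emptyset$. Measures $\nu_n$ on $T_n$ form a b-tight sequence if $\lim_{R\to\infty}\limsup_{n\to\infty}\nu_n(T_n\setminus\overline B_{T_n}(\rho_n,R))=0$. Convention: weak convergence of measures that are only eventually finite includes the assertion that they are finite for all large $n$. *)

theory Defs
  imports "HOL-Analysis.Analysis"
begin

section \<open>Rooted real trees\<close>

text \<open>Pointed metric spaces are pairs of a metric and a root. A subtree of \<open>m\<close> with point set
  \<open>S\<close> is handled as the metric \<^term>\<open>submetric m S\<close>.\<close>

text \<open>Number of elements of a set, with value \<^term>\<open>\<infinity>\<close> for all infinite sets
  (whereas \<^term>\<open>card\<close> would give \<open>0\<close>).\<close>
definition ecard :: "'a set \<Rightarrow> ennreal" where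
  "ecard A = emeasure (count_space UNIV) A"

definition is_segment :: "'a metric \<Rightarrow> 'a set \<Rightarrow> 'a \<Rightarrow> 'a \<Rightarrow> bool" where
  "is_segment m S a b \<longleftrightarrow> S \<subseteq> mspace m \<and>
     (\<exists>(p::real) q g. p \<le> q \<and> (\<forall>s\<in>{p..q}. \<forall>t\<in>{p..q}. mdist m (g s) (g t) = \<bar>s - t\<bar>) \<and>
        g p = a \<and> g q = b \<and> S = g ` {p..q})"

definition rtree :: "'a metric \<Rightarrow> 'a \<Rightarrow> bool" where
  "rtree m \<rho> \<longleftrightarrow> \<rho> \<in> mspace m \<and>
     (\<forall>a\<in>mspace m. \<forall>b\<in>mspace m. \<exists>!S. is_segment m S a b) \<and>
     (\<forall>a\<in>mspace m. \<forall>b\<in>mspace m. \<forall>c\<in>mspace m. \<forall>S S'.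
        is_segment m S a c \<longrightarrow> is_segment m S' c b \<longrightarrow> S \<inter> S' = {c} \<longrightarrow> is_segment m (S \<union> S') a b)"

definition polish_metric :: "'a metric \<Rightarrow> bool" where
  "polish_metric m \<longleftrightarrow> mcomplete_of m \<and> separable_space (mtopology_of m)"

definition seg :: "'a metric \<Rightarrow> 'a \<Rightarrow> 'a \<Rightarrow> 'a set" where
  "seg m a b = (THE S. is_segment m S a b)"

definition above :: "'a metric \<Rightarrow> 'a \<Rightarrow> 'a \<Rightarrow> 'a set" where
  "above m \<rho> \<sigma> = {\<sigma>' \<in> mspace m. \<sigma> \<in> seg m \<rho> \<sigma>'}"

definition tball :: "'a metric \<Rightarrow> 'a \<Rightarrow> real \<Rightarrow> 'a set" where
  "tball m \<rho> r = {\<sigma> \<in> mspace m. mdist m \<rho> \<sigma> \<le> r}"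

definition tsphere :: "'a metric \<Rightarrow> 'a \<Rightarrow> real \<Rightarrow> 'a set" where
  "tsphere m \<rho> r = {\<sigma> \<in> mspace m. mdist m \<rho> \<sigma> = r}"

definition ncomp :: "'a metric \<Rightarrow> 'a \<Rightarrow> ennreal" where
  "ncomp m \<sigma> =
     ecard (connected_components_of (subtopology (mtopology_of m) (mspace m - {\<sigma>})))"

definition Lf :: "'a metric \<Rightarrow> 'a \<Rightarrow> 'a set" where
  "Lf m \<rho> = {\<sigma> \<in> mspace m. \<sigma> \<noteq> \<rho> \<and> ncomp m \<sigma> = 1}"

definition Bp :: "'a metric \<Rightarrow> 'a \<Rightarrow> 'a set" where
  "Bp m \<rho> = {\<sigma> \<in> mspace m. \<sigma> \<noteq> \<rho> \<and> ncomp m \<sigma> \<ge> 3}"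

definition discrete_rtree :: "'a metric \<Rightarrow> 'a \<Rightarrow> bool" where
  "discrete_rtree m \<rho> \<longleftrightarrow> rtree m \<rho> \<and> mcomplete_of m \<and>
     (\<forall>r>0. ncomp m \<rho> + (\<Sum>\<^sub>\<infinity>\<sigma>\<in>Bp m \<rho> \<inter> tball m \<rho> r. ncomp m \<sigma>) < \<infinity>)"

definition tree_span :: "'a metric \<Rightarrow> 'a \<Rightarrow> 'a set \<Rightarrow> 'a set" where
  "tree_span m \<rho> A = {\<rho>} \<union> (\<Union>\<sigma>\<in>A. seg m \<rho> \<sigma>)"

section \<open>Measures on trees\<close>

definition metric_borel :: "'a metric \<Rightarrow> 'a measure" where
  "metric_borel m = sigma (mspace m) {U. openin (mtopology_of m) U}"

definition borel_measures :: "'a metric \<Rightarrow> 'a measure set" where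
  "borel_measures m = {\<mu>. space \<mu> = mspace m \<and> sets \<mu> = sets (metric_borel m)}"

definition M_fin :: "'a metric \<Rightarrow> 'a measure set" where
  "M_fin m = {\<mu> \<in> borel_measures m. finite_measure \<mu>}"

definition M_bf :: "'a metric \<Rightarrow> 'a measure set" where
  "M_bf m = {\<mu> \<in> borel_measures m.
     \<forall>B\<in>sets \<mu>. Metric_space.mbounded (mspace m) (mdist m) B \<longrightarrow> emeasure \<mu> B < \<infinity>}"

definition msupp :: "'a metric \<Rightarrow> 'a measure \<Rightarrow> 'a set" where
  "msupp m \<mu> = {x \<in> mspace m. \<forall>U. openin (mtopology_of m) U \<longrightarrow> x \<in> U \<longrightarrow> emeasure \<mu> U > 0}"

text \<open>The restriction of \<open>\<mu>\<close> to \<open>B\<close>, still regarded as a measure on the whole space.\<close>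
definition mrestr :: "'a measure \<Rightarrow> 'a set \<Rightarrow> 'a measure" where
  "mrestr \<mu> B = density \<mu> (indicator B)"

definition Skel :: "'a metric \<Rightarrow> 'a \<Rightarrow> 'a measure \<Rightarrow> 'a set" where
  "Skel m \<rho> \<mu> = {\<rho>} \<union> {\<sigma> \<in> mspace m. emeasure \<mu> (above m \<rho> \<sigma>) = \<infinity>}"

definition discretely_infinite :: "'a metric \<Rightarrow> 'a \<Rightarrow> 'a measure \<Rightarrow> bool" where
  "discretely_infinite m \<rho> \<mu> \<longleftrightarrow> \<mu> \<in> M_bf m \<and> emeasure \<mu> (mspace m) = \<infinity> \<and>
     discrete_rtree (submetric m (Skel m \<rho> \<mu>)) \<rho> \<and>
     (\<forall>r>0. emeasure \<mu>
        (\<Union>\<sigma>\<in>tsphere m \<rho> r \<inter> (mspace m - Skel m \<rho> \<mu>). above m \<rho> \<sigma>) < \<infinity>)"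

definition M_di :: "'a metric \<Rightarrow> 'a \<Rightarrow> 'a measure set" where
  "M_di m \<rho> = {\<mu>. \<mu> \<in> M_fin m \<or> discretely_infinite m \<rho> \<mu>}"

section \<open>Measured trees\<close>

text \<open>A measured tree is a representative of its isometry class. The constructions below are all
  defined on representatives and only depend on the isometry class.\<close>

record 'a mtree =
  tmet :: "'a metric"
  troot :: "'a"
  tmeas :: "'a measure"

definition minimal_polish_rtree :: "'a mtree \<Rightarrow> bool" where
  "minimal_polish_rtree X \<longleftrightarrow> rtree (tmet X) (troot X) \<and> polish_metric (tmet X) \<and>
     mspace (tmet X) = mtopology_of (tmet X) closure_of
       tree_span (tmet X) (troot X) (msupp (tmet X) (tmeas X))"

definition T_min_di :: "'a mtree set" where
  "T_min_di = {X. minimal_polish_rtree X \<and> tmeas X \<in> M_di (tmet X) (troot X)}"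

definition spanned_tree :: "'a metric \<Rightarrow> 'a \<Rightarrow> 'a measure \<Rightarrow> 'a mtree" where
  "spanned_tree m \<rho> \<nu> =
     (let S = mtopology_of m closure_of tree_span m \<rho> (msupp m \<nu>)
      in \<lparr>tmet = submetric m S, troot = \<rho>, tmeas = restrict_space \<nu> S\<rparr>)"

definition height_measure :: "'a mtree \<Rightarrow> real measure" where
  "height_measure X =
     distr (tmeas X) (restrict_space borel {0..}) (\<lambda>\<sigma>. mdist (tmet X) (troot X) \<sigma>)"

section \<open>Mass erasure\<close>

definition tree_proj :: "'a metric \<Rightarrow> 'a \<Rightarrow> 'a set \<Rightarrow> 'a \<Rightarrow> 'a" where
  "tree_proj m \<rho> S \<sigma> = (THE p. p \<in> S \<and> seg m \<rho> \<sigma> \<inter> S = seg m \<rho> p)"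

definition Pr_meas :: "'a metric \<Rightarrow> 'a \<Rightarrow> 'a set \<Rightarrow> 'a measure \<Rightarrow> 'a measure" where
  "Pr_meas m \<rho> S \<mu> = distr \<mu> (metric_borel m) (tree_proj m \<rho> S)"

definition R_erase :: "'a metric \<Rightarrow> 'a \<Rightarrow> 'a measure \<Rightarrow> real \<Rightarrow> 'a set" where
  "R_erase m \<rho> \<mu> h = {\<rho>} \<union> {\<sigma> \<in> mspace m. emeasure \<mu> (above m \<rho> \<sigma>) \<ge> ennreal h}"

definition R_erase_plus :: "'a metric \<Rightarrow> 'a \<Rightarrow> 'a measure \<Rightarrow> real \<Rightarrow> 'a set" where
  "R_erase_plus m \<rho> \<mu> h = mtopology_of m closure_of (\<Union>h'\<in>{h<..}. R_erase m \<rho> \<mu> h')"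

text \<open>The factor \<open>n(\<rho>, R) - 1\<close> at the root equals \<open>-1\<close> if \<open>R = {\<rho>}\<close>, so the sum must not be
  computed with the truncated subtraction of \<^typ>\<open>ennreal\<close>; it is therefore formed in
  \<^typ>\<open>ereal\<close>, where the total is nonnegative. The two sums over leaves and branch points have
  nonnegative terms.\<close>
definition erase :: "'a metric \<Rightarrow> 'a \<Rightarrow> real \<Rightarrow> 'a measure \<Rightarrow> 'a measure" where
  "erase m \<rho> h \<mu> =
     (if emeasure \<mu> (mspace m) < ennreal h then null_measure \<mu>
      else let R = R_erase m \<rho> \<mu> h; mR = submetric m R in
        measure_of (mspace m) (sets (metric_borel m)) (\<lambda>A. e2ennreal (
          enn2ereal (emeasure (Pr_meas m \<rho> R \<mu>) (A \<inter> (R - Lf mR \<rho>))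
            + (\<Sum>\<^sub>\<infinity>\<sigma>\<in>Lf mR \<rho>. (emeasure \<mu> (above m \<rho> \<sigma>) - ennreal h) * indicator A \<sigma>)
            + ennreal h * (\<Sum>\<^sub>\<infinity>\<sigma>\<in>Bp mR \<rho>. (ncomp mR \<sigma> - 2) * indicator A \<sigma>))
          + ereal h * (enn2ereal (ncomp mR \<rho>) - 1) * indicator A \<rho>)))"

definition erase_tree :: "real \<Rightarrow> 'a mtree \<Rightarrow> 'a mtree" where
  "erase_tree h X =
     (let R = R_erase_plus (tmet X) (troot X) (tmeas X) h
      in \<lparr>tmet = submetric (tmet X) R, troot = troot X,
          tmeas = restrict_space (erase (tmet X) (troot X) h (tmeas X)) R\<rparr>)"

section \<open>Gromov-type convergences\<close>

text \<open>The infimum over the empty set is \<open>\<infinity>\<close>, hence the neighbourhood of the empty set is empty.\<close>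
definition closed_nbhd :: "'a metric \<Rightarrow> 'a set \<Rightarrow> real \<Rightarrow> 'a set" where
  "closed_nbhd m A \<epsilon> = {x \<in> mspace m. (INF a\<in>A. ennreal (mdist m x a)) \<le> ennreal \<epsilon>}"

definition prohorov_dist :: "'a metric \<Rightarrow> 'a measure \<Rightarrow> 'a measure \<Rightarrow> ennreal" where
  "prohorov_dist m \<mu> \<nu> =
     (INF \<epsilon>\<in>{\<epsilon>::real. \<epsilon> > 0 \<and> (\<forall>A. closedin (mtopology_of m) A \<longrightarrow>
          emeasure \<mu> A \<le> emeasure \<nu> (closed_nbhd m A \<epsilon>) + ennreal \<epsilon> \<and>
          emeasure \<nu> A \<le> emeasure \<mu> (closed_nbhd m A \<epsilon>) + ennreal \<epsilon>)}. ennreal \<epsilon>)"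

definition rooted_isometric_embedding ::
  "'a metric \<Rightarrow> 'a \<Rightarrow> 'b metric \<Rightarrow> 'b \<Rightarrow> ('a \<Rightarrow> 'b) \<Rightarrow> bool" where
  "rooted_isometric_embedding m \<rho> m' \<rho>' \<phi> \<longleftrightarrow> \<phi> ` mspace m \<subseteq> mspace m' \<and> \<phi> \<rho> = \<rho>' \<and>
     (\<forall>x\<in>mspace m. \<forall>y\<in>mspace m. mdist m' (\<phi> x) (\<phi> y) = mdist m x y)"

text \<open>Quantifying only over metric spaces with points in \<^typ>\<open>'a + 'b\<close> is no restriction: replacing
  \<open>Z\<close> by the union of the two images (a closed subset of \<open>Z\<close>, the trees being complete) does not
  change the Prohorov distance, and that union injects into \<^typ>\<open>'a + 'b\<close>.\<close>
definition GP_dist :: "'a mtree \<Rightarrow> 'b mtree \<Rightarrow> ennreal" where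
  "GP_dist X Y =
     (INF (Z, z, \<phi>, \<psi>)\<in>{(Z :: ('a + 'b) metric, z, \<phi>, \<psi>). z \<in> mspace Z \<and>
          rooted_isometric_embedding (tmet X) (troot X) Z z \<phi> \<and>
          rooted_isometric_embedding (tmet Y) (troot Y) Z z \<psi>}.
        prohorov_dist Z (distr (tmeas X) (metric_borel Z) \<phi>) (distr (tmeas Y) (metric_borel Z) \<psi>))"

definition truncate_tree :: "real \<Rightarrow> 'a mtree \<Rightarrow> 'a mtree" where
  "truncate_tree r X =
     spanned_tree (tmet X) (troot X) (mrestr (tmeas X) (tball (tmet X) (troot X) r))"

definition GV_dist :: "'a mtree \<Rightarrow> 'b mtree \<Rightarrow> ennreal" where
  "GV_dist X Y = (\<integral>\<^sup>+ r. ennreal (exp (- r)) * min 1 (GP_dist (truncate_tree r X) (truncate_tree r Y))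
     * indicator {0<..} r \<partial>lborel)"

definition GV_converges :: "(nat \<Rightarrow> 'b mtree) \<Rightarrow> 'a mtree \<Rightarrow> bool" where
  "GV_converges Xs X \<longleftrightarrow> (\<lambda>n. GV_dist (Xs n) X) \<longlonglongrightarrow> 0"

definition GV_erasure_converges :: "(nat \<Rightarrow> 'b mtree) \<Rightarrow> 'a mtree \<Rightarrow> bool" where
  "GV_erasure_converges Xs X \<longleftrightarrow>
     (\<forall>h>0. GV_converges (\<lambda>n. erase_tree h (Xs n)) (erase_tree h X))"

text \<open>Weak convergence of measures on \<open>[0, \<infinity>)\<close> to a finite measure; finiteness of all but finitely
  many members of the sequence is part of the assertion.\<close>
definition weak_converges :: "(nat \<Rightarrow> real measure) \<Rightarrow> real measure \<Rightarrow> bool" where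
  "weak_converges \<nu>s \<nu> \<longleftrightarrow> finite_measure \<nu> \<and> (\<forall>\<^sub>F n in sequentially. finite_measure (\<nu>s n)) \<and>
     (\<forall>f :: real \<Rightarrow> real. continuous_on {0..} f \<longrightarrow> bounded (f ` {0..}) \<longrightarrow>
        (\<lambda>n. integral\<^sup>L (\<nu>s n) f) \<longlonglongrightarrow> integral\<^sup>L \<nu> f)"

section \<open>Cutting off\<close>

definition bullet :: "'a mtree \<Rightarrow> real \<Rightarrow> 'a set" where
  "bullet X r = tsphere (tmet X) (troot X) r \<inter> Skel (tmet X) (troot X) (tmeas X)"

definition Cut :: "'a mtree \<Rightarrow> real \<Rightarrow> 'a set \<Rightarrow> 'a set" where
  "Cut X r D = tball (tmet X) (troot X) r \<union>
     (\<Union>\<sigma>\<in>tsphere (tmet X) (troot X) r - D. above (tmet X) (troot X) \<sigma>)"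

definition cut_measure :: "real \<Rightarrow> 'a mtree \<Rightarrow> real \<Rightarrow> 'a set \<Rightarrow> 'a measure" where
  "cut_measure h0 X r D = measure_of (mspace (tmet X)) (sets (metric_borel (tmet X)))
     (\<lambda>A. emeasure (mrestr (tmeas X) (Cut X r D)) A + ennreal h0 * (\<Sum>\<sigma>\<in>D. indicator A \<sigma>))"

definition cut_tree :: "real \<Rightarrow> 'a mtree \<Rightarrow> real \<Rightarrow> 'a set \<Rightarrow> 'a mtree" where
  "cut_tree h0 X r D = spanned_tree (tmet X) (troot X) (cut_measure h0 X r D)"

definition compatible_cut_points :: "'a mtree \<Rightarrow> 'b mtree \<Rightarrow> real \<Rightarrow> 'b set \<Rightarrow> bool" where
  "compatible_cut_points X Y r D \<longleftrightarrow> finite D \<and> D \<subseteq> tsphere (tmet Y) (troot Y) r \<and>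
     ecard D = min (ecard (bullet X r)) (ecard (tsphere (tmet Y) (troot Y) r))"

definition nice_radius :: "'a mtree \<Rightarrow> real \<Rightarrow> bool" where
  "nice_radius X r \<longleftrightarrow> r > 0 \<and> emeasure (tmeas X) (tsphere (tmet X) (troot X) r) = 0 \<and>
     tsphere (tmet X) (troot X) r \<inter> Bp (tmet X) (troot X) = {}"

definition b_tight :: "(nat \<Rightarrow> 'b mtree) \<Rightarrow> (nat \<Rightarrow> 'b measure) \<Rightarrow> bool" where
  "b_tight Xs \<nu> \<longleftrightarrow>
     ((\<lambda>r. limsup (\<lambda>n. emeasure (\<nu> n)
         (mspace (tmet (Xs n)) - tball (tmet (Xs n)) (troot (Xs n)) r))) \<longlongrightarrow> 0) at_top"

end

theory Submission
 imports Defs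
begin

text \<open>Gromov--vague convergence of measured trees is controlled by the masses of the cones over finitely many
nodes at generic heights, together with the heights of the nodes, the heights at which they branch, and the
masses above generic levels: cutting both trees into small cells over matched nodes transports one measure
to the other with small error. Cutting off at a nice radius makes the measures finite while keeping these
data. Erasure of mass \<open>h\<close> subtracts \<open>h\<close> from the mass of every cone whose mass exceeds \<open>h\<close>, which yields the
implication from (a) to (b). Conversely the nodes of \<open>mu\<close> are recovered by letting \<open>h\<close> tend to 0,
but not the masses above levels, since the erased mass is moved downwards; convergence of the height measures
is exactly what supplies these.\<close>

text \<open>The link between cutting and erasing is an Euler characteristic count. In a region of
  \<open>R_erase\<close> that starts at one point and is cut off at k points, every leaf loses
  \<open>h\<close>, every branching returns \<open>h\<close> per additional branch, and the balance
  is \<open>h * (k - 1)\<close>. An additional weight \<open>h\<close> on each cut point absorbs the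
  term \<open>h * k\<close>: cutting with weight \<open>c + h\<close> before erasure and with weight
  \<open>c\<close> after it then differ by exactly \<open>h\<close> (truncated at 0) on the cone
  over every point below the cut-off level. This is why the weight of the cut points is a parameter
  throughout, and why the converse runs with weight \<open>h0 - h\<close> for small
  \<open>h\<close>.

  The cut points of the approximating trees are prescribed, not constructed. Tightness forces them
  to be the right ones: the cone over a point of infinite mass has large mass far from the root in
  the n-th tree too, so a misplaced cut point would leave this mass uncut. The bound on their number
  then excludes any further cut points.\<close>

abbreviation "em == emeasure"
abbreviation "mb == metric_borel"
abbreviation evs :: "(nat => bool) => bool" (binder "EV " 10) where "evs P == eventually P sequentially"

section \<open>Geometry of rooted real trees\<close>

lemma is_segmentI:
 assumes "p <= q" "!!s t. s : {p..q} ==> t : {p..q} ==> mdist m (g s) (g t) = \<bar>s - t\<bar>"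
  "g p = a" "g q = b" "S = g ` {p..q}" "S <= mspace m"
 shows "is_segment m S a b"
 unfolding is_segment_def using assms by (intro conjI exI[of _ p] exI[of _ q] exI[of _ g]) auto

lemma is_segment_param:
 assumes "is_segment m S a b"
 shows "EX g. (ALL s:{0..mdist m a b}. ALL t:{0..mdist m a b}. mdist m (g s) (g t) = \<bar>s - t\<bar>) &
  g 0 = a & g (mdist m a b) = b & S = g ` {0..mdist m a b} & S <= mspace m"
proof -
 obtain p q g where g: "p <= q" "ALL s:{p..q}. ALL t:{p..q}. mdist m (g s) (g t) = \<bar>s - t\<bar>"
  "g p = a" "g q = b" "S = g ` {p..q}" "S <= mspace m"
  using assms unfolding is_segment_def by (elim exE conjE)
 have L: "mdist m a b = q - p"
  using g(1,2) unfolding g(3,4)[symmetric] by simp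
 have "S = (%s. g (p + s)) ` {0..q - p}"
 proof (intro equalityI subsetI)
  fix x assume "x : S"
  then obtain s where "s : {p..q}" "x = g s" unfolding g(5) by (rule imageE)
  then show "x : (%s. g (p + s)) ` {0..q - p}"
   by (intro image_eqI[of _ _ "s - p"]) simp_all
 qed (auto simp: g(5))
 then show ?thesis
  unfolding L by (intro exI[of _ "%s. g (p + s)"]) (use g in simp)
qed

lemma is_segment_ends:
 assumes "is_segment m S a b" shows "a : S" "b : S" "S <= mspace m" "a : mspace m" "b : mspace m"
proof -
 obtain g where g: "g 0 = a" "g (mdist m a b) = b" "S = g ` {0..mdist m a b}" "S <= mspace m"
  using is_segment_param[OF assms] by (elim exE conjE)
 have "g 0 : S" "g (mdist m a b) : S" unfolding g(3) by simp_all
 then show S: "a : S" "b : S" "S <= mspace m" unfolding g(1,2) using g(4) by simp_all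
 show "a : mspace m" "b : mspace m" using S by auto
qed

lemma is_segment_submetric:
 "is_segment (submetric m R) S a b \<longleftrightarrow> S <= R & is_segment m S a b"
 unfolding is_segment_def by auto

locale rooted_tree =
 fixes m :: "'a metric" and ro :: 'a
 assumes tree: "rtree m ro"
begin
abbreviation "up == above m ro"
abbreviation "Pt == mspace m"
abbreviation "Bor == sets (mb m)"

definition ht :: "'a => real" where "ht x = mdist m ro x"

abbreviation "lev s == {x : Pt. ht x = s}"
abbreviation "hi s == {x : Pt. s <= ht x}"
abbreviation "lo s == {x : Pt. ht x <= s}"

text \<open>The Gromov product based at the root; in the tree it is the height of the point where
  the segments from the root to \<open>x\<close> and to \<open>y\<close> part.\<close>

definition gp :: "'a => 'a => real" where "gp x y = (ht x + ht y - mdist m x y) / 2"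

text \<open>The point at height \<open>s\<close> on the segment from the root to \<open>x\<close>:
  for \<open>p\<close> of height \<open>s\<close>, \<open>gp p x = s\<close> says that
  \<open>p\<close> lies on that segment. Outside \<open>0 <= s <= ht x\<close> no such point exists
  and the choice is arbitrary.\<close>

definition anc :: "'a => real => 'a" where
 "anc x s = (SOME p. p : Pt & ht p = s & gp p x = s)"

lemma root_in [simp]: "ro : Pt"
 using tree unfolding rtree_def by (rule conjunct1)

lemma seg_ex1:
 assumes "a : Pt" "b : Pt" shows "EX!S. is_segment m S a b"
 by (metis tree rtree_def assms)

lemma seg_unique:
 assumes "is_segment m S a b" "is_segment m S' a b"
 shows "S = S'"
 using seg_ex1[OF is_segment_ends(4,5)[OF assms(1)]] assms by (auto elim: ex1E)

lemma is_segment_seg: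
 assumes "a : Pt" "b : Pt" shows "is_segment m (seg m a b) a b"
 unfolding seg_def using seg_ex1[OF assms] by (rule theI')

lemma seg_eq:
 assumes "is_segment m S a b" shows "seg m a b = S"
 unfolding seg_def using assms seg_unique[OF _ assms] by (rule the_equality)

lemma seg_join:
 assumes "is_segment m S a c" "is_segment m S' c b" "S Int S' = {c}"
 shows "is_segment m (S Un S') a b"
proof -
 have "ALL a:Pt. ALL b:Pt. ALL c:Pt. ALL S S'.
    is_segment m S a c --> is_segment m S' c b --> S Int S' = {c} --> is_segment m (S Un S') a b"
  using tree unfolding rtree_def by (elim conjE)
 from this[rule_format, OF is_segment_ends(4)[OF assms(1)] is_segment_ends(5)[OF assms(2)]
   is_segment_ends(5)[OF assms(1)] assms] show ?thesis .
qed

lemma seg_point: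
 assumes "is_segment m S a b" "x : S"
 shows "mdist m a x + mdist m x b = mdist m a b"
proof -
 obtain g where g: "ALL s:{0..mdist m a b}. ALL t:{0..mdist m a b}. mdist m (g s) (g t) = \<bar>s - t\<bar>"
  "g 0 = a" "g (mdist m a b) = b" "S = g ` {0..mdist m a b}"
  using is_segment_param[OF assms(1)] by (elim exE conjE)
 obtain s where s: "s : {0..mdist m a b}" "x = g s" using assms(2) unfolding g(4) by (rule imageE)
 have "mdist m (g 0) (g s) = \<bar>0 - s\<bar>" using g(1) s(1) by simp
 moreover have "mdist m (g s) (g (mdist m a b)) = \<bar>s - mdist m a b\<bar>" using g(1) s(1) by simp
 ultimately show ?thesis unfolding g(2,3) s(2)[symmetric] using s(1) by simp
qed

lemma subseg:
 assumes "is_segment m S a b" "x : S"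
 shows "is_segment m {y : S. mdist m a y <= mdist m a x} a x"
  and "is_segment m {y : S. mdist m a y >= mdist m a x} x b"
  and "y : S ==> mdist m a x = mdist m a y ==> x = y"
proof -
 let ?d = "mdist m a b"
 obtain g where g: "ALL s:{0..?d}. ALL t:{0..?d}. mdist m (g s) (g t) = \<bar>s - t\<bar>"
  "g 0 = a" "g ?d = b" "S = g ` {0..?d}" "S <= Pt"
  using is_segment_param[OF assms(1)] by (elim exE conjE)
 obtain s where s: "s : {0..?d}" "x = g s" using assms(2) unfolding g(4) by (rule imageE)
 have d: "mdist m a (g t) = t" if "t : {0..?d}" for t
  using g(1)[rule_format, of 0 t] that unfolding g(2) by simp
 have dx: "mdist m a x = s" using d s by simp
 have 1: "{y : S. mdist m a y <= mdist m a x} = g ` {0..s}"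
 proof (intro equalityI subsetI)
  fix y assume "y : {y : S. mdist m a y <= mdist m a x}"
  then have y: "y : g ` {0..?d}" "mdist m a y <= s" using dx g(4) by simp_all
  from y(1) obtain t where "t : {0..?d}" "y = g t" by (rule imageE)
  then show "y : g ` {0..s}" using y(2) d by auto
 next
  fix y assume "y : g ` {0..s}"
  then obtain t where "t : {0..s}" "y = g t" by (rule imageE)
  then show "y : {y : S. mdist m a y <= mdist m a x}" using d s(1) dx unfolding g(4) by auto
 qed
 have 2: "{y : S. mdist m a y >= mdist m a x} = g ` {s..?d}"
 proof (intro equalityI subsetI)
  fix y assume "y : {y : S. mdist m a y >= mdist m a x}"
  then have y: "y : g ` {0..?d}" "mdist m a y >= s" using dx g(4) by simp_all
  from y(1) obtain t where "t : {0..?d}" "y = g t" by (rule imageE)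
  then show "y : g ` {s..?d}" using y(2) d by auto
 next
  fix y assume "y : g ` {s..?d}"
  then obtain t where "t : {s..?d}" "y = g t" by (rule imageE)
  then show "y : {y : S. mdist m a y >= mdist m a x}" using d s(1) dx unfolding g(4) by auto
 qed
 show "is_segment m {y : S. mdist m a y <= mdist m a x} a x"
  by (rule is_segmentI[of 0 s _ g]) (use g s 1 in auto)
 show "is_segment m {y : S. mdist m a y >= mdist m a x} x b"
  by (rule is_segmentI[of s ?d _ g]) (use g s 2 in auto)
 show "x = y" if "y : S" "mdist m a x = mdist m a y"
 proof -
  obtain t where t: "t : {0..?d}" "y = g t" using \<open>y : S\<close> unfolding g(4) by (rule imageE)
  then show ?thesis using that(2) dx d s by simp
 qed
qed

lemmas subseg_initial = subseg(1) and subseg_final = subseg(2) and seg_between = subseg(3)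

lemma is_segment_sym:
 assumes "is_segment m S a b" shows "is_segment m S b a"
proof -
 let ?d = "mdist m a b"
 obtain g where g: "ALL s:{0..?d}. ALL t:{0..?d}. mdist m (g s) (g t) = \<bar>s - t\<bar>"
  "g 0 = a" "g ?d = b" "S = g ` {0..?d}" "S <= Pt"
  using is_segment_param[OF assms(1)] by (elim exE conjE)
 show ?thesis
 proof (rule is_segmentI[of 0 ?d _ "%s. g (?d - s)"])
  show "S = (%s. g (?d - s)) ` {0..?d}"
  proof (intro equalityI subsetI)
   fix x assume "x : S"
   then obtain s where "s : {0..?d}" "x = g s" unfolding g(4) by (rule imageE)
   then show "x : (%s. g (?d - s)) ` {0..?d}"
    by (intro image_eqI[of _ _ "?d - s"]) simp_all
  qed (auto simp: g(4))
  show "mdist m (g (?d - s)) (g (?d - t)) = \<bar>s - t\<bar>" if "s : {0..?d}" "t : {0..?d}" for s t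
   using g(1)[rule_format, of "?d - s" "?d - t"] that by simp
 qed (use g in simp_all)
qed

lemma ht_nonneg [simp]: "0 <= ht x" by (simp add: ht_def)

lemma ht_root [simp]: "ht ro = 0" by (simp add: ht_def)

lemma ht_eq_0: "x : Pt ==> ht x = 0 \<longleftrightarrow> x = ro"
 unfolding ht_def by (metis mdist_zero root_in)

text \<open>The segments from the root to \<open>x\<close> and to \<open>y\<close> share an initial piece, whose end \<open>w\<close> is the
 last point of the first one on the second one; the remaining pieces meet only in \<open>w\<close>.\<close>
lemma meet_exists:
 assumes "x : Pt" "y : Pt"
 shows "EX w. w : seg m ro x & w : seg m ro y &
  mdist m x y = mdist m x w + mdist m w y &
  (ALL z:seg m ro x. ht z <= ht w --> z : seg m ro y)"
proof -
 let ?A = "seg m ro x" and ?B = "seg m ro y"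
 have A: "is_segment m ?A ro x" and B: "is_segment m ?B ro y"
  using assms is_segment_seg by auto
 let ?X = "mdist m ro x" and ?Y = "mdist m ro y"
 obtain f where f0: "ALL s:{0..?X}. ALL t:{0..?X}. mdist m (f s) (f t) = \<bar>s - t\<bar>"
  and f: "f 0 = ro" "f ?X = x" "?A = f ` {0..?X}" "?A <= Pt"
  using is_segment_param[OF A] by (elim exE conjE)
 obtain g where g0: "ALL s:{0..?Y}. ALL t:{0..?Y}. mdist m (g s) (g t) = \<bar>s - t\<bar>"
  and g: "g 0 = ro" "g ?Y = y" "?B = g ` {0..?Y}" "?B <= Pt"
  using is_segment_param[OF B] by (elim exE conjE)
 have hf: "ht (f t) = t" if "0 <= t" "t <= ?X" for t
  using f0[rule_format, of 0 t] f(1) that by (simp add: ht_def)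
 have hg: "ht (g t) = t" if "0 <= t" "t <= ?Y" for t
  using g0[rule_format, of 0 t] g(1) that by (simp add: ht_def)
 define I where "I = {t. 0 <= t & t <= ?X & t <= ?Y & f t = g t}"
 have I_int: "ht z : I" if z: "z : ?A" "z : ?B" for z
 proof -
  obtain t where t: "t : {0..?X}" "z = f t" using z(1) unfolding f(3) by (rule imageE)
  obtain u where u: "u : {0..?Y}" "z = g u" using z(2) unfolding g(3) by (rule imageE)
  have "ht z = t" using hf[of t] t by simp
  moreover have "ht z = u" using hg[of u] u by simp
  ultimately have "f (ht z) = g (ht z)" "ht z : {0..?X}" "ht z : {0..?Y}" using t u by metis+
  then show ?thesis unfolding I_def by simp
 qed
 have "0 : I" unfolding I_def using f(1) g(1) by simp
 define s where "s = Sup I"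
 have bdd: "bdd_above I" unfolding I_def bdd_above_def by blast
 have s0: "0 <= s" unfolding s_def using cSup_upper[OF \<open>0 : I\<close> bdd] .
 have sX: "s <= ?X" "s <= ?Y" unfolding s_def using \<open>0 : I\<close>
  by (auto intro!: cSup_least simp: I_def)
 \<comment> \<open>The supremum is attained: both arcs move at unit speed, so agreement at
   parameters arbitrarily close to \<open>s\<close> puts \<open>f s\<close> and \<open>g s\<close>
   at distance 0.\<close>
 have sI: "s : I"
 proof -
  have "mdist m (f s) (g s) <= 2 * e" if "e > 0" for e
  proof -
   have "s - e < Sup I" using \<open>e > 0\<close> by (simp add: s_def)
   then obtain t where t0: "t : I" "s - e < t"
    using less_cSupD[of I "s - e"] \<open>0 : I\<close> by blast
   then have t: "t : I" "s - e < t" "t <= s"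
    using cSup_upper[OF t0(1) bdd] by (auto simp: s_def)
   have "mdist m (f s) (g s) <= mdist m (f s) (f t) + mdist m (g t) (g s)"
   proof -
    have "t : {0..?X}" "s : {0..?X}" "s : {0..?Y}"
     using s0 sX t(1) unfolding I_def by simp_all
    then have "f s : ?A" "g s : ?B" "f t : ?A" unfolding f(3) g(3) by (simp_all only: imageI)
    then have "f s : Pt" "g s : Pt" "f t : Pt" using f(4) g(4) by blast+
    then show ?thesis using t(1) mdist_triangle[of "f s" m "f t" "g s"] unfolding I_def by simp
   qed
   also have "... <= 2 * e"
    using f0[rule_format, of s t] g0[rule_format, of t s] t s0 sX unfolding I_def by simp
   finally show ?thesis .
  qed
  from this[of "mdist m (f s) (g s) / 4"] have "mdist m (f s) (g s) <= 0" by linarith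
  then have "mdist m (f s) (g s) = 0" using mdist_nonneg[of m "f s" "g s"] by linarith
  moreover have "f s : ?A" "g s : ?B" unfolding f(3) g(3) using s0 sX by simp_all
  then have "f s : Pt" "g s : Pt" using f(4) g(4) by blast+
  ultimately have "f s = g s" by simp
  then show ?thesis unfolding I_def using s0 sX by simp
 qed
 define w where "w = f s"
 have wA: "w : ?A" unfolding f(3) w_def using s0 sX by simp
 have "w = g s" using sI unfolding I_def w_def by simp
 then have wB: "w : ?B" unfolding g(3) using s0 sX by simp
 have hw: "ht w = s" using hf[OF s0 sX(1)] w_def by simp
 let ?A' = "{z : ?A. mdist m ro z >= mdist m ro w}" and ?B' = "{z : ?B. mdist m ro z >= mdist m ro w}"
 have A': "is_segment m ?A' x w" using subseg_final[OF A wA] is_segment_sym by blast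
 have B': "is_segment m ?B' w y" using subseg_final[OF B wB] .
 have "?A' Int ?B' = {w}"
 proof (intro equalityI subsetI)
  fix z assume z: "z : ?A' Int ?B'"
  then have "ht z : I" using I_int[of z] by simp
  then have "ht z <= s" unfolding s_def using cSup_upper[OF _ bdd] by simp
  then have "mdist m ro z = mdist m ro w" using z hw unfolding ht_def by simp
  then have "z = w" using z wA seg_between[OF A, of z w] by simp
  then show "z : {w}" by simp
 qed (use wA wB in simp)
 then have "is_segment m (?A' Un ?B') x y" using seg_join[OF A' B'] by blast
 then have "mdist m x y = mdist m x w + mdist m w y"
  using seg_point[of "?A' Un ?B'" x y w] wA by simp
 \<comment> \<open>Up to height \<open>ht w\<close> the two segments coincide, since both initial
   pieces are segments from the root to \<open>w\<close>.\<close>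
 moreover have "z : ?B" if z: "z : ?A" "ht z <= ht w" for z
 proof -
  have "is_segment m {y : ?A. mdist m ro y <= mdist m ro w} ro w"
   "is_segment m {z : ?B. mdist m ro z <= mdist m ro w} ro w"
   using subseg_initial[OF A wA] subseg_initial[OF B wB] by auto
  from seg_unique[OF this] show ?thesis using z unfolding ht_def by blast
 qed
 ultimately show ?thesis using wA wB by blast
qed

lemma gp_commute: "gp x y = gp y x"
 by (simp add: gp_def mdist_commute)

lemma gp_self [simp]: "x : Pt ==> gp x x = ht x"
 by (simp add: gp_def)

lemma dist_gp: "mdist m x y = ht x + ht y - 2 * gp x y"
 by (simp add: gp_def field_simps)

lemma gp_le:
 assumes "x : Pt" "y : Pt" shows "gp x y <= ht x" "gp x y <= ht y" "0 <= gp x y"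
proof -
 have "mdist m ro y <= mdist m ro x + mdist m x y" "mdist m ro x <= mdist m ro y + mdist m x y"
  "mdist m x y <= mdist m ro x + mdist m ro y"
  using mdist_triangle[OF root_in assms(1,2)] mdist_triangle[OF root_in assms(2,1)]
   mdist_triangle[OF assms(1) root_in assms(2)] mdist_commute[of m x ro] mdist_commute[of m x y]
  by simp_all
 then show "gp x y <= ht x" "gp x y <= ht y" "0 <= gp x y"
  unfolding gp_def ht_def by simp_all
qed

text \<open>The equation says that \<open>y\<close> splits the distance from the root to
  \<open>x\<close>. If it holds, the meeting point \<open>w\<close> of the segments to
  \<open>y\<close> and to \<open>x\<close> is at distance 0 from \<open>y\<close>, and
  \<open>w\<close> lies on the segment to \<open>x\<close>.\<close>

lemma seg_iff:
 assumes "x : Pt" shows "y : seg m ro x \<longleftrightarrow> y : Pt & gp y x = ht y"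
proof
 assume y: "y : seg m ro x"
 have S: "is_segment m (seg m ro x) ro x" using assms is_segment_seg by simp
 then have "y : Pt" using y unfolding is_segment_def by blast
 then show "y : Pt & gp y x = ht y"
  using seg_point[OF S y] by (simp add: gp_def ht_def)
next
 assume "y : Pt & gp y x = ht y"
 then have y: "y : Pt" and gy: "gp y x = ht y" by auto
 obtain w where w: "w : seg m ro y" "w : seg m ro x" "mdist m y x = mdist m y w + mdist m w x"
  using meet_exists[OF y assms] by blast
 note Sy = is_segment_seg[OF root_in y] and Sx = is_segment_seg[OF root_in assms]
 have wm: "w : Pt" using w(1) Sy unfolding is_segment_def by blast
 have "mdist m ro w + mdist m w y = mdist m ro y" "mdist m ro w + mdist m w x = mdist m ro x"
  using seg_point[OF Sy w(1)] seg_point[OF Sx w(2)] .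
 then have "mdist m y w = 0" using w(3) gy mdist_commute[of m y w] by (simp add: gp_def ht_def)
 then have "y = w" using wm y by simp
 then show "y : seg m ro x" using w by simp
qed

lemma anc_exists:
 assumes "x : Pt" "0 <= s" "s <= ht x"
 shows "EX p. p : Pt & ht p = s & gp p x = s"
proof -
 have S: "is_segment m (seg m ro x) ro x" using assms is_segment_seg by simp
 obtain g where g: "ALL s:{0..mdist m ro x}. ALL t:{0..mdist m ro x}. mdist m (g s) (g t) = \<bar>s - t\<bar>"
  "g 0 = ro" "seg m ro x = g ` {0..mdist m ro x}"
  using is_segment_param[OF S] by (elim exE conjE)
 have "g s : seg m ro x" unfolding g(3) using assms by (simp add: ht_def)
 moreover have "ht (g s) = s"
  using g(1)[rule_format, of 0 s] g(2) assms by (simp add: ht_def)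
 ultimately show ?thesis using seg_iff[OF assms(1)] by auto
qed

lemma anc:
 assumes "x : Pt" "0 <= s" "s <= ht x"
 shows anc_in: "anc x s : Pt" and ht_anc: "ht (anc x s) = s" and gp_anc: "gp (anc x s) x = s"
 using someI_ex[OF anc_exists[OF assms]] unfolding anc_def by auto

lemma below_unique:
 assumes "x : Pt" "p : Pt" "q : Pt" "gp p x = ht p" "gp q x = ht q" "ht p = ht q"
 shows "p = q"
proof -
 have "p : seg m ro x" "q : seg m ro x" using assms seg_iff by auto
 then show ?thesis using seg_between[OF is_segment_seg[of ro x], of p q] assms by (auto simp: ht_def)
qed

text \<open>The four-point condition of a tree: the ancestor of \<open>y\<close> at the smaller of
  the two heights lies on the segments to \<open>x\<close> and to \<open>z\<close> as well, so the
  path through it bounds the distance from \<open>x\<close> to \<open>z\<close>. Later geometry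
  rests on this inequality and hardly ever returns to segments.\<close>

lemma gp_ultra:
 assumes "x : Pt" "y : Pt" "z : Pt"
 shows "min (gp x y) (gp y z) <= gp x z"
proof -
 define s where "s = min (gp x y) (gp y z)"
 have low: "gp p b = s" if ab: "a : Pt" "b : Pt"
  and p: "p : Pt" "gp p a = s" "ht p = s" "s <= gp a b" for a b p
 proof -
  obtain w where w: "w : seg m ro a" "w : seg m ro b" "mdist m a b = mdist m a w + mdist m w b"
   "ALL z:seg m ro a. ht z <= ht w --> z : seg m ro b"
   using meet_exists[OF ab] by blast
  have "gp w a = ht w" "gp w b = ht w"
   using seg_iff[OF ab(1)] seg_iff[OF ab(2)] w(1,2) by simp_all
  then have "ht w = gp a b" using w(3) mdist_commute[of m a w] by (simp add: gp_def)
  then have "p : seg m ro b" using w(4) p seg_iff[OF ab(1)] by simp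
  then show ?thesis using p seg_iff[OF ab(2)] by simp
 qed
 have s: "0 <= s" "s <= ht y" "s <= gp y x" "s <= gp y z"
  using gp_le[of x y] gp_le[of y z] assms unfolding s_def by (auto simp: gp_commute)
 let ?p = "anc y s"
 have p: "?p : Pt" "ht ?p = s" "gp ?p y = s" using anc[OF assms(2) s(1,2)] by simp_all
 have "gp ?p x = s" "gp ?p z = s"
  using low[OF assms(2,1) p(1,3,2) s(3)] low[OF assms(2,3) p(1,3,2) s(4)] by simp_all
 then have "mdist m ?p x = ht x - s" "mdist m ?p z = ht z - s" using p by (simp_all add: gp_def)
 then have "mdist m x z <= ht x + ht z - 2 * s"
  using mdist_triangle[of x m ?p z] assms p by (simp add: mdist_commute)
 then show ?thesis unfolding s_def[symmetric] by (simp add: gp_def)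
qed

lemma gp_ge_trans:
 assumes "x : Pt" "y : Pt" "z : Pt" "s <= gp x y" "s <= gp y z"
 shows "s <= gp x z"
 using gp_ultra[OF assms(1-3)] assms(4,5) by (simp add: min_def split: if_splits)

lemma above_iff:
 assumes "si : Pt" shows "y : up si \<longleftrightarrow> y : Pt & gp si y = ht si"
 unfolding above_def using seg_iff assms by auto

lemma above_iff_ge:
 assumes "si : Pt" shows "y : up si \<longleftrightarrow> y : Pt & ht si <= gp si y"
 using above_iff[OF assms] gp_le[OF assms] by force

lemma above_subset: "up si <= Pt"
 unfolding above_def by auto

lemma above_root [simp]: "up ro = Pt"
 using above_iff_ge[of ro] gp_le(3)[of ro] by auto

lemma above_self: "si : Pt ==> si : up si"
 by (simp add: above_iff)

lemma above_ht: "si : Pt ==> y : up si ==> ht si <= ht y"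
 using above_iff[of si y] gp_le(2)[of si y] by simp

lemma above_trans: "si : Pt ==> y : up si ==> z : up y ==> z : up si"
 using above_iff[of y z] above_iff_ge[of si y] above_iff_ge[of si z]
  gp_ge_trans[of si y z "ht si"] above_ht[of si y] by auto

lemma anc_above: "x : Pt ==> 0 <= s ==> s <= ht x ==> x : up (anc x s)"
 using anc[of x s] above_iff[of "anc x s" x] by simp

lemma anc_eqI:
 assumes "x : Pt" "p : Pt" "x : up p"
 shows "anc x (ht p) = p"
 using above_ht below_unique anc assms above_iff by auto

text \<open>The Gromov product is thus the largest height up to which two points share their
  ancestors.\<close>

lemma gp_ge_iff_anc:
 assumes "x : Pt" "y : Pt" "0 <= s" "s <= ht x" "s <= ht y"
 shows "s <= gp x y \<longleftrightarrow> anc x s = anc y s"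
proof
 note ax = anc[OF assms(1,3,4)] and ay = anc[OF assms(2,3,5)]
 assume s: "s <= gp x y"
 have "s <= gp (anc x s) y"
  using gp_ge_trans[OF ax(1) assms(1,2), of s] ax(3) s by linarith
 then have "gp (anc x s) y = s" using gp_le(1)[OF ax(1) assms(2)] ax(2) by linarith
 then show "anc x s = anc y s"
  using below_unique[OF assms(2) ax(1) ay(1)] ax ay by presburger
next
 note ax = anc[OF assms(1,3,4)] and ay = anc[OF assms(2,3,5)]
 assume "anc x s = anc y s"
 then show "s <= gp x y"
  using gp_ge_trans[OF assms(1) ax(1) assms(2), of s] ax(3) ay(3) gp_commute[of x "anc x s"]
  by (metis order_refl)
qed

lemma above_disjoint:
 assumes "si : Pt" "ta : Pt" "ht si = ht ta" "x : up si" "x : up ta"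
 shows "si = ta"
proof -
 have x: "x : Pt" using assms(4) above_subset by blast
 have "anc x (ht si) = si" "anc x (ht ta) = ta"
  using anc_eqI[OF x assms(1,4)] anc_eqI[OF x assms(2,5)] .
 then show ?thesis unfolding assms(3) by simp
qed

lemma gp_anc_left:
 assumes "x : Pt" "y : Pt" "0 <= s" "s <= ht x"
 shows "gp (anc x s) y = min s (gp x y)"
proof -
 note ax = anc[OF assms(1,3,4)]
 have 1: "min s (gp x y) <= gp (anc x s) y"
  using gp_ultra[OF ax(1) assms(1,2)] ax(3) by simp
 have 2: "gp (anc x s) y <= s" using gp_le(1)[OF ax(1) assms(2)] ax(2) by linarith
 have "min (gp x (anc x s)) (gp (anc x s) y) <= gp x y"
  using gp_ultra[OF assms(1) ax(1) assms(2)] .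
 then show ?thesis using 1 2 ax(3) gp_commute[of x "anc x s"] by linarith
qed

lemma ht_lipschitz:
 assumes "x : Pt" "y : Pt"
 shows "\<bar>ht x - ht y\<bar> <= mdist m x y"
 using mdist_triangle[OF root_in assms] mdist_triangle[OF root_in assms(2,1)] mdist_commute[of m x y]
 unfolding ht_def by linarith

lemma gp_lipschitz:
 assumes "x : Pt" "y : Pt" "z : Pt"
 shows "\<bar>gp x z - gp y z\<bar> <= mdist m x y"
proof -
 have 1: "ht x - ht y <= mdist m x y" "ht y - ht x <= mdist m x y"
  using ht_lipschitz[OF assms(1,2)] unfolding abs_le_iff by simp_all
 have 2: "mdist m x z - mdist m y z <= mdist m x y" "mdist m y z - mdist m x z <= mdist m x y"
  using mdist_triangle[OF assms(1,2,3)] mdist_triangle[OF assms(2,1,3)] mdist_commute[of m x y]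
  by simp_all
 show ?thesis unfolding abs_le_iff gp_def using 1 2 by (simp add: field_simps)
qed

lemma gp_near:
 assumes "x : Pt" "y : Pt"
 shows "ht x - mdist m x y <= gp x y"
 using ht_lipschitz[OF assms] dist_gp[of x y] by auto

lemma anc_anc:
 assumes "x : Pt" "0 <= s" "s <= t" "t <= ht x"
 shows "anc (anc x t) s = anc x s"
 by (smt (verit) assms anc gp_anc_left above_iff anc_eqI)

lemma comparable_dist:
 assumes "x : Pt" "y : up x" shows "mdist m x y = ht y - ht x"
 using assms above_iff[OF assms(1)] dist_gp[of x y] by simp

lemma tball_iff: "x : tball m ro r \<longleftrightarrow> x : Pt & ht x <= r"
 by (simp add: tball_def ht_def)

lemma tsphere_iff: "x : tsphere m ro r \<longleftrightarrow> x : Pt & ht x = r"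
 by (simp add: tsphere_def ht_def)

end

section \<open>Borel sets of metric spaces\<close>

lemma mdist_refl [simp]: "x : mspace m ==> mdist m x x = 0"
 by simp

lemma openin_mtopology_of:
 "openin (mtopology_of m) U \<longleftrightarrow>
  U <= mspace m & (ALL x:U. EX e>0. ALL y:mspace m. mdist m x y < e --> y : U)"
proof -
 interpret Metric_space "mspace m" "mdist m" by (rule Metric_space_mspace_mdist)
 show ?thesis
  unfolding mtopology_of_def openin_mtopology subset_iff in_mball by blast
qed

lemma closedin_mtopology_of:
 "closedin (mtopology_of m) C \<longleftrightarrow>
  C <= mspace m & (ALL x:mspace m - C. EX e>0. ALL y:C. e <= mdist m x y)"
proof -
 have "(ALL y:mspace m. mdist m x y < e --> y : mspace m - C) \<longleftrightarrow> (ALL y:C. e <= mdist m x y)"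
  if "C <= mspace m" for x e
  using that by (meson DiffD2 DiffI leD leI subsetD)
 then show ?thesis
  unfolding closedin_def topspace_mtopology_of openin_mtopology_of by auto
qed

lemma closure_of_mtopology_of:
 "mtopology_of m closure_of A = {x : mspace m. ALL e>0. EX y:A. y : mspace m & mdist m x y < e}"
proof -
 interpret Metric_space "mspace m" "mdist m" by (rule Metric_space_mspace_mdist)
 show ?thesis
  unfolding mtopology_of_def metric_closure_of in_mball by blast
qed

lemma space_metric_borel [simp]: "space (mb m) = mspace m"
 by (simp add: metric_borel_def space_measure_of_conv)

lemma sets_metric_borel:
 "sets (mb m) = sigma_sets (mspace m) {U. openin (mtopology_of m) U}"
 unfolding metric_borel_def by (rule sets_measure_of) (auto simp: openin_mtopology_of)

lemma borel_open [intro]: "openin (mtopology_of m) U ==> U : sets (mb m)"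
 unfolding sets_metric_borel by (rule sigma_sets.Basic) simp

lemma borel_closed [intro]:
 assumes "closedin (mtopology_of m) C" shows "C : sets (mb m)"
proof -
 have "mspace m - C : sets (mb m)"
  using assms unfolding closedin_def topspace_mtopology_of by (intro borel_open) auto
 then have "space (mb m) - (mspace m - C) : sets (mb m)" by (intro sets.compl_sets)
 moreover have "C <= mspace m" using assms unfolding closedin_mtopology_of by simp
 ultimately show ?thesis by (simp add: double_diff)
qed

lemma sets_metric_borel_submetric:
 assumes "S <= mspace m"
 shows "sets (mb (submetric m S)) = (Int) S ` sets (mb m)"
proof -
 have "{U. openin (mtopology_of (submetric m S)) U} = (Int) S ` {U. openin (mtopology_of m) U}"
  unfolding mtopology_of_submetric by (auto simp: openin_subtopology)
 moreover have "(Int) S ` sigma_sets (mspace m) {U. openin (mtopology_of m) U}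
   = sigma_sets S ((Int) S ` {U. openin (mtopology_of m) U})"
 proof (intro equalityI subsetI)
  fix x assume "x : (Int) S ` sigma_sets (mspace m) {U. openin (mtopology_of m) U}"
  then obtain y where "y : sigma_sets (mspace m) {U. openin (mtopology_of m) U}" "x = S Int y" by blast
  then show "x : sigma_sets S ((Int) S ` {U. openin (mtopology_of m) U})"
  proof (induction arbitrary: x)
   case (Basic a) then show ?case by (intro sigma_sets.Basic) simp
  next
   case Empty then show ?case using sigma_sets.Empty by simp
  next
   case (Compl a)
   have "S - (S Int a) : sigma_sets S ((Int) S ` {U. openin (mtopology_of m) U})"
    using Compl.IH by (intro sigma_sets.Compl) simp
   moreover have "S - (S Int a) = S Int (mspace m - a)" using assms by auto
   ultimately show ?case using Compl.prems by simp
  next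
   case (Union a)
   have "(UN i. S Int a i) : sigma_sets S ((Int) S ` {U. openin (mtopology_of m) U})"
    using Union.IH by (intro sigma_sets.Union) simp
   moreover have "(UN i. S Int a i) = S Int (UN i. a i)" by auto
   ultimately show ?case using Union.prems by simp
  qed
 next
  fix x assume "x : sigma_sets S ((Int) S ` {U. openin (mtopology_of m) U})"
  then show "x : (Int) S ` sigma_sets (mspace m) {U. openin (mtopology_of m) U}"
  proof induction
   case (Basic a) then show ?case using sigma_sets.Basic by blast
  next
   case Empty then show ?case using sigma_sets.Empty by (intro image_eqI[of _ _ "{}"]) auto
  next
   case (Compl a)
   then obtain y where y: "y : sigma_sets (mspace m) {U. openin (mtopology_of m) U}" "a = S Int y" by blast
   then show ?case using assms
    by (intro image_eqI[of _ _ "mspace m - y"] sigma_sets.Compl) auto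
  next
   case (Union a)
   have "ALL i. EX y. y : sigma_sets (mspace m) {U. openin (mtopology_of m) U} & a i = S Int y"
    using Union.IH by blast
   then obtain y where y: "!!i. y i : sigma_sets (mspace m) {U. openin (mtopology_of m) U}"
    "!!i. a i = S Int y i" by metis
   then show ?case
    by (intro image_eqI[of _ _ "UN i. y i"] sigma_sets.Union) auto
  qed
 qed
 ultimately show ?thesis unfolding sets_metric_borel using assms by (simp add: Int_absorb2)
qed

lemma borel_submetric_iff:
 assumes "S : sets (mb m)"
 shows "B : sets (mb (submetric m S)) \<longleftrightarrow> B <= S & B : sets (mb m)"
proof -
 have S: "S <= mspace m" using sets.sets_into_space[OF assms] by simp
 show ?thesis
 proof
  assume "B : sets (mb (submetric m S))"
  then obtain A where "A : sets (mb m)" "B = S Int A"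
   unfolding sets_metric_borel_submetric[OF S] by blast
  then show "B <= S & B : sets (mb m)" using assms by auto
 next
  assume "B <= S & B : sets (mb m)"
  then show "B : sets (mb (submetric m S))"
   unfolding sets_metric_borel_submetric[OF S] by (intro image_eqI[of _ _ B]) auto
 qed
qed

text \<open>Height and Gromov product are 1-Lipschitz, so this yields at once that balls, outer
  regions and cones are closed, hence Borel.\<close>

lemma lipschitz_superlevel_closed:
 assumes "!!x y. x : mspace m ==> y : mspace m ==> \<bar>f x - f y\<bar> <= mdist m x y"
 shows "closedin (mtopology_of m) {x : mspace m. c <= f x}"
  and "closedin (mtopology_of m) {x : mspace m. f x <= c}"
proof -
 have "EX e>0. ALL y:{x : mspace m. c <= f x}. e <= mdist m x y" if "x : mspace m" "~ c <= f x" for x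
  by (rule exI[of _ "c - f x"]) (use that assms[OF that(1)] in fastforce)
 then show "closedin (mtopology_of m) {x : mspace m. c <= f x}"
  unfolding closedin_mtopology_of by blast
 have "EX e>0. ALL y:{x : mspace m. f x <= c}. e <= mdist m x y" if "x : mspace m" "~ f x <= c" for x
  by (rule exI[of _ "f x - c"]) (use that assms[OF that(1)] in fastforce)
 then show "closedin (mtopology_of m) {x : mspace m. f x <= c}"
  unfolding closedin_mtopology_of by blast
qed

lemma measurable_metric_borel:
 assumes "f : mspace m \<rightarrow> mspace m'"
  "!!U. openin (mtopology_of m') U ==> f -` U Int mspace m : sets (mb m)"
 shows "f : measurable (mb m) (mb m')"
 unfolding metric_borel_def[of m']
 by (rule measurable_measure_of) (use assms in \<open>auto simp: openin_mtopology_of\<close>)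

lemma measurable_lipschitz:
 assumes f: "f : mspace m \<rightarrow> mspace m'"
  and lip: "!!x y. x : mspace m ==> y : mspace m ==> mdist m' (f x) (f y) <= mdist m x y"
 shows "f : measurable (mb m) (mb m')"
proof (rule measurable_metric_borel[OF f])
 fix U assume U: "openin (mtopology_of m') U"
 show "f -` U Int mspace m : sets (mb m)"
 proof (rule borel_open, unfold openin_mtopology_of, safe)
  fix x assume x: "f x : U" "x : mspace m"
  then obtain e where e: "e > 0" "ALL y:mspace m'. mdist m' (f x) y < e --> y : U"
   using U unfolding openin_mtopology_of by blast
  have "y : f -` U Int mspace m" if "y : mspace m" "mdist m x y < e" for y
   using e(2) f lip[OF x(2) that(1)] that by (auto simp: Pi_iff)
  then show "EX e>0. ALL y:mspace m. mdist m x y < e --> y : f -` U Int mspace m"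
   using e(1) by blast
 qed
qed

text \<open>A countable base, phrased with small open sets: unlike a dense sequence, it restricts
  directly to arbitrary subspaces.\<close>

definition second_countable_metric :: "'a metric => bool" where
 "second_countable_metric m \<longleftrightarrow> (EX \<C>. countable \<C> & (ALL C:\<C>. openin (mtopology_of m) C) &
   (ALL x:mspace m. ALL e>0. EX C:\<C>. x : C & (ALL y:C. mdist m x y < e)))"

lemma second_countable_metricI:
 assumes "separable_space (mtopology_of m)"
 shows "second_countable_metric m"
proof -
 obtain Q where Q: "countable Q" "Q <= mspace m" "mtopology_of m closure_of Q = mspace m"
  using assms unfolding separable_space_def by auto
 define \<C> where "\<C> = (%(q, k::nat). {y : mspace m. mdist m q y < 1 / Suc k}) ` (Q \<times> UNIV)"
 have "countable \<C>" unfolding \<C>_def using Q(1) by simp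
 moreover have "openin (mtopology_of m) C" if C: "C : \<C>" for C
 proof -
  obtain q k where qk: "q : Q" "C = {y : mspace m. mdist m q y < 1 / Suc k}"
   using C unfolding \<C>_def by auto
  interpret Metric_space "mspace m" "mdist m" by (rule Metric_space_mspace_mdist)
  have "C = mball q (1 / Suc k)" using qk Q(2) by auto
  then show ?thesis unfolding mtopology_of_def by simp
 qed
 moreover have "EX C:\<C>. x : C & (ALL y:C. mdist m x y < e)" if x: "x : mspace m" and "e > 0" for x e
 proof -
  obtain k :: nat where k: "inverse (Suc k) < e / 2" using reals_Archimedean[of "e / 2"] \<open>e > 0\<close> by auto
  have "x : mtopology_of m closure_of Q" using Q x by simp
  then obtain q where q: "q : Q" "mdist m x q < 1 / Suc k"
   unfolding closure_of_mtopology_of by (auto dest!: spec[of _ "1 / Suc k"])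
  have "mdist m x y < e" if "y : mspace m" "mdist m q y < 1 / Suc k" for y
   using mdist_triangle[of x m q y] x q Q(2) that k by (auto simp: inverse_eq_divide)
  moreover have "{y : mspace m. mdist m q y < 1 / Suc k} : \<C>"
   unfolding \<C>_def using q(1) by (intro image_eqI[of _ _ "(q, k)"]) auto
  ultimately show ?thesis
   using q(2) x mdist_commute[of m x q] by (intro bexI[of _ "{y : mspace m. mdist m q y < 1 / Suc k}"]) auto
 qed
 ultimately show ?thesis unfolding second_countable_metric_def by blast
qed

lemma second_countable_submetric:
 assumes "second_countable_metric m" shows "second_countable_metric (submetric m S)"
proof -
 obtain \<C> where C: "countable \<C>" "ALL C:\<C>. openin (mtopology_of m) C"
   "ALL x:mspace m. ALL e>0. EX C:\<C>. x : C & (ALL y:C. mdist m x y < e)"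
  using assms unfolding second_countable_metric_def by blast
 show ?thesis unfolding second_countable_metric_def
 proof (intro exI[of _ "(Int) S ` \<C>"] conjI ballI allI impI)
  show "countable ((Int) S ` \<C>)" using C(1) by simp
  show "openin (mtopology_of (submetric m S)) D" if "D : (Int) S ` \<C>" for D
   using that C(2) unfolding mtopology_of_submetric by (auto simp: openin_subtopology)
  show "EX C:(Int) S ` \<C>. x : C & (ALL y:C. mdist (submetric m S) x y < e)"
   if x: "x : mspace (submetric m S)" "e > 0" for x e
  proof -
   obtain C0 where "C0 : \<C>" "x : C0" "ALL y:C0. mdist m x y < e"
    using C(3)[rule_format, of x e] x by auto
   then show ?thesis using x by (intro bexI[of _ "S Int C0"]) auto
  qed
 qed
qed

text \<open>By the Lindelof property.\<close>
lemma locally_null: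
 assumes sc: "second_countable_metric m" and nu: "sets nu = sets (mb m)"
  and U: "U : sets nu"
  and loc: "!!x. x : U ==> EX e>0. EX N:sets nu. em nu N = 0 & (ALL y:mspace m. mdist m x y < e --> y : N)"
 shows "em nu U = 0"
proof -
 obtain \<C> where C: "countable \<C>" "ALL C:\<C>. openin (mtopology_of m) C"
   "ALL x:mspace m. ALL e>0. EX C:\<C>. x : C & (ALL y:C. mdist m x y < e)"
  using sc unfolding second_countable_metric_def by blast
 have meas: "C : sets nu" if "C : \<C>" for C unfolding nu using C(2) that by auto
 define \<D> where "\<D> = {C : \<C>. em nu C = 0}"
 have D: "countable \<D>" "\<D> <= sets nu" using C(1) meas unfolding \<D>_def by auto
 have UD: "U <= \<Union>\<D>"
 proof
  fix x assume x: "x : U"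
  obtain e N where e: "e > 0" "N : sets nu" "em nu N = 0"
   "ALL y:mspace m. mdist m x y < e --> y : N" using loc[OF x] by blast
  have "x : mspace m" using x sets.sets_into_space[OF U] sets_eq_imp_space_eq[OF nu] by auto
  then obtain C0 where C0: "C0 : \<C>" "x : C0" "ALL y:C0. mdist m x y < e" using C(3) e(1) by blast
  have "C0 <= N" using C0(1,3) C(2) e(4) unfolding openin_mtopology_of by blast
  then have "em nu C0 = 0" using emeasure_mono[of C0 N nu] e by simp
  then show "x : \<Union>\<D>" using C0 unfolding \<D>_def by blast
 qed
 have "em nu (\<Union>\<D>) = 0"
 proof -
  have "(UN C:\<D>. C) : null_sets nu"
   using D by (intro null_sets_UN') (auto simp: \<D>_def)
  then show ?thesis by auto
 qed
 moreover have "\<Union>\<D> : sets nu" using D by (metis sets.countable_Union)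
 ultimately show ?thesis using emeasure_mono[OF UD, of nu] by simp
qed

lemma emeasure_mrestr:
 assumes "B : sets mu" "A : sets mu" shows "em (mrestr mu B) A = em mu (A Int B)"
proof -
 have "em (mrestr mu B) A = (\<integral>\<^sup>+x. indicator B x * indicator A x \<partial>mu)"
  unfolding mrestr_def using assms by (intro emeasure_density) auto
 also have "... = (\<integral>\<^sup>+x. indicator (A Int B) x \<partial>mu)"
  by (intro nn_integral_cong) (auto simp: indicator_def)
 also have "... = em mu (A Int B)" using assms by (intro nn_integral_indicator) auto
 finally show ?thesis .
qed

lemma sets_mrestr [simp]: "sets (mrestr mu B) = sets mu"
 by (simp add: mrestr_def)

lemma space_mrestr [simp]: "space (mrestr mu B) = space mu"
 by (simp add: mrestr_def)

section \<open>Trees carrying a measure that lives on a larger tree\<close>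

text \<open>\<open>Y\<close> is a measured subspace of \<open>m\<close>, and extending its measure by zero gives \<open>nu\<close>.\<close>
definition represents :: "'a mtree => 'a metric => 'a => 'a measure => bool" where
 "represents Y m ro nu \<longleftrightarrow> (EX S. S : sets (mb m) & ro : S & tmet Y = submetric m S & troot Y = ro &
   sets (tmeas Y) = sets (mb (tmet Y)) & sets nu = sets (mb m) &
   (ALL B:sets (mb m). em (tmeas Y) (B Int S) = em nu B))"

lemma assumes "represents Y m ro nu"
 shows represents_subset: "mspace (tmet Y) <= mspace m"
  and represents_dist: "mdist (tmet Y) = mdist m"
  and represents_root: "ro : mspace (tmet Y)" "troot Y = ro"
  and represents_sets: "sets (tmeas Y) = sets (mb (tmet Y))" "sets nu = sets (mb m)"
  and represents_space: "space (tmeas Y) = mspace (tmet Y)"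
  and represents_emeasure: "B : sets (mb m) ==> em (tmeas Y) (B Int mspace (tmet Y)) = em nu B"
  and represents_trace: "B : sets (mb m) ==> B Int mspace (tmet Y) : sets (tmeas Y)"
proof -
 obtain S where S: "S : sets (mb m)" "ro : S" "tmet Y = submetric m S" "troot Y = ro"
  "sets (tmeas Y) = sets (mb (tmet Y))" "sets nu = sets (mb m)"
  "!!B. B : sets (mb m) ==> em (tmeas Y) (B Int S) = em nu B"
  using assms unfolding represents_def by blast
 have "S <= mspace m" using sets.sets_into_space[OF S(1)] by simp
 then have sp: "mspace (tmet Y) = S" unfolding S(3) by auto
 show "mspace (tmet Y) <= mspace m" "mdist (tmet Y) = mdist m" "ro : mspace (tmet Y)" "troot Y = ro"
  "sets (tmeas Y) = sets (mb (tmet Y))" "sets nu = sets (mb m)"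
  using S sp \<open>S <= mspace m\<close> by simp_all
 show "space (tmeas Y) = mspace (tmet Y)" using sets_eq_imp_space_eq[OF S(5)] by simp
 show "em (tmeas Y) (B Int mspace (tmet Y)) = em nu B" if "B : sets (mb m)"
  using S(7)[OF that] unfolding sp .
 show "B Int mspace (tmet Y) : sets (tmeas Y)" if "B : sets (mb m)"
  using that S(1) unfolding sp S(5) unfolding S(3) borel_submetric_iff[OF S(1)] by simp
qed

text \<open>The hypothesis on \<open>seg\<close> puts the support inside its span. A point outside
  the closure of the span is therefore no support point and has a null neighbourhood, so the whole
  complement is null and restricting \<open>nu\<close> loses nothing.\<close>

lemma spanned_tree_represents:
 assumes sc: "second_countable_metric m" and nu: "sets nu = sets (mb m)"
  and ro: "ro : mspace m" and seg: "!!x. x : mspace m ==> x : seg m ro x"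
 shows "represents (spanned_tree m ro nu) m ro nu"
proof -
 define S where "S = mtopology_of m closure_of tree_span m ro (msupp m nu)"
 have S: "closedin (mtopology_of m) S" unfolding S_def by simp
 then have Sb: "S : sets (mb m)" and SS: "S <= mspace m"
  by (auto simp: closedin_mtopology_of)
 have sp: "space nu = mspace m" using sets_eq_imp_space_eq[OF nu] by simp
 have clos: "x : S" if "x : mspace m" "x : tree_span m ro (msupp m nu)" for x
  unfolding S_def closure_of_mtopology_of using that by (auto intro!: bexI[of _ x] simp del: mdist_zero)
 have roS: "ro : S" using clos[OF ro] by (simp add: tree_span_def)
 have null: "em nu (mspace m - S) = 0"
 proof (rule locally_null[OF sc nu])
  show "mspace m - S : sets nu" using Sb sp nu by (metis sets.compl_sets)
  fix x assume x: "x : mspace m - S"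
  have "x ~: msupp m nu"
   using seg x tree_span_def clos by fastforce
  then obtain U where "openin (mtopology_of m) U" "x : U" "em nu U = 0"
   using x unfolding msupp_def by (auto simp: not_gr_zero)
  then show "EX e>0. EX N:sets nu. em nu N = 0 & (ALL y:mspace m. mdist m x y < e --> y : N)"
   unfolding nu using borel_open[of m U] unfolding openin_mtopology_of by blast
 qed
 have "em (restrict_space nu S) (B Int S) = em nu B" if B: "B : sets (mb m)" for B
 proof -
  have "em (restrict_space nu S) (B Int S) = em nu (B Int S)"
   using Sb SS sp by (intro emeasure_restrict_space) (auto simp: nu Int_absorb2)
  also have "... = em nu B"
  proof (rule antisym)
   show "em nu (B Int S) <= em nu B" using B by (intro emeasure_mono) (auto simp: nu)
   have "B <= (B Int S) Un (mspace m - S)" using sets.sets_into_space[OF B] by auto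
   then have "em nu B <= em nu ((B Int S) Un (mspace m - S))"
    using B Sb sets.compl_sets[OF Sb] by (intro emeasure_mono) (auto simp: nu)
   also have "... <= em nu (B Int S) + em nu (mspace m - S)"
    using B Sb sets.compl_sets[OF Sb] by (intro emeasure_subadditive) (auto simp: nu)
   finally show "em nu B <= em nu (B Int S)" using null by simp
  qed
  finally show ?thesis .
 qed
 moreover have "sets (restrict_space nu S) = sets (mb (submetric m S))"
  unfolding sets_metric_borel_submetric[OF SS] sets_restrict_space nu ..
 ultimately show ?thesis
  unfolding represents_def spanned_tree_def S_def[symmetric] Let_def
  using Sb roS nu by (intro exI[of _ S]) simp
qed

lemma represents_trans:
 assumes Y: "represents Y (submetric m S) ro nu'" and S: "S : sets (mb m)"
  and nu: "sets nu = sets (mb m)"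
  and eq: "!!B. B : sets (mb m) ==> em nu' (B Int S) = em nu B"
 shows "represents Y m ro nu"
proof -
 obtain S' where S': "S' : sets (mb (submetric m S))" "ro : S'" "tmet Y = submetric (submetric m S) S'"
  "troot Y = ro" "sets (tmeas Y) = sets (mb (tmet Y))"
  "!!B. B : sets (mb (submetric m S)) ==> em (tmeas Y) (B Int S') = em nu' B"
  using Y unfolding represents_def by auto
 have sub: "S' <= S" "S' : sets (mb m)" using S'(1) borel_submetric_iff[OF S] by auto
 have "em (tmeas Y) (B Int S') = em nu B" if "B : sets (mb m)" for B
 proof -
  have "B Int S : sets (mb (submetric m S))" using borel_submetric_iff[OF S] S that by auto
  from S'(6)[OF this] have "em (tmeas Y) (B Int S') = em nu' (B Int S)"
   using sub(1) by (simp add: Int_assoc Int_absorb1)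
  then show ?thesis using eq[OF that] by simp
 qed
 then show ?thesis unfolding represents_def using S' sub nu
  by (intro exI[of _ S']) (simp add: Int_absorb1)
qed

section \<open>Borel sets of a tree: balls, levels and cones\<close>

context rooted_tree
begin

lemma seg_self: "x : Pt ==> x : seg m ro x"
 using seg_iff[of x x] gp_self[of x] by simp

lemma seg_submetric:
 assumes S: "S <= Pt" "!!x. x : S ==> seg m ro x <= S" and x: "x : S"
 shows "seg (submetric m S) ro x = seg m ro x"
proof -
 have 1: "is_segment (submetric m S) (seg m ro x) ro x"
  using is_segment_seg[of ro x] S x unfolding is_segment_submetric by auto
 show ?thesis
  unfolding seg_def[of "submetric m S"]
  by (rule the_equality) (use 1 seg_eq in \<open>auto simp: is_segment_submetric\<close>)
qed

lemma ht_closed: "closedin (mtopology_of m) (hi c)"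
 "closedin (mtopology_of m) (lo c)"
proof -
 show "closedin (mtopology_of m) (hi c)"
  by (rule lipschitz_superlevel_closed(1)[OF ht_lipschitz])
 show "closedin (mtopology_of m) (lo c)"
  by (rule lipschitz_superlevel_closed(2)[OF ht_lipschitz])
qed

lemma gp_closed:
 assumes "z : Pt"
 shows "closedin (mtopology_of m) {x : Pt. c <= gp z x}"
  and "closedin (mtopology_of m) {x : Pt. gp z x <= c}"
proof -
 show "closedin (mtopology_of m) {x : Pt. c <= gp z x}"
  unfolding gp_commute[of z] by (rule lipschitz_superlevel_closed(1)[OF gp_lipschitz[OF _ _ assms]])
 show "closedin (mtopology_of m) {x : Pt. gp z x <= c}"
  unfolding gp_commute[of z] by (rule lipschitz_superlevel_closed(2)[OF gp_lipschitz[OF _ _ assms]])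
qed

lemma above_closed: "si : Pt ==> closedin (mtopology_of m) (up si)"
 using gp_closed(1)[of si "ht si"] above_iff_ge[of si]
 by (metis (no_types, lifting) Collect_cong Collect_mem_eq)

lemma ht_borel_ge [measurable]: "(hi c) : Bor"
 and ht_borel_le [measurable]: "(lo c) : Bor"
 using ht_closed by auto

lemma ht_borel_gr: "{x : Pt. c < ht x} : Bor"
 and ht_borel_less: "{x : Pt. ht x < c} : Bor"
proof -
 have "{x : Pt. c < ht x} = space (mb m) - (lo c)"
  "{x : Pt. ht x < c} = space (mb m) - (hi c)" by auto
 then show "{x : Pt. c < ht x} : Bor" "{x : Pt. ht x < c} : Bor"
  by (metis sets.compl_sets ht_borel_le, metis sets.compl_sets ht_borel_ge)
qed

lemma above_borel: "si : Pt ==> up si : Bor"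
 using above_closed by auto

lemma tball_eq: "tball m ro r = (lo r)"
 using tball_iff by blast

lemma tsphere_eq: "tsphere m ro r = (lev r)"
 using tsphere_iff by blast

lemma tball_borel: "tball m ro r : Bor"
 unfolding tball_eq by (rule ht_borel_le)

lemma ht_borel_eq: "(lev r) : Bor"
proof -
 have "(lev r) = (lo r) Int (hi r)" by auto
 then show ?thesis using ht_borel_le ht_borel_ge by simp
qed

lemma singleton_borel: "x : Pt ==> {x} : Bor"
proof (rule borel_closed, unfold closedin_mtopology_of, intro conjI ballI)
 fix y assume "x : Pt" "y : Pt - {x}"
 then show "EX e>0. ALL z:{x}. e <= mdist m y z"
  by (intro exI[of _ "mdist m y x"]) (auto simp: less_le)
qed simp

lemma ht_measurable: "ht : borel_measurable (mb m)"
 unfolding borel_measurable_iff_ge using ht_borel_ge by simp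

end

section \<open>Small Gromov--Prokhorov distance\<close>

lemma rooted_isometric_embedding_measurable:
 assumes "rooted_isometric_embedding (tmet Y) (troot Y) Z z ph"
  and "sets (tmeas Y) = sets (mb (tmet Y))"
 shows "ph : measurable (tmeas Y) (mb Z)"
proof -
 have "ph : measurable (mb (tmet Y)) (mb Z)"
  by (rule measurable_lipschitz) (use assms in \<open>auto simp: rooted_isometric_embedding_def\<close>)
 then show ?thesis using measurable_cong_sets[OF assms(2) refl] by auto
qed

lemma closed_nbhd_closed: "closedin (mtopology_of Z) (closed_nbhd Z A ep)" if A: "A <= mspace Z" "0 <= ep"
 unfolding closedin_mtopology_of
proof (intro conjI ballI)
 show "closed_nbhd Z A ep <= mspace Z" by (auto simp: closed_nbhd_def)
 fix x assume x: "x : mspace Z - closed_nbhd Z A ep"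
 then have "ennreal ep < (INF a\<in>A. ennreal (mdist Z x a))" by (auto simp: closed_nbhd_def not_le)
 then obtain s where s: "ennreal ep < s" "s < (INF a\<in>A. ennreal (mdist Z x a))" using dense by blast
 then have "s ~= top" by auto
 then obtain t where t: "s = ennreal t" "t >= 0" by (cases s) auto
 have te: "ep < t" using s(1) t A(2) by (simp add: ennreal_less_iff)
 have xa: "t <= mdist Z x a" if "a : A" for a
 proof -
  have "ennreal t < ennreal (mdist Z x a)" using s(2) t less_INF_D[OF s(2) that] by simp
  then show ?thesis using t by (simp add: ennreal_less_iff)
 qed
 show "EX e>0. ALL y:closed_nbhd Z A ep. e <= mdist Z x y"
 proof (intro exI[of _ "(t - ep) / 2"] conjI ballI)
  fix y assume y: "y : closed_nbhd Z A ep"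
  then have "(INF a\<in>A. ennreal (mdist Z y a)) <= ennreal ep" by (simp add: closed_nbhd_def)
  also have "ennreal ep < ennreal ((t + ep) / 2)" using te A(2) by (simp add: ennreal_less_iff)
  finally obtain a where a: "a : A" "ennreal (mdist Z y a) < ennreal ((t + ep) / 2)"
   unfolding INF_less_iff by blast
  then have "mdist Z y a < (t + ep) / 2" by (simp add: ennreal_less_iff)
  moreover have "mdist Z x a <= mdist Z x y + mdist Z y a"
   using mdist_triangle[of x Z y a] x y a A(1) by (auto simp: closed_nbhd_def)
  ultimately show "(t - ep) / 2 <= mdist Z x y" using xa[OF a(1)] by (simp add: field_simps)
 qed (use te in simp)
qed

text \<open>The Prohorov condition speaks of closed sets. For a Borel set \<open>I\<close> it is
  applied to the closure of the image of \<open>I\<close>; passing from \<open>ep\<close> to the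
  larger \<open>dl\<close> makes up both for the closure and for an infimum in
  \<open>closed_nbhd\<close> that is not attained.\<close>

lemma prohorov_side:
 assumes Y: "represents Y m ro nu" and Y': "represents Y' m' ro' nu'"
  and ph: "rooted_isometric_embedding (tmet Y) (troot Y) Z z ph"
  and ps: "rooted_isometric_embedding (tmet Y') (troot Y') Z z ps"
  and le: "!!A. closedin (mtopology_of Z) A ==> em (distr (tmeas Y) (mb Z) ph) A
   <= em (distr (tmeas Y') (mb Z) ps) (closed_nbhd Z A ep) + ennreal ep"
  and ep: "0 < ep" "ep < dl" and I: "I : sets (mb m)" and B: "B : sets (mb m')"
  and IB: "!!x y. x : I ==> x : mspace (tmet Y) ==> y : mspace (tmet Y') ==>
   mdist Z (ph x) (ps y) < dl ==> y : B"
 shows "em nu I <= em nu' B + ennreal dl"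
proof -
 define S where "S = mspace (tmet Y)"
 note S = represents_subset[OF Y] S_def[symmetric] represents_sets(1)[OF Y] represents_space[OF Y, folded S_def]
  represents_emeasure[OF Y, folded S_def] represents_trace[OF Y, folded S_def]
 define S' where "S' = mspace (tmet Y')"
 note S' = represents_subset[OF Y'] S'_def[symmetric] represents_sets(1)[OF Y'] represents_space[OF Y', folded S'_def]
  represents_emeasure[OF Y', folded S'_def] represents_trace[OF Y', folded S'_def]
 have phm: "ph : measurable (tmeas Y) (mb Z)" "ps : measurable (tmeas Y') (mb Z)"
  using rooted_isometric_embedding_measurable[OF ph S(3)]
   rooted_isometric_embedding_measurable[OF ps S'(3)] .
 have phS: "ph x : mspace Z" if "x : S" for x
  using ph that unfolding rooted_isometric_embedding_def S(2) by auto
 have psS: "ps x : mspace Z" if "x : S'" for x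
  using ps that unfolding rooted_isometric_embedding_def S'(2) by auto
 define A where "A = mtopology_of Z closure_of (ph ` (I Int S))"
 have Ac: "closedin (mtopology_of Z) A" unfolding A_def by simp
 then have AZ: "A <= mspace Z" unfolding closedin_mtopology_of by simp
 define N where "N = closed_nbhd Z A ep"
 have Nb: "N : sets (mb Z)" unfolding N_def using closed_nbhd_closed[OF AZ] ep by auto
 have sub: "I Int S <= ph -` A Int S"
 proof -
  have "ph ` (I Int S) <= A" unfolding A_def
   by (rule closure_of_subset) (use phS in \<open>simp add: image_subset_iff\<close>)
  then show ?thesis by blast
 qed
 have "em nu I = em (tmeas Y) (I Int S)" using S(5) I by simp
 also have "... <= em (tmeas Y) (ph -` A Int S)"
  using measurable_sets[OF phm(1) borel_closed[OF Ac]] sub S(4) by (intro emeasure_mono) auto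
 also have "... = em (distr (tmeas Y) (mb Z) ph) A"
  using emeasure_distr[OF phm(1) borel_closed[OF Ac]] S(4) by simp
 also have "... <= em (distr (tmeas Y') (mb Z) ps) N + ennreal ep"
  using le[OF Ac] unfolding N_def .
 also have "em (distr (tmeas Y') (mb Z) ps) N = em (tmeas Y') (ps -` N Int S')"
  using emeasure_distr[OF phm(2) Nb] S'(4) by simp
 also have "... <= em (tmeas Y') (B Int S')"
 proof (rule emeasure_mono[OF _ S'(6)[OF B]], safe)
  fix y assume y: "y : S'" "ps y : N"
  then have "(INF a\<in>A. ennreal (mdist Z (ps y) a)) <= ennreal ep" unfolding N_def closed_nbhd_def by simp
  also have "... < ennreal dl" using ep by (simp add: ennreal_less_iff)
  finally have "EX a:A. ennreal (mdist Z (ps y) a) < ennreal dl" unfolding INF_less_iff .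
  then obtain a where a: "a : A" "mdist Z (ps y) a < dl" by (auto simp: ennreal_less_iff)
  then have "EX b:ph ` (I Int S). b : mspace Z & mdist Z a b < dl - mdist Z (ps y) a"
   unfolding A_def closure_of_mtopology_of by simp
  then obtain x where x: "x : I" "x : S" "mdist Z a (ph x) < dl - mdist Z (ps y) a" by blast
  have "mdist Z (ps y) (ph x) <= mdist Z (ps y) a + mdist Z a (ph x)"
   using mdist_triangle[OF psS[OF y(1)] subsetD[OF AZ a(1)] phS[OF x(2)]] .
  then have "mdist Z (ph x) (ps y) < dl" using x(3) by (simp add: mdist_commute)
  then show "y : B" using IB[OF x(1)] x(2) y(1) S(2) S'(2) by simp
 qed
 also have "... = em nu' B" using S'(5) B by simp
 finally have "em nu I <= em nu' B + ennreal ep" by (simp add: add_right_mono)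
 also have "... <= em nu' B + ennreal dl" using ep by (intro add_left_mono ennreal_leI) simp
 finally show ?thesis .
qed

text \<open>Consequences of a small Gromov--Prokhorov distance, with the common ambient space replaced
 by the relation \<open>C\<close> of being close in it.\<close>
definition close_by :: "real => 'a metric => 'a => 'a measure => 'b metric => 'b => 'b measure =>
  ('a => 'b => bool) => bool" where
 "close_by dl m ro nu m' ro' nu' C \<longleftrightarrow>
  (ALL x y. C x y --> x : mspace m & y : mspace m' & \<bar>mdist m ro x - mdist m' ro' y\<bar> <= dl) &
  (ALL x y x' y'. C x y --> C x' y' --> \<bar>mdist m x x' - mdist m' y y'\<bar> <= 2 * dl) &
  (ALL I:sets (mb m). ALL B:sets (mb m'). (ALL x y. x : I --> C x y --> y : B) -->
    em nu I <= em nu' B + ennreal dl) &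
  (ALL I:sets (mb m). ALL B:sets (mb m'). (ALL x y. y : B --> C x y --> x : I) -->
    em nu' B <= em nu I + ennreal dl)"

lemma mdist_reverse_triangle:
 assumes "a : mspace Z" "b : mspace Z" "c : mspace Z"
 shows "\<bar>mdist Z a b - mdist Z a c\<bar> <= mdist Z b c"
 using mdist_triangle[OF assms(1,2,3)] mdist_triangle[OF assms(1,3,2)] mdist_commute[of Z b c]
 unfolding abs_le_iff by simp

lemma GP_dist_close_by:
 fixes Y :: "'a mtree" and Y' :: "'b mtree"
 assumes Y: "represents Y m ro nu" and Y': "represents Y' m' ro' nu'" and GP: "GP_dist Y Y' < ennreal dl"
 shows "EX C. close_by dl m ro nu m' ro' nu' C"
proof -
 define S where "S = mspace (tmet Y)"
 note S = represents_subset[OF Y, folded S_def] represents_dist[OF Y] S_def[symmetric] represents_root(2)[OF Y]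
  represents_root(1)[OF Y, folded S_def]
 define S' where "S' = mspace (tmet Y')"
 note S' = represents_subset[OF Y', folded S'_def] represents_dist[OF Y'] S'_def[symmetric] represents_root(2)[OF Y']
  represents_root(1)[OF Y', folded S'_def]
 have "EX (Z :: ('a + 'b) metric) z ph ps. z : mspace Z &
     rooted_isometric_embedding (tmet Y) (troot Y) Z z ph &
     rooted_isometric_embedding (tmet Y') (troot Y') Z z ps &
     prohorov_dist Z (distr (tmeas Y) (mb Z) ph) (distr (tmeas Y') (mb Z) ps) < ennreal dl"
  using GP unfolding GP_dist_def INF_less_iff by auto
 then obtain Z :: "('a + 'b) metric" and z ph ps where Z: "z : mspace Z"
  "rooted_isometric_embedding (tmet Y) (troot Y) Z z ph"
  "rooted_isometric_embedding (tmet Y') (troot Y') Z z ps"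
  "prohorov_dist Z (distr (tmeas Y) (mb Z) ph) (distr (tmeas Y') (mb Z) ps) < ennreal dl"
  by blast
 obtain ep where ep: "ep > 0" "ennreal ep < ennreal dl"
  and "ALL A. closedin (mtopology_of Z) A --> em (distr (tmeas Y) (mb Z) ph) A
   <= em (distr (tmeas Y') (mb Z) ps) (closed_nbhd Z A ep) + ennreal ep &
   em (distr (tmeas Y') (mb Z) ps) A
   <= em (distr (tmeas Y) (mb Z) ph) (closed_nbhd Z A ep) + ennreal ep"
  using Z(4) unfolding prohorov_dist_def INF_less_iff by (elim bexE CollectE conjE)
 then have le: "!!A. closedin (mtopology_of Z) A ==> em (distr (tmeas Y) (mb Z) ph) A
   <= em (distr (tmeas Y') (mb Z) ps) (closed_nbhd Z A ep) + ennreal ep"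
   "!!A. closedin (mtopology_of Z) A ==> em (distr (tmeas Y') (mb Z) ps) A
   <= em (distr (tmeas Y) (mb Z) ph) (closed_nbhd Z A ep) + ennreal ep"
  by simp_all
 have epdl: "ep < dl" "0 < dl" using ep by (auto simp: ennreal_less_iff)
 have ph: "ph x : mspace Z" if "x : S" for x
  using Z(2) that unfolding rooted_isometric_embedding_def S(3) by auto
 have phd: "mdist Z (ph x) (ph y) = mdist m x y" if "x : S" "y : S" for x y
  using Z(2) that unfolding rooted_isometric_embedding_def S(2,3) by simp
 have ps: "ps x : mspace Z" if "x : S'" for x
  using Z(3) that unfolding rooted_isometric_embedding_def S'(3) by auto
 have psd: "mdist Z (ps x) (ps y) = mdist m' x y" if "x : S'" "y : S'" for x y
  using Z(3) that unfolding rooted_isometric_embedding_def S'(2,3) by simp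
 have root: "ph ro = z" "ps ro' = z"
  using Z(2,3) S(4) S'(4) unfolding rooted_isometric_embedding_def by auto
 define C where "C x y \<longleftrightarrow> x : S & y : S' & mdist Z (ph x) (ps y) < dl" for x y
 have 1: "\<bar>mdist m ro x - mdist m' ro' y\<bar> <= dl" if "C x y" for x y
 proof -
  have "x : S" "y : S'" "mdist Z (ph x) (ps y) < dl" using that unfolding C_def by auto
  moreover from this have "\<bar>mdist Z z (ph x) - mdist Z z (ps y)\<bar> <= mdist Z (ph x) (ps y)"
   using mdist_reverse_triangle[OF Z(1) ph ps] by blast
  moreover have "mdist Z z (ph x) = mdist m ro x" "mdist Z z (ps y) = mdist m' ro' y"
   using phd[OF S(5) \<open>x : S\<close>] psd[OF S'(5) \<open>y : S'\<close>] root by auto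
  ultimately show ?thesis by simp
 qed
 have 2: "\<bar>mdist m x x' - mdist m' y y'\<bar> <= 2 * dl" if "C x y" "C x' y'" for x y x' y'
 proof -
  have c: "x : S" "y : S'" "mdist Z (ph x) (ps y) < dl" "x' : S" "y' : S'" "mdist Z (ph x') (ps y') < dl"
   using that unfolding C_def by auto
  have "\<bar>mdist Z (ph x) (ph x') - mdist Z (ph x) (ps y')\<bar> <= mdist Z (ph x') (ps y')"
   using mdist_reverse_triangle[OF ph ph ps] c by blast
  moreover have "\<bar>mdist Z (ps y') (ph x) - mdist Z (ps y') (ps y)\<bar> <= mdist Z (ph x) (ps y)"
   using mdist_reverse_triangle[OF ps ph ps] c by blast
  ultimately have "\<bar>mdist Z (ph x) (ph x') - mdist Z (ps y') (ps y)\<bar> <= 2 * dl"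
   using c mdist_commute[of Z "ps y'" "ph x"] unfolding abs_le_iff by simp
  then show ?thesis using phd psd c mdist_commute[of m' y y'] by simp
 qed
 have "close_by dl m ro nu m' ro' nu' C"
  unfolding close_by_def
 proof (intro conjI allI impI ballI)
  fix I B assume IB: "I : sets (mb m)" "B : sets (mb m')"
  show "em nu I <= em nu' B + ennreal dl" if H: "ALL x y. x : I --> C x y --> y : B"
   by (rule prohorov_side[OF Y Y' Z(2,3) le(1) ep(1) epdl(1) IB]) (use H S(3) S'(3) in \<open>auto simp: C_def\<close>)
  show "em nu' B <= em nu I + ennreal dl" if H: "ALL x y. y : B --> C x y --> x : I"
   by (rule prohorov_side[OF Y' Y Z(3,2) le(2) ep(1) epdl(1) IB(2,1)])
    (use H S(3) S'(3) in \<open>auto simp: C_def mdist_commute\<close>)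
 qed (use 1 2 S(1) S'(1) in \<open>auto simp: C_def\<close>)
 then show ?thesis by blast
qed

text \<open>A closed set \<open>F\<close> is tested only through the cells that it meets. Each of
  them is replaced by its partner cell, which lies in the \<open>ep\<close>-neighbourhood of
  \<open>F\<close>; disjointness of the partner cells lets their masses be added up again. The
  errors \<open>et\<close> and the uncovered mass \<open>ka\<close> are paid from the additive
  \<open>ep\<close>.\<close>

lemma prohorov_cells:
 assumes Y: "represents Y m ro nu" and Y': "represents Y' m' ro' nu'"
  and ph: "rooted_isometric_embedding (tmet Y) (troot Y) Z z ph"
  and ps: "rooted_isometric_embedding (tmet Y') (troot Y') Z z ps"
  and fin: "finite J" and A: "!!i. i : J ==> A i : sets (mb m)"
  and A': "!!i. i : J ==> A' i : sets (mb m')"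
  and disj: "disjoint_family_on A' J"
  and near: "!!i a b. i : J ==> a : A i ==> a : mspace (tmet Y) ==> b : A' i ==> b : mspace (tmet Y') ==>
    mdist Z (ph a) (ps b) <= ep"
  and mass: "!!i. i : J ==> em nu (A i) <= em nu' (A' i) + ennreal (et i)"
  and et: "!!i. i : J ==> 0 <= et i" "0 <= ka" "sum et J + ka <= ep"
  and rest: "em nu (mspace m - (UN i:J. A i)) <= ennreal ka"
  and F: "closedin (mtopology_of Z) F"
 shows "em (distr (tmeas Y) (mb Z) ph) F
   <= em (distr (tmeas Y') (mb Z) ps) (closed_nbhd Z F ep) + ennreal ep"
proof -
 have ep: "0 <= ep" using et sum_nonneg[of J et] by force
 define S where "S = mspace (tmet Y)"
 note S = represents_subset[OF Y, folded S_def] S_def[symmetric] represents_sets(1)[OF Y] represents_space[OF Y, folded S_def]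
  represents_sets(2)[OF Y] represents_emeasure[OF Y, folded S_def] represents_trace[OF Y, folded S_def]
 define S' where "S' = mspace (tmet Y')"
 note S' = represents_subset[OF Y', folded S'_def] S'_def[symmetric] represents_sets(1)[OF Y'] represents_space[OF Y', folded S'_def]
  represents_sets(2)[OF Y'] represents_emeasure[OF Y', folded S'_def] represents_trace[OF Y', folded S'_def]
 have phm: "ph : measurable (tmeas Y) (mb Z)" "ps : measurable (tmeas Y') (mb Z)"
  using rooted_isometric_embedding_measurable[OF ph S(3)]
   rooted_isometric_embedding_measurable[OF ps S'(3)] .
 have psS: "ps x : mspace Z" if "x : S'" for x
  using ps that unfolding rooted_isometric_embedding_def S'(2) by auto
 have FZ: "F <= mspace Z" using F unfolding closedin_mtopology_of by simp
 define N where "N = closed_nbhd Z F ep"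
 have Nb: "N : sets (mb Z)" unfolding N_def using closed_nbhd_closed[OF FZ ep] by auto
 define K where "K = {i : J. EX a:A i. a : S & ph a : F}"
 have K: "K <= J" "finite K" using fin unfolding K_def by auto
 have AK: "(UN i:K. A i) : sets (mb m)" using K A by (intro sets.finite_UN) auto
 have AJ: "mspace m - (UN i:J. A i) : sets (mb m)"
  using sets.compl_sets[OF sets.finite_UN[OF fin A]] by simp
 have AK': "(UN i:K. A' i) : sets (mb m')" using K A' by (intro sets.finite_UN) auto
 have "em (distr (tmeas Y) (mb Z) ph) F = em (tmeas Y) (ph -` F Int S)"
  using emeasure_distr[OF phm(1) borel_closed[OF F]] S(4) by simp
 also have "... <= em (tmeas Y) (((UN i:K. A i) Un (mspace m - (UN i:J. A i))) Int S)"
  using S(7)[OF sets.Un[OF AK AJ]] S(1) by (intro emeasure_mono) (auto simp: K_def)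
 also have "... = em nu ((UN i:K. A i) Un (mspace m - (UN i:J. A i)))"
  by (rule S(6)[OF sets.Un[OF AK AJ]])
 also have "... <= em nu (UN i:K. A i) + em nu (mspace m - (UN i:J. A i))"
  using AK AJ by (intro emeasure_subadditive) (auto simp: S(5))
 also have "... <= (SUM i:K. em nu (A i)) + ennreal ka"
  using K A rest by (intro add_mono emeasure_subadditive_finite) (auto simp: S(5))
 also have "... <= (SUM i:K. em nu' (A' i) + ennreal (et i)) + ennreal ka"
  using K mass by (intro add_mono sum_mono) auto
 also have "... = (SUM i:K. em nu' (A' i)) + ennreal (sum et K + ka)"
  using K et(1,2) by (simp add: sum.distrib sum_nonneg add.assoc subset_iff ennreal_plus[symmetric] del: ennreal_plus)
 also have "... <= (SUM i:K. em nu' (A' i)) + ennreal ep"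
  using et K fin sum_mono2[of J K et] by (intro add_left_mono ennreal_leI) force
 also have "(SUM i:K. em nu' (A' i)) = em nu' (UN i:K. A' i)"
  using K A' disjoint_family_on_mono[OF K(1) disj] by (intro sum_emeasure) (auto simp: S'(5))
 also have "... = em (tmeas Y') ((UN i:K. A' i) Int S')" using S'(6)[OF AK'] by simp
 also have "... <= em (tmeas Y') (ps -` N Int S')"
 proof (rule emeasure_mono)
  show "ps -` N Int S' : sets (tmeas Y')" using measurable_sets[OF phm(2) Nb] S'(4) by simp
  show "(UN i:K. A' i) Int S' <= ps -` N Int S'"
  proof
   fix b assume "b : (UN i:K. A' i) Int S'"
   then obtain i where i: "i : K" "b : A' i" "b : S'" by auto
   then obtain a where a: "a : A i" "a : S" "ph a : F" "i : J" unfolding K_def by auto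
   have "mdist Z (ph a) (ps b) <= ep" using near[OF a(4,1)] a i S(2) S'(2) by auto
   then have "(INF f\<in>F. ennreal (mdist Z (ps b) f)) <= ennreal ep"
    using a(3) mdist_commute[of Z "ph a" "ps b"] by (intro INF_lower2[of "ph a"]) (auto intro: ennreal_leI)
   then show "b : ps -` N Int S'" using psS i unfolding N_def closed_nbhd_def by auto
  qed
 qed
 also have "... = em (distr (tmeas Y') (mb Z) ps) N"
  using emeasure_distr[OF phm(2) Nb] S'(4) by simp
 finally show ?thesis unfolding N_def by (simp add: add_right_mono)
qed

section \<open>Gluing two trees by bridges between matched points\<close>

locale glued =
 fixes m :: "'a metric" and ro :: 'a and m' :: "'b metric" and ro' :: 'b
  and J :: "'i set" and o\<^sub>J :: 'i and x :: "'i => 'a" and x' :: "'i => 'b" and w :: "'i => real"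
 assumes fin: "finite J" and oJ: "o\<^sub>J : J" "x o\<^sub>J = ro" "x' o\<^sub>J = ro'" "w o\<^sub>J = 0"
  and xm: "!!i. i : J ==> x i : mspace m" "!!i. i : J ==> x' i : mspace m'"
  and w_nonneg: "!!i. 0 <= w i" and w_pos: "!!i. i : J ==> i ~= o\<^sub>J ==> 0 < w i"
  and dist: "!!i j. i : J ==> j : J ==> \<bar>mdist m (x i) (x j) - mdist m' (x' i) (x' j)\<bar> <= w i + w j"
begin

text \<open>Each \<open>x i\<close> is joined to \<open>x' i\<close> by a bridge of length
  \<open>w i\<close>, and \<open>cross\<close> is the shortest way over a bridge. The assumption
  \<open>dist\<close> says that crossing one bridge and returning over another never shortens a
  distance, so both spaces stay isometrically embedded. The bridge \<open>o\<^sub>J\<close> has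
  length 0 and identifies the roots.\<close>

definition cross :: "'a => 'b => real" where
 "cross a b = Min ((%i. mdist m a (x i) + w i + mdist m' (x' i) b) ` J)"

lemma cross_le: "i : J ==> cross a b <= mdist m a (x i) + w i + mdist m' (x' i) b"
 unfolding cross_def using fin by (intro Min_le) auto

lemma cross_attained: "EX i:J. cross a b = mdist m a (x i) + w i + mdist m' (x' i) b"
proof -
 have "cross a b : (%i. mdist m a (x i) + w i + mdist m' (x' i) b) ` J"
  unfolding cross_def using fin oJ(1) by (intro Min_in) auto
 then show ?thesis by auto
qed

lemma cross_nonneg: "0 <= cross a b"
proof -
 obtain i where "cross a b = mdist m a (x i) + w i + mdist m' (x' i) b" using cross_attained by blast
 then show ?thesis using w_nonneg[of i] by simp
qed

lemma cross_zero:
 assumes "a : mspace m" "b : mspace m'" "cross a b = 0" shows "a = ro" "b = ro'"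
proof -
 obtain i where i: "i : J" "cross a b = mdist m a (x i) + w i + mdist m' (x' i) b"
  using cross_attained by blast
 have "mdist m a (x i) >= 0" "mdist m' (x' i) b >= 0" by simp_all
 then have z: "mdist m a (x i) = 0" "w i = 0" "mdist m' (x' i) b = 0"
  using i(2) w_nonneg[of i] assms(3) by linarith+
 then have "i = o\<^sub>J" using w_pos[OF i(1)] by force
 then show "a = ro" "b = ro'" using z assms(1,2) xm[OF i(1)] oJ by auto
qed

lemma cross_triangle:
 assumes "a : mspace m" "a' : mspace m" "b : mspace m'" "b' : mspace m'"
 shows "cross a b <= mdist m a a' + cross a' b" "cross a b' <= cross a b + mdist m' b b'"
  "mdist m a a' <= cross a b + cross a' b" "mdist m' b b' <= cross a b + cross a b'"
proof -
 obtain i where i: "i : J" "cross a b = mdist m a (x i) + w i + mdist m' (x' i) b"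
  using cross_attained by blast
 obtain j where j: "j : J" "cross a' b = mdist m a' (x j) + w j + mdist m' (x' j) b"
  using cross_attained by blast
 obtain l where l: "l : J" "cross a b' = mdist m a (x l) + w l + mdist m' (x' l) b'"
  using cross_attained by blast
 show "cross a b <= mdist m a a' + cross a' b"
  using cross_le[OF j(1), of a b] j(2) mdist_triangle[OF assms(1,2) xm(1)[OF j(1)]] by linarith
 show "cross a b' <= cross a b + mdist m' b b'"
  using cross_le[OF i(1), of a b'] i(2) mdist_triangle[OF xm(2)[OF i(1)] assms(3,4)] by linarith
 have d: "mdist m (x i) (x j) <= mdist m' (x' i) (x' j) + (w i + w j)"
  "mdist m' (x' i) (x' l) <= mdist m (x i) (x l) + (w i + w l)"
  using dist[OF i(1) j(1)] dist[OF i(1) l(1)] unfolding abs_le_iff by linarith+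
 have "mdist m a a' <= mdist m a (x i) + mdist m (x i) a'"
  "mdist m (x i) a' <= mdist m (x i) (x j) + mdist m (x j) a'"
  "mdist m' (x' i) (x' j) <= mdist m' (x' i) b + mdist m' b (x' j)"
  using mdist_triangle xm i(1) j(1) assms by metis+
 then show "mdist m a a' <= cross a b + cross a' b"
  using d(1) i(2) j(2) mdist_commute[of m a' "x j"] mdist_commute[of m' b "x' j"] by linarith
 have "mdist m' b b' <= mdist m' b (x' i) + mdist m' (x' i) b'"
  "mdist m' (x' i) b' <= mdist m' (x' i) (x' l) + mdist m' (x' l) b'"
  "mdist m (x i) (x l) <= mdist m (x i) a + mdist m a (x l)"
  using mdist_triangle xm i(1) l(1) assms by metis+
 then show "mdist m' b b' <= cross a b + cross a b'"
  using d(2) i(2) l(2) mdist_commute[of m' b "x' i"] mdist_commute[of m a "x i"] by linarith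
qed

lemma cross_root:
 assumes "b : mspace m'" shows "cross ro b = mdist m' ro' b"
proof (rule antisym)
 show "cross ro b <= mdist m' ro' b" using cross_le[OF oJ(1), of ro b] oJ xm(1)[OF oJ(1)] by simp
 have r: "ro : mspace m" "ro' : mspace m'" using xm[OF oJ(1)] oJ by auto
 have "cross ro ro' = 0" using cross_le[OF oJ(1), of ro ro'] oJ r cross_nonneg[of ro ro'] by simp
 then show "mdist m' ro' b <= cross ro b" using cross_triangle(4)[OF r(1,1,2) assms] by simp
qed

fun gdist :: "'a + 'b => 'a + 'b => real" where
 "gdist (Inl a) (Inl a') = mdist m a a'"
| "gdist (Inr b) (Inr b') = mdist m' b b'"
| "gdist (Inl a) (Inr b) = cross a b"
| "gdist (Inr b) (Inl a) = cross a b"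

text \<open>The two roots are at distance 0, so the second one is left out of the carrier to obtain
  a metric and not merely a pseudometric; \<open>right_emb\<close> sends it to the first
  one.\<close>

lemma gdist_metric: "Metric_space (Inl ` mspace m Un Inr ` (mspace m' - {ro'})) gdist"
proof
 fix p q show "0 <= gdist p q" by (cases p; cases q) (simp_all add: cross_nonneg)
 show "gdist p q = gdist q p"
  using mdist_commute[of m "projl p" "projl q"] mdist_commute[of m' "projr p" "projr q"]
  by (cases p; cases q) simp_all
next
 fix p q assume pq: "p : Inl ` mspace m Un Inr ` (mspace m' - {ro'})" "q : Inl ` mspace m Un Inr ` (mspace m' - {ro'})"
 have "cross a b ~= 0" if "a : mspace m" "b : mspace m'" "b ~= ro'" for a b
  using cross_zero(2)[OF that(1,2)] that(3) by blast
 then have cross: "cross a b ~= 0" if "a : mspace m" "b : mspace m' - {ro'}" for a b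
  using that by blast
 show "gdist p q = 0 \<longleftrightarrow> p = q"
  using pq cross by auto
next
 fix p q r assume pqr: "p : Inl ` mspace m Un Inr ` (mspace m' - {ro'})" "q : Inl ` mspace m Un Inr ` (mspace m' - {ro'})"
  "r : Inl ` mspace m Un Inr ` (mspace m' - {ro'})"
 show "gdist p r <= gdist p q + gdist q r"
 proof (cases p)
  case p: (Inl a)
  show ?thesis
  proof (cases q)
   case q: (Inl a')
   show ?thesis
   proof (cases r)
    case r: (Inl c)
    then show ?thesis using p q pqr mdist_triangle[of a m a' c] by auto
   next
    case r: (Inr b)
    then show ?thesis using p q pqr cross_triangle(1)[of a a' b b] by auto
   qed
  next
   case q: (Inr b)
   show ?thesis
   proof (cases r)
    case r: (Inl c)
    then show ?thesis using p q pqr cross_triangle(3)[of a c b b] by auto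
   next
    case r: (Inr b')
    then show ?thesis using p q pqr cross_triangle(2)[of a a b b'] by auto
   qed
  qed
 next
  case p: (Inr b)
  show ?thesis
  proof (cases q)
   case q: (Inl a)
   show ?thesis
   proof (cases r)
    case r: (Inl c)
    then show ?thesis using p q pqr cross_triangle(1)[of c a b b] mdist_commute[of m c a] by auto
   next
    case r: (Inr b')
    then show ?thesis using p q pqr cross_triangle(4)[of a a b b'] by auto
   qed
  next
   case q: (Inr b')
   show ?thesis
   proof (cases r)
    case r: (Inl c)
    then show ?thesis using p q pqr cross_triangle(2)[of c c b' b] mdist_commute[of m' b b'] by auto
   next
    case r: (Inr b'')
    then show ?thesis using p q pqr mdist_triangle[of b m' b' b''] by auto
   qed
  qed
 qed
qed

definition gmetric :: "('a + 'b) metric" where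
 "gmetric = metric (Inl ` mspace m Un Inr ` (mspace m' - {ro'}), gdist)"

lemma mspace_gmetric: "mspace gmetric = Inl ` mspace m Un Inr ` (mspace m' - {ro'})"
 unfolding gmetric_def by (rule Metric_space.mspace_metric[OF gdist_metric])

lemma mdist_gmetric: "mdist gmetric = gdist"
 unfolding gmetric_def by (rule Metric_space.mdist_metric[OF gdist_metric])

definition right_emb :: "'b => 'a + 'b" where
 "right_emb y = (if y = ro' then Inl ro else Inr y)"

lemma gdist_right_emb: "y : mspace m' ==> gdist (Inl a) (right_emb y) <= cross a y" if "a : mspace m"
proof -
 assume y: "y : mspace m'"
 have r: "ro : mspace m" "ro' : mspace m'" using xm[OF oJ(1)] oJ by auto
 have "cross ro ro' = 0" using cross_root[OF r(2)] r by simp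
 then have "mdist m a ro <= cross a ro'" using cross_triangle(3)[OF that r(1,2,2)] by simp
 then show ?thesis by (simp add: right_emb_def)
qed

lemma embeddings:
 assumes Y: "represents Y m ro nu" and Y': "represents Y' m' ro' nu'"
 shows "rooted_isometric_embedding (tmet Y) (troot Y) gmetric (Inl ro) Inl"
  "rooted_isometric_embedding (tmet Y') (troot Y') gmetric (Inl ro) right_emb"
proof -
 have r: "ro : mspace m" "ro' : mspace m'" using xm[OF oJ(1)] oJ by auto
 show "rooted_isometric_embedding (tmet Y) (troot Y) gmetric (Inl ro) Inl"
  using represents_subset[OF Y]
  by (auto simp: rooted_isometric_embedding_def represents_root[OF Y] represents_dist[OF Y]
    mspace_gmetric mdist_gmetric)
 have iso: "gdist (right_emb y) (right_emb y') = mdist m' y y'" if "y : mspace m'" "y' : mspace m'" for y y'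
  using that r cross_root[of y] cross_root[of y'] by (auto simp: right_emb_def mdist_commute simp del: mdist_zero)
 show "rooted_isometric_embedding (tmet Y') (troot Y') gmetric (Inl ro) right_emb"
  unfolding rooted_isometric_embedding_def represents_root[OF Y'] represents_dist[OF Y'] mspace_gmetric mdist_gmetric
 proof (intro conjI ballI)
  show "right_emb ` mspace (tmet Y') <= Inl ` mspace m Un Inr ` (mspace m' - {ro'})"
   using represents_subset[OF Y'] r by (auto simp: right_emb_def)
  show "right_emb ro' = Inl ro" by (simp add: right_emb_def)
  show "gdist (right_emb x) (right_emb y) = mdist m' x y"
   if "x : mspace (tmet Y')" "y : mspace (tmet Y')" for x y
   using iso[of x y] that represents_subset[OF Y'] by blast
 qed
qed

lemma GP_dist_le:
 assumes Y: "represents Y m ro nu" and Y': "represents Y' m' ro' nu'"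
  and A: "!!i. i : J ==> A i : sets (mb m)" "disjoint_family_on A J"
  and A': "!!i. i : J ==> A' i : sets (mb m')" "disjoint_family_on A' J"
  and near: "!!i a. i : J ==> a : A i ==> mdist m a (x i) <= e" "!!i b. i : J ==> b : A' i ==> mdist m' (x' i) b <= e"
   "!!i. i : J ==> w i <= e"
  and mass: "!!i. i : J ==> em nu (A i) <= em nu' (A' i) + ennreal (et i)"
   "!!i. i : J ==> em nu' (A' i) <= em nu (A i) + ennreal (et i)"
  and et: "!!i. i : J ==> 0 <= et i" "0 <= ka" "sum et J + ka <= ep" "3 * e <= ep" "0 < ep"
  and rest: "em nu (mspace m - (UN i:J. A i)) <= ennreal ka"
   "em nu' (mspace m' - (UN i:J. A' i)) <= ennreal ka"
 shows "GP_dist Y Y' <= ennreal ep"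
proof -
 let ?P = "prohorov_dist gmetric (distr (tmeas Y) (mb gmetric) Inl)
    (distr (tmeas Y') (mb gmetric) right_emb)"
 have nr: "gdist (Inl a) (right_emb b) <= ep" if "i : J" "a : A i" "b : A' i" for i a b
 proof -
  have "a : mspace m" "b : mspace m'"
   using sets.sets_into_space[OF A(1)[OF that(1)]] sets.sets_into_space[OF A'(1)[OF that(1)]] that by auto
  then have "gdist (Inl a) (right_emb b) <= cross a b" by (rule gdist_right_emb)
  \<comment> \<open>From \<open>a\<close> to its node, over the bridge, and on to \<open>b\<close>;
    this is the origin of the condition \<open>3 * e <= ep\<close>.\<close>
  also have "... <= e + e + e"
   using cross_le[OF that(1), of a b] near(1)[OF that(1,2)] near(2)[OF that(1,3)] near(3)[OF that(1)] by simp
  finally show ?thesis using et(4) by simp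
 qed
 have "?P <= ennreal ep"
  unfolding prohorov_dist_def
 proof (rule INF_lower, safe)
  fix F assume F: "closedin (mtopology_of gmetric) F"
  show "em (distr (tmeas Y) (mb gmetric) Inl) F
   <= em (distr (tmeas Y') (mb gmetric) right_emb) (closed_nbhd gmetric F ep) + ennreal ep"
   by (rule prohorov_cells[OF Y Y' embeddings[OF Y Y'] fin A(1) A'(1) A'(2) _ mass(1) et(1-3) rest(1) F])
    (use nr in \<open>auto simp: mdist_gmetric\<close>)
  show "em (distr (tmeas Y') (mb gmetric) right_emb) F
   <= em (distr (tmeas Y) (mb gmetric) Inl) (closed_nbhd gmetric F ep) + ennreal ep"
   by (rule prohorov_cells[OF Y' Y embeddings(2)[OF Y Y'] embeddings(1)[OF Y Y'] fin A'(1) A(1) A(2) _ mass(2) et(1-3) rest(2) F])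
    (use nr Metric_space.commute[OF gdist_metric] in \<open>auto simp: mdist_gmetric\<close>)
 qed (rule et(5))
 moreover have "GP_dist Y Y' <= ?P"
 proof -
  have "ro : mspace m" using xm(1)[OF oJ(1)] oJ by simp
  then show ?thesis
   unfolding GP_dist_def
   by (intro INF_lower2[of "(gmetric, Inl ro, Inl, right_emb)"])
    (use embeddings[OF Y Y'] in \<open>auto simp: mspace_gmetric\<close>)
 qed
 ultimately show ?thesis by simp
qed

end

section \<open>Matching the nodes of two trees\<close>

definition near :: "real => ennreal => ennreal => bool" where
 "near et a b \<longleftrightarrow> a <= b + ennreal et & b <= a + ennreal et"

lemma close_byD:
 assumes C: "close_by dl m ro nu m' ro' nu' C"
 shows "C x y ==> x : mspace m" "C x y ==> y : mspace m'" "C x y ==> \<bar>mdist m ro x - mdist m' ro' y\<bar> <= dl"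
  "C x y ==> C x' y' ==> \<bar>mdist m x x' - mdist m' y y'\<bar> <= 2 * dl"
  "I : sets (mb m) ==> B : sets (mb m') ==> (!!x y. x : I ==> C x y ==> y : B) ==>
    em nu I <= em nu' B + ennreal dl"
  "I : sets (mb m) ==> B : sets (mb m') ==> (!!x y. y : B ==> C x y ==> x : I) ==>
    em nu' B <= em nu I + ennreal dl"
proof -
 have 1: "ALL x y. C x y --> x : mspace m & y : mspace m' & \<bar>mdist m ro x - mdist m' ro' y\<bar> <= dl"
  using C unfolding close_by_def by (elim conjE)
 then show "C x y ==> x : mspace m" "C x y ==> y : mspace m'" "C x y ==> \<bar>mdist m ro x - mdist m' ro' y\<bar> <= dl"
  by simp_all
 have 2: "ALL x y x' y'. C x y --> C x' y' --> \<bar>mdist m x x' - mdist m' y y'\<bar> <= 2 * dl"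
  using C unfolding close_by_def by (elim conjE)
 then show "C x y ==> C x' y' ==> \<bar>mdist m x x' - mdist m' y y'\<bar> <= 2 * dl" by simp
 have 3: "ALL I:sets (mb m). ALL B:sets (mb m'). (ALL x y. x : I --> C x y --> y : B) -->
    em nu I <= em nu' B + ennreal dl"
  using C unfolding close_by_def by (elim conjE)
 show "em nu I <= em nu' B + ennreal dl"
  if "I : sets (mb m)" "B : sets (mb m')" "!!x y. x : I ==> C x y ==> y : B"
  using bspec[OF bspec[OF 3 that(1)] that(2)] that(3) by simp
 have 4: "ALL I:sets (mb m). ALL B:sets (mb m'). (ALL x y. y : B --> C x y --> x : I) -->
    em nu' B <= em nu I + ennreal dl"
  using C unfolding close_by_def by (elim conjE)
 show "em nu' B <= em nu I + ennreal dl"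
  if "I : sets (mb m)" "B : sets (mb m')" "!!x y. y : B ==> C x y ==> x : I"
  using bspec[OF bspec[OF 4 that(1)] that(2)] that(3) by simp
qed

lemma finite_ennreal_lower_bound:
 fixes f :: "'a => ennreal"
 assumes "finite V" "!!x. x : V ==> 0 < f x" shows "EX c>0. ALL x:V. ennreal c < f x"
 using assms
proof (induction V rule: finite_induct)
 case (insert x V)
 then obtain c where c: "0 < c" "!!y. y : V ==> ennreal c < f y" by auto
 obtain z where z: "0 < z" "z < f x" using dense[of 0 "f x"] insert.prems by auto
 then obtain d where d: "0 < d" "ennreal d < f x" by (cases z) auto
 have "ennreal (min c d) < f y" if "y : insert x V" for y
  using that c(2)[of y] d(2) le_less_trans[OF ennreal_leI, of "min c d" c] le_less_trans[OF ennreal_leI, of "min c d" d] by auto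
 then show ?case using c(1) d(1) by (intro exI[of _ "min c d"]) auto
qed (auto intro: zero_less_one)

lemma inverse_Suc_mono: "k <= l ==> 1 / real (Suc l) <= 1 / real (Suc k)"
 by (intro divide_left_mono) auto

lemma eventually_inner:
 assumes "range A <= sets M" "incseq A" "B <= (UN k. A k) Un N" "B : sets M" "N : sets M"
  "em M N = 0" "em M B < \<infinity>" "0 < et"
 shows "EV k. em M B <= em M (A k) + ennreal et"
proof -
 have "(%k. em M (A k) + ennreal et) \<longlonglongrightarrow> em M (UN k. A k) + ennreal et"
  by (intro tendsto_add Lim_emeasure_incseq assms tendsto_const)
 moreover have "em M B < em M (UN k. A k) + ennreal et"
 proof -
  have "em M B <= em M ((UN k. A k) Un N)"
   using assms by (intro emeasure_mono) auto
  also have "... <= em M (UN k. A k) + em M N"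
   using assms(1,5) by (intro emeasure_subadditive sets.countable_UN) auto
  finally have le: "em M B <= em M (UN k. A k)" using assms(6) by simp
  have "em M B < em M B + ennreal et"
   using assms(7,8) by (simp add: ennreal_add_left_cancel_less[of _ 0, simplified])
  also have "... <= em M (UN k. A k) + ennreal et" using le by (rule add_right_mono)
  finally show ?thesis .
 qed
 ultimately have "EV k. em M B < em M (A k) + ennreal et"
  by (rule order_tendstoD(1))
 then show ?thesis by eventually_elim simp
qed

lemma eventually_outer:
 assumes "range A <= sets M" "decseq A" "(INT k. A k) <= B" "B : sets M"
  "!!k. em M (A k) < \<infinity>" "0 < et"
 shows "EV k. em M (A k) <= em M B + ennreal et"
proof -
 have le: "em M (INT k. A k) <= em M B" using assms by (intro emeasure_mono) auto
 have fin: "em M (INT k. A k) < \<infinity>"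
  using le_less_trans[OF emeasure_mono assms(5)[of 0], of "INT k. A k"] assms(1) by blast
 have "(%k. em M (A k)) \<longlonglongrightarrow> em M (INT k. A k)"
  using assms(5) by (intro Lim_emeasure_decseq assms) (auto simp: less_top)
 moreover have "em M (INT k. A k) < em M B + ennreal et"
 proof -
  have "em M (INT k. A k) < em M (INT k. A k) + ennreal et"
   using fin assms(6) by (simp add: ennreal_add_left_cancel_less[of _ 0, simplified])
  also have "... <= em M B + ennreal et" using le by (rule add_right_mono)
  finally show ?thesis .
 qed
 ultimately have "EV k. em M (A k) < em M B + ennreal et"
  by (rule order_tendstoD(2))
 then show ?thesis by eventually_elim simp
qed

lemma near_trans_add:
 assumes "a <= b + ennreal et" "b <= c + ennreal th" "0 <= et" "0 <= th"
 shows "a <= c + ennreal (et + th)"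
proof -
 have "a <= (c + ennreal th) + ennreal et" using assms(1,2) by (meson add_right_mono order_trans)
 also have "... = c + ennreal (et + th)" using assms(3,4) by (simp add: ac_simps)
 finally show ?thesis .
qed

context rooted_tree
begin

definition slab :: "'a => real => real => 'a set" where
 "slab si t R = {x : Pt. ht si <= gp si x & t <= ht x & ht x <= R}"

text \<open>At such a height the alternative \<open>gp x y < s\<close> or \<open>s < gp x y\<close>,
  for points above \<open>s\<close>, is stable under small perturbations. In a separable tree only
  countably many heights are excluded (\<open>countable_branching\<close>).\<close>

definition no_branching :: "real => bool" where
 "no_branching s \<longleftrightarrow> (ALL x:Pt. ALL y:Pt. s < ht x --> s < ht y --> gp x y ~= s)"

lemma slab_borel:
 assumes "si : Pt" shows "{x : Pt. c <= gp si x & t <= ht x & ht x <= R} : Bor"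
proof -
 have "{x : Pt. c <= gp si x & t <= ht x & ht x <= R}
  = {x : Pt. c <= gp si x} Int (hi t) Int (lo R)" by auto
 then show ?thesis
  using borel_closed[OF gp_closed(1)[OF assms]] ht_borel_ge ht_borel_le by (simp add: sets.Int)
qed

lemma slab_above: "si : Pt ==> slab si t R = {x : up si. t <= ht x & ht x <= R}"
 unfolding slab_def using above_iff_ge by auto

end

text \<open>\<open>near\<close> for the part of the cone over a node between heights \<open>t : Q\<close> and \<open>R\<close>; moreover the relative
 position of the nodes, as far as the levels in \<open>S\<close> can see it, is the same in both trees.\<close>
definition matched :: "real => real set => 'a set => real set => real => 'a metric => 'a => 'a measure =>
  'b metric => 'b => 'b measure => ('a => 'b) => bool" where
 "matched et S V Q R m ro mu m' ro' mu' bt \<longleftrightarrow>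
  (ALL si:V. bt si : mspace m' & mdist m' ro' (bt si) = mdist m ro si &
    (ALL t:Q. near et (em mu' (rooted_tree.slab m' ro' (bt si) t R))
         (em mu (rooted_tree.slab m ro si t R)))) &
  (ALL si:V. ALL ta:V. ALL s:S. s <= rooted_tree.gp m ro si ta \<longleftrightarrow> s <= rooted_tree.gp m' ro' (bt si) (bt ta)) &
  (ALL t:Q. near et (em mu' (rooted_tree.slab m' ro' ro' t R)) (em mu (rooted_tree.slab m ro ro t R)))"

context rooted_tree
begin

text \<open>The level -1 is empty, and a slab with lower bound -1 is the full cone up to its upper
  bound. Admitting -1 as a level treats whole cones and their parts above a level alike.\<close>

lemma null_neg: "em M (lev (-1)) = 0"
proof -
 have "(lev (-1)) = {}" using ht_nonneg by (metis (mono_tags, lifting) Collect_empty_eq neg_0_le_iff_le not_one_le_zero)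
 then show ?thesis by (simp only: emeasure_empty)
qed

lemma slab_borel0: "{x : Pt. t <= ht x & ht x <= R} : Bor"
proof -
 have "{x : Pt. t <= ht x & ht x <= R} = {x : Pt. 0 <= gp ro x & t <= ht x & ht x <= R}" using gp_le(3)[OF root_in] by blast
 then show ?thesis using slab_borel[OF root_in, of 0] by simp
qed

text \<open>The inner sets keep a margin to the boundary of the slab. For a node other than the root
  the margin is expressed by a fixed \<open>p\<close> strictly above it: as nothing branches at
  height \<open>ht si\<close>, every point of the cone strictly above that height has
  \<open>gp p x\<close> greater than \<open>ht si\<close>. What the inner sets miss lies on levels
  of mass 0.\<close>

lemma slab_inner_eventually:
 assumes mu: "sets mu = Bor" and fin: "em mu (lo R) < \<infinity>" and si: "si : Pt"
  and p: "si ~= ro ==> p : up si & ht si < ht p & no_branching (ht si) & em mu (lev (ht si)) = 0"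
  and null: "em mu (lev t) = 0" "em mu (lev R) = 0" and et: "0 < et"
 shows "EV k. em mu (slab si t R)
  <= em mu {x : Pt. (si ~= ro --> ht si + 1 / Suc k <= gp p x) & t + 1 / Suc k <= ht x & ht x <= R - 1 / Suc k} + ennreal et"
  (is "\<forall>\<^sub>F k in _. _ <= em mu (?A k) + _")
proof -
 let ?L = "if si = ro then {} else (lev (ht si))"
 let ?N = "?L Un (lev t) Un (lev R)"
 have gp: "p : Pt" "gp si p = ht si" if "si ~= ro" using p[OF that] above_iff[OF si] by auto
 show ?thesis
 proof (rule eventually_inner[where N = ?N])
  have "?A k : Bor" for k
   using slab_borel[OF gp(1), of "ht si + 1 / Suc k"] slab_borel0 by (cases "si = ro") auto
  then show "range ?A <= sets mu" unfolding mu by blast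
  show "incseq ?A"
   by (rule monoI, rule Collect_mono) (use inverse_Suc_mono in \<open>force intro: order_trans[OF _ add_left_mono] order_trans diff_left_mono\<close>)
  show "slab si t R <= (UN k. ?A k) Un ?N"
  proof
   fix x assume x: "x : slab si t R"
   then have xm: "x : Pt" and x1: "ht si <= gp si x" "t <= ht x" "ht x <= R" unfolding slab_def by auto
   show "x : (UN k. ?A k) Un ?N"
   proof (cases "x : ?N")
    case False
    define g where "g = (if si = ro then 1 else gp p x - ht si)"
    have "0 < gp p x - ht si" if "si ~= ro"
    proof -
     have "ht si < ht x" using gp_le(2)[OF si xm] x1(1) False that xm by force
     moreover have "ht si <= gp p x" using gp_ge_trans[OF gp(1)[OF that] si xm, of "ht si"] gp(2)[OF that] gp_commute[of si p] x1 by simp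
     ultimately show ?thesis using p[OF that] gp(1)[OF that] xm unfolding no_branching_def by force
    qed
    then have pos: "0 < min g (min (ht x - t) (R - ht x))" using x1 False xm unfolding g_def by (auto split: if_splits)
    obtain k :: nat where "1 / Suc k < min g (min (ht x - t) (R - ht x))" using nat_approx_posE[OF pos] by blast
    then have "x : ?A k" using xm unfolding g_def by (auto split: if_splits)
    then show ?thesis by blast
   qed blast
  qed
  show "slab si t R : sets mu" unfolding slab_def mu by (rule slab_borel[OF si])
  have "?N : null_sets mu" using null p ht_borel_eq by (intro null_sets.Un) (auto simp: null_sets_def mu)
  then show "?N : sets mu" "em mu ?N = 0" by auto
  have "em mu (slab si t R) <= em mu (lo R)"
   using ht_borel_le by (intro emeasure_mono) (auto simp: slab_def mu)
  then show "em mu (slab si t R) < \<infinity>" using fin by (rule le_less_trans)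
 qed (rule et)
qed

lemma slab_outer_eventually:
 assumes mu: "sets mu = Bor" and fin: "em mu {x : Pt. ht x <= R + 1} < \<infinity>"
  and si: "si : Pt" and et: "0 < et"
 shows "EV k.
  em mu {x : Pt. ht si - 1 / Suc k <= gp si x & t - 1 / Suc k <= ht x & ht x <= R + 1 / Suc k}
  <= em mu (slab si t R) + ennreal et"
proof -
 let ?A = "%k. {x : Pt. ht si - 1 / Suc k <= gp si x & t - 1 / Suc k <= ht x & ht x <= R + 1 / Suc k}"
 show ?thesis
 proof (rule eventually_outer)
  show "range ?A <= sets mu" unfolding mu using slab_borel[OF si] by blast
  show "decseq ?A"
  proof (rule antimonoI, rule Collect_mono, safe)
   fix k l :: nat and x assume kl: "k <= l"
    and x: "ht si - 1 / Suc l <= gp si x" "t - 1 / Suc l <= ht x" "ht x <= R + 1 / Suc l"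
   have "1 / real (Suc l) <= 1 / real (Suc k)" using kl by (intro divide_left_mono) auto
   then show "ht si - 1 / Suc k <= gp si x" "t - 1 / Suc k <= ht x" "ht x <= R + 1 / Suc k"
    using x by linarith+
  qed
  show "(INT k. ?A k) <= slab si t R"
  proof
   fix x assume "x : (INT k. ?A k)"
   then have x: "x : Pt" and x1: "!!k::nat. ht si - 1 / Suc k <= gp si x" "!!k::nat. t - 1 / Suc k <= ht x"
    "!!k::nat. ht x <= R + 1 / Suc k" by auto
   have le: "a <= b" if "!!k::nat. a - 1 / Suc k <= b" for a b :: real
   proof (rule field_le_epsilon)
    fix e :: real assume "e > 0"
    then obtain k :: nat where "1 / Suc k < e" using nat_approx_posE by blast
    then show "a <= b + e" using that[of k] by linarith
   qed
   have "ht x - 1 / Suc k <= R" for k :: nat using x1(3)[of k] by linarith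
   then show "x : slab si t R" unfolding slab_def using x le[of _ "gp si x", OF x1(1)] le[of _ "ht x", OF x1(2)] le[of "ht x" R] by blast
  qed
  show "slab si t R : sets mu" unfolding slab_def mu by (rule slab_borel[OF si])
  fix k :: nat
  have "1 / (1 + real k) <= 1" by simp
  then have "em mu (?A k) <= em mu {x : Pt. ht x <= R + 1}"
   using ht_borel_le by (intro emeasure_mono subsetI) (auto simp: mu intro: order_trans)
  then show "em mu (?A k) < \<infinity>" using fin by (rule le_less_trans)
 qed (rule et)
qed

end

section \<open>Constructing matched nodes from a small Gromov-Prokhorov distance\<close>

context rooted_tree
begin

lemma gp_anc2:
 assumes "x : Pt" "y : Pt" "0 <= s" "s <= ht x" "0 <= t" "t <= ht y"
 shows "gp (anc x s) (anc y t) = min (min s t) (gp x y)"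
 by (metis gp_anc_left assms anc_in gp_commute min.assoc)

text \<open>A node of the second tree is found as the ancestor, at the same height, of a partner of
  some point lying with margin \<open>h\<close> above the given node. The relation \<open>C\<close>
  distorts Gromov products by at most \<open>2 * dl\<close>, hence by at most \<open>h / 2\<close>.
  So partners of points of the inner set are above the new node, and points above the new node have
  their partners in the outer set; this traps its mass.\<close>

theorem matching_exists:
 assumes mu: "sets mu = Bor" and fin: "em mu {x : Pt. ht x <= R + 1} < \<infinity>"
  and V: "finite V" "!!si. si : V ==> si : Pt" and S: "finite S" "!!s. s : S ==> no_branching s"
  and VS: "!!si. si : V ==> ht si : S" "!!si. si : V ==> em mu (lev (ht si)) = 0"
   "!!si. si : V ==> 0 < em mu (slab si (-1) R)" "!!si. si : V ==> 0 < ht si"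
  and Q: "finite Q" "!!t. t : Q ==> em mu (lev t) = 0"
  and R: "em mu (lev R) = 0" and et: "0 < et"
 shows "EX dl>0. ALL m' (ro' :: 'b) mu' C r. rooted_tree m' ro' --> sets mu' = sets (mb m') --> R + 1 <= r -->
  close_by dl m ro (mrestr mu (tball m ro r)) m' ro' (mrestr mu' (tball m' ro' r)) C -->
  (EX bt. matched et S V Q R m ro mu m' ro' mu' bt)"
proof -
 have finR: "em mu (lo R) < \<infinity>"
  using le_less_trans[OF emeasure_mono fin, of "lo R"] ht_borel_le by (force simp: mu)
 define Q' where "Q' = insert (-1) Q"
 have Q': "finite Q'" "-1 : Q'" "!!t. t : Q ==> t : Q'" "!!t. t : Q' ==> em mu (lev t) = 0"
  unfolding Q'_def using Q null_neg by auto
 have "EX p. p : up si & ht si < ht p" if si: "si : V" for si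
 proof (rule ccontr)
  assume n: "~ ?thesis"
  have "slab si (-1) R <= (lev (ht si))"
   using n above_ht[OF V(2)[OF si]] above_subset unfolding slab_above[OF V(2)[OF si]] by force
  then have "em mu (slab si (-1) R) <= em mu (lev (ht si))"
   using ht_borel_eq by (intro emeasure_mono) (auto simp: mu)
  then show False using VS(2,3)[OF si] by simp
 qed
 then obtain p where p: "!!si. si : V ==> p si : up si" "!!si. si : V ==> ht si < ht (p si)" by metis
 have pm: "p si : Pt" if "si : V" for si using p(1)[OF that] above_subset by auto
 have nr: "si ~= ro" if "si : V" for si using VS(4)[OF that] by auto
 have Vr: "si : Pt" if "si : insert ro V" for si using that V(2) by auto
 obtain d where d: "0 < d" "!!si. si : V ==> ennreal d < em mu (slab si (-1) R)"
  using finite_ennreal_lower_bound[OF V(1), of "%si. em mu (slab si (-1) R)"] VS(3) by blast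
 define e where "e = min (et/2) (d/2)"
 have e: "0 < e" "e <= et/2" "e <= d/2" unfolding e_def using d et by auto
 define I where "I k si t = {x : Pt. (si ~= ro --> ht si + 1 / Suc k <= gp (p si) x) & t + 1 / Suc k <= ht x & ht x <= R - 1 / Suc k}" for k :: nat and si t
 define Ou where "Ou k si t = {x : Pt. ht si - 1 / Suc k <= gp si x & t - 1 / Suc k <= ht x & ht x <= R + 1 / Suc k}" for k :: nat and si t
 have evI: "EV k. ALL si:insert ro V. ALL t:Q'. em mu (slab si t R) <= em mu (I k si t) + ennreal e"
  unfolding I_def
  by (intro eventually_ball_finite finite.insertI V(1) Q'(1) ballI slab_inner_eventually[OF mu finR])
   (use p Vr VS S(2) Q'(4) R e in auto)
 have evO: "EV k. ALL si:insert ro V. ALL t:Q'. em mu (Ou k si t) <= em mu (slab si t R) + ennreal e"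
  unfolding Ou_def
  by (intro eventually_ball_finite finite.insertI V(1) Q'(1) ballI slab_outer_eventually[OF mu fin]) (use Vr e in auto)
 \<comment> \<open>The margin also separates each product \<open>gp (p si) (p ta)\<close> from the
   levels of \<open>S\<close> different from it; by genericity these include all levels of
   \<open>S\<close> that are not above either of the two nodes.\<close>
 have evG: "EV k. ALL si:V. ALL ta:V. ALL s:S. gp (p si) (p ta) ~= s --> 1 / real (Suc k) < \<bar>gp (p si) (p ta) - s\<bar>"
 proof (intro eventually_ball_finite V(1) S(1) ballI)
  fix si ta s
  have "(%k. 1 / real (Suc k)) \<longlonglongrightarrow> 0" using LIMSEQ_inverse_real_of_nat by (simp add: inverse_eq_divide)
  then show "EV k. gp (p si) (p ta) ~= s --> 1 / real (Suc k) < \<bar>gp (p si) (p ta) - s\<bar>"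
   by (cases "gp (p si) (p ta) = s") (auto intro: order_tendstoD(2))
 qed
 obtain k where kI: "ALL si:insert ro V. ALL t:Q'. em mu (slab si t R) <= em mu (I k si t) + ennreal e"
  and kO: "ALL si:insert ro V. ALL t:Q'. em mu (Ou k si t) <= em mu (slab si t R) + ennreal e"
  and kG: "ALL si:V. ALL ta:V. ALL s:S. gp (p si) (p ta) ~= s --> 1 / real (Suc k) < \<bar>gp (p si) (p ta) - s\<bar>"
  using eventually_happens'[OF _ eventually_conj[OF evI eventually_conj[OF evO evG]]] by auto
 define h where "h = 1 / real (Suc k)"
 have h: "0 < h" "h <= 1" unfolding h_def by auto
 have I_h: "I k si t = {x : Pt. (si ~= ro --> ht si + h <= gp (p si) x) & t + h <= ht x & ht x <= R - h}" for si t
  unfolding I_def h_def ..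
 have Ou_h: "Ou k si t = {x : Pt. ht si - h <= gp si x & t - h <= ht x & ht x <= R + h}" for si t
  unfolding Ou_def h_def ..
 have Ib: "I k si t : Bor" "Ou k si t : Bor" if "si : insert ro V" for si t
  unfolding I_h Ou_h using slab_borel[OF pm, of si "ht si + h"] slab_borel0 slab_borel[OF Vr[OF that]] that nr
  by auto
 define dl where "dl = min (h/4) e"
 have dl: "0 < dl" "dl <= h/4" "dl <= e" unfolding dl_def using e h by auto
 have twice: "a <= c + ennreal et" if "a <= b + ennreal x" "b <= c + ennreal y" "x <= et/2" "y <= et/2" for a b c x y
  using near_trans_add[of a b "et/2" c "et/2"] order_trans[OF that(1) add_left_mono[OF ennreal_leI[OF that(3)]]]
   order_trans[OF that(2) add_left_mono[OF ennreal_leI[OF that(4)]]] et by simp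
 show ?thesis
 proof (intro exI[of _ dl] conjI allI impI)
  show "0 < dl" by fact
  fix m' :: "'b metric" and ro' mu' C r
  assume T': "rooted_tree m' ro'" and mu': "sets mu' = sets (mb m')" and r: "R + 1 <= r"
   and C: "close_by dl m ro (mrestr mu (tball m ro r)) m' ro' (mrestr mu' (tball m' ro' r)) C"
  interpret T': rooted_tree m' ro' by fact
  have c1: "x : Pt" "y : mspace m'" "\<bar>ht x - T'.ht y\<bar> <= dl" if "C x y" for x y
   using close_byD(1,2,3)[OF C that] unfolding ht_def T'.ht_def .
  have c2: "\<bar>gp x x' - T'.gp y y'\<bar> <= 2 * dl" if "C x y" "C x' y'" for x y x' y'
   using close_byD(4)[OF C that] c1(3)[OF that(1)] c1(3)[OF that(2)] unfolding gp_def T'.gp_def abs_le_iff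
   by (simp add: field_simps)
  have c3: "(!!x y. x : A ==> C x y ==> y : B) ==> em mu A <= em mu' B + ennreal dl"
    "(!!x y. y : B ==> C x y ==> x : A) ==> em mu' B <= em mu A + ennreal dl"
   if A: "A : Bor" "!!x. x : A ==> ht x <= R + 1" and B: "B : sets (mb m')" "!!x. x : B ==> T'.ht x <= R + 1" for A B
  proof -
   have "A Int tball m ro r = A" "B Int tball m' ro' r = B"
    using A B r sets.sets_into_space[OF A(1)] sets.sets_into_space[OF B(1)] unfolding tball_eq T'.tball_eq by force+
   then have e: "em (mrestr mu (tball m ro r)) A = em mu A" "em (mrestr mu' (tball m' ro' r)) B = em mu' B"
    using A(1) B(1) tball_borel T'.tball_borel by (simp_all add: emeasure_mrestr mu mu')
   show "em mu A <= em mu' B + ennreal dl" if "!!x y. x : A ==> C x y ==> y : B"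
    using close_byD(5)[OF C A(1) B(1) that] e by simp
   show "em mu' B <= em mu A + ennreal dl" if "!!x y. y : B ==> C x y ==> x : A"
    using close_byD(6)[OF C A(1) B(1) that] e by simp
  qed
  \<comment> \<open>Without any partner the inner set would have mass at most \<open>dl\<close>, and
    the cone at most \<open>dl + e <= d\<close>, against the choice of \<open>d\<close>.\<close>
  have "EX x y. x : I k si (-1) & C x y" if si: "si : V" for si
  proof (rule ccontr)
   assume n: "~ ?thesis"
   have "em mu (I k si (-1)) <= em mu' {} + ennreal dl"
    by (rule c3(1)[OF Ib(1)]) (use n h si in \<open>auto simp: I_h\<close>)
   then have "em mu (slab si (-1) R) <= ennreal dl + ennreal e"
    using kI si Q'(2) by (force intro: order_trans[OF _ add_right_mono])
   also have "... <= ennreal d" using dl e by (simp add: ennreal_plus[symmetric] ennreal_leI del: ennreal_plus)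
   finally show False using d(2)[OF si] by simp
  qed
  then obtain xs ys where xy: "!!si. si : V ==> xs si : I k si (-1)" "!!si. si : V ==> C (xs si) (ys si)" by metis
  have xs: "xs si : Pt" "ys si : mspace m'" "ht si + h <= gp (p si) (xs si)" "ht si <= T'.ht (ys si)" if si: "si : V" for si
  proof -
   show 1: "xs si : Pt" "ys si : mspace m'" "ht si + h <= gp (p si) (xs si)"
    using xy(1)[OF si] c1[OF xy(2)[OF si]] nr[OF si] by (auto simp: I_h)
   show "ht si <= T'.ht (ys si)"
    using 1(3) gp_le(2)[OF pm[OF si] 1(1)] c1(3)[OF xy(2)[OF si]] dl(2) h unfolding abs_le_iff by linarith
  qed
  define bt where "bt si = (if si = ro then ro' else T'.anc (ys si) (ht si))" for si
  have bt: "bt si : mspace m'" "T'.ht (bt si) = ht si" "T'.gp (bt si) (ys si) = ht si" if "si : V" for si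
   using T'.anc[OF xs(2)[OF that] ht_nonneg xs(4)[OF that]] nr[OF that] unfolding bt_def by auto
  have btr: "bt ro = ro'" unfolding bt_def by simp
  have bt': "bt si : mspace m'" "T'.ht (bt si) = ht si" if "si : insert ro V" for si using that bt by (auto simp: btr)
  have up: "ht si <= T'.gp (bt si) y" if si: "si : insert ro V" and x: "x : I k si t" "C x y" for si x y t
  proof (cases "si = ro")
   case False
   then have si: "si : V" and x1: "x : Pt" "ht si + h <= gp (p si) x" using si x unfolding I_h by auto
   have "ht si + h <= gp x (xs si)"
    using gp_ge_trans[OF x1(1) pm[OF si] xs(1)[OF si]] x1(2) xs(3)[OF si] gp_commute[of x] by simp
   then have "ht si <= T'.gp y (ys si)" using c2[OF x(2) xy(2)[OF si]] dl(2) h unfolding abs_le_iff by linarith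
   then show ?thesis using T'.gp_ge_trans[OF bt(1)[OF si] xs(2)[OF si] c1(2)[OF x(2)], of "ht si"] bt(3)[OF si] T'.gp_commute[of y] by simp
  qed (use T'.gp_le(3)[OF T'.root_in c1(2)[OF x(2)]] in \<open>simp add: bt_def\<close>)
  have dn: "ht si - 2 * dl <= gp si x" if si: "si : insert ro V" and y: "ht si <= T'.gp (bt si) y" "C x y" for si x y
  proof (cases "si = ro")
   case False
   then have si: "si : V" using si by simp
   have "ht si <= T'.gp y (ys si)"
    using T'.gp_ge_trans[OF c1(2)[OF y(2)] bt(1)[OF si] xs(2)[OF si], of "ht si"] bt(3)[OF si] y(1) T'.gp_commute[of y] by simp
   then have 1: "ht si - 2 * dl <= gp x (xs si)" using c2[OF y(2) xy(2)[OF si]] unfolding abs_le_iff by linarith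
   have "ht si <= gp si (xs si)"
    using gp_ge_trans[OF V(2)[OF si] pm[OF si] xs(1)[OF si], of "ht si"] xs(3)[OF si] h p(1)[OF si] above_iff_ge[OF V(2)[OF si]] by simp
   then show ?thesis
    using gp_ge_trans[OF V(2)[OF si] xs(1)[OF si] c1(1)[OF y(2)], of "ht si - 2 * dl"] 1 gp_commute[of x] dl(1) by simp
  qed (use gp_le(3)[OF root_in c1(1)[OF y(2)]] dl in simp)
  have near: "near et (em mu' (T'.slab (bt si) t R)) (em mu (slab si t R))" if si: "si : insert ro V" and t: "t : Q" for si t
  proof -
   have B: "T'.slab (bt si) t R : sets (mb m')" unfolding T'.slab_def by (rule T'.slab_borel[OF bt'(1)[OF si]])
   have "em mu (I k si t) <= em mu' (T'.slab (bt si) t R) + ennreal dl"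
   proof (rule c3(1)[OF Ib(1)[OF si] _ B])
    fix x y assume x: "x : I k si t" "C x y"
    then show "y : T'.slab (bt si) t R"
     using up[OF si x] c1[OF x(2)] dl(2) h unfolding T'.slab_def I_h bt'(2)[OF si] abs_le_iff by auto
   qed (use h in \<open>auto simp: I_h T'.slab_def\<close>)
   moreover have "em mu' (T'.slab (bt si) t R) <= em mu (Ou k si t) + ennreal dl"
   proof (rule c3(2)[OF Ib(2)[OF si] _ B])
    fix x y assume y: "y : T'.slab (bt si) t R" "C x y"
    then show "x : Ou k si t"
     using dn[OF si _ y(2)] c1[OF y(2)] dl(2) h unfolding T'.slab_def Ou_h bt'(2)[OF si] abs_le_iff by force
   qed (use h in \<open>auto simp: Ou_h T'.slab_def\<close>)
   moreover have "em mu (slab si t R) <= em mu (I k si t) + ennreal e" "em mu (Ou k si t) <= em mu (slab si t R) + ennreal e"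
    using kI kO si Q'(3)[OF t] by auto
   ultimately show ?thesis unfolding near_def using twice order_trans[OF dl(3) e(2)] e(2) by blast
  qed
  \<comment> \<open>By \<open>gp_anc2\<close> both products are those of the points
    \<open>p\<close>, respectively \<open>ys\<close>, capped at the heights of the nodes. The one
    for \<open>p\<close> is more than \<open>h\<close> away from \<open>s\<close>, while passing
    from \<open>xs\<close> to \<open>ys\<close> costs only \<open>2 * dl\<close>.\<close>
  have cond: "s <= gp si ta \<longleftrightarrow> s <= T'.gp (bt si) (bt ta)" if si: "si : V" and ta: "ta : V" and s: "s : S" for si ta s
  proof (cases "s <= ht si & s <= ht ta")
   case False
   then show ?thesis
    using gp_le(1,2)[OF V(2)[OF si] V(2)[OF ta]] T'.gp_le(1,2)[OF bt(1)[OF si] bt(1)[OF ta]] bt(2)[OF si] bt(2)[OF ta] by linarith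
  next
   case True
   have "anc (p si) (ht si) = si" "anc (p ta) (ht ta) = ta" using anc_eqI pm V(2) p(1) si ta by auto
   then have "gp si ta = min (min (ht si) (ht ta)) (gp (p si) (p ta))"
    using gp_anc2[OF pm[OF si] pm[OF ta], of "ht si" "ht ta"] p(2)[OF si] p(2)[OF ta] by simp
   moreover have "T'.gp (bt si) (bt ta) = min (min (ht si) (ht ta)) (T'.gp (ys si) (ys ta))"
    unfolding bt_def using T'.gp_anc2[OF xs(2)[OF si] xs(2)[OF ta]] xs(4)[OF si] xs(4)[OF ta] nr[OF si] nr[OF ta] by simp
   moreover have c: "\<bar>gp (xs si) (xs ta) - T'.gp (ys si) (ys ta)\<bar> <= 2 * dl" by (rule c2[OF xy(2)[OF si] xy(2)[OF ta]])
   moreover have "gp (p si) (p ta) ~= s"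
    using S(2)[OF s] pm[OF si] pm[OF ta] p(2)[OF si] p(2)[OF ta] True unfolding no_branching_def by simp
   then have marg: "h < \<bar>gp (p si) (p ta) - s\<bar>" using kG si ta s unfolding h_def by blast
   moreover have "s + h <= gp (xs si) (xs ta)" if "s + h <= gp (p si) (p ta)"
    using gp_ge_trans[OF xs(1)[OF si] pm[OF si] pm[OF ta], of "s + h"] gp_ge_trans[OF xs(1)[OF si] pm[OF ta] xs(1)[OF ta], of "s + h"]
     that xs(3)[OF si] xs(3)[OF ta] True gp_commute[of "xs si"] by simp
   moreover have "s - 2 * dl <= gp (p si) (p ta)" if "s - 2 * dl <= gp (xs si) (xs ta)"
    using gp_ge_trans[OF pm[OF si] xs(1)[OF si] xs(1)[OF ta], of "s - 2 * dl"] gp_ge_trans[OF pm[OF si] xs(1)[OF ta] pm[OF ta], of "s - 2 * dl"] dl(1) h(1)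
     that xs(3)[OF si] xs(3)[OF ta] True gp_commute[of "xs ta"] by simp
   ultimately show ?thesis using True dl(1,2) h(1) by linarith
  qed
  have "matched et S V Q R m ro mu m' ro' mu' bt"
   unfolding matched_def ht_def[symmetric] T'.ht_def[symmetric] using bt btr near near[of ro] cond by simp
  then show "EX bt. matched et S V Q R m ro mu m' ro' mu' bt" by blast
 qed
qed

end

section \<open>From matched nodes to small Gromov--Prokhorov distance\<close>

text \<open>The counterpart of \<open>matched\<close> for finite measures, with whole cones and
  without truncation at a height.\<close>

definition node_matched :: "real => real set => 'a set => 'a metric => 'a => 'a measure =>
  'b metric => 'b => 'b measure => ('a => 'b) => bool" where
 "node_matched et S V m ro M m' ro' M' bt \<longleftrightarrow>
  (ALL si:V. bt si : mspace m' & mdist m' ro' (bt si) = mdist m ro si &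
    near et (em M' (above m' ro' (bt si))) (em M (above m ro si))) &
  (ALL si:V. ALL ta:V. ALL s:S. s <= rooted_tree.gp m ro si ta \<longleftrightarrow> s <= rooted_tree.gp m' ro' (bt si) (bt ta))"

lemma near_measure:
 assumes "finite_measure M" "finite_measure M'" "near et (em M' B) (em M A)" "0 <= et"
 shows "\<bar>measure M A - measure M' B\<bar> <= et"
proof -
 have "ennreal (measure M A) <= ennreal (measure M' B + et)" "ennreal (measure M' B) <= ennreal (measure M A + et)"
  using assms finite_measure.emeasure_eq_measure[OF assms(1)] finite_measure.emeasure_eq_measure[OF assms(2)]
  unfolding near_def by (simp_all add: ennreal_plus)
 then have "measure M A <= measure M' B + et" "measure M' B <= measure M A + et"
  using assms(4) by (simp_all add: ennreal_le_iff del: ennreal_plus)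
 then show ?thesis by (simp add: abs_le_iff)
qed

lemma near_measureI:
 assumes "finite_measure M" "finite_measure M'" "\<bar>measure M A - measure M' B\<bar> <= et"
 shows "near et (em M' B) (em M A)"
proof -
 have "0 <= et" using assms(3) by linarith
 moreover have "measure M A <= measure M' B + et" "measure M' B <= measure M A + et"
  using assms(3) unfolding abs_le_iff by linarith+
 ultimately show ?thesis
  using finite_measure.emeasure_eq_measure[OF assms(1)] finite_measure.emeasure_eq_measure[OF assms(2)]
  unfolding near_def by (simp add: ennreal_plus[symmetric] ennreal_leI del: ennreal_plus)
qed

section \<open>Cells between consecutive levels and the mass they miss\<close>

context rooted_tree
begin

lemma above_same_level_disjoint:
 assumes "V <= Pt" "!!si. si : V ==> ht si = a"
 shows "disjoint_family_on up V"
 unfolding disjoint_family_on_def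
 using above_disjoint assms by fastforce

definition residual :: "real => 'a set => 'a set" where
 "residual b V = (hi b) - (UN ta:V. up ta)"

lemma residual_borel:
 assumes "finite V" "V <= Pt" shows "residual b V : Bor"
 unfolding residual_def using ht_borel_ge above_borel assms
 by (intro sets.Diff sets.finite_UN) auto

text \<open>A cone splits into its part below level \<open>b\<close>, the cones of the nodes of
  \<open>W\<close> over its node, and a remainder. The cone of \<open>ta\<close> lies inside or
  outside that of \<open>si\<close> according to \<open>a <= gp si ta\<close>, so relative positions
  of nodes decide which cones to subtract.\<close>

lemma cell_mass:
 assumes M: "finite_measure M" "sets M = Bor"
  and V: "finite V" "V <= Pt" "!!si. si : V ==> ht si = a"
  and W: "finite W" "W <= Pt" "!!ta. ta : W ==> ht ta = b" and ab: "a < b"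
 shows "si : V ==> measure M {x : up si. ht x < b}
   = measure M (up si) - (SUM ta:{ta:W. a <= gp si ta}. measure M (up ta))
    - measure M (up si Int residual b W)"
  and "(SUM si:V. measure M (up si Int residual b W)) <= measure M (residual b W)"
  and "measure M (residual b W) = measure M (hi b) - (SUM ta:W. measure M (up ta))"
proof -
 interpret finite_measure M by fact
 have ab_s: "up z : sets M" if "z : Pt" for z using above_borel[OF that] M(2) by simp
 have res_s: "residual b W : sets M" using residual_borel[OF W(1,2)] M(2) by simp
 have ge_s: "(hi b) : sets M" using ht_borel_ge M(2) by simp
 have disjW: "disjoint_family_on up W" by (rule above_same_level_disjoint[OF W(2,3)])
 have sumW: "measure M (UN ta:W'. up ta) = (SUM ta:W'. measure M (up ta))" if "W' <= W" for W'
  using that finite_subset[OF that W(1)] ab_s W(2) disjoint_family_on_mono[OF that disjW]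
  by (intro finite_measure_finite_Union) auto
 show "measure M (residual b W) = measure M (hi b) - (SUM ta:W. measure M (up ta))"
 proof -
  have "(UN ta:W. up ta) <= (hi b)"
   using above_subset above_ht W(2,3) by fastforce
  then have "measure M (residual b W) = measure M (hi b) - measure M (UN ta:W. up ta)"
   unfolding residual_def using ge_s ab_s W by (intro finite_measure_Diff sets.finite_UN) auto
  then show ?thesis using sumW[OF order_refl] by simp
 qed
 show "(SUM si:V. measure M (up si Int residual b W)) <= measure M (residual b W)"
 proof -
  have disj: "disjoint_family_on (%si. up si Int residual b W) V"
   using above_same_level_disjoint[OF V(2,3)] unfolding disjoint_family_on_def by blast
  have "(SUM si:V. measure M (up si Int residual b W)) = measure M (UN si:V. up si Int residual b W)"
   using V(1,2) ab_s res_s disj by (intro finite_measure_finite_Union[symmetric]) auto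
  also have "... <= measure M (residual b W)" using res_s by (intro finite_measure_mono) auto
  finally show ?thesis .
 qed
 assume si: "si : V"
 define W' where "W' = {ta:W. a <= gp si ta}"
 have sim: "si : Pt" "ht si = a" using si V by auto
 have Wm: "ta : Pt" "ht ta = b" if "ta : W" for ta using W that by auto
 have up: "up ta <= up si" if "ta : W'" for ta
 proof
  fix x assume x: "x : up ta"
  have ta: "ta : W" "a <= gp si ta" using that unfolding W'_def by auto
  then have "ta : up si" using above_iff_ge[OF sim(1), of ta] sim(2) Wm(1)[OF ta(1)] by simp
  then show "x : up si" using x by (rule above_trans[OF sim(1)])
 qed
 have other: "up si Int up ta = {}" if ta: "ta : W" "ta ~: W'" for ta
 proof -
  have "a <= gp si ta" if x: "x : up si" "x : up ta" for x
   by (smt (verit) x above_iff_ge sim Wm gp_ge_trans gp_commute ta ab)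
  then show ?thesis using ta unfolding W'_def by blast
 qed
 have eq: "up si = {x : up si. ht x < b} Un ((UN ta:W'. up ta) Un (up si Int residual b W))"
 proof (intro equalityI subsetI)
  fix x assume x: "x : up si"
  then have xm: "x : Pt" using above_subset by blast
  show "x : {x : up si. ht x < b} Un ((UN ta:W'. up ta) Un (up si Int residual b W))"
   using x xm other unfolding residual_def by (cases "ht x < b") (auto simp: not_less)
 next
  fix x assume "x : {x : up si. ht x < b} Un ((UN ta:W'. up ta) Un (up si Int residual b W))"
  then show "x : up si" using up by blast
 qed
 have s1: "{x : up si. ht x < b} : sets M"
 proof -
  have "{x : up si. ht x < b} = up si Int {x : Pt. ht x < b}" using above_subset by auto
  then show ?thesis using ab_s[OF sim(1)] ht_borel_less M(2) by simp
 qed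
 have s2: "(UN ta:W'. up ta) : sets M" using ab_s Wm W(1) unfolding W'_def by (intro sets.finite_UN) auto
 have s3: "up si Int residual b W : sets M" using ab_s[OF sim(1)] res_s by simp
 have d1: "{x : up si. ht x < b} Int ((UN ta:W'. up ta) Un (up si Int residual b W)) = {}"
  using above_ht Wm W'_def residual_def by fastforce
 have d2: "(UN ta:W'. up ta) Int (up si Int residual b W) = {}"
  unfolding residual_def W'_def by blast
 have "measure M (up si) = measure M {x : up si. ht x < b} +
   (measure M (UN ta:W'. up ta) + measure M (up si Int residual b W))"
  using finite_measure_Union[OF s1 sets.Un[OF s2 s3] d1] finite_measure_Union[OF s2 s3 d2] eq by metis
 then show "measure M {x : up si. ht x < b}
   = measure M (up si) - (SUM ta:{ta:W. a <= gp si ta}. measure M (up ta))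
    - measure M (up si Int residual b W)"
  using sumW[of W'] unfolding W'_def by auto
qed

text \<open>By separability.\<close>
lemma countable_nodes:
 assumes "second_countable_metric m" "0 <= s"
 shows "countable {si : Pt. ht si = s & (EX x:up si. s < ht x)}" (is "countable ?N")
proof -
 obtain \<C> where C: "countable \<C>" "ALL C:\<C>. openin (mtopology_of m) C"
   "ALL x:Pt. ALL e>0. EX C:\<C>. x : C & (ALL y:C. mdist m x y < e)"
  using assms unfolding second_countable_metric_def by (elim exE conjE)
 have "EX C. C : \<C> & C ~= {} & C <= up si" if si: "si : ?N" for si
 proof -
  obtain x where x: "x : up si" "s < ht x" and sim: "si : Pt" "ht si = s" using si by blast
  have xm: "x : Pt" using x above_subset by blast
  obtain C where C': "C : \<C>" "x : C" "ALL y:C. mdist m x y < ht x - s"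
   using bspec[OF C(3) xm] x(2) by (metis diff_gt_0_iff_gt)
  have "y : up si" if y: "y : C" for y
  proof -
   have ym: "y : Pt" using C(2) C'(1) y unfolding openin_mtopology_of by blast
   have "s <= gp x y" using gp_near[OF xm ym] C'(3) y by force
   then have "s <= gp si y" using gp_ge_trans[OF sim(1) xm ym] x(1) above_iff_ge[OF sim(1)] sim(2) by blast
   then show ?thesis using above_iff_ge[OF sim(1)] sim(2) ym by blast
  qed
  then show ?thesis using C' by blast
 qed
 then have "ALL si:?N. EX C. C : \<C> & C ~= {} & C <= up si" by blast
 then obtain f where f: "ALL si:?N. f si : \<C> & f si ~= {} & f si <= up si"
  by (rule bchoice[THEN exE])
 have "inj_on f ?N"
 proof (rule inj_onI)
  fix si ta assume st: "si : ?N" "ta : ?N" "f si = f ta"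
  then obtain x where "x : f si" using f by blast
  then have "x : up si" "x : up ta" using f st by auto
  then show "si = ta" using above_disjoint[of si ta x] st by simp
 qed
 moreover have "f ` ?N <= \<C>" using f by blast
 ultimately show ?thesis using countable_subset[OF _ C(1)] countable_image_inj_on by blast
qed

text \<open>Almost every point at or above level \<open>s\<close> lies strictly above it, hence in
  the cone of one of countably many nodes, and finitely many of these leave mass at most
  \<open>ze\<close>. Nodes with a null cone are then dropped, since only nodes of positive mass can
  be matched.\<close>

lemma residual_small:
 assumes sc: "second_countable_metric m" and M: "finite_measure M" "sets M = Bor"
  and s: "0 <= s" "em M (lev s) = 0" and ze: "0 < ze"
 shows "EX V. finite V & V <= {si : Pt. ht si = s & 0 < em M (up si)} &
  measure M (residual s V) <= ze"
proof -
 interpret finite_measure M by fact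
 define N where "N = {si : Pt. ht si = s & (EX x:up si. s < ht x)}"
 have cN: "countable N" unfolding N_def by (rule countable_nodes[OF sc s(1)])
 have Nm: "N <= Pt" unfolding N_def by auto
 define E where "E n = (from_nat_into N ` {..<n}) Int N" for n :: nat
 have E: "finite (E n)" "E n <= N" for n unfolding E_def by auto
 have Einc: "E n <= E k" if "n <= k" for n k using that unfolding E_def by auto
 let ?A = "%n. residual s (E n)"
 have As: "?A n : sets M" for n unfolding M(2) by (rule residual_borel[OF E(1)]) (use E Nm in auto)
 have "(%n. measure M (?A n)) \<longlonglongrightarrow> measure M (INT n. ?A n)"
 proof (rule finite_Lim_measure_decseq)
  show "range ?A <= sets M" using As by auto
  show "decseq ?A" unfolding residual_def by (rule antimonoI) (use Einc in blast)
 qed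
 moreover have "measure M (INT n. ?A n) = 0"
 proof -
  have "(INT n. ?A n) <= (lev s)"
  proof
   fix x assume x: "x : (INT n. ?A n)"
   then have x1: "x : Pt" "s <= ht x" "!!n. x ~: (UN ta:E n. up ta)"
    unfolding residual_def by auto
   have "~ s < ht x"
   proof
    assume sx: "s < ht x"
    note an = anc[OF x1(1) s(1) x1(2)]
    have "anc x s : N" unfolding N_def using an sx anc_above[OF x1(1) s(1) x1(2)] by blast
    then obtain i where "from_nat_into N i = anc x s" using from_nat_into_surj[OF cN] by blast
    then have "anc x s : E (Suc i)" unfolding E_def using \<open>anc x s : N\<close> by (auto simp: image_iff intro!: bexI[of _ i])
    then show False using x1(3)[of "Suc i"] anc_above[OF x1(1) s(1) x1(2)] by blast
   qed
   then show "x : (lev s)" using x1 by auto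
  qed
  then have "em M (INT n. ?A n) <= em M (lev s)"
   using ht_borel_eq M(2) by (intro emeasure_mono) auto
  then show ?thesis using s(2) unfolding measure_def by simp
 qed
 ultimately have "EV n. measure M (?A n) < ze" using ze by (intro order_tendstoD(2)) auto
 then obtain n where n: "measure M (?A n) < ze" by (auto dest: eventually_happens)
 define V where "V = {si : E n. 0 < em M (up si)}"
 have "measure M (residual s V) = measure M (?A n)"
 proof -
  define Z where "Z = (UN si:E n - V. up si)"
  have Zs: "Z : sets M" unfolding Z_def using E Nm above_borel M(2) by (intro sets.finite_UN) blast+
  have "Z : null_sets M"
   unfolding Z_def using E Nm above_borel
   by (intro null_sets.finite_UN) (auto simp: V_def null_sets_def M(2) zero_less_iff_neq_zero subset_iff)
  then have Z0: "measure M Z = 0" by (rule measure_eq_0_null_sets)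
  have Vs: "residual s V : sets M" unfolding M(2) by (rule residual_borel) (use E Nm in \<open>auto simp: V_def\<close>)
  have "residual s V <= ?A n Un Z" unfolding residual_def Z_def by blast
  then have "measure M (residual s V) <= measure M (?A n) + measure M Z"
   using finite_measure_mono[of "residual s V" "?A n Un Z"] measure_Un_le[OF As[of n] Zs] As Zs by simp
  moreover have "measure M (?A n) <= measure M (residual s V)"
   using Vs by (intro finite_measure_mono) (auto simp: residual_def V_def)
  ultimately show ?thesis using Z0 by simp
 qed
 then show ?thesis using n E Nm by (intro exI[of _ V]) (auto simp: V_def N_def)
qed

end

lemma level_grid:
 fixes r e :: real
 assumes G: "!!a b. 0 <= a ==> a < b ==> EX s:G. a < s & s < b" and r: "0 < r" and e: "0 < e"
 shows "EX J s. 0 < J & s 0 = (0::real) & s J = r & (ALL j<J. s j < s (Suc j) & s (Suc j) <= s j + e) &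
  (ALL j. 0 < j --> j < J --> s j : G)"
proof -
 obtain n :: nat where n: "2 * r / e < n" using reals_Archimedean2 by blast
 have n0: "0 < n" using n r e by (cases n) (auto simp: field_simps)
 define w where "w = r / n"
 have w: "0 < w" "2 * w < e" "n * w = r" unfolding w_def using n n0 r e by (auto simp: field_simps)
 \<comment> \<open>One point of \<open>G\<close> in the upper half of each interval of length
   \<open>w\<close>: consecutive ones increase and are at most \<open>3/2 * w\<close> apart. The two
   ends are afterwards set to 0 and \<open>r\<close> exactly.\<close>
 have "EX t:G. (real j - 1/2) * w < t & t < j * w" if "0 < j" for j :: nat
  using that w by (intro G) (auto simp: field_simps mult_less_cancel_right)
 then have "EX t. 0 < j --> t : G & (real j - 1/2) * w < t & t < j * w" for j :: nat by blast
 then obtain u where u: "!!j::nat. 0 < j ==> u j : G & (real j - 1/2) * w < u j & u j < j * w" by metis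
 define s where "s j = (if j = 0 then 0 else if j = n then r else u j)" for j
 have bd: "(real j - 1/2) * w < s j" "s j <= j * w" for j
  using u[of j] w n0 unfolding s_def by (auto simp: field_simps)
 have step: "s j < s (Suc j)" "s (Suc j) <= s j + e" if "j < n" for j
 proof -
  have "s j <= real j * w" by (rule bd)
  also have "... < (real (Suc j) - 1/2) * w" using w by (intro mult_strict_right_mono) auto
  also have "... < s (Suc j)" by (rule bd)
  finally show "s j < s (Suc j)" .
  have "s (Suc j) <= real (Suc j) * w" by (rule bd)
  also have "... = (real j - 1/2) * w + (3/2) * w" by (simp add: algebra_simps)
  also have "... <= s j + e" using bd(1)[of j] w by linarith
  finally show "s (Suc j) <= s j + e" .
 qed
 show ?thesis
  by (rule exI[of _ n], rule exI[of _ s]) (use n0 step u in \<open>auto simp: s_def\<close>)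
qed

lemma grid_cell:
 fixes s :: "nat => real"
 assumes "s 0 = 0" "0 <= t" "t < s J"
 shows "EX j<J. s j <= t & t < s (Suc j)"
 using assms(3)
proof (induction J)
 case 0 then show ?case using assms by simp
next
 case (Suc J)
 show ?case
  using Suc.IH less_Suc_eq Suc.prems by fastforce
qed

text \<open>A tree cut into cells at the levels \<open>s j\<close>: the cell of the node \<open>p i\<close>, \<open>i : V j\<close>, is the part of the cone over it below
 the next level. Nodes are indexed so that matched nodes of two trees share their index.\<close>
locale node_grid = rooted_tree m ro for m :: "'a metric" and ro +
 fixes M :: "'a measure" and J :: nat and s :: "nat => real" and V :: "nat => 'i set" and p :: "'i => 'a"
 assumes M: "finite_measure M" "sets M = sets (mb m)" and s: "s 0 = 0" "!!j. j < J ==> s j < s (Suc j)"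
  and V: "!!j. j <= J ==> finite (V j)" "!!i j. j <= J ==> i : V j ==> p i : mspace m" "!!i j. j <= J ==> i : V j ==> ht (p i) = s j"
   "!!j. j <= J ==> inj_on p (V j)" and V0: "V 0 ~= {}"
begin

sublocale finite_measure M by (rule M)

abbreviation "Idx == SIGMA j:{..<J}. V j"

definition "cell = (%(j, i). {x : up (p i). ht x < s (Suc j)})"
definition "lost j = measure M (residual (s j) (p ` V j))"
text \<open>This is what the cone of node \<open>i\<close> contains beyond its own cell and the
  cones of the next nodes; summed over \<open>i\<close> it is at most
  \<open>lost (Suc j)\<close>.\<close>

definition "loss j i = measure M (up (p i) Int residual (s (Suc j)) (p ` V (Suc j)))"

lemma s_mono: "i <= j ==> j <= J ==> s i <= s j"
 by (induction j rule: dec_induct) (auto intro: order_trans[OF _ less_imp_le[OF s(2)]])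

lemma cellD:
 assumes "j < J" "i : V j" "x : cell (j, i)"
 shows "x : up (p i)" "x : Pt" "s j <= ht x" "ht x < s (Suc j)" "mdist m (p i) x = ht x - s j"
proof -
 show x: "x : up (p i)" "ht x < s (Suc j)" using assms(3) unfolding cell_def by auto
 show "x : Pt" "s j <= ht x" "mdist m (p i) x = ht x - s j"
  using x above_subset above_ht[of "p i" x] V(2,3)[of j i] assms comparable_dist[of "p i" x] by auto
qed

lemma cell_sets: "k : Idx ==> cell k : Bor"
proof -
 assume "k : Idx"
 then obtain j i where k: "k = (j, i)" "j < J" "i : V j" by auto
 have "cell k = up (p i) Int {x : Pt. ht x < s (Suc j)}" unfolding cell_def k using above_subset by auto
 then show ?thesis using above_borel V(2)[of j i] k ht_borel_less by auto
qed

lemma cell_disjoint: "disjoint_family_on cell Idx"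
 unfolding disjoint_family_on_def
proof (intro ballI impI equals0I)
 fix k k' x assume kk: "k : Idx" "k' : Idx" "k ~= k'" and x: "x : cell k Int cell k'"
 then obtain j i j' i' where k: "k = (j, i)" "j < J" "i : V j" "k' = (j', i')" "j' < J" "i' : V j'" by auto
 note c = cellD[OF k(2,3)] cellD[OF k(5,6)]
 have "j = j'" using c[of x] x k s_mono[of "Suc j" j'] s_mono[of "Suc j'" j] by (cases j j' rule: linorder_cases) auto
 moreover have "p i = p i'" using above_disjoint[of "p i" "p i'" x] c(1,6)[of x] x k V(2,3)[of j] V(2,3)[of j'] \<open>j = j'\<close> by auto
 ultimately show False using kk k inj_onD[OF V(4)[of j], of i i'] by auto
qed

lemma cell_truncate: "k : Idx ==> em (mrestr M (tball m ro (s J))) (cell k) = em M (cell k)"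
proof -
 assume k: "k : Idx"
 then obtain j i where "k = (j, i)" "j < J" "i : V j" by auto
 then have "cell k <= tball m ro (s J)"
  using cellD(2)[of j i] order_trans[OF less_imp_le[OF cellD(4)[of j i]] s_mono[of "Suc j" J]] by (auto simp: tball_eq)
 then show ?thesis using cell_sets[OF k] M(2) tball_borel by (simp add: emeasure_mrestr Int_absorb2)
qed

text \<open>A point of the ball in no cell lies on the bounding sphere or over no chosen node of its
  level. The latter is impossible at level 0, whose only node is the root; hence the sum starts at
  1.\<close>

lemma uncovered:
 "em (mrestr M (tball m ro (s J))) (Pt - (UN k:Idx. cell k)) <= ennreal (measure M {x : Pt. ht x = s J} + (SUM j:{1..<J}. lost j))"
proof -
 have C: "Pt - (UN k:Idx. cell k) : sets M"
  unfolding M(2) using sets.finite_UN[of Idx cell "mb m"] V(1) cell_sets sets.compl_sets[of _ "mb m"] by force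
 have R: "residual (s j) (p ` V j) : sets M" if "j : {1..<J}" for j unfolding M(2) using V(1,2)[of j] that by (intro residual_borel) auto
 let ?R = "UN j:{1..<J}. residual (s j) (p ` V j)"
 have "(Pt - (UN k:Idx. cell k)) Int tball m ro (s J) <= {x : Pt. ht x = s J} Un ?R"
 proof
  fix x assume x: "x : (Pt - (UN k:Idx. cell k)) Int tball m ro (s J)"
  show "x : {x : Pt. ht x = s J} Un ?R"
  proof (cases "ht x = s J")
   case False
   then obtain j where j: "j < J" "s j <= ht x" "ht x < s (Suc j)"
    using grid_cell[of s "ht x" J] s(1) x by (auto simp: tball_eq)
   have no: "x ~: up (p i)" if "i : V j" for i using x j that unfolding cell_def by force
   obtain i where "i : V 0" using V0 by blast
   then have "p i = ro" using V(2,3)[of 0 i] ht_eq_0 s(1) by simp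
   then have "j ~= 0" using no[of i] \<open>i : V 0\<close> x by (cases "j = 0") auto
   then show ?thesis using no x j unfolding residual_def by auto
  qed (use x in simp)
 qed
 then have "em (mrestr M (tball m ro (s J))) (Pt - (UN k:Idx. cell k)) <= em M ({x : Pt. ht x = s J} Un ?R)"
  using C M(2) tball_borel R ht_borel_eq by (subst emeasure_mrestr) (auto intro!: emeasure_mono)
 also have "... <= ennreal (measure M {x : Pt. ht x = s J} + (SUM j:{1..<J}. lost j))"
  unfolding emeasure_eq_measure
 proof (rule ennreal_leI)
  have "measure M ({x : Pt. ht x = s J} Un ?R) <= measure M {x : Pt. ht x = s J} + measure M ?R"
   using R ht_borel_eq M(2) by (intro measure_Un_le) auto
  also have "measure M ?R <= (SUM j:{1..<J}. lost j)"
   unfolding lost_def using R by (intro finite_measure_subadditive_finite) auto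
  finally show "measure M ({x : Pt. ht x = s J} Un ?R) <= measure M {x : Pt. ht x = s J} + (SUM j:{1..<J}. lost j)" by simp
 qed
 finally show ?thesis .
qed

lemma cell_measure:
 assumes "j < J" "i : V j"
 shows "measure M (cell (j, i)) = measure M (up (p i)) - (SUM k:{k:V (Suc j). s j <= gp (p i) (p k)}. measure M (up (p k))) - loss j i"
proof -
 have "measure M (cell (j, i)) = measure M (up (p i)) - (SUM ta:{ta:p ` V (Suc j). s j <= gp (p i) ta}. measure M (up ta)) - loss j i"
  unfolding cell_def prod.case loss_def
  by (rule cell_mass(1)[OF M, of "p ` V j"]) (use assms V(1-3)[of j] V(1-3)[of "Suc j"] s(2) in auto)
 also have "{ta:p ` V (Suc j). s j <= gp (p i) ta} = p ` {k:V (Suc j). s j <= gp (p i) (p k)}" by auto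
 also have "(SUM ta:.... measure M (up ta)) = (SUM k:{k:V (Suc j). s j <= gp (p i) (p k)}. measure M (up (p k)))"
  using V(4)[of "Suc j"] assms by (subst sum.reindex) (auto intro: inj_on_subset)
 finally show ?thesis .
qed

lemma sum_loss:
 assumes "j < J" shows "(SUM i:V j. loss j i) <= lost (Suc j)"
proof -
 have "(SUM i:V j. loss j i) = (SUM si:p ` V j. measure M (up si Int residual (s (Suc j)) (p ` V (Suc j))))"
  unfolding loss_def using V(4)[of j] assms by (subst sum.reindex) auto
 also have "... <= lost (Suc j)" unfolding lost_def
  by (rule cell_mass(2)[OF M]) (use assms V(1-3)[of j] V(1-3)[of "Suc j"] s(2) in auto)
 finally show ?thesis .
qed

lemma lost_eq:
 assumes "j <= J" shows "lost j = measure M {x : Pt. s j <= ht x} - (SUM i:V j. measure M (up (p i)))"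
proof -
 have "lost j = measure M {x : Pt. s j <= ht x} - (SUM ta:p ` V j. measure M (up ta))"
  unfolding lost_def by (rule cell_mass(3)[OF M, of "{}" "s j - 1"]) (use assms V(1-3)[of j] in auto)
 then show ?thesis using V(4)[OF assms] by (subst (asm) sum.reindex) auto
qed

lemma Idx_finite: "finite Idx" using V(1) by auto

end

section \<open>Counting components and branches\<close>

lemma card_image_same_kernel:
 assumes "!!x y. x : A ==> y : A ==> f x = f y \<longleftrightarrow> g x = g y"
 shows "card (f ` A) = card (g ` A)"
proof -
 have "bij_betw (%z. g (inv_into A f z)) (f ` A) (g ` A)"
 proof (rule bij_betw_imageI)
  show "inj_on (%z. g (inv_into A f z)) (f ` A)"
   by (smt (verit) inj_onI assms inv_into_into f_inv_into_f)
  have eq: "g (inv_into A f (f x)) = g x" if "x : A" for x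
   using assms[OF inv_into_into[OF imageI[OF that, of f]] that] f_inv_into_f[OF imageI[OF that, of f]] by simp
  show "(%z. g (inv_into A f z)) ` f ` A = g ` A"
   unfolding image_image using eq by (intro image_cong) auto
 qed
 then show ?thesis by (rule bij_betw_same_card)
qed

context rooted_tree
begin

text \<open>The points of \<open>Q\<close> strictly above \<open>b\<close>, and the blocks into which \<open>b\<close> separates them.\<close>
definition over :: "'a set => 'a => 'a set" where
 "over Q b = {q : Q. q : up b & q ~= b}"

definition block :: "'a set => 'a => 'a => 'a set" where
 "block Q b q = {q' : Q. ht b < gp q q'}"

definition branches :: "'a set => 'a => nat" where
 "branches Q b = card (block Q b ` over Q b)"

lemma above_strict:
 assumes "b : Pt" "x : up b" "x ~= b"
 shows "ht b < ht x"
proof -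
 have xm: "x : Pt" using assms(2) above_subset by blast
 have "ht b ~= ht x"
 proof
  assume "ht b = ht x"
  then have "anc x (ht x) = b" using anc_eqI[OF xm assms(1,2)] by simp
  moreover have "anc x (ht x) = x" using anc_eqI[OF xm xm above_self[OF xm]] .
  ultimately show False using assms(3) by simp
 qed
 then show ?thesis using above_ht[OF assms(1,2)] by simp
qed

lemma overI: "b : Pt ==> q : Q ==> q : up b ==> ht b < ht q ==> q : over Q b"
 unfolding over_def by auto

lemma over_gp:
 assumes "b : Pt" "x : up b" "y : Pt" "ht b < gp x y"
 shows "y : up b" "ht b < ht y"
proof -
 have xm: "x : Pt" using assms(2) above_subset by blast
 have "ht b <= gp b y"
  using gp_ge_trans[OF assms(1) xm assms(3), of "ht b"] assms(2,4) above_iff_ge[OF assms(1)] by simp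
 then show "y : up b" using above_iff_ge[OF assms(1)] assms(3) by simp
 show "ht b < ht y" using gp_le(2)[OF xm assms(3)] assms(4) by simp
qed

lemma gp_gr_trans:
 assumes "x : Pt" "y : Pt" "z : Pt" "s < gp x y" "s < gp y z"
 shows "s < gp x z"
 using gp_ultra[OF assms(1-3)] assms(4,5) by (simp add: min_def split: if_splits)

lemma block_eq_iff:
 assumes Q: "Q <= Pt" and b: "b : Pt" and q: "q : over Q b" "q' : over Q b"
 shows "block Q b q = block Q b q' \<longleftrightarrow> ht b < gp q q'"
proof
 have qm: "q : Pt" "q' : Pt" "q' : Q" using q Q unfolding over_def by auto
 have "ht b < gp q' q'" using above_strict[OF b, of q'] q(2) qm unfolding over_def by simp
 then have self: "q' : block Q b q'" using qm unfolding block_def by simp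
 show "ht b < gp q q'" if "block Q b q = block Q b q'" using self that unfolding block_def by auto
 assume g: "ht b < gp q q'"
 have "ht b < gp q x \<longleftrightarrow> ht b < gp q' x" if "x : Q" for x
  using gp_gr_trans[OF qm(1,2), of x "ht b"] gp_gr_trans[OF qm(2,1), of x "ht b"] g gp_commute[of q q'] that Q by auto
 then show "block Q b q = block Q b q'" unfolding block_def by auto
qed

text \<open>The new point leaves the old tree at \<open>b0\<close>, its highest common ancestor with
  a point of \<open>Q\<close>, and adds one branch there. Below \<open>b0\<close> it joins the block
  of \<open>q1\<close>. Between \<open>b0\<close> and the new point the number of branches rises
  from 0 to 1, which the truncated \<open>- 1\<close> does not see.\<close>

lemma branches_insert:
 assumes Q: "finite Q" "Q ~= {}" "insert q0 Q <= Pt" and q0: "q0 ~: Q"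
  and anti: "!!p q. p : insert q0 Q ==> q : insert q0 Q ==> q : up p ==> q = p"
 obtains b0 where "b0 : Pt" "1 <= branches Q b0" "branches (insert q0 Q) b0 = Suc (branches Q b0)"
  "!!b. b : Pt ==> b ~= b0 ==> branches (insert q0 Q) b - 1 = branches Q b - 1"
proof -
 let ?Q = "insert q0 Q"
 have q0m: "q0 : Pt" and Qm: "Q <= Pt" using Q(3) by auto
 define g where "g = Max (gp q0 ` Q)"
 have gle: "gp q0 q <= g" if "q : Q" for q unfolding g_def using Q(1) that by simp
 have "g : gp q0 ` Q" unfolding g_def using Q(1,2) by (intro Max_in) auto
 then obtain q1 where q1: "q1 : Q" "gp q0 q1 = g" by auto
 have q1m: "q1 : Pt" using q1 Qm by auto
 have g0: "0 <= g" "g <= ht q0" "g <= ht q1" using gp_le[OF q0m q1m] q1(2) by auto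
 define b0 where "b0 = anc q0 g"
 have b0: "b0 : Pt" "ht b0 = g" "q0 : up b0"
  unfolding b0_def using anc[OF q0m g0(1,2)] anc_above[OF q0m g0(1,2)] by auto
 have "anc q1 g = b0" unfolding b0_def using gp_ge_iff_anc[OF q0m q1m g0] q1(2) by simp
 then have q1b: "q1 : up b0" using anc_above[OF q1m g0(1,3)] by simp
 have ne: "q1 ~= b0" "q0 ~= b0"
  using anti[of q1 q0] anti[of q0 q1] b0(3) q1b q1(1) q0 by auto
 have fin_over: "finite (over Q b)" for b unfolding over_def using Q(1) by simp
 have kernel: "card (block ?Q b ` over Q b) = branches Q b" if b: "b : Pt" for b
  unfolding branches_def
 proof (rule card_image_same_kernel)
  fix x y assume xy: "x : over Q b" "y : over Q b"
  then have "x : over ?Q b" "y : over ?Q b" unfolding over_def by auto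
  then show "block ?Q b x = block ?Q b y \<longleftrightarrow> block Q b x = block Q b y"
   using block_eq_iff[OF Q(3) b] block_eq_iff[OF Qm b] xy by simp
 qed
 have new: "branches ?Q b = Suc (branches Q b)" if b: "b : Pt" "q0 : over ?Q b" "g <= ht b" for b
 proof -
  have ov: "over ?Q b = insert q0 (over Q b)" using b(2) unfolding over_def by auto
  have "block ?Q b q0 ~: block ?Q b ` over Q b"
  proof
   assume "block ?Q b q0 : block ?Q b ` over Q b"
   then obtain q where q: "q : over Q b" "block ?Q b q0 = block ?Q b q" by blast
   then have "q : over ?Q b" "q : Q" unfolding over_def by auto
   then have "ht b < gp q0 q" using block_eq_iff[OF Q(3) b(1,2), of q] q(2) by blast
   then show False using gle[OF \<open>q : Q\<close>] b(3) by simp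
  qed
  then show ?thesis using kernel[OF b(1)] fin_over[of b] unfolding branches_def ov by simp
 qed
 have "branches ?Q b - 1 = branches Q b - 1" if b: "b : Pt" "b ~= b0" for b
 proof (cases "q0 : over ?Q b")
  case False
  then have "over ?Q b = over Q b" unfolding over_def by auto
  then show ?thesis using kernel[OF b(1)] unfolding branches_def by simp
 next
  case q0b: True
  show ?thesis
  proof (cases "ht b < g")
   case True
   have "q1 : up b" "ht b < ht q1"
    using over_gp[OF b(1) _ q1m, of q0] q0b True q1(2) unfolding over_def by auto
   then have q1o: "q1 : over Q b" using overI[OF b(1) q1(1)] by simp
   then have "q1 : over ?Q b" unfolding over_def by auto
   then have "block ?Q b q0 = block ?Q b q1" using block_eq_iff[OF Q(3) b(1) q0b] q1(2) True by simp
   moreover have "over ?Q b = insert q0 (over Q b)" using q0b unfolding over_def by auto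
   ultimately have "block ?Q b ` over ?Q b = block ?Q b ` over Q b" using q1o by auto
   then show ?thesis using kernel[OF b(1)] unfolding branches_def by simp
  next
   case False
   then have 1: "branches ?Q b = Suc (branches Q b)" using new[OF b(1) q0b] by simp
   have q0b': "q0 : up b" using q0b unfolding over_def by simp
   have hb: "g < ht b"
   proof (rule ccontr)
    assume "~ g < ht b"
    then have "ht b = ht b0" using False b0(2) by simp
    then show False using above_disjoint[OF b(1) b0(1) _ q0b' b0(3)] b(2) by simp
   qed
   have "over Q b = {}"
   proof (rule equals0I)
    fix q assume q: "q : over Q b"
    then have q': "q : Q" "q : up b" "q : Pt" using Qm unfolding over_def by auto
    have "ht b <= gp q0 q"
     using gp_ge_trans[OF q0m b(1) q'(3), of "ht b"] above_iff_ge[OF b(1)] q0b' q'(2) gp_commute[of q0 b] by simp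
    then show False using gle[OF q'(1)] hb by simp
   qed
   then have "branches Q b = 0" unfolding branches_def by simp
   then show ?thesis using 1 by simp
  qed
 qed
 moreover have "q0 : over ?Q b0" using b0(3) ne(2) unfolding over_def by simp
 then have "branches ?Q b0 = Suc (branches Q b0)" using new[OF b0(1)] b0(2) by simp
 moreover have "q1 : over Q b0" using q1(1) q1b ne(1) unfolding over_def by simp
 then have "1 <= branches Q b0" unfolding branches_def using fin_over[of b0] by (auto simp: Suc_le_eq card_gt_0_iff)
 ultimately show ?thesis using that[OF b0(1)] by blast
qed

text \<open>An Euler characteristic formula for the finite tree spanned by an antichain.\<close>
lemma branches_sum:
 assumes "finite Q" "Q ~= {}" "Q <= Pt"
  and "!!p q. p : Q ==> q : Q ==> q : up p ==> q = p"
 shows "finite {b : Pt. 2 <= branches Q b}"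
  and "(SUM b:{b : Pt. 2 <= branches Q b}. branches Q b - 1) = card Q - 1"
proof -
 have "finite {b : Pt. 2 <= branches Q b} & (SUM b:{b : Pt. 2 <= branches Q b}. branches Q b - 1) = card Q - 1"
  using assms
 proof (induction Q rule: finite_ne_induct)
  case (singleton q)
  have "card (block {q} b ` over {q} b) <= 1" for b
  proof -
   have "over {q} b <= {q}" unfolding over_def by auto
   then have "block {q} b ` over {q} b <= {block {q} b q}" by auto
   then show ?thesis using card_mono[of "{block {q} b q}"] by simp
  qed
  then have "branches {q} b <= 1" for b unfolding branches_def .
  then have "~ 2 <= branches {q} b" for b by (metis Suc_1 not_less_eq_eq)
  then have e: "{b : Pt. 2 <= branches {q} b} = {}" by blast
  show ?case unfolding e by simp
 next
  case (insert q0 Q)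
  let ?Q = "insert q0 Q"
  let ?s = "%Q. {b : Pt. 2 <= branches Q b}"
  have IH: "finite (?s Q)" "(SUM b:?s Q. branches Q b - 1) = card Q - 1"
   using insert.IH insert.prems by auto
  obtain b0 where b0: "b0 : Pt" "1 <= branches Q b0" "branches ?Q b0 = Suc (branches Q b0)"
   and eq: "!!b. b : Pt ==> b ~= b0 ==> branches ?Q b - 1 = branches Q b - 1"
   using branches_insert[OF insert.hyps(1,2) insert.prems(1) insert.hyps(3) insert.prems(2)] by blast
  have two: "2 <= branches ?Q b \<longleftrightarrow> 2 <= branches Q b" if "b : Pt" "b ~= b0" for b
   using eq[OF that] by linarith
  have supp: "?s ?Q = insert b0 (?s Q - {b0})"
   using two b0 by fastforce
  have fin: "finite (?s Q - {b0})" using IH(1) by simp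
  have "(SUM b:?s ?Q. branches ?Q b - 1) = branches Q b0 + (SUM b:?s Q - {b0}. branches ?Q b - 1)"
   unfolding supp by (subst sum.insert[OF fin]) (simp_all add: b0(3))
  also have "(SUM b:?s Q - {b0}. branches ?Q b - 1) = (SUM b:?s Q - {b0}. branches Q b - 1)"
   using eq by (intro sum.cong) auto
  also have "branches Q b0 + (SUM b:?s Q - {b0}. branches Q b - 1) = Suc (SUM b:?s Q. branches Q b - 1)"
  proof (cases "b0 : ?s Q")
   case True
   then show ?thesis using sum.remove[OF IH(1) True, of "%b. branches Q b - 1"] b0(2) by simp
  next
   case False
   then have "branches Q b0 = 1" using b0(1,2) by auto
   then show ?thesis using False by simp
  qed
  also have "Suc (SUM b:?s Q. branches Q b - 1) = card ?Q - 1"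
   using IH(2) insert.hyps by (simp add: card_gt_0_iff)
  finally show ?case unfolding supp using fin by simp
 qed
 then show "finite {b : Pt. 2 <= branches Q b}"
  "(SUM b:{b : Pt. 2 <= branches Q b}. branches Q b - 1) = card Q - 1" by auto
qed

text \<open>Two points of \<open>Q\<close> part at \<open>b\<close>, so \<open>b\<close> lies
  strictly below a point of \<open>Q\<close>; and since both are over \<open>si\<close>, they part
  no lower than at \<open>si\<close>.\<close>

lemma branches_ge2_location:
 assumes Q: "finite Q" "Q <= up si" and si: "si : Pt" and b: "b : Pt" "2 <= branches Q b"
 shows "b : up si" "EX q:Q. q : up b & q ~= b"
proof -
 have Qm: "Q <= Pt" using Q(2) above_subset by blast
 have "over Q b ~= {}" using b(2) unfolding branches_def by auto
 then obtain q where q: "q : over Q b" by blast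
 then show "EX q:Q. q : up b & q ~= b" unfolding over_def by auto
 have "EX q':over Q b. ~ ht b < gp q q'"
 proof (rule ccontr)
  assume "~ ?thesis"
  then have "block Q b ` over Q b <= {block Q b q}" using block_eq_iff[OF Qm b(1) q] by blast
  then have "branches Q b <= 1" unfolding branches_def using card_mono[of "{block Q b q}"] by simp
  then show False using b(2) by simp
 qed
 then obtain q' where q': "q' : over Q b" "gp q q' <= ht b" by auto
 have qs: "q : Pt" "q' : Pt" "q : up si" "q' : up si" "q : up b"
  using q q'(1) Q(2) Qm unfolding over_def by auto
 have "ht si <= gp q q'"
  using gp_ge_trans[OF qs(1) si qs(2), of "ht si"] qs(3,4) above_iff_ge[OF si] gp_commute[of q si] by simp
 then have hb: "ht si <= ht b" using q'(2) by simp
 have "ht si <= gp si b"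
  using gp_ge_trans[OF si qs(1) b(1), of "ht si"] qs(3,5) above_iff_ge[OF si] above_iff_ge[OF b(1)] hb gp_commute[of b q] by simp
 then show "b : up si" using above_iff_ge[OF si] b(1) by simp
qed

subsection \<open>Connected components of a subtree minus a point\<close>

text \<open>Closure under ancestors expresses connectedness together with the root; closedness is
  kept as a separate hypothesis.\<close>

definition subtree :: "'a set => bool" where
 "subtree R \<longleftrightarrow> R <= Pt & ro : R & (ALL x:R. ALL s. 0 <= s --> s <= ht x --> anc x s : R)"

lemma dist_anc:
 assumes "x : Pt" "0 <= s" "s <= ht x" "0 <= t" "t <= ht x"
 shows "mdist m (anc x s) (anc x t) = \<bar>s - t\<bar>"
 using gp_anc2 assms dist_gp anc by auto

lemma connectedin_anc:
 assumes "x : Pt" "0 <= g" "g <= ht x"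
 shows "connectedin (mtopology_of m) (anc x ` {g..ht x})"
proof (rule connectedin_continuous_map_image)
 show "connectedin (subtopology euclideanreal {g..ht x}) {g..ht x}"
  by (simp add: connectedin_subtopology)
 interpret Metric_space "Pt" "mdist m" by (rule Metric_space_mspace_mdist)
 show "continuous_map (subtopology euclideanreal {g..ht x}) (mtopology_of m) (anc x)"
  unfolding continuous_map_def
 proof (intro conjI allI impI)
  show "anc x : topspace (subtopology euclideanreal {g..ht x}) \<rightarrow> topspace (mtopology_of m)"
   using anc_in[OF assms(1)] assms(2) by auto
  fix U assume U: "openin (mtopology_of m) U"
  show "openin (subtopology euclideanreal {g..ht x}) {s : topspace (subtopology euclideanreal {g..ht x}). anc x s : U}"
  proof -
   have "openin (top_of_set {g..ht x}) {s : {g..ht x}. anc x s : U}"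
    unfolding openin_euclidean_subtopology_iff
   proof (intro conjI ballI)
    fix s assume s: "s : {s : {g..ht x}. anc x s : U}"
    then obtain e where e: "e > 0" "ALL y:Pt. mdist m (anc x s) y < e --> y : U"
     using U unfolding openin_mtopology_of by blast
    have "t : {s : {g..ht x}. anc x s : U}" if "t : {g..ht x}" "dist t s < e" for t
     using e(2) dist_anc[OF assms(1), of s t] anc_in[OF assms(1), of t] s that assms(2)
     by (auto simp: dist_real_def abs_minus_commute)
    then show "EX e>0. ALL x':{g..ht x}. dist x' s < e --> x' : {s : {g..ht x}. anc x s : U}"
     using e(1) by blast
   qed auto
   then show ?thesis by simp
  qed
 qed
qed

context
 fixes R b assumes R: "subtree R" and b: "b : R"
begin

abbreviation punctured :: "'a topology" where
 "punctured == subtopology (mtopology_of (submetric m R)) (mspace (submetric m R) - {b})"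

lemma subtree_facts: "R <= Pt" "ro : R" "x : R ==> 0 <= s ==> s <= ht x ==> anc x s : R" "b : Pt"
 using R b unfolding subtree_def by auto

lemma punctured_eq: "punctured = subtopology (mtopology_of m) (R - {b})"
 unfolding mtopology_of_submetric subtopology_subtopology using subtree_facts(1)
 by (simp add: Int_absorb2 Int_Diff[symmetric] Diff_eq Int_assoc[symmetric])

lemma topspace_punctured [simp]: "topspace punctured = R - {b}"
 unfolding punctured_eq using subtree_facts(1) by auto

text \<open>The comparison of \<open>gp x z\<close> with \<open>ht b\<close> is locally constant in
  \<open>z\<close> away from \<open>b\<close>. The delicate case is \<open>gp x z = ht b\<close>:
  then \<open>z\<close> lies strictly above \<open>b\<close>, and points closer to \<open>z\<close>
  than \<open>ht z - ht b\<close> leave \<open>b\<close> in the same direction as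
  \<open>z\<close>.\<close>

lemma component_above_clopen:
 assumes x: "x : R" "x : up b" "x ~= b"
 shows "openin punctured {z : R - {b}. ht b < gp x z}" "closedin punctured {z : R - {b}. ht b < gp x z}"
proof -
 have xm: "x : Pt" using x(2) above_subset by blast
 have bm: "b : Pt" by (rule subtree_facts(4))
 have near: "ht b < gp x y \<longleftrightarrow> ht b < gp x z"
  if z: "z : R" "z ~= b" and y: "y : Pt" "mdist m z y < \<bar>ht b - gp x z\<bar> | (gp x z = ht b & mdist m z y < ht z - ht b)" for y z
 proof -
  have zm: "z : Pt" using z(1) subtree_facts(1) by blast
  have lip: "\<bar>gp x z - gp x y\<bar> <= mdist m z y" using gp_lipschitz[OF zm y(1) xm] gp_commute[of x] by simp
  from y(2) show ?thesis
   by (smt (verit) lip gp_near zm gp_gr_trans xm gp_commute y)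
 qed
 have rad: "EX e>0. ALL y:Pt. mdist m z y < e --> (ht b < gp x y \<longleftrightarrow> ht b < gp x z)" if z: "z : R" "z ~= b" for z
 proof (cases "gp x z = ht b")
  case True
  have zm: "z : Pt" using z(1) subtree_facts(1) by blast
  have "ht b <= gp b z" using gp_ge_trans[OF bm xm zm, of "ht b"] x(2) above_iff_ge[OF bm] True by simp
  then have "ht b < ht z" using above_strict[OF bm _ z(2)] above_iff_ge[OF bm] zm by simp
  then show ?thesis using near[OF z] True by (intro exI[of _ "ht z - ht b"]) auto
 next
  case False
  then show ?thesis using near[OF z] by (intro exI[of _ "\<bar>ht b - gp x z\<bar>"]) auto
 qed
 \<comment> \<open>The predicate \<open>P\<close> covers the set and its complement in one argument,
   which gives both open and closed.\<close>
 have op: "openin punctured {z : R - {b}. P (ht b < gp x z)}" for P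
 proof -
  define U where "U = {z : Pt. EX w:R - {b}. P (ht b < gp x w) & (EX e>0. mdist m w z < e &
    (ALL y:Pt. mdist m w y < e --> (ht b < gp x y \<longleftrightarrow> ht b < gp x w)))}"
  have "openin (mtopology_of m) U"
   unfolding openin_mtopology_of
  proof (intro conjI ballI)
   fix z assume "z : U"
   then obtain w e where zm: "z : Pt" and w: "w : R - {b}" "P (ht b < gp x w)" "e > 0" "mdist m w z < e"
    "ALL y:Pt. mdist m w y < e --> (ht b < gp x y \<longleftrightarrow> ht b < gp x w)" unfolding U_def by blast
   have wm: "w : Pt" using w(1) subtree_facts(1) by blast
   have "y : U" if y: "y : Pt" "mdist m z y < e - mdist m w z" for y
   proof -
    have "mdist m w y < e" using mdist_triangle[OF wm zm y(1)] y(2) by simp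
    then show ?thesis unfolding U_def using y(1) w by blast
   qed
   then show "EX e>0. ALL y:Pt. mdist m z y < e --> y : U" using w(4) by (intro exI[of _ "e - mdist m w z"]) auto
  qed (auto simp: U_def)
  moreover have "{z : R - {b}. P (ht b < gp x z)} = U Int (R - {b})"
  proof (intro equalityI subsetI)
   fix z assume z: "z : {z : R - {b}. P (ht b < gp x z)}"
   then have zm: "z : Pt" using subtree_facts(1) by blast
   obtain e where e: "e > 0" "ALL y:Pt. mdist m z y < e --> (ht b < gp x y \<longleftrightarrow> ht b < gp x z)" using rad[of z] z by blast
   have "mdist m z z < e" using e(1) zm by simp
   then show "z : U Int (R - {b})" unfolding U_def using z zm e by blast
  next
   fix z assume "z : U Int (R - {b})"
   then show "z : {z : R - {b}. P (ht b < gp x z)}" unfolding U_def by auto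
  qed
  ultimately show ?thesis unfolding punctured_eq openin_subtopology by blast
 qed
 show "openin punctured {z : R - {b}. ht b < gp x z}" using op[of "%u. u"] .
 have o: "openin punctured {z : R - {b}. ~ ht b < gp x z}" using op[of "%u. ~ u"] .
 have e: "topspace punctured - {z : R - {b}. ht b < gp x z} = {z : R - {b}. ~ ht b < gp x z}"
  unfolding topspace_punctured by blast
 have s: "{z : R - {b}. ht b < gp x z} <= topspace punctured"
  unfolding topspace_punctured by blast
 show "closedin punctured {z : R - {b}. ht b < gp x z}" unfolding closedin_def e using s o by (rule conjI)
qed

text \<open>Points of different classes are separated by a clopen set. Points of the same class are
  joined by the descents to their meeting point, and these avoid \<open>b\<close>.\<close>

lemma connected_component_iff:
 assumes x: "x : R" "x ~= b" and y: "y : R" "y ~= b"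
 shows "connected_component_of punctured x y \<longleftrightarrow>
  (x ~: up b & y ~: up b) | (x : up b & y : up b & ht b < gp x y)"
proof
 have bm: "b : Pt" and xm: "x : Pt" and ym: "y : Pt"
  using subtree_facts x y by auto
 {
  assume C: "connected_component_of punctured x y"
  have *: "ht b < gp u v" if u: "u : R" "u : up b" "u ~= b" and v: "v : R" "v ~= b" and c: "connected_component_of punctured u v" for u v
  proof -
   obtain D where D: "connectedin punctured D" "u : D" "v : D"
    using c unfolding connected_component_of_def by blast
   have "D <= {z : R - {b}. ht b < gp u z} | disjnt D {z : R - {b}. ht b < gp u z}"
    using connectedin_clopen_cases[OF D(1) component_above_clopen(2)[OF u] component_above_clopen(1)[OF u]] .
   moreover have "u : {z : R - {b}. ht b < gp u z}" using u above_strict[OF bm u(2,3)] gp_self[of u] subtree_facts(1) by auto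
   ultimately show ?thesis using D(2,3) unfolding disjnt_iff by blast
  qed
  show "(x ~: up b & y ~: up b) | (x : up b & y : up b & ht b < gp x y)"
  proof (cases "x : up b")
   case True
   then have "ht b < gp x y" using *[OF x(1) True x(2) y C] by simp
   then show ?thesis using over_gp(1)[OF bm True ym] True by simp
  next
   case False
   have "y ~: up b"
   proof
    assume ya: "y : up b"
    have "connected_component_of punctured y x" using C by (simp add: connected_component_of_sym)
    then have "ht b < gp y x" using *[OF y(1) ya y(2) x] by simp
    then show False using over_gp(1)[OF bm ya xm] False by simp
   qed
   then show ?thesis using False by simp
  qed
 }
 assume H: "(x ~: up b & y ~: up b) | (x : up b & y : up b & ht b < gp x y)"
 define g where "g = gp x y"
 have g: "0 <= g" "g <= ht x" "g <= ht y" unfolding g_def using gp_le[OF xm ym] by auto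
 let ?D = "anc x ` {g..ht x} Un anc y ` {g..ht y}"
 have ends: "anc x (ht x) = x" "anc y (ht y) = y" "anc x g = anc y g"
  using anc_eqI[OF xm xm above_self[OF xm]] anc_eqI[OF ym ym above_self[OF ym]] gp_ge_iff_anc[OF xm ym g] unfolding g_def by auto
 have "connectedin (mtopology_of m) ?D"
 proof (rule connectedin_Un[OF connectedin_anc[OF xm g(1,2)] connectedin_anc[OF ym g(1,3)]])
  have "anc x g : anc x ` {g..ht x}" "anc y g : anc y ` {g..ht y}" using g by auto
  then show "anc x ` {g..ht x} Int anc y ` {g..ht y} ~= {}" unfolding ends(3) by blast
 qed
 moreover have "?D <= R - {b}"
 proof -
  have "anc u s ~= b" if u: "u : R" "u = x | u = y" and s: "g <= s" "s <= ht u" for u s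
   by (smt (verit) u xm ym s g ht_anc anc_above H g_def)
  moreover have "anc u s : R" if "u : R" "g <= s" "s <= ht u" for u s
   using subtree_facts(3)[OF that(1) _ that(3)] that(2) g(1) by simp
  ultimately show ?thesis using x(1) y(1) by (auto simp del: atLeastAtMost_iff) (auto simp only: atLeastAtMost_iff)
 qed
 ultimately have "connectedin punctured ?D" unfolding punctured_eq connectedin_subtopology by simp
 moreover have "x : ?D" "y : ?D" using ends g by (auto intro: image_eqI[of _ _ "ht x"] image_eqI[of _ _ "ht y"])
 ultimately show "connected_component_of punctured x y" unfolding connected_component_of_def by blast
qed

lemma components_eq:
 "connected_components_of punctured = connected_component_of_set punctured ` (R - {b})"
 unfolding connected_components_of_def topspace_punctured ..

lemma component_set_eq_iff:
 assumes "x : R - {b}" "y : R - {b}"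
 shows "connected_component_of_set punctured x = connected_component_of_set punctured y \<longleftrightarrow> connected_component_of punctured x y"
 by (smt (verit) Collect_inj connected_component_of_eq topspace_punctured assms)

text \<open>Components above \<open>b\<close> correspond to blocks, and if \<open>Q\<close> meets
  every branch they are all obtained this way. The part not above \<open>b\<close> is one further
  component, present unless \<open>b\<close> is the root. Without the covering condition a lower
  bound remains.\<close>

lemma branch_components:
 assumes Q: "finite Q" "Q <= Pt" "over Q b <= R"
 shows "EX B. finite B & B <= connected_components_of punctured & card B = branches Q b + (if b = ro then 0 else 1) &
  ((ALL x:R. x : up b --> x ~= b --> (EX q:Q. ht b < gp x q)) --> connected_components_of punctured <= B)"
proof -
 let ?C = "connected_component_of_set punctured"
 let ?cov = "ALL x:R. x : up b --> x ~= b --> (EX q:Q. ht b < gp x q)"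
 have bm: "b : Pt" by (rule subtree_facts(4))
 have fo: "finite (over Q b)" unfolding over_def using Q(1) by simp
 have oR: "over Q b <= R - {b}" using Q(3) unfolding over_def by auto
 have same: "?C q = ?C q' \<longleftrightarrow> block Q b q = block Q b q'" if "q : over Q b" "q' : over Q b" for q q'
 proof -
  have "?C q = ?C q' \<longleftrightarrow> connected_component_of punctured q q'" using component_set_eq_iff oR that by blast
  also have "... \<longleftrightarrow> ht b < gp q q'" using connected_component_iff[of q q'] that oR unfolding over_def by auto
  finally show ?thesis using block_eq_iff[OF Q(2) bm that] by simp
 qed
 then have c1: "card (?C ` over Q b) = branches Q b"
  unfolding branches_def by (rule card_image_same_kernel)
 have up: "?C x : ?C ` over Q b" if cov: ?cov and x: "x : R - {b}" "x : up b" for x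
 proof -
  obtain q where q: "q : Q" "ht b < gp x q" using cov x by auto
  have "q : over Q b" using over_gp[OF bm x(2) _ q(2)] q Q(2) overI[OF bm q(1)] by auto
  moreover have "connected_component_of punctured x q"
   using connected_component_iff[of x q] x oR calculation q(2) unfolding over_def by auto
  ultimately show ?thesis using component_set_eq_iff[of x q] x(1) oR by blast
 qed
 show ?thesis
 proof (cases "b = ro")
  case True
  have "x : up b" if "x : R" for x using that subtree_facts(1) True by auto
  then have "?cov ==> connected_components_of punctured <= ?C ` over Q b"
   unfolding components_eq using up by blast
  moreover have "?C ` over Q b <= connected_components_of punctured" unfolding components_eq using oR by blast
  ultimately show ?thesis using c1 fo True by (intro exI[of _ "?C ` over Q b"]) simp
 next
  case False
  have "0 < ht b" using ht_eq_0[OF bm] ht_nonneg[of b] False by linarith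
  then have ra: "ro : R - {b}" "ro ~: up b"
   using subtree_facts(2) False above_ht[OF bm, of ro] by auto
  have low: "?C x = ?C ro" if "x : R - {b}" "x ~: up b" for x
   using component_set_eq_iff[OF that(1) ra(1)] connected_component_iff[of x ro] that ra by auto
  have "connected_components_of punctured <= insert (?C ro) (?C ` over Q b)" if cov: ?cov
   unfolding components_eq
   using up cov low by auto
  moreover have "insert (?C ro) (?C ` over Q b) <= connected_components_of punctured"
   unfolding components_eq using ra oR by blast
  moreover have "?C ro ~: ?C ` over Q b"
   using component_set_eq_iff oR connected_component_iff ra over_def by auto
  ultimately show ?thesis using c1 fo False by (intro exI[of _ "insert (?C ro) (?C ` over Q b)"]) simp
 qed
qed

lemma ncomp_ge_branches:
 assumes "finite Q" "Q <= Pt" "over Q b <= R"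
 shows "of_nat (branches Q b + (if b = ro then 0 else 1)) <= ncomp (submetric m R) b"
proof -
 obtain B where B: "finite B" "B <= connected_components_of punctured" "card B = branches Q b + (if b = ro then 0 else 1)"
  using branch_components[OF assms] by auto
 have "ecard B <= ncomp (submetric m R) b" unfolding ncomp_def ecard_def by (rule emeasure_mono[OF B(2)]) simp
 then show ?thesis using B(1,3) unfolding ecard_def by (simp add: emeasure_count_space)
qed

lemma ncomp_branches:
 assumes Q: "finite Q" "Q <= Pt" "over Q b <= R"
  and cover: "!!x. x : R ==> x : up b ==> x ~= b ==> EX q:Q. ht b < gp x q"
 shows "ncomp (submetric m R) b = of_nat (branches Q b + (if b = ro then 0 else 1))"
proof -
 obtain B where B: "finite B" "B <= connected_components_of punctured" "card B = branches Q b + (if b = ro then 0 else 1)"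
  "connected_components_of punctured <= B"
  using branch_components[OF Q] cover by auto
 have "connected_components_of punctured = B" using B(2,4) by simp
 then show ?thesis unfolding ncomp_def ecard_def using B(1,3) by (simp add: emeasure_count_space)
qed

end

end

section \<open>Mass erasure\<close>

text \<open>The index set may be uncountable, so sums over it are handled as suprema of finite sums.
  Finite additivity gives one inequality, the exchange of a series with a finite sum the
  other.\<close>

lemma countably_additive_point_masses:
 fixes f :: "'a => ennreal"
 shows "countably_additive \<A> (%A. INFSUM si:B. f si * indicator A si)"
proof (rule countably_additiveI)
 fix A :: "nat => 'a set" assume disj: "disjoint_family A"
 let ?F = "{F. finite F & F <= B}"
 define nu where "nu A = (INFSUM si:B. f si * indicator A si)" for A
 have SUP: "nu A = (SUP F\<in>?F. SUM si:F. f si * indicator A si)" for A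
  unfolding nu_def by (rule nonneg_infsum_complete) simp
 have mono: "nu A <= nu A'" if "A <= A'" for A A'
  unfolding SUP using that by (intro SUP_mono') (auto intro!: sum_mono mult_left_mono simp: indicator_def)
 have add: "nu (A Un A') = nu A + nu A'" if "A Int A' = {}" for A A'
 proof -
  have "nu (A Un A') = (INFSUM si:B. f si * indicator A si + f si * indicator A' si)"
   unfolding nu_def by (rule infsum_cong) (use that in \<open>auto simp: indicator_def\<close>)
  also have "... = nu A + nu A'"
   unfolding nu_def by (rule infsum_add) (auto intro: nonneg_summable_on_complete)
  finally show ?thesis .
 qed
 have partial: "(SUM n<N. nu (A n)) = nu (\<Union>n<N. A n)" for N
 proof (induction N)
  case 0 show ?case unfolding nu_def by simp
 next
  case (Suc N)
  have "A n Int A N = {}" if "n < N" for n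
   using disjoint_family_onD[OF disj, of n N] that by simp
  then have "(\<Union>n<N. A n) Int A N = {}" by blast
  from add[OF this] show ?case using Suc by (simp add: lessThan_Suc Un_commute)
 qed
 have "(\<Sum>n. nu (A n)) = nu (UN n. A n)"
 proof (rule antisym)
  show "(\<Sum>n. nu (A n)) <= nu (UN n. A n)"
  proof (rule suminf_le_const)
   show "(SUM n<N. nu (A n)) <= nu (UN n. A n)" for N unfolding partial by (rule mono) auto
  qed simp
  show "nu (UN n. A n) <= (\<Sum>n. nu (A n))"
   unfolding SUP[of "UN n. A n"]
  proof (rule SUP_least)
   fix F assume F: "F : ?F"
   have "(SUM si:F. f si * indicator (UN n. A n) si) = (SUM si:F. \<Sum>n. f si * indicator (A n) si)"
    using suminf_indicator[OF disj] by (intro sum.cong) (simp_all add: ennreal_suminf_cmult)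
   also have "... = (\<Sum>n. SUM si:F. f si * indicator (A n) si)" by (rule suminf_sum[symmetric]) simp
   also have "... <= (\<Sum>n. nu (A n))"
   proof (rule suminf_le)
    show "(SUM si:F. f si * indicator (A n) si) <= nu (A n)" for n
     unfolding SUP by (rule SUP_upper[OF F])
   qed simp_all
   finally show "(SUM si:F. f si * indicator (UN n. A n) si) <= (\<Sum>n. nu (A n))" .
  qed
 qed
 then show "(\<Sum>n. INFSUM si:B. f si * indicator (A n) si) = (INFSUM si:B. f si * indicator (UN n. A n) si)"
  unfolding nu_def .
qed

lemma infsum_indicator_finite:
 fixes f :: "'a => ennreal"
 assumes "finite (B Int A)"
 shows "(INFSUM si:B. f si * indicator A si) = (SUM si:B Int A. f si)"
proof -
 have "(INFSUM si:B. f si * indicator A si) = (INFSUM si:B Int A. f si)"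
  by (rule infsum_cong_neutral) auto
 then show ?thesis using assms by simp
qed

context rooted_tree
begin

lemma above_antisym:
 assumes "x : Pt" "y : up x" "x : up y" shows "x = y"
proof -
 have y: "y : Pt" using assms(2) above_subset by blast
 have "ht x = ht y" using above_ht[OF assms(1,2)] above_ht[OF y assms(3)] by simp
 then show ?thesis using above_disjoint[OF assms(1) y _ assms(2) above_self[OF y]] by simp
qed

lemma common_above_comparable:
 assumes "x : Pt" "y : Pt" "z : up x" "z : up y" "ht x <= ht y"
 shows "y : up x"
 by (smt (verit) assms above_iff_ge gp_commute gp_ge_trans)

text \<open>Zorn's lemma for the order of the tree. A chain has bounded heights, and distances in it
  are differences of heights, so a sequence whose heights tend to the supremum is Cauchy; its limit
  stays in the closed set \<open>R\<close> and is an upper bound.\<close>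

lemma maximal_exists:
 assumes comp: "mcomplete_of m" and R: "closedin (mtopology_of m) R" and x: "x : R"
  and bd: "!!y. y : R ==> y : up x ==> ht y <= K"
 shows "EX l:R. l : up x & (ALL y:R. y : up l --> y = l)"
proof -
 have Rm: "R <= Pt" using R unfolding closedin_mtopology_of by simp
 have xm: "x : Pt" using x Rm by auto
 define P where "P a b \<longleftrightarrow> b : up a" for a b
 define A where "A = R Int up x"
 have Am: "A <= Pt" unfolding A_def using Rm by auto
 have "EX l:A. ALL a:A. P l a --> a = l"
 proof (rule predicate_Zorn)
  show "partial_order_on A (relation_of P A)"
  proof (rule partial_order_on_relation_ofI)
   show "P a a" if "a : A" for a unfolding P_def using above_self that Am by auto
   show "P a c" if "a : A" "b : A" "c : A" "P a b" "P b c" for a b c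
    using above_trans[of a b c] that Am unfolding P_def by auto
   show "a = b" if "a : A" "b : A" "P a b" "P b a" for a b
    using above_antisym[of a b] that Am unfolding P_def by auto
  qed
  fix C assume C: "C : Chains (relation_of P A)"
  have CA: "C <= A" and Cc: "!!a b. a : C ==> b : C ==> P a b | P b a"
   using C unfolding Chains_def relation_of_def by auto
  show "EX u:A. ALL a:C. P a u"
  proof (cases "C = {}")
   case True
   then show ?thesis using x above_self[OF xm] unfolding A_def by auto
  next
   case False
   have bdd: "bdd_above (ht ` C)" unfolding bdd_above_def using bd CA unfolding A_def by blast
   define H where "H = Sup (ht ` C)"
   have leH: "ht c <= H" if "c : C" for c unfolding H_def by (rule cSup_upper[OF imageI[OF that] bdd])
   have "EX c:C. H - 1 / Suc k < ht c" for k :: nat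
   proof -
    have "H - 1 / Suc k < Sup (ht ` C)" unfolding H_def by simp
    then show ?thesis using less_cSupD[of "ht ` C"] False by blast
   qed
   then have "ALL k::nat. EX c. c : C & H - 1 / Suc k < ht c" by blast
   then obtain c where c0: "ALL k::nat. c k : C & H - 1 / Suc k < ht (c k)" by (rule choice[THEN exE])
   have c: "c k : C" "H - 1 / Suc k < ht (c k)" for k :: nat using spec[OF c0, of k] by simp_all
   have cm: "c k : Pt" for k using c(1) CA Am by blast
   have dist: "mdist m a b = \<bar>ht a - ht b\<bar>" if "a : C" "b : C" for a b
   proof -
    have ab: "a : Pt" "b : Pt" using that CA Am by auto
    from Cc[OF that] show ?thesis
     using comparable_dist[OF ab(1), of b] comparable_dist[OF ab(2), of a] mdist_commute[of m a b] mdist_nonneg[of m a b]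
     unfolding P_def by (metis abs_minus_commute abs_of_nonneg)
   qed
   interpret MS: Metric_space "Pt" "mdist m" by (rule Metric_space_mspace_mdist)
   have "MS.MCauchy c"
    unfolding MS.MCauchy_def
   proof (intro conjI allI impI)
    show "range c <= Pt" using cm by auto
    fix e :: real assume "0 < e"
    then obtain N :: nat where N: "1 / Suc N < e" using nat_approx_posE by blast
    have "mdist m (c n) (c n') < e" if "N <= n" "N <= n'" for n n'
    proof -
     have "1 / real (Suc n) <= 1 / real (Suc N)" "1 / real (Suc n') <= 1 / real (Suc N)"
      using that by (auto intro!: divide_left_mono)
     then have "H - e < ht (c n)" "H - e < ht (c n')" using c(2)[of n] c(2)[of n'] N by linarith+
     then show ?thesis using dist[OF c(1) c(1)] leH[OF c(1)[of n]] leH[OF c(1)[of n']] by auto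
    qed
    then show "EX N. ALL n n'. N <= n --> N <= n' --> mdist m (c n) (c n') < e" by blast
   qed
   then obtain u where u: "limitin MS.mtopology c u sequentially"
    using comp unfolding mcomplete_of_def MS.mcomplete_def by blast
   have um: "u : Pt" and lim: "!!e. e > 0 ==> EV k. mdist m (c k) u < e"
    using u unfolding MS.limitin_metric by (auto elim: eventually_mono)
   have uR: "u : R"
   proof (rule ccontr)
    assume "u ~: R"
    then obtain e where e: "e > 0" "ALL y:R. e <= mdist m u y" using R um unfolding closedin_mtopology_of by blast
    obtain k where "mdist m (c k) u < e" using lim[OF e(1)] by (auto dest: eventually_happens)
    then show False using e(2) c(1)[of k] CA mdist_commute[of m u "c k"] unfolding A_def by force
   qed
   have ua: "u : up a" if a: "a : C" for a
   proof -
    have am: "a : Pt" using a CA Am by auto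
    have "ht a <= gp a u + e" if "e > 0" for e
    proof -
     obtain N :: nat where N: "1 / Suc N < e / 2" using nat_approx_posE[of "e/2"] \<open>e > 0\<close> by auto
     have "EV k. mdist m (c k) u < e / 2 & N <= k"
      using lim[of "e/2"] eventually_ge_at_top[of N] \<open>e > 0\<close> by (intro eventually_conj) auto
     then obtain k where k: "mdist m (c k) u < e / 2" "N <= k" by (auto dest: eventually_happens)
     have "1 / real (Suc k) <= 1 / real (Suc N)" using k(2) by (auto intro!: divide_left_mono)
     then have "H - e / 2 < ht (c k)" using c(2)[of k] N by linarith
     moreover have "gp a (c k) = min (ht a) (ht (c k))"
      using dist[OF a c(1)[of k]] unfolding gp_def by (auto simp: min_def abs_if)
     ultimately have "ht a - e / 2 <= gp a (c k)" using leH[OF a] \<open>e > 0\<close> by (auto simp: min_def)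
     moreover have "\<bar>gp (c k) a - gp u a\<bar> <= mdist m (c k) u" by (rule gp_lipschitz[OF cm um am])
     ultimately show ?thesis using k(1) gp_commute[of a u] gp_commute[of a "c k"] unfolding abs_le_iff by linarith
    qed
    then have "ht a <= gp a u" by (rule field_le_epsilon)
    then show ?thesis using above_iff_ge[OF am] um by simp
   qed
   have "u : up x"
    using above_trans[OF xm, of "c 0" u] ua[OF c(1)] c(1)[of 0] CA unfolding A_def by auto
   then show ?thesis using uR ua unfolding A_def P_def by blast
  qed
 qed
 then obtain l where l: "l : A" "ALL a:A. P l a --> a = l" by blast
 have "y = l" if "y : R" "y : up l" for y
 proof -
  have "y : A" unfolding A_def using that above_trans[OF xm, of l y] l(1) unfolding A_def by auto
  then show ?thesis using l(2) that(2) unfolding P_def by blast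
 qed
 then show ?thesis using l(1) unfolding A_def by blast
qed

subsection \<open>Projection onto a closed subtree\<close>

text \<open>The projection is the highest ancestor of \<open>x\<close> in \<open>R\<close>, which
  exists because \<open>R\<close> is closed. The third claim is the form in which later arguments
  use this maximality.\<close>

lemma tree_proj:
 assumes R: "subtree R" "closedin (mtopology_of m) R" and x: "x : Pt"
 shows "tree_proj m ro R x : R" "x : up (tree_proj m ro R x)"
  "!!si. si : R ==> x : up si ==> tree_proj m ro R x : up si"
proof -
 have Rm: "R <= Pt" and roR: "ro : R" and dc: "!!y s. y : R ==> 0 <= s ==> s <= ht y ==> anc y s : R"
  using R(1) unfolding subtree_def by auto
 define I where "I = {s. 0 <= s & s <= ht x & anc x s : R}"
 have "anc x 0 = ro" using anc_eqI[OF x root_in] x by simp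
 then have I0: "0 : I" unfolding I_def using roR by simp
 have bdd: "bdd_above I" unfolding I_def bdd_above_def by blast
 define t where "t = Sup I"
 have tI: "s <= t" if "s : I" for s unfolding t_def using that bdd by (rule cSup_upper)
 have t: "0 <= t" by (rule tI[OF I0])
 have t2: "t <= ht x" unfolding t_def
 proof (rule cSup_least)
  show "I ~= {}" using I0 by blast
  show "s <= ht x" if "s : I" for s using that unfolding I_def by simp
 qed
 note t = t t2
 have "anc x t : R"
 proof (rule ccontr)
  assume n: "anc x t ~: R"
  then obtain e where e: "e > 0" "ALL y:R. e <= mdist m (anc x t) y"
   using R(2) anc_in[OF x t] unfolding closedin_mtopology_of by blast
  have "t - e < Sup I" using e(1) unfolding t_def by simp
  then obtain s where s: "s : I" "t - e < s" using less_cSupD[of I] I0 by blast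
  have s': "0 <= s" "s <= ht x" "anc x s : R" using s(1) unfolding I_def by auto
  have "mdist m (anc x t) (anc x s) = \<bar>t - s\<bar>" by (rule dist_anc[OF x t s'(1,2)])
  then show False using e(2) s' s(2) tI[OF s(1)] by force
 qed
 define p where "p = anc x t"
 have p: "p : R" "p : Pt" "ht p = t" "x : up p"
  unfolding p_def using \<open>anc x t : R\<close> anc[OF x t] anc_above[OF x t] by auto
 have top: "p : up si" if "si : R" "x : up si" for si
 proof -
  have sim: "si : Pt" using that Rm by auto
  have "anc x (ht si) = si" by (rule anc_eqI[OF x sim that(2)])
  then have "ht si : I" unfolding I_def using that above_ht[OF sim that(2)] by simp
  then show ?thesis using common_above_comparable[OF sim p(2) that(2) p(4)] tI p(3) by simp
 qed
 have segeq: "seg m ro x Int R = seg m ro p"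
 proof (intro equalityI subsetI)
  fix y assume "y : seg m ro x Int R"
  then have y: "y : Pt" "gp y x = ht y" "y : R" using seg_iff[OF x] by auto
  have "x : up y" unfolding above_iff[OF y(1)] using x y(2) by simp
  from top[OF y(3) this] show "y : seg m ro p" using seg_iff[OF p(2)] above_iff[OF y(1)] y(1) by simp
 next
  fix y assume "y : seg m ro p"
  then have y: "y : Pt" "p : up y" using seg_iff[OF p(2)] above_iff p(2) by auto
  have "x : up y" by (rule above_trans[OF y p(4)])
  moreover have "y : R" using dc[OF p(1), of "ht y"] above_ht[OF y] anc_eqI[OF p(2) y] by simp
  ultimately show "y : seg m ro x Int R" using seg_iff[OF x] above_iff[OF y(1)] y(1) by simp
 qed
 have "tree_proj m ro R x = p"
  unfolding tree_proj_def
 proof (rule the_equality)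
  show "p : R & seg m ro x Int R = seg m ro p" using p(1) segeq by simp
  fix q assume q: "q : R & seg m ro x Int R = seg m ro q"
  then have qm: "q : Pt" using Rm by auto
  have "seg m ro q = seg m ro p" using q segeq by simp
  then have "q : seg m ro p" "p : seg m ro q" using seg_self[OF qm] seg_self[OF p(2)] by auto
  then have "p : up q" "q : up p"
   using seg_iff[OF p(2)] seg_iff[OF qm] above_iff[OF qm] above_iff[OF p(2)] p(2) qm by auto
  then show "q = p" using above_antisym[OF qm] by simp
 qed
 then show "tree_proj m ro R x : R" "x : up (tree_proj m ro R x)"
  "!!si. si : R ==> x : up si ==> tree_proj m ro R x : up si"
  using p top by auto
qed

text \<open>If one projection lies strictly below the height where \<open>x\<close> and
  \<open>y\<close> part, the other point has the same projection. Otherwise projecting preserves the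
  Gromov product and only lowers heights.\<close>

lemma tree_proj_lipschitz:
 assumes R: "subtree R" "closedin (mtopology_of m) R" and x: "x : Pt" and y: "y : Pt"
 shows "mdist m (tree_proj m ro R x) (tree_proj m ro R y) <= mdist m x y"
proof -
 have Rm: "R <= Pt" and dc: "!!y s. y : R ==> 0 <= s ==> s <= ht y ==> anc y s : R"
  using R(1) unfolding subtree_def by auto
 define f where "f = tree_proj m ro R"
 have f: "f z : R" "z : up (f z)" "!!si. si : R ==> z : up si ==> f z : up si" "f z : Pt" "ht (f z) <= ht z"
  if "z : Pt" for z
  using tree_proj[OF R that] Rm above_ht[of "f z" z] unfolding f_def by auto
 have eqf: "anc z (ht (f z)) = f z" if "z : Pt" for z
  using anc_eqI[OF that f(4)[OF that] f(2)[OF that]] .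
 have g: "gp (f x) (f y) = min (min (ht (f x)) (ht (f y))) (gp x y)"
  using gp_anc2[OF x y ht_nonneg f(5)[OF x] ht_nonneg f(5)[OF y]] eqf[OF x] eqf[OF y] by simp
 have same: "f u = f v" if u: "u : Pt" and v: "v : Pt" and lt: "ht (f u) < gp u v" for u v
 proof -
  have vu: "v : up (f u)"
  proof -
   have "ht (f u) <= gp (f u) v"
    using gp_ge_trans[OF f(4)[OF u] u v, of "ht (f u)"] f(2)[OF u] above_iff_ge[OF f(4)[OF u]] lt by simp
   then show ?thesis using above_iff_ge[OF f(4)[OF u]] v by simp
  qed
  have a: "f v : up (f u)" by (rule f(3)[OF v f(1)[OF u] vu])
  define s where "s = min (ht (f v)) (gp u v)"
  have s: "0 <= s" "s <= ht (f v)" "s <= ht u" "s <= ht v" "ht (f u) <= s"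
   using gp_le[OF u v] above_ht[OF f(4)[OF u] a] lt f(5)[OF v] unfolding s_def by (auto simp: min_def)
  have "anc (f v) s = anc v s" using anc_anc[OF v s(1,2) f(5)[OF v]] eqf[OF v] by simp
  moreover have "anc v s = anc u s" using gp_ge_iff_anc[OF u v s(1,3,4)] unfolding s_def by simp
  moreover have "anc (f v) s : R" by (rule dc[OF f(1)[OF v] s(1,2)])
  ultimately have w: "anc u s : R" by simp
  have "f u : up (anc u s)" by (rule f(3)[OF u w anc_above[OF u s(1,3)]])
  then have "s <= ht (f u)" using above_ht[OF anc_in[OF u s(1,3)]] ht_anc[OF u s(1,3)] by simp
  then have "ht (f v) = ht (f u)" using s(5) lt unfolding s_def by (auto simp: min_def split: if_splits)
  then show ?thesis using above_disjoint[OF f(4)[OF u] f(4)[OF v] _ a above_self[OF f(4)[OF v]]] by simp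
 qed
 have "mdist m (f x) (f y) <= mdist m x y"
 proof (cases "ht (f x) < gp x y | ht (f y) < gp x y")
  case True
  then have "f x = f y" using same[OF x y] same[OF y x] gp_commute[of x y] by auto
  then show ?thesis using f(4)[OF y] by simp
 next
  case False
  then have "gp (f x) (f y) = gp x y" using g by simp
  then show ?thesis using dist_gp[of "f x" "f y"] dist_gp[of x y] f(5)[OF x] f(5)[OF y] by simp
 qed
 then show ?thesis unfolding f_def .
qed

lemma tree_proj_measurable:
 assumes "subtree R" "closedin (mtopology_of m) R"
 shows "tree_proj m ro R : measurable (mb m) (mb m)"
proof (rule measurable_lipschitz)
 show "tree_proj m ro R : Pt \<rightarrow> Pt"
  using tree_proj(1)[OF assms] assms(1) unfolding subtree_def by auto
qed (rule tree_proj_lipschitz[OF assms])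

end

section \<open>Measures with finitely many infinite cones at each height\<close>

context rooted_tree
begin

definition heavy_at :: "'a measure => real => 'a set" where
 "heavy_at mu s = {si : Pt. ht si = s & em mu (up si) = \<infinity>}"

definition off :: "'a set => 'a set" where
 "off D = Pt - (UN d:D. up d)"

text \<open>The consequence of \<open>M_di\<close> on which the proof runs. It is stated level by
  level, with no reference to the shape of the skeleton, and in this form it passes to erased
  measures (\<open>erase_admissible\<close>).\<close>

definition admissible :: "'a measure => bool" where
 "admissible mu \<longleftrightarrow> sets mu = Bor &
   (ALL s>0. finite (heavy_at mu s) & em mu (off (heavy_at mu s)) < \<infinity>)"

lemma off_borel: "finite D ==> D <= Pt ==> off D : Bor"
 unfolding off_def using above_borel sets.top[of "mb m"] by (intro sets.Diff sets.finite_UN) auto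

lemma above_mono: "si : Pt ==> y : up si ==> up y <= up si"
 using above_trans by blast

lemma level_antichain: "D <= Pt ==> (!!d. d : D ==> ht d = s) ==> p : D ==> q : D ==> q : up p ==> q = p"
 using above_disjoint[of p q q] above_self[of q] by (auto dest: subsetD)

lemma superlevel_subtree:
 assumes mu: "sets mu = Bor"
 shows "subtree ({ro} Un {si : Pt. c <= em mu (up si)})"
 unfolding subtree_def
proof (intro conjI ballI allI impI)
 fix x s assume x: "x : {ro} Un {si : Pt. c <= em mu (up si)}" and s: "0 <= s" "s <= ht x"
 have xm: "x : Pt" using x by auto
 show "anc x s : {ro} Un {si : Pt. c <= em mu (up si)}"
 proof (cases "x = ro")
  case True
  then show ?thesis using anc[OF xm s] s ht_eq_0 by auto
 next
  case False
  have "em mu (up x) <= em mu (up (anc x s))"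
   using above_borel[OF anc_in[OF xm s]] mu by (intro emeasure_mono above_mono[OF anc_in[OF xm s] anc_above[OF xm s]]) simp
  then show ?thesis using False x anc_in[OF xm s] by auto
 qed
qed auto

lemma Skel_eq: "Skel m ro mu = {ro} Un {si : Pt. \<infinity> <= em mu (up si)}"
 unfolding Skel_def by (simp add: top_unique)

lemma heavy_at_eq: "0 < s ==> heavy_at mu s = tsphere m ro s Int Skel m ro mu"
 unfolding heavy_at_def Skel_def tsphere_eq by auto

text \<open>By \<open>branches_sum\<close>, \<open>k\<close> heavy points of one level require
  branchings of total excess \<open>k - 1\<close> below them, all in the skeleton. Discreteness
  bounds the number of components at the root and these branch points by \<open>K\<close> in total,
  so a level carries at most \<open>K + 1\<close> heavy points.\<close>

lemma discrete_Skel_level_finite: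
 assumes mu: "sets mu = Bor" and disc: "discrete_rtree (submetric m (Skel m ro mu)) ro" and s: "0 < s"
 shows "finite (heavy_at mu s)"
proof (rule ccontr)
 assume inf: "infinite (heavy_at mu s)"
 let ?S = "Skel m ro mu"
 let ?n = "%b. ncomp (submetric m ?S) b"
 let ?B = "Bp (submetric m ?S) ro Int tball (submetric m ?S) ro s"
 define K where "K = ?n ro + (INFSUM si:?B. ?n si)"
 have K: "K < \<infinity>" using disc s unfolding discrete_rtree_def K_def by blast
 have S: "subtree ?S" unfolding Skel_eq by (rule superlevel_subtree[OF mu])
 have Sm: "?S <= Pt" and dc: "!!x t. x : ?S ==> 0 <= t ==> t <= ht x ==> anc x t : ?S" using S unfolding subtree_def by auto
 obtain k :: nat where k: "K + 2 < of_nat k" using ennreal_Ex_less_of_nat[of "K + 2"] K by (auto simp: less_top)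
 obtain F where F: "F <= heavy_at mu s" "finite F" "card F = k" using infinite_arbitrarily_large[OF inf] by blast
 have Fm: "F <= Pt" "!!q. q : F ==> ht q = s" "F <= ?S"
  using F(1) unfolding heavy_at_eq[OF s] tsphere_eq by auto
 have "F ~= {}" using k F by auto
 note sum = branches_sum[OF F(2) this Fm(1) level_antichain[OF Fm(1,2)]]
 let ?T = "{b : Pt. 2 <= branches F b}"
 have loc: "b : ?S" "ht b <= s" if b: "b : ?T" for b
 proof -
  have bm: "b : Pt" using b by simp
  obtain q where q: "q : F" "q : up b"
   using branches_ge2_location(2)[OF F(2) _ root_in, of b] b Fm(1) by auto
  show "ht b <= s" using above_ht[OF bm q(2)] Fm(2)[OF q(1)] by simp
  then show "b : ?S"
   using dc[of q "ht b"] subsetD[OF Fm(3) q(1)] subsetD[OF Fm(1) q(1)] anc_eqI[OF _ bm q(2)] Fm(2)[OF q(1)] by simp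
 qed
 have le: "of_nat (branches F b + (if b = ro then 0 else 1)) <= ?n b" if b: "b : ?T" for b
  by (rule ncomp_ge_branches[OF S loc(1)[OF b] F(2) Fm(1)]) (use Fm(3) in \<open>auto simp: over_def\<close>)
 have TB: "?T - {ro} <= ?B"
 proof
  fix b assume b: "b : ?T - {ro}"
  have "(of_nat 3 :: ennreal) <= of_nat (branches F b + (if b = ro then 0 else 1))" using b by (intro of_nat_mono) simp
  from order_trans[OF this le[of b]] have "3 <= ?n b" using b by simp
  then show "b : ?B" using b loc[of b] Sm unfolding Bp_def tball_def ht_def by auto
 qed
 have "of_nat (card F - 1) = (SUM b:?T. of_nat (branches F b - 1) :: ennreal)" by (simp only: sum(2)[symmetric] of_nat_sum)
 also have "... <= (SUM b:?T. ?n b)"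
 proof (rule sum_mono)
  fix b assume b: "b : ?T"
  have "(of_nat (branches F b - 1) :: ennreal) <= of_nat (branches F b + (if b = ro then 0 else 1))" by (intro of_nat_mono) simp
  then show "of_nat (branches F b - 1) <= ?n b" using le[OF b] by (rule order_trans)
 qed
 also have "... <= (SUM b:insert ro (?T - {ro}). ?n b)" by (rule sum_mono2) (use sum(1) in auto)
 also have "... = ?n ro + (SUM b:?T - {ro}. ?n b)" by (rule sum.insert) (use sum(1) in auto)
 also have "... <= K"
  unfolding K_def
  by (intro add_left_mono) (subst nonneg_infsum_complete, simp, intro SUP_upper, use TB sum(1) in simp)
 finally have "of_nat (card F - 1) <= K" .
 moreover have "(of_nat k :: ennreal) <= of_nat (card F - 1) + 1" unfolding F(3) by (cases k) auto
 ultimately have "of_nat k <= K + 1" by (meson add_right_mono order_trans)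
 also have "K + 1 <= K + 2" by (intro add_left_mono) simp
 finally show False using k by simp
qed

text \<open>A finite measure has no infinite cones. For a discretely infinite one, the complement of
  the heavy cones at level \<open>s\<close> is covered by the ball of radius \<open>s\<close> and
  the cones over the light points of the sphere, both of finite mass.\<close>

lemma M_di_admissible:
 assumes "mu : M_di m ro"
 shows "admissible mu"
proof -
 have mu: "sets mu = Bor"
  using assms unfolding M_di_def M_fin_def discretely_infinite_def M_bf_def borel_measures_def by auto
 show ?thesis
 proof (cases "mu : M_fin m")
  case True
  then interpret finite_measure mu unfolding M_fin_def by simp
  have e: "heavy_at mu s = {}" for s unfolding heavy_at_def using emeasure_finite by (auto simp: top_unique)
  show ?thesis unfolding admissible_def e using mu by (simp add: less_top[symmetric])
 next
  case False
  then have D: "discretely_infinite m ro mu" using assms unfolding M_di_def by simp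
  have bf: "!!B. B : sets mu ==> Metric_space.mbounded (Pt) (mdist m) B ==> em mu B < \<infinity>"
   using D unfolding discretely_infinite_def M_bf_def by blast
  have disc: "discrete_rtree (submetric m (Skel m ro mu)) ro"
   and F: "!!r. r > 0 ==> em mu (UN si:tsphere m ro r Int (Pt - Skel m ro mu). up si) < \<infinity>"
   using D unfolding discretely_infinite_def by auto
  have "finite (heavy_at mu s) & em mu (off (heavy_at mu s)) < \<infinity>" if s: "0 < s" for s
  proof
   show fin: "finite (heavy_at mu s)" by (rule discrete_Skel_level_finite[OF mu disc s])
   let ?U = "UN si:tsphere m ro s Int (Pt - Skel m ro mu). up si"
   have hm: "heavy_at mu s <= Pt" unfolding heavy_at_def by auto
   have Um: "?U = (hi s) Int off (heavy_at mu s)"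
   proof (intro equalityI subsetI)
    fix x assume "x : ?U"
    then obtain si where si: "si : Pt" "ht si = s" "si ~: Skel m ro mu" "x : up si" unfolding tsphere_eq by auto
    have xm: "x : Pt" using si(4) above_subset by auto
    have "d ~: heavy_at mu s" if "x : up d" for d
    proof
     assume d: "d : heavy_at mu s"
     then have "si = d" using above_disjoint[OF si(1) _ _ si(4) that] si(2) unfolding heavy_at_def by simp
     then show False using d si(3) unfolding heavy_at_eq[OF s] by simp
    qed
    then show "x : (hi s) Int off (heavy_at mu s)"
     using xm above_ht[OF si(1,4)] si(2) unfolding off_def by auto
   next
    fix x assume x: "x : (hi s) Int off (heavy_at mu s)"
    then have xm: "x : Pt" "s <= ht x" by auto
    note a = anc[OF xm(1) less_imp_le[OF s] xm(2)] anc_above[OF xm(1) less_imp_le[OF s] xm(2)]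
    have "anc x s ~: heavy_at mu s" using x a(4) unfolding off_def by auto
    then have "anc x s : tsphere m ro s Int (Pt - Skel m ro mu)" using a(1,2) unfolding heavy_at_eq[OF s] tsphere_eq by auto
    then show "x : ?U" using a(4) by blast
   qed
   have Ub: "?U : sets mu" unfolding Um using off_borel[OF fin hm] ht_borel_ge mu by simp
   have "off (heavy_at mu s) <= tball m ro s Un ?U" unfolding Um tball_eq by (auto simp: off_def)
   then have "em mu (off (heavy_at mu s)) <= em mu (tball m ro s Un ?U)"
    using Ub tball_borel mu by (intro emeasure_mono) auto
   also have "... <= em mu (tball m ro s) + em mu ?U" by (rule emeasure_subadditive) (use Ub tball_borel mu in auto)
   also have "... < \<infinity>"
   proof -
    have "Metric_space.mbounded (Pt) (mdist m) (tball m ro s)"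
     unfolding Metric_space.mbounded_def[OF Metric_space_mspace_mdist] Metric_space.mcball_def[OF Metric_space_mspace_mdist]
     by (intro exI[of _ ro] exI[of _ s]) (auto simp: tball_eq ht_def)
    then show ?thesis using bf[of "tball m ro s"] F[OF s] tball_borel mu by (simp add: less_top)
   qed
   finally show "em mu (off (heavy_at mu s)) < \<infinity>" .
  qed
  then show ?thesis unfolding admissible_def using mu by simp
 qed
qed

text \<open>The ball avoids every cone over the higher level \<open>t\<close>, so it lies in
  \<open>off (heavy_at mu t)\<close>.\<close>

lemma admissible_ball:
 assumes "admissible mu" shows "em mu (lo s) < \<infinity>"
proof -
 define t where "t = max s 0 + 1"
 have t: "0 < t" "s < t" unfolding t_def by auto
 have mu: "sets mu = Bor" and fin: "finite (heavy_at mu t)" "em mu (off (heavy_at mu t)) < \<infinity>"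
  using assms t(1) unfolding admissible_def by auto
 have "(lo s) <= off (heavy_at mu t)"
  unfolding off_def heavy_at_def using above_ht t(2) by force
 then have "em mu (lo s) <= em mu (off (heavy_at mu t))"
  using off_borel[OF fin(1)] mu by (intro emeasure_mono) (auto simp: heavy_at_def)
 then show ?thesis using fin(2) by simp
qed

end

section \<open>The subtree left by erasure: closedness and tips\<close>

locale erasing = rooted_tree m ro for m :: "'a metric" and ro +
 fixes mu and h :: real assumes adm: "admissible mu" and h: "0 < h" and comp: "mcomplete_of m"
begin

abbreviation R where "R == R_erase m ro mu h"

lemma adm_sets: "sets mu = Bor" using adm unfolding admissible_def by simp

lemma adm_heavy: "0 < s ==> finite (heavy_at mu s)" "0 < s ==> em mu (off (heavy_at mu s)) < \<infinity>"
 using adm unfolding admissible_def by auto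

lemma R_subtree: "subtree R"
 unfolding R_erase_def using superlevel_subtree[OF adm_sets, of "ennreal h"] by simp

lemma R_in: "x : R ==> x : Pt" "ro : R" "x : R ==> 0 <= s ==> s <= ht x ==> anc x s : R"
 using R_subtree unfolding subtree_def by auto

lemma R_mass: "x : R ==> x ~= ro ==> ennreal h <= em mu (up x)"
 unfolding R_erase_def by simp

lemma R_below: "x : R ==> y : Pt ==> x : up y ==> y : R"
 using R_in(3)[of x "ht y"] anc_eqI[OF R_in(1)] above_ht[of y x] by simp

lemma heavy_subset_R: "heavy_at mu s <= R"
 unfolding heavy_at_def R_erase_def by auto

text \<open>Continuity of \<open>mu\<close> from above along cones over ancestors of
  \<open>x\<close>. The finite mass it requires is available just below \<open>x\<close>: the heavy
  points at the height of \<open>x\<close> are finitely many and different from \<open>x\<close>, so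
  cones over close ancestors avoid all heavy cones.\<close>

lemma light_neighbour:
 assumes x: "x : Pt" "x ~= ro" and light: "em mu (up x) < ennreal c"
 shows "EX e>0. e < ht x & em mu (up (anc x (ht x - e))) < ennreal c"
proof -
 define s where "s = ht x"
 have s: "0 < s" using ht_eq_0[OF x(1)] ht_nonneg[of x] x(2) unfolding s_def by linarith
 define e where "e k = s / real (k + 2)" for k :: nat
 have e: "0 < e k" "e k < s" for k using s unfolding e_def by (auto simp: field_simps intro!: add_pos_nonneg mult_nonneg_nonneg)
 have e0: "e \<longlonglongrightarrow> 0" unfolding e_def by (intro LIMSEQ_ignore_initial_segment[of "%k. s / real k"] lim_const_over_n)
 have lim: "(%k. s - e k) \<longlonglongrightarrow> s" using tendsto_diff[OF tendsto_const e0, of s] by simp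
 define p where "p k = anc x (s - e k)" for k
 have p: "p k : Pt" "ht (p k) = s - e k" "x : up (p k)" for k
  unfolding p_def using anc[OF x(1), of "s - e k"] anc_above[OF x(1), of "s - e k"] e[of k] unfolding s_def by auto
 have pa: "y : up (p k) \<longleftrightarrow> y : Pt & s - e k <= gp x y" for y k
 proof (cases "y : Pt")
  case True
  have "gp (p k) y = min (s - e k) (gp x y)"
   unfolding p_def using e[of k] by (intro gp_anc_left[OF x(1) True]) (auto simp: s_def)
  then show ?thesis using above_iff_ge[OF p(1)] p(2) True by (auto simp: min_def)
 qed (use above_subset in auto)
 let ?D = "heavy_at mu s"
 have Dm: "?D <= Pt" unfolding heavy_at_def by auto
 have "EV k. ALL d:?D. gp d x < s - e k"
 proof (rule eventually_ball_finite[OF adm_heavy(1)[OF s]], rule ballI)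
  fix d assume d: "d : ?D"
  then have dm: "d : Pt" "ht d = s" "em mu (up d) = \<infinity>" unfolding heavy_at_def by auto
  have "gp d x < s"
  proof (rule ccontr)
   assume "~ gp d x < s"
   then have "x : up d" using above_iff_ge[OF dm(1)] dm(2) x(1) by simp
   then have "d = x" using above_disjoint[OF dm(1) x(1) _ _ above_self[OF x(1)]] dm(2) s_def by simp
   then show False using light dm(3) by simp
  qed
  then show "EV k. gp d x < s - e k" by (rule order_tendstoD(1)[OF lim])
 qed
 then obtain k0 where k0: "!!k d. k0 <= k ==> d : ?D ==> gp d x < s - e k"
  unfolding eventually_sequentially by blast
 define A where "A k = up (p (k + k0))" for k
 have Ab: "range A <= sets mu" unfolding A_def using above_borel p(1) adm_sets by auto
 have Aoff: "A k <= off ?D" for k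
 proof
  fix y assume y: "y : A k"
  then have y': "y : Pt" "s - e (k + k0) <= gp x y" unfolding A_def pa by auto
  have "y ~: up d" if d: "d : ?D" for d
  proof
   assume yd: "y : up d"
   have dm: "d : Pt" "ht d = s" using d unfolding heavy_at_def by auto
   have "s <= gp d y" using above_iff_ge[OF dm(1)] yd dm(2) by simp
   then have "s - e (k + k0) <= gp d x"
    using gp_ge_trans[OF dm(1) y'(1) x(1), of "s - e (k + k0)"] y'(2) e[of "k + k0"] gp_commute[of y x] by simp
   then show False using k0[of "k + k0" d] d by simp
  qed
  then show "y : off ?D" unfolding off_def using y'(1) by blast
 qed
 have "EV k. em mu (A k) <= em mu (up x) + ennreal ((c - enn2real (em mu (up x))) / 2)"
 proof (rule eventually_outer[OF Ab])
  show "decseq A"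
  proof (rule antimonoI)
   fix i j :: nat assume "i <= j"
   then have "e (j + k0) <= e (i + k0)" unfolding e_def using s by (intro divide_left_mono) auto
   then show "A j <= A i" unfolding A_def by (auto simp: pa)
  qed
  show "(INT k. A k) <= up x"
  proof
   fix y assume "y : (INT k. A k)"
   then have y: "y : Pt" "!!k. s - e (k + k0) <= gp x y" unfolding A_def by (auto simp: pa)
   have "s <= gp x y" by (rule LIMSEQ_le_const2[OF LIMSEQ_ignore_initial_segment[OF lim, of k0]]) (use y(2) in auto)
   then show "y : up x" using above_iff_ge[OF x(1)] y(1) unfolding s_def by simp
  qed
  show "up x : sets mu" using above_borel[OF x(1)] adm_sets by simp
  show "em mu (A k) < \<infinity>" for k
  proof -
   have "em mu (A k) <= em mu (off ?D)"
    using off_borel[OF adm_heavy(1)[OF s] Dm] adm_sets by (intro emeasure_mono[OF Aoff]) simp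
   then show ?thesis using adm_heavy(2)[OF s] by simp
  qed
  show "0 < (c - enn2real (em mu (up x))) / 2" using light by (cases "em mu (up x)") (auto simp: ennreal_less_iff)
 qed
 then obtain k where k: "em mu (A k) <= em mu (up x) + ennreal ((c - enn2real (em mu (up x))) / 2)"
  by (auto dest: eventually_happens)
 have "em mu (up x) + ennreal ((c - enn2real (em mu (up x))) / 2) < ennreal c"
  using light by (cases "em mu (up x)") (auto simp: ennreal_less_iff ennreal_plus[symmetric] field_simps simp del: ennreal_plus)
 then have "em mu (A k) < ennreal c" using k by simp
 then show ?thesis unfolding A_def p_def s_def using e[of "k + k0"] by (intro exI[of _ "e (k + k0)"]) (simp add: s_def)
qed

lemma near_above_anc:
 assumes x: "x : Pt" and e: "0 <= e" "e <= ht x" and y: "y : Pt" "mdist m x y <= e"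
 shows "y : up (anc x (ht x - e))"
 by (smt (verit) gp_anc_left x e gp_near above_iff_ge anc_in ht_anc y)

lemma R_closed: "closedin (mtopology_of m) R"
 unfolding closedin_mtopology_of
proof (intro conjI ballI)
 show "R <= Pt" using R_in(1) by blast
 fix x assume x: "x : Pt - R"
 then have xm: "x : Pt" "x ~= ro" "em mu (up x) < ennreal h" unfolding R_erase_def by (auto simp: not_le)
 obtain e where e: "e > 0" "e < ht x" "em mu (up (anc x (ht x - e))) < ennreal h"
  using light_neighbour[OF xm] by blast
 have p: "anc x (ht x - e) : Pt" "ht (anc x (ht x - e)) = ht x - e" using anc[OF xm(1)] e by auto
 have "e <= mdist m x y" if y: "y : R" for y
 proof (rule ccontr)
  assume n: "~ e <= mdist m x y"
  have ym: "y : Pt" using R_in(1)[OF y] .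
  have ya: "y : up (anc x (ht x - e))" using near_above_anc[OF xm(1) _ _ ym, of e] e n by simp
  then have "y ~= ro" using above_ht[OF p(1)] p(2) e by force
  then have "ennreal h <= em mu (up y)" using R_mass[OF y] by simp
  also have "... <= em mu (up (anc x (ht x - e)))"
   using above_borel[OF p(1)] adm_sets by (intro emeasure_mono above_mono[OF p(1) ya]) simp
  finally show False using e(3) by simp
 qed
 then show "EX e>0. ALL y:R. e <= mdist m x y" using e(1) by blast
qed

text \<open>A point of \<open>R\<close> above height \<open>k\<close> would bring mass
  \<open>h\<close> into the part of the cone above \<open>k\<close>, whose mass tends to 0. So the
  heights of \<open>R\<close> over \<open>x\<close> are bounded, as \<open>maximal_exists\<close>
  requires.\<close>

lemma tip_above:
 assumes x: "x : R" and fin: "em mu (up x) < \<infinity>"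
 shows "EX l:R. l : up x & (ALL y:R. y : up l --> y = l)"
proof -
 have xm: "x : Pt" using R_in(1)[OF x] .
 define B where "B k = {y : up x. real k <= ht y}" for k
 have B_eq: "B k = up x Int {y : Pt. real k <= ht y}" for k unfolding B_def using above_subset by auto
 have Bs: "B k : sets mu" for k unfolding B_eq using above_borel[OF xm] ht_borel_ge adm_sets by simp
 have "EV k. em mu (B k) <= em mu {} + ennreal (h / 2)"
 proof (rule eventually_outer)
  show "decseq B" unfolding B_def by (rule antimonoI) auto
  show "(INT k. B k) <= {}"
   using B_def reals_Archimedean2 not_less by fastforce
  show "em mu (B k) < \<infinity>" for k
  proof -
   have "em mu (B k) <= em mu (up x)" unfolding B_def using above_borel[OF xm] adm_sets by (intro emeasure_mono) auto
   then show ?thesis using fin by simp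
  qed
 qed (use Bs h in auto)
 then obtain k where k: "em mu (B k) <= ennreal (h / 2)" by (auto dest: eventually_happens)
 show ?thesis
 proof (rule maximal_exists[OF comp R_closed x, of "real k"])
  fix y assume y: "y : R" "y : up x"
  show "ht y <= real k"
  proof (rule ccontr)
   assume n: "~ ht y <= real k"
   then have "0 < ht y" by linarith
   then have "y ~= ro" by force
   then have "ennreal h <= em mu (up y)" using R_mass[OF y(1)] by simp
   also have "... <= em mu (B k)"
   proof (rule emeasure_mono[OF _ Bs], rule subsetI)
    fix z assume z: "z : up y"
    show "z : B k" unfolding B_def using above_trans[OF xm y(2) z] above_ht[OF R_in(1)[OF y(1)] z] n by simp
   qed
   finally have "ennreal h <= ennreal (h / 2)" using k by (rule order_trans)
   then show False using h by (simp add: ennreal_le_iff)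
  qed
 qed
qed

definition tips :: "'a set => 'a set" where
 "tips A = {l : R Int A. ALL y:R. y : up l --> y = l}"

definition erase_value :: "'a set => ereal" where
 "erase_value B = enn2ereal (em (Pr_meas m ro R mu) (B Int (R - Lf (submetric m R) ro))
   + (INFSUM si:Lf (submetric m R) ro. (em mu (up si) - ennreal h) * indicator B si)
   + ennreal h * (INFSUM si:Bp (submetric m R) ro. (ncomp (submetric m R) si - 2) * indicator B si))
  + ereal h * (enn2ereal (ncomp (submetric m R) ro) - 1) * indicator B ro"

section \<open>Regions of the erased tree between a point and an antichain\<close>

context
 fixes si D A
 assumes si: "si : R" and D: "finite D" "D <= R" "!!d. d : D ==> d : up si" "si ~: D"
   "!!p q. p : D ==> q : D ==> q : up p ==> q = p"
  and A_def: "A = up si Int off D" and finA: "em mu A < \<infinity>"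
begin

lemma A_in: "x : A \<longleftrightarrow> x : up si & (ALL d:D. x ~: up d)"
 unfolding A_def off_def using above_subset by auto

lemma A_space: "x : A ==> x : Pt" unfolding A_in using above_subset by auto

lemma A_sets: "A : sets mu"
 unfolding A_def adm_sets using above_borel[OF R_in(1)[OF si]] off_borel[OF D(1)] D(2) R_in(1) by auto

lemma D_outside: "d : D ==> d ~: A"
 unfolding A_in using above_self R_in(1) D(2) by auto

lemma not_in_A: "x : up si ==> x ~: A ==> EX d:D. x : up d"
 unfolding A_in by blast

lemma above_tip_in_A:
 assumes l: "l : A" and nD: "!!d. d : D ==> d ~: up l" shows "up l <= A"
proof
 fix z assume z: "z : up l"
 have lm: "l : Pt" and lsi: "l : up si" using l A_space A_in by auto
 have "z ~: up d" if d: "d : D" for d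
 proof
  assume zd: "z : up d"
  have dm: "d : Pt" using d D(2) R_in(1) by auto
  show False
   by (smt (verit) common_above_comparable lm dm z zd nD d l A_in)
 qed
 then show "z : A" unfolding A_in using above_trans[OF R_in(1)[OF si] lsi z] by simp
qed

lemma tipsD: assumes "l : tips A"
 shows "l : R" "l : A" "!!y. y : R ==> y : up l ==> y = l" "up l <= A"
proof -
 show l: "l : R" "l : A" "!!y. y : R ==> y : up l ==> y = l" using assms unfolding tips_def by auto
 show "up l <= A"
 proof (rule above_tip_in_A[OF l(2)], rule notI)
  fix d assume d: "d : D" "d : up l"
  then have "d = l" using l(3) D(2) by blast
  then show False using d(1) D_outside l(2) by simp
 qed
qed

lemma tips_disjoint: "disjoint_family_on up (tips A)"
 unfolding disjoint_family_on_def
proof (intro ballI impI)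
 fix f g assume fg: "f : tips A" "g : tips A" "f ~= g"
 note fm = R_in(1)[OF tipsD(1)[OF fg(1)]] and gm = R_in(1)[OF tipsD(1)[OF fg(2)]]
 have "~ (z : up f & z : up g)" for z
  using common_above_comparable[OF fm gm, of z] common_above_comparable[OF gm fm, of z]
   tipsD(3)[OF fg(1) tipsD(1)[OF fg(2)]] tipsD(3)[OF fg(2) tipsD(1)[OF fg(1)]] fg(3) linear[of "ht f" "ht g"] by blast
 then show "up f Int up g = {}" by blast
qed

text \<open>The cones over tips are disjoint, lie in the region, and have mass at least
  \<open>h\<close> each, except possibly for the root.\<close>

lemma tips_finite: "finite (tips A)"
proof (rule ccontr)
 assume "infinite (tips A)"
 then have inf: "infinite (tips A - {ro})" by simp
 obtain a where a: "em mu A = ennreal a" "0 <= a" using finA by (cases "em mu A") auto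
 obtain k :: nat where k: "a / h < real k" using reals_Archimedean2 by blast
 obtain F where F: "F <= tips A - {ro}" "finite F" "card F = k" using infinite_arbitrarily_large[OF inf] by blast
 have Fm: "f : Pt" if "f : F" for f using tipsD(1) R_in(1) F(1) that by blast
 have disj: "disjoint_family_on up F"
  by (rule disjoint_family_on_mono[OF _ tips_disjoint]) (use F(1) in auto)
 have "of_nat k * ennreal h = (SUM f:F. ennreal h)" using F(3) by simp
 also have "... <= (SUM f:F. em mu (up f))"
  using F(1) tipsD(1) by (intro sum_mono R_mass) auto
 also have "... = em mu (UN f:F. up f)"
  using above_borel Fm adm_sets by (intro sum_emeasure disj F(2)) auto
 also have "... <= em mu A" using tipsD(4) F(1) by (intro emeasure_mono A_sets) blast
 finally have "ennreal (real k * h) <= ennreal a" using a(1) h by (simp add: ennreal_mult ennreal_of_nat_eq_real_of_nat)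
 then show False using k a(2) h by (simp add: ennreal_le_iff field_simps)
qed

text \<open>An antichain that meets every branch of \<open>R\<close> in the region, so that
  \<open>branches Q\<close> counts the components of \<open>R\<close> without a point.\<close>

abbreviation Q where "Q == tips A Un D"

lemma Q_facts: "finite Q" "Q <= R" "Q <= Pt" "Q <= up si"
 "!!p q. p : Q ==> q : Q ==> q : up p ==> q = p"
proof -
 show "finite Q" "Q <= R" using tips_finite D tipsD(1) by auto
 then show "Q <= Pt" using R_in(1) by auto
 show "Q <= up si" using tipsD(2) D(3) unfolding A_in by blast
 fix p q assume pq: "p : Q" "q : Q" "q : up p"
 show "q = p"
 proof (cases "p : tips A")
  case True
  then show ?thesis using tipsD(3)[OF True] \<open>Q <= R\<close> pq by blast
 next
  case False
  then have p: "p : D" using pq by simp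
  then have "q : D" using pq tipsD(2)[of q] unfolding A_in by blast
  then show ?thesis using D(5) p pq(3) by simp
 qed
qed

text \<open>Over a point of \<open>R\<close> in the region there is either a point of
  \<open>D\<close>, or the whole cone stays in the region, has finite mass, and contains a tip by
  \<open>tip_above\<close>.\<close>

lemma cover:
 assumes b: "b : A" and x: "x : R" "x : up b" "x ~= b"
 shows "EX q:Q. ht b < gp x q"
proof -
 have bm: "b : Pt" and xm: "x : Pt" using b A_space x(1) R_in(1) by auto
 have bx: "ht b < ht x" by (rule above_strict[OF bm x(2,3)])
 have xsi: "x : up si" using above_trans[OF R_in(1)[OF si] _ x(2)] b unfolding A_in by simp
 show ?thesis
 proof (cases "x : A")
  case False
  then obtain d where d: "d : D" "x : up d" using not_in_A[OF xsi] by blast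
  have dm: "d : Pt" using d D(2) R_in(1) by auto
  have "ht b < ht d"
   using common_above_comparable[OF dm bm d(2) x(2)] b d(1) unfolding A_in by force
  then have "ht b < gp x d" using above_iff[OF dm] d(2) gp_commute[of d x] by simp
  then show ?thesis using d(1) by blast
 next
  case True
  show ?thesis
  proof (cases "EX d:D. d : up x")
   case True
   then obtain d where d: "d : D" "d : up x" by blast
   then have "gp x d = ht x" using above_iff[OF xm] by simp
   then show ?thesis using d(1) bx by (intro bexI[of _ d]) simp_all
  next
   case False
   have xA: "up x <= A" using above_tip_in_A[OF True] False by blast
   have "em mu (up x) < \<infinity>" using emeasure_mono[OF xA A_sets] finA by simp
   then obtain l where l: "l : R" "l : up x" "ALL y:R. y : up l --> y = l"
    using tip_above[OF x(1)] by blast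
   have "l : tips A" unfolding tips_def using l xA by auto
   moreover have "gp x l = ht x" using above_iff[OF xm] l(2) by simp
   ultimately show ?thesis using bx by (intro bexI[of _ l]) simp_all
  qed
 qed
qed

lemma Q_nonempty: "Q ~= {}"
proof (cases "D = {}")
 case True
 have "A = up si" unfolding A_def off_def True using above_subset by auto
 then obtain l where l: "l : R" "l : A" "ALL y:R. y : up l --> y = l"
  using tip_above[OF si] finA by auto
 have "l : tips A" unfolding tips_def using l by auto
 then show ?thesis by blast
qed simp

lemma ncomp_region:
 assumes b: "b : R" "b : A"
 shows "ncomp (submetric m R) b = of_nat (branches Q b + (if b = ro then 0 else 1))"
  and "branches Q b = 0 \<longleftrightarrow> b : tips A"
proof -
 show "ncomp (submetric m R) b = of_nat (branches Q b + (if b = ro then 0 else 1))"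
  by (rule ncomp_branches[OF R_subtree b(1) Q_facts(1,3)]) (use Q_facts(2) cover[OF b(2)] in \<open>auto simp: over_def\<close>)
 have bm: "b : Pt" using R_in(1)[OF b(1)] .
 have "branches Q b = 0 \<longleftrightarrow> over Q b = {}"
  unfolding branches_def using Q_facts(1) by (simp add: over_def card_eq_0_iff)
 also have "... \<longleftrightarrow> b : tips A"
 proof
  assume e: "over Q b = {}"
  have "y = b" if y: "y : R" "y : up b" for y
  proof (rule ccontr)
   assume "y ~= b"
   then obtain q where q: "q : Q" "ht b < gp y q" using cover[OF b(2) y] by blast
   then have "q : over Q b" using over_gp[OF bm y(2) _ q(2)] Q_facts(3) overI[OF bm q(1)] by auto
   then show False using e by simp
  qed
  then show "b : tips A" unfolding tips_def using b by auto
 next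
  assume "b : tips A"
  then show "over Q b = {}" using tipsD(3)[of b] Q_facts(2) unfolding over_def by blast
 qed
 finally show "branches Q b = 0 \<longleftrightarrow> b : tips A" .
qed

lemma Lf_region: "Lf (submetric m R) ro Int A = tips A - {ro}"
proof (intro equalityI subsetI)
 fix b assume "b : Lf (submetric m R) ro Int A"
 then have b: "b : R" "b : A" "b ~= ro" "ncomp (submetric m R) b = 1" unfolding Lf_def by auto
 have "(of_nat (branches Q b + 1) :: ennreal) = of_nat 1" using ncomp_region(1)[OF b(1,2)] b(3,4) by simp
 then have "branches Q b = 0" unfolding of_nat_eq_iff by simp
 then show "b : tips A - {ro}" using ncomp_region(2)[OF b(1,2)] b(3) by simp
next
 fix b assume b: "b : tips A - {ro}"
 then have b': "b : R" "b : A" using tipsD by auto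
 have "branches Q b = 0" using ncomp_region(2)[OF b'] b by simp
 then show "b : Lf (submetric m R) ro Int A"
  using ncomp_region(1)[OF b'] b b' R_in(1) unfolding Lf_def by auto
qed

text \<open>Membership in the region is decided by cones over points of \<open>R\<close>, so
  projecting onto \<open>R\<close> does not change it; and precisely the cone over a tip is sent to
  that tip. Hence the preimage of the region without leaves is the region without the cones over the
  leaves.\<close>

lemma projected_mass:
 "enn2real (em (Pr_meas m ro R mu) (A Int (R - Lf (submetric m R) ro))) =
   enn2real (em mu A) - (SUM l:tips A - {ro}. enn2real (em mu (up l)))"
 "em (Pr_meas m ro R mu) (A Int (R - Lf (submetric m R) ro)) < \<infinity>"
 "!!l. l : tips A ==> em mu (up l) < \<infinity>"
proof -
 let ?f = "tree_proj m ro R" and ?T = "tips A - {ro}"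
 let ?B = "A Int (R - Lf (submetric m R) ro)"
 note f = tree_proj[OF R_subtree R_closed]
 have fA: "?f x : A \<longleftrightarrow> x : A" if x: "x : Pt" for x
 proof -
  have "?f x : up r \<longleftrightarrow> x : up r" if "r : R" for r
   using f(3)[OF x that] above_trans[OF R_in(1)[OF that] _ f(2)[OF x]] by blast
  then show ?thesis unfolding A_in using si D(2) by auto
 qed
 have fl: "?f x = l \<longleftrightarrow> x : up l" if x: "x : Pt" and l: "l : tips A" for x l
  using f(2)[OF x] f(3)[OF x tipsD(1)[OF l]] tipsD(3)[OF l f(1)[OF x]] by blast
 have sp: "space mu = Pt" using sets_eq_imp_space_eq[OF adm_sets] by simp
 have pre: "?f -` ?B Int space mu = A - (UN l:?T. up l)"
 proof (intro equalityI subsetI)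
  fix x assume "x : ?f -` ?B Int space mu"
  then have x: "x : Pt" "?f x : A" "?f x ~: Lf (submetric m R) ro" unfolding sp by auto
  have "?f x ~: ?T" using x(2,3) Lf_region by blast
  then show "x : A - (UN l:?T. up l)" using fA[OF x(1)] x(2) fl[OF x(1)] by blast
 next
  fix x assume x: "x : A - (UN l:?T. up l)"
  then have xm: "x : Pt" using A_space by auto
  have "?f x ~: ?T" using x fl[OF xm] by blast
  then show "x : ?f -` ?B Int space mu" using x fA[OF xm] f(1)[OF xm] Lf_region xm unfolding sp by blast
 qed
 have Bb: "?B : Bor"
 proof -
  have "?B = A Int R - ?T" using Lf_region by blast
  moreover have "?T : Bor"
   by (rule sets.countable) (use singleton_borel tipsD(1) R_in(1) tips_finite in \<open>auto intro: countable_finite\<close>)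
  ultimately show ?thesis using A_sets R_closed adm_sets by auto
 qed
 have "?f : measurable mu (mb m)"
  using tree_proj_measurable[OF R_subtree R_closed] by (simp add: measurable_cong_sets[OF adm_sets refl])
 then have P: "em (Pr_meas m ro R mu) ?B = em mu (A - (UN l:?T. up l))"
  unfolding Pr_meas_def by (simp only: emeasure_distr[OF _ Bb] pre)
 have fT: "finite ?T" using tips_finite by simp
 have ab: "up l : sets mu" "em mu (up l) < \<infinity>" if "l : tips A" for l
  using above_borel[OF R_in(1)[OF tipsD(1)[OF that]]] adm_sets emeasure_mono[OF tipsD(4)[OF that] A_sets] finA by auto
 have disj: "disjoint_family_on up ?T" by (rule disjoint_family_on_mono[OF _ tips_disjoint]) auto
 have sub: "(UN l:?T. up l) <= A" using tipsD(4) by blast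
 have Ub: "(UN l:?T. up l) : sets mu" using ab fT by auto
 have finU: "em mu (UN l:?T. up l) < \<infinity>" using emeasure_mono[OF sub A_sets] finA by simp
 have "measure mu (A - (UN l:?T. up l)) = measure mu A - measure mu (UN l:?T. up l)"
  by (rule measure_Diff) (use finA Ub A_sets sub in auto)
 also have "measure mu (UN l:?T. up l) = (SUM l:?T. measure mu (up l))"
  by (rule measure_finite_Union[OF fT _ disj]) (use ab in \<open>auto simp: less_top[symmetric]\<close>)
 finally show "enn2real (em (Pr_meas m ro R mu) ?B) =
   enn2real (em mu A) - (SUM l:tips A - {ro}. enn2real (em mu (up l)))"
  unfolding P measure_def .
 have "em mu (A - (UN l:?T. up l)) <= em mu A" by (rule emeasure_mono[OF _ A_sets]) auto
 then show "em (Pr_meas m ro R mu) ?B < \<infinity>" unfolding P using finA by simp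
 show "!!l. l : tips A ==> em mu (up l) < \<infinity>" by (rule ab(2))
qed

lemma branch_points_region: "{b : Pt. 2 <= branches Q b} <= R Int A"
proof
 fix b assume "b : {b : Pt. 2 <= branches Q b}"
 then have b: "b : Pt" "2 <= branches Q b" by auto
 obtain q where q: "q : Q" "q : up b" "q ~= b"
  and bs: "b : up si"
  using branches_ge2_location[OF Q_facts(1,4) R_in(1)[OF si] b] by blast
 have bR: "b : R" using R_below[OF _ b(1) q(2)] q(1) Q_facts(2) by blast
 have "b : A"
 proof (rule ccontr)
  assume "b ~: A"
  then obtain d where d: "d : D" "b : up d" using not_in_A[OF bs] by blast
  have dm: "d : Pt" using d D(2) R_in(1) by auto
  have "q : up d" by (rule above_trans[OF dm d(2) q(2)])
  then have "q = d" using Q_facts(5)[of d q] d(1) q(1) by simp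
  then show False using above_antisym[OF dm d(2)] q by simp
 qed
 then show "b : R Int A" using bR by simp
qed

lemma Bp_region: "Bp (submetric m R) ro Int A = {b : Pt. 2 <= branches Q b} - {ro}"
proof (intro equalityI subsetI)
 fix b assume "b : Bp (submetric m R) ro Int A"
 then have b: "b : R" "b : A" "b ~= ro" "3 <= ncomp (submetric m R) b" unfolding Bp_def by auto
 have "(of_nat 3 :: ennreal) <= of_nat (branches Q b + 1)" using ncomp_region(1)[OF b(1,2)] b(3,4) by simp
 then have "3 <= branches Q b + 1" unfolding of_nat_le_iff .
 then show "b : {b : Pt. 2 <= branches Q b} - {ro}" using b(3) R_in(1)[OF b(1)] by simp
next
 fix b assume b: "b : {b : Pt. 2 <= branches Q b} - {ro}"
 then have b': "b : R" "b : A" using branch_points_region by auto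
 have "(of_nat 3 :: ennreal) <= of_nat (branches Q b + (if b = ro then 0 else 1))" using b by (intro of_nat_mono) simp
 then have "3 <= ncomp (submetric m R) b" unfolding ncomp_region(1)[OF b'] by simp
 then show "b : Bp (submetric m R) ro Int A" using b b' R_in(1) unfolding Bp_def by auto
qed

text \<open>The projected mass and the masses over the leaves recombine to the mass of the region.
  The excess numbers of branches add up to the number of tips plus \<open>card D\<close> minus 1 by
  \<open>branches_sum\<close>, and the tips cancel against the \<open>h\<close> subtracted at each
  leaf.\<close>

lemma erase_value_region: "erase_value A = ereal (enn2real (em mu A) + h * (real (card D) - 1))"
proof -
 let ?mR = "submetric m R" and ?L = "tips A - {ro}" and ?T = "{b : Pt. 2 <= branches Q b}"
 define p where "p = enn2real (em (Pr_meas m ro R mu) (A Int (R - Lf (submetric m R) ro)))"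
 define a where "a l = enn2real (em mu (up l))" for l
 have P: "em (Pr_meas m ro R mu) (A Int (R - Lf ?mR ro)) = ennreal p"
  unfolding p_def using projected_mass(2) by simp
 have p: "p = enn2real (em mu A) - (SUM l:?L. a l)" "0 <= p"
  by (simp_all only: p_def a_def projected_mass(1)[symmetric] enn2real_nonneg)
 have aL: "em mu (up l) = ennreal (a l)" "h <= a l" if "l : ?L" for l
 proof -
  show e: "em mu (up l) = ennreal (a l)" unfolding a_def using projected_mass(3)[of l] that by simp
  show "h <= a l" using R_mass[of l] tipsD(1)[of l] that h unfolding e by (auto simp: ennreal_le_iff2)
 qed
 have fT: "finite ?T" and eul: "(SUM b:?T. branches Q b - 1) = card Q - 1"
  using branches_sum[OF Q_facts(1) Q_nonempty Q_facts(3,5)] by blast+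
 have cQ: "card Q = card (tips A) + card D"
  by (rule card_Un_disjoint[OF tips_finite D(1)]) (use D_outside tipsD(2) in blast)
 have cQ0: "0 < card Q" using Q_nonempty Q_facts(1) by (simp add: card_gt_0_iff)
 have leaves: "(INFSUM si:Lf ?mR ro. (em mu (up si) - ennreal h) * indicator A si) = ennreal (SUM l:?L. a l - h)"
 proof -
  have "finite (Lf ?mR ro Int A)" unfolding Lf_region using tips_finite by simp
  then have "(INFSUM si:Lf ?mR ro. (em mu (up si) - ennreal h) * indicator A si) = (SUM l:?L. em mu (up l) - ennreal h)"
   by (subst infsum_indicator_finite) (simp_all only: Lf_region)
  also have "... = (SUM l:?L. ennreal (a l - h))" using aL h by (intro sum.cong refl) (simp add: ennreal_minus)
  also have "... = ennreal (SUM l:?L. a l - h)" by (rule sum_ennreal) (use aL(2) in auto)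
  finally show ?thesis .
 qed
 have bps: "(INFSUM si:Bp ?mR ro. (ncomp ?mR si - 2) * indicator A si) = ennreal (SUM b:?T - {ro}. real (branches Q b) - 1)"
 proof -
  have "finite (Bp ?mR ro Int A)" unfolding Bp_region using fT by simp
  then have "(INFSUM si:Bp ?mR ro. (ncomp ?mR si - 2) * indicator A si) = (SUM b:?T - {ro}. ncomp ?mR b - 2)"
   by (subst infsum_indicator_finite) (simp_all only: Bp_region)
  also have "... = (SUM b:?T - {ro}. ennreal (real (branches Q b) - 1))"
  proof (intro sum.cong refl)
   fix b assume b: "b : ?T - {ro}"
   then have b': "b : R" "b : A" using branch_points_region by auto
   have "ncomp ?mR b = ennreal (real (branches Q b) + 1)"
    unfolding ncomp_region(1)[OF b'] using b by (simp add: ennreal_of_nat_eq_real_of_nat)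
   then show "ncomp ?mR b - 2 = ennreal (real (branches Q b) - 1)" using ennreal_minus[of 2 "real (branches Q b) + 1"] by simp
  qed
  also have "... = ennreal (SUM b:?T - {ro}. real (branches Q b) - 1)" by (rule sum_ennreal) auto
  finally show ?thesis .
 qed
 \<comment> \<open>Contribution of the root in units of \<open>h\<close>. It is -1 if
   \<open>R\<close> is the root alone, which is why the balance is drawn in the reals.\<close>
 define k where "k = (if ro : A then real (branches Q ro) - 1 else 0)"
 have root: "ereal h * (enn2ereal (ncomp ?mR ro) - 1) * indicator A ro = ereal (h * k)"
 proof (cases "ro : A")
  case True
  have "ncomp ?mR ro = ennreal (real (branches Q ro))"
   unfolding ncomp_region(1)[OF R_in(2) True] by (simp add: ennreal_of_nat_eq_real_of_nat)
  then show ?thesis using True unfolding k_def by (simp add: one_ereal_def)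
 qed (simp add: k_def)
 have total: "(SUM b:?T - {ro}. real (branches Q b) - 1) + k = real (card ?L) + real (card D) - 1"
 proof -
  have "(SUM b:?T. real (branches Q b) - 1) = real (SUM b:?T. branches Q b - 1)" by (simp add: of_nat_diff)
  then have S: "(SUM b:?T. real (branches Q b) - 1) = real (card (tips A)) + real (card D) - 1"
   unfolding eul using cQ cQ0 by (simp add: of_nat_diff)
  show ?thesis
  proof (cases "ro : A")
   case False
   then have "ro ~: ?T" "ro ~: tips A" using branch_points_region tipsD(2) by blast+
   then show ?thesis using S False unfolding k_def by simp
  next
   case True
   note b0 = ncomp_region(2)[OF R_in(2) True]
   \<comment> \<open>The root enters the sums in three ways: as a tip that is not a leaf, as neither
     tip nor branching, or as a branching that is counted apart from \<open>Bp\<close>.\<close>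
   consider "branches Q ro = 0" | "branches Q ro = 1" | "2 <= branches Q ro" by linarith
   then show ?thesis
   proof cases
    case 1
    then have "ro : tips A" "ro ~: ?T" using b0 by auto
    moreover have "card (tips A) = Suc (card ?L)" by (rule card.remove[OF tips_finite \<open>ro : tips A\<close>])
    ultimately show ?thesis using S True 1 unfolding k_def by simp
   next
    case 2
    then have "ro ~: tips A" "ro ~: ?T" using b0 by auto
    then show ?thesis using S True 2 unfolding k_def by simp
   next
    case 3
    then have "ro ~: tips A" "ro : ?T" using b0 by auto
    then show ?thesis using S True sum.remove[OF fT \<open>ro : ?T\<close>, of "%b. real (branches Q b) - 1"] unfolding k_def by simp
   qed
  qed
 qed
 have nn: "0 <= (SUM l:?L. a l - h)" by (rule sum_nonneg) (simp only: diff_ge_0_iff_ge aL(2))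
 have nn2: "0 <= (SUM b:?T - {ro}. real (branches Q b) - 1)" by (rule sum_nonneg) auto
 have "erase_value A = ereal (p + (SUM l:?L. a l - h) + h * (SUM b:?T - {ro}. real (branches Q b) - 1) + h * k)"
  unfolding erase_value_def root P leaves bps using nn nn2 p(2) h
  by (simp add: ennreal_mult[symmetric] ennreal_plus[symmetric] enn2ereal_ennreal del: ennreal_plus)
 also have "p + (SUM l:?L. a l - h) + h * (SUM b:?T - {ro}. real (branches Q b) - 1) + h * k
   = enn2real (em mu A) - h * real (card ?L) + h * ((SUM b:?T - {ro}. real (branches Q b) - 1) + k)"
  unfolding p(1) by (simp add: sum_subtractf algebra_simps)
 also have "... = enn2real (em mu A) + h * (real (card D) - 1)" unfolding total by (simp add: algebra_simps)
 finally show ?thesis .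
qed

end

end

lemma e2ennreal_ereal: "e2ennreal (ereal x) = ennreal x"
 unfolding ennreal_def by (cases "0 <= x") (simp_all add: max_def e2ennreal_neg ennreal_neg)

lemma e2ennreal_0: "e2ennreal 0 = 0"
 using e2ennreal_ereal[of 0] by (simp add: zero_ereal_def)

context erasing
begin

text \<open>Countability makes the set of leaves Borel, as the countable additivity of the erased
  measure requires. Leaves below height \<open>n\<close> lie off the heavy cones of level
  \<open>Suc n\<close>, in a region with finitely many tips.\<close>

lemma Lf_countable: "countable (Lf (submetric m R) ro)"
proof -
 have fin: "finite (Lf (submetric m R) ro Int off (heavy_at mu s))" if s: "0 < s" for s
 proof -
  have hm: "d : heavy_at mu s ==> d : Pt & ht d = s" for d unfolding heavy_at_def by auto
  have "Lf (submetric m R) ro Int (up ro Int off (heavy_at mu s)) = tips (up ro Int off (heavy_at mu s)) - {ro}"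
  proof (rule Lf_region[OF R_in(2) adm_heavy(1)[OF s] heavy_subset_R _ _ _ refl])
   show "ro ~: heavy_at mu s" using s unfolding heavy_at_def by auto
   show "q = p" if "p : heavy_at mu s" "q : heavy_at mu s" "q : up p" for p q
    by (rule level_antichain[of "heavy_at mu s" s]) (use hm that in auto)
  qed (use hm adm_heavy(2)[OF s] in \<open>auto simp: off_def Int_absorb1\<close>)
  moreover have "finite (tips (up ro Int off (heavy_at mu s)))"
  proof (rule tips_finite[OF R_in(2) adm_heavy(1)[OF s] heavy_subset_R _ _ _ refl])
   show "ro ~: heavy_at mu s" using s unfolding heavy_at_def by auto
   show "q = p" if "p : heavy_at mu s" "q : heavy_at mu s" "q : up p" for p q
    by (rule level_antichain[of "heavy_at mu s" s]) (use hm that in auto)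
  qed (use hm adm_heavy(2)[OF s] in \<open>auto simp: off_def Int_absorb1\<close>)
  moreover have "up ro Int off (heavy_at mu s) = off (heavy_at mu s)" unfolding off_def by auto
  ultimately show ?thesis by simp
 qed
 have "Lf (submetric m R) ro <= (UN n. Lf (submetric m R) ro Int off (heavy_at mu (Suc n)))"
 proof
  fix l assume l: "l : Lf (submetric m R) ro"
  then have lm: "l : Pt" unfolding Lf_def by simp
  obtain n :: nat where n: "ht l < real n" using reals_Archimedean2 by blast
  have "l : off (heavy_at mu (Suc n))" unfolding off_def heavy_at_def using lm n above_ht by fastforce
  then show "l : (UN n. Lf (submetric m R) ro Int off (heavy_at mu (Suc n)))" using l by blast
 qed
 moreover have "countable (UN n. Lf (submetric m R) ro Int off (heavy_at mu (Suc n)))"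
  by (rule countable_UN) (use fin in \<open>auto intro: countable_finite\<close>)
 ultimately show ?thesis by (rule countable_subset)
qed

lemma R_trivial: "em mu (Pt) < ennreal h ==> R = {ro}"
proof -
 assume small: "em mu (Pt) < ennreal h"
 have "x = ro" if x: "x : R" for x
 proof (rule ccontr)
  assume "x ~= ro"
  then have "ennreal h <= em mu (up x)" by (rule R_mass[OF x])
  also have "... <= em mu (Pt)"
   using sets.top[of mu] sets_eq_imp_space_eq[OF adm_sets] by (intro emeasure_mono above_subset) simp
  finally show False using small by simp
 qed
 then show ?thesis using R_in(2) by blast
qed

lemma sets_erase: "sets (erase m ro h mu) = Bor"
proof -
 have "sigma_algebra (Pt) (Bor)"
  using sets.sigma_algebra_axioms[of "mb m"] by simp
 then show ?thesis unfolding erase_def Let_def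
  using adm_sets sets.space_closed[of "mb m"] by (simp add: sigma_algebra.sigma_sets_eq)
qed

lemma space_erase: "space (erase m ro h mu) = Pt"
 using sets_eq_imp_space_eq[OF sets_erase] by simp

text \<open>The root term has the factor \<open>ncomp - 1\<close>, which is negative if
  \<open>R\<close> is the root alone. In that case everything projects to the root and the value is
  a point mass of weight \<open>mu(T) - h\<close> there; otherwise each summand is nonnegative and
  countably additive by itself.\<close>

lemma erase_value_countably_additive:
 assumes big: "ennreal h <= em mu (Pt)"
 shows "countably_additive (Bor) (%B. e2ennreal (erase_value B))"
proof -
 let ?mR = "submetric m R" and ?P = "Pr_meas m ro R mu"
 have RL: "R - Lf ?mR ro : Bor"
 proof (rule sets.Diff[OF borel_closed[OF R_closed]])
  show "Lf ?mR ro : Bor"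
   by (rule sets.countable[OF _ Lf_countable]) (use R_in(1) singleton_borel in \<open>auto simp: Lf_def\<close>)
 qed
 have add: "countably_additive \<A> (%B. f B + g B)" if "countably_additive \<A> f" "countably_additive \<A> g" for \<A> and f g :: "'a set => ennreal"
  using that unfolding countably_additive_def by (simp add: suminf_add[symmetric])
 have scale: "countably_additive \<A> (%B. c * f B)" if "countably_additive \<A> f" for \<A> c and f :: "'a set => ennreal"
  using that unfolding countably_additive_def by simp
 have dirac: "countably_additive \<A> (%B. c * indicator B ro)" for \<A> and c :: ennreal
  by (rule scale) (simp add: countably_additive_def suminf_indicator)
 let ?g = "%B. em ?P (B Int (R - Lf ?mR ro))
   + (INFSUM si:Lf ?mR ro. (em mu (up si) - ennreal h) * indicator B si)
   + ennreal h * (INFSUM si:Bp ?mR ro. (ncomp ?mR si - 2) * indicator B si)"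
 have sP: "sets ?P = Bor" unfolding Pr_meas_def by simp
 have "countably_additive (Bor) (%B. em ?P (B Int (R - Lf ?mR ro)))"
  unfolding countably_additive_def
 proof (intro allI impI)
  fix B :: "nat => 'a set" assume B: "range B <= Bor" "disjoint_family B"
  have "(\<Sum>i. em ?P (B i Int (R - Lf ?mR ro))) = em ?P (UN i. B i Int (R - Lf ?mR ro))"
   by (rule suminf_emeasure) (use B RL sP in \<open>auto simp: disjoint_family_on_def\<close>)
  then show "(\<Sum>i. em ?P (B i Int (R - Lf ?mR ro))) = em ?P (\<Union> (range B) Int (R - Lf ?mR ro))"
   by (simp only: UN_extend_simps(4))
 qed
 then have g: "countably_additive (Bor) ?g"
  by (intro add scale countably_additive_point_masses)
 show ?thesis
 proof (cases "R = {ro}")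
  case False
  have "1 <= ncomp ?mR ro"
  proof -
   let ?X = "subtopology (mtopology_of ?mR) (mspace ?mR - {ro})"
   obtain x where "x : R" "x ~= ro" using False R_in(2) by blast
   then have "topspace ?X ~= {}" using R_in(1) by auto
   then have "connected_components_of ?X ~= {}" unfolding connected_components_of_def by (simp only: image_is_empty) simp
   then obtain C where C: "C : connected_components_of ?X" by (meson ex_in_conv)
   have "ecard {C} <= ncomp ?mR ro" unfolding ncomp_def ecard_def by (rule emeasure_mono) (use C in auto)
   then show ?thesis unfolding ecard_def by (simp add: emeasure_count_space)
  qed
  then have n: "enn2ereal (ncomp ?mR ro) - 1 = enn2ereal (ncomp ?mR ro - 1)"
   by (simp add: minus_ennreal.rep_eq one_ennreal.rep_eq less_eq_ennreal.rep_eq ereal_diff_positive max_absorb2)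
  have "e2ennreal (erase_value B) = ?g B + (ennreal h * (ncomp ?mR ro - 1)) * indicator B ro" for B
  proof -
   have "ereal h * enn2ereal (ncomp ?mR ro - 1) * indicator B ro = enn2ereal ((ennreal h * (ncomp ?mR ro - 1)) * indicator B ro)"
    using h by (cases "ro : B") (simp_all add: times_ennreal.rep_eq enn2ereal_ennreal zero_ennreal.rep_eq)
   then show ?thesis unfolding erase_value_def n by (simp only: plus_ennreal.rep_eq[symmetric] e2ennreal_enn2ereal)
  qed
  then show ?thesis using add[OF g dirac] by simp
 next
  case True
  have e: "mspace ?mR - {ro} = {}" using True by auto
  have n0: "ncomp ?mR ro = 0" unfolding ncomp_def ecard_def e by (simp add: connected_components_of_def)
  have L0: "Lf ?mR ro = {}" "Bp ?mR ro = {}" unfolding Lf_def Bp_def using True by auto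
  have P: "em ?P (B Int {ro}) = em mu (Pt) * indicator B ro" if B: "B : Bor" for B
  proof -
   have f: "tree_proj m ro R : measurable mu (mb m)"
    using tree_proj_measurable[OF R_subtree R_closed] by (simp add: measurable_cong_sets[OF adm_sets refl])
   have "tree_proj m ro R -` (B Int {ro}) Int space mu = (if ro : B then Pt else {})"
    using tree_proj(1)[OF R_subtree R_closed] True sets_eq_imp_space_eq[OF adm_sets] by auto
   then show ?thesis unfolding Pr_meas_def using emeasure_distr[OF f, of "B Int {ro}"] B singleton_borel[OF root_in] by auto
  qed
  then have "e2ennreal (erase_value B) = (em mu (Pt) - ennreal h) * indicator B ro" if "B : Bor" for B
  proof (cases "ro : B")
   case in_B: True
   have "erase_value B = enn2ereal (em mu (Pt)) + ereal (- h)"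
    unfolding erase_value_def n0 L0 using True in_B P[OF that] by (simp add: zero_ennreal.rep_eq)
   then show ?thesis using in_B big h
    by (cases "em mu (Pt)") (auto simp: enn2ereal_ennreal ennreal_minus e2ennreal_ereal top_ennreal.rep_eq)
  next
   case False
   then show ?thesis unfolding erase_value_def n0 L0 using True by (simp add: zero_ennreal.rep_eq e2ennreal_0)
  qed
  then show ?thesis using dirac[of "Bor" "em mu (Pt) - ennreal h"]
   unfolding countably_additive_def by (simp add: image_subset_iff)
 qed
qed

lemma erase_emeasure:
 assumes big: "ennreal h <= em mu (Pt)" and B: "B : Bor"
 shows "em (erase m ro h mu) B = e2ennreal (erase_value B)"
proof -
 have E: "erase m ro h mu = measure_of (Pt) (Bor) (%B. e2ennreal (erase_value B))"
  unfolding erase_def Let_def erase_value_def using big by (simp only: not_less[symmetric] if_False)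
 show ?thesis unfolding E
 proof (rule emeasure_measure_of_sigma[OF _ _ erase_value_countably_additive[OF big] B])
  show "sigma_algebra (Pt) (Bor)" using sets.sigma_algebra_axioms[of "mb m"] by simp
  show "positive (Bor) (%B. e2ennreal (erase_value B))"
   unfolding positive_def erase_value_def by (simp add: infsum_0 zero_ennreal.rep_eq e2ennreal_0)
 qed
qed

lemma erase_null:
 assumes B: "B : Bor" "B Int R = {}"
 shows "em (erase m ro h mu) B = 0"
proof (cases "ennreal h <= em mu (Pt)")
 case True
 have 1: "B Int (R - Lf (submetric m R) ro) = {}" "ro ~: B" using B(2) R_in(2) by auto
 have 2: "(INFSUM si:Lf (submetric m R) ro. f si * indicator B si) = (0 :: ennreal)" for f
  by (rule infsum_0) (use B(2) in \<open>auto simp: Lf_def indicator_def\<close>)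
 have 3: "(INFSUM si:Bp (submetric m R) ro. f si * indicator B si) = (0 :: ennreal)" for f
  by (rule infsum_0) (use B(2) in \<open>auto simp: Bp_def indicator_def\<close>)
 show ?thesis unfolding erase_emeasure[OF True B(1)] erase_value_def 1(1) 2 3 using 1(2) by (simp add: zero_ennreal.rep_eq e2ennreal_0)
next
 case False
 then show ?thesis unfolding erase_def by (simp add: not_le)
qed

text \<open>If the total mass is below \<open>h\<close>, then \<open>R\<close> is the root,
  \<open>D\<close> is empty, and the right-hand side is \<open>ennreal\<close> of a number not above
  0, hence 0, in accordance with the first case of \<open>erase\<close>.\<close>

theorem erase_region:
 assumes si: "si : R" and D: "finite D" "D <= R" "!!d. d : D ==> d : up si" "si ~: D"
   "!!p q. p : D ==> q : D ==> q : up p ==> q = p"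
  and fin: "em mu (up si Int off D) < \<infinity>"
 shows "em (erase m ro h mu) (up si Int off D) =
  ennreal (enn2real (em mu (up si Int off D)) + h * (real (card D) - 1))"
proof (cases "ennreal h <= em mu (Pt)")
 case True
 have "up si Int off D : Bor"
  using above_borel[OF R_in(1)[OF si]] off_borel[OF D(1)] D(2) R_in(1) by auto
 from erase_emeasure[OF True this] show ?thesis
  by (simp only: erase_value_region[OF si D refl fin] e2ennreal_ereal)
next
 case False
 then have small: "em mu (Pt) < ennreal h" by simp
 have "si = ro" "D = {}" using R_trivial[OF small] si D(2,4) by auto
 then have A: "up si Int off D = Pt" unfolding off_def by simp
 have "enn2real (em mu (Pt)) <= h" using small by (cases "em mu (Pt)") (auto simp: ennreal_less_iff)
 then show ?thesis unfolding A using \<open>D = {}\<close> small unfolding erase_def by (simp add: ennreal_neg)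
qed

end

section \<open>Cut-off measures and short infinite edges\<close>

context rooted_tree
begin

definition cut_at :: "'a set => 'a measure => 'a set => real => 'a measure" where
 "cut_at U mu D c = measure_of (Pt) (Bor)
   (%A. em (mrestr mu U) A + ennreal c * (SUM si:D. indicator A si))"

lemma sets_cut_at [simp]: "sets (cut_at U mu D c) = Bor"
 using sets.sigma_algebra_axioms[of "mb m"] sets.space_closed[of "mb m"]
 unfolding cut_at_def by (simp add: sigma_algebra.sigma_sets_eq)

lemma space_cut_at [simp]: "space (cut_at U mu D c) = Pt"
 using sets_eq_imp_space_eq[OF sets_cut_at] by simp

lemma emeasure_cut_at:
 assumes mu: "sets mu = Bor" and U: "U : sets mu" and D: "finite D" and A: "A : Bor"
 shows "em (cut_at U mu D c) A = em mu (A Int U) + ennreal c * of_nat (card (D Int A))"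
proof -
 let ?f = "%A. em (mrestr mu U) A + ennreal c * (SUM si:D. indicator A si)"
 have "em (cut_at U mu D c) A = ?f A"
  unfolding cut_at_def
 proof (rule emeasure_measure_of_sigma[OF _ _ _ A])
  show "sigma_algebra (Pt) (Bor)" using sets.sigma_algebra_axioms[of "mb m"] by simp
  show "positive (Bor) ?f" by (simp add: positive_def)
  show "countably_additive (Bor) ?f"
   unfolding countably_additive_def
  proof (intro allI impI)
   fix B :: "nat => 'a set" assume B: "range B <= Bor" "disjoint_family B"
   have 1: "(\<Sum>i. em (mrestr mu U) (B i)) = em (mrestr mu U) (UN i. B i)"
    by (rule suminf_emeasure) (use B mu in auto)
   have 2: "(\<Sum>i. SUM si:D. indicator (B i) si) = (SUM si:D. indicator (UN i. B i) si :: ennreal)"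
    using suminf_indicator[OF B(2)] by (subst suminf_sum) simp_all
   show "(\<Sum>i. ?f (B i)) = ?f (UN i. B i)"
    by (simp only: suminf_add[symmetric, OF summableI summableI] 1 ennreal_suminf_cmult 2)
  qed
 qed
 also have "(SUM si:D. indicator A si :: ennreal) = of_nat (card (D Int A))"
  using D by (simp add: indicator_def sum.If_cases)
 finally show ?thesis using emeasure_mrestr[OF U, of A] A mu by simp
qed

text \<open>The cones over \<open>D\<close> are removed together with the points of
  \<open>D\<close>, whereas \<open>Cut\<close> keeps these points. Masses of cones thus split
  without correction terms; the mass of \<open>D\<close> itself is accounted for where height
  measures are compared (\<open>height_cut\<close>).\<close>

abbreviation cutm :: "'a measure => 'a set => real => 'a measure" where
 "cutm mu D == cut_at (off D) mu D"

lemma emeasure_cutm: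
 assumes "sets mu = Bor" "finite D" "D <= Pt" "A : Bor"
 shows "em (cutm mu D c) A = em mu (A Int off D) + ennreal c * of_nat (card (D Int A))"
 using assms off_borel[OF assms(2,3)] by (intro emeasure_cut_at) auto

lemma finite_cutm:
 assumes "sets mu = Bor" "finite D" "D <= Pt" "em mu (off D) < \<infinity>"
 shows "finite_measure (cutm mu D c)"
proof
 have "Pt Int off D = off D" unfolding off_def by auto
 then show "em (cutm mu D c) (space (cutm mu D c)) ~= \<infinity>"
  using assms(4) emeasure_cutm[OF assms(1-3) sets.top[of "mb m", simplified]]
  by (simp add: ennreal_mult_eq_top_iff)
qed

lemma off_above:
 assumes "si : Pt" "D <= Pt" "!!d. d : D ==> ht si <= ht d"
 shows "up si Int off (D Int up si) = up si Int off D"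
proof -
 have "d : up si" if "z : up si" "d : D" "z : up d" for z d
  using common_above_comparable[OF assms(1) _ that(1,3) assms(3)[OF that(2)]] assms(2) that(2) by blast
 then show ?thesis unfolding off_def by blast
qed

text \<open>The heavy points one unit higher over \<open>b\<close> are finitely many and all leave
  \<open>b\<close> in the same direction, so they share ancestors up to some height
  \<open>g0\<close> above \<open>ht b\<close>; these ancestors are the points \<open>y\<close>. What
  lies over \<open>b\<close> but not over \<open>y\<close> avoids the heavy cones, so it has finite
  mass, and it shrinks to \<open>{b}\<close> as \<open>y\<close> descends to
  \<open>b\<close>.\<close>

lemma infinite_edge_above:
 assumes adm: "admissible mu" and b: "b : Pt" "0 < ht b" "em mu (up b) = \<infinity>" "em mu {b} = 0"
  and nb: "!!x y. x : up b ==> x ~= b ==> y : up b ==> y ~= b ==> ht b < gp x y" and et: "0 < et"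
 shows "EX t0>ht b. ALL t. ht b < t --> t < t0 --> (EX y:up b. ht y = t & em mu (up y) = \<infinity> &
  em mu (up b - up y) <= ennreal et)"
proof -
 have mu: "sets mu = Bor" using adm unfolding admissible_def by simp
 define s where "s = ht b + 1"
 define H where "H = heavy_at mu s"
 have s: "0 < s" "ht b < s" using b(2) unfolding s_def by auto
 have H: "finite H" "em mu (off H) < \<infinity>" "H <= Pt" "!!d. d : H ==> ht d = s & em mu (up d) = \<infinity>"
  using adm s(1) unfolding admissible_def H_def by (auto simp: heavy_at_def)
 have oH: "off H : sets mu" using off_borel[OF H(1,3)] mu by simp
 define F where "F = H Int up b"
 have "F ~= {}"
 proof
  assume "F = {}"
  then have "up b = up b Int off H"
   using off_above[OF b(1) H(3)] H(4) s(2) unfolding F_def off_def using above_subset by fastforce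
  then have "em mu (up b) <= em mu (off H)" by (intro emeasure_mono oH) blast
  then show False using b(3) H(2) by simp
 qed
 then obtain f where f: "f : F" by blast
 have Fb: "g : up b" "g ~= b" "g : Pt" "ht g = s" if "g : F" for g
  using that H(3,4) s(2) unfolding F_def by auto
 define g0 where "g0 = Min (gp f ` F)"
 have finF: "finite F" unfolding F_def using H(1) by simp
 have g0: "ht b < g0" "!!g. g : F ==> g0 <= gp f g" "g0 <= s"
 proof -
  show g: "!!g. g : F ==> g0 <= gp f g" unfolding g0_def using finF by simp
  show "ht b < g0" unfolding g0_def using finF f nb Fb by (subst Min_gr_iff) auto
  show "g0 <= s" using g[OF f] gp_self[OF Fb(3)[OF f]] Fb(4)[OF f] by simp
 qed
 define y where "y t = anc f t" for t
 have y: "y t : Pt" "ht (y t) = t" "f : up (y t)" "y t : up b" if "ht b < t" "t <= g0" for t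
 proof -
  have t: "0 <= t" "t <= ht f" using that g0(3) b(2) Fb(4)[OF f] by auto
  show yt: "y t : Pt" "ht (y t) = t" "f : up (y t)"
   unfolding y_def using anc[OF Fb(3)[OF f] t] anc_above[OF Fb(3)[OF f] t] by auto
  show "y t : up b" using common_above_comparable[OF b(1) yt(1) Fb(1)[OF f] yt(3)] yt(2) that by simp
 qed
 have out: "up b - up (y t) <= off H" if t: "ht b < t" "t <= g0" for t
 proof
  fix z assume z: "z : up b - up (y t)"
  have "z ~: up d" if d: "d : H" for d
  proof
   assume zd: "z : up d"
   have dm: "d : Pt" using d H(3) by auto
   have "d : F" unfolding F_def using common_above_comparable[OF b(1) dm _ zd] z d H(4)[OF d] s(2) by simp
   then have "t <= gp f d" using g0(2) t by force
   then have "d : up (y t)"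
    using above_iff_ge[OF y(1)[OF t]] y(2)[OF t] dm gp_anc_left[OF Fb(3)[OF f] dm, of t] t g0(3) b(2) Fb(4)[OF f]
    unfolding y_def by simp
   then have "z : up (y t)" using above_trans[OF y(1)[OF t] _ zd] by simp
   then show False using z by simp
  qed
  then show "z : off H" unfolding off_def using z above_subset by blast
 qed
 define e where "e k = (g0 - ht b) / Suc k" for k :: nat
 have e: "0 < e k" "ht b + e k <= g0" for k
  using g0(1) divide_left_mono[of 1 "real (Suc k)" "g0 - ht b"] unfolding e_def by auto
 have ty: "ht b < ht b + e k" "ht b + e k <= g0" for k using e[of k] by auto
 have e0: "e \<longlonglongrightarrow> 0" unfolding e_def by (intro LIMSEQ_Suc lim_const_over_n)
 have mono: "up b - up (y t) <= up b - up (y t')" if "ht b < t" "t <= t'" "t' <= g0" for t t'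
 proof -
  have "y t' : up (y t)"
   using common_above_comparable[OF y(1) y(1) y(3) y(3), of t t'] y(2)[of t] y(2)[of t'] that by simp
  then show ?thesis using above_mono[OF y(1)[of t]] that by auto
 qed
 have Ab: "up b - up (y (ht b + e k)) : sets mu" for k
  using above_borel[OF b(1)] above_borel[OF y(1)[OF ty]] mu by simp
 have "EV k. em mu (up b - up (y (ht b + e k))) <= em mu {b} + ennreal et"
 proof (rule eventually_outer[OF _ _ _ _ _ et])
  show "decseq (%k. up b - up (y (ht b + e k)))"
  proof (rule antimonoI)
   fix i j :: nat assume "i <= j"
   then have "e j <= e i" unfolding e_def using g0(1) by (intro divide_left_mono) auto
   then show "up b - up (y (ht b + e j)) <= up b - up (y (ht b + e i))"
    using mono[of "ht b + e j" "ht b + e i"] e[of i] e[of j] by simp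
  qed
  show "(INT k. up b - up (y (ht b + e k))) <= {b}"
  proof (rule subsetI, rule ccontr)
   fix z assume z: "z : (INT k. up b - up (y (ht b + e k)))" "z ~: {b}"
   then have zb: "z : up b" "z ~= b" "z : Pt" using above_subset by auto
   have "ht b < gp f z" using nb[OF Fb(1,2)[OF f] zb(1,2)] .
   then have "EV k. e k < gp f z - ht b" by (intro order_tendstoD(2)[OF e0]) simp
   then obtain k where k: "e k < gp f z - ht b" by (auto dest: eventually_happens)
   have "z : up (y (ht b + e k))"
    using above_iff_ge[OF y(1)[OF ty]] y(2)[OF ty] zb(3) gp_anc_left[OF Fb(3)[OF f] zb(3), of "ht b + e k"] ty[of k] g0(3) b(2) Fb(4)[OF f] k
    unfolding y_def by simp
   then show False using z(1) by blast
  qed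
  show "{b} : sets mu" using singleton_borel[OF b(1)] mu by simp
  show "em mu (up b - up (y (ht b + e k))) < \<infinity>" for k
   using emeasure_mono[OF out[OF ty] oH, of k] H(2) by simp
 qed (use Ab in auto)
 then obtain k where k: "em mu (up b - up (y (ht b + e k))) <= ennreal et"
  using b(4) by (auto dest: eventually_happens)
 have "EX y:up b. ht y = t & em mu (up y) = \<infinity> & em mu (up b - up y) <= ennreal et"
  if t: "ht b < t" "t < ht b + e k" for t
 proof (intro bexI conjI)
  have t': "t <= g0" using t e[of k] by simp
  note yt = y[OF t(1) t']
  show "y t : up b" "ht (y t) = t" by (rule yt)+
  have "em mu (up f) <= em mu (up (y t))"
   using above_borel[OF yt(1)] mu by (intro emeasure_mono above_mono yt) simp
  then show "em mu (up (y t)) = \<infinity>" using H(4)[of f] f unfolding F_def by (simp add: top_unique)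
  show "em mu (up b - up (y t)) <= ennreal et"
   using emeasure_mono[OF mono[OF t(1), of "ht b + e k"] Ab] t e[of k] k by (auto intro: order_trans)
 qed
 then show ?thesis using e(1)[of k] by (intro exI[of _ "ht b + e k"]) auto
qed

end

section \<open>Erased mass of cones, tails and points\<close>

context erasing
begin

abbreviation E where "E == erase m ro h mu"

lemma erase_above:
 assumes si: "si : R" and fin: "em mu (up si) < \<infinity>"
 shows "em E (up si) = em mu (up si) - ennreal h"
proof -
 have o: "up si Int off {} = up si" unfolding off_def using above_subset by auto
 have "em E (up si Int off {}) = ennreal (enn2real (em mu (up si Int off {})) + h * (real (card ({} :: 'a set)) - 1))"
  by (rule erase_region[OF si]) (use fin in \<open>auto simp: o\<close>)
 then show ?thesis unfolding o using fin h by (cases "em mu (up si)") (auto simp: ennreal_minus)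
qed

lemma erase_outside: "si : Pt ==> si ~: R ==> em E (up si) = 0"
 using erase_null[OF above_borel] R_below by blast

text \<open>With \<open>n\<close> cut points in the cone, erasure changes the mass by
  \<open>h * (n - 1)\<close>; the additional weight \<open>h\<close> on each of them accounts for
  \<open>h * n\<close> and leaves \<open>- h\<close>. For a point outside \<open>R\<close> both
  sides vanish.\<close>

lemma erase_cut_above:
 assumes D: "finite D" "D <= R" "!!d. d : D ==> ht d = r" and fin: "em mu (off D) < \<infinity>"
  and si: "si : Pt" "ht si < r" and c: "0 <= c"
 shows "em (cutm E D c) (up si) = em (cutm mu D (c + h)) (up si) - ennreal h"
proof -
 let ?D = "D Int up si" and ?A = "up si Int off D"
 have Dm: "D <= Pt" using D(2) R_in(1) by auto
 have oD: "up si Int off ?D = ?A" by (rule off_above[OF si(1) Dm]) (use D(3) si(2) in simp)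
 have finA: "em mu ?A < \<infinity>"
  using emeasure_mono[of ?A "off D" mu] off_borel[OF D(1) Dm] adm_sets fin by simp
 note cut = emeasure_cutm[OF _ D(1) Dm above_borel[OF si(1)]]
 note cuts = cut[OF sets_erase, of c] cut[OF adm_sets, of "c + h"]
 show ?thesis
 proof (cases "si : R")
  case True
  define n where "n = card ?D"
  obtain a where a: "em mu ?A = ennreal a" "0 <= a" using finA by (cases "em mu ?A") auto
  have "em E (up si Int off ?D) = ennreal (enn2real (em mu (up si Int off ?D)) + h * (real (card ?D) - 1))"
  proof (rule erase_region[OF True])
   show "si ~: ?D" using D(3) si(2) by auto
   show "q = p" if "p : ?D" "q : ?D" "q : up p" for p q
    by (rule level_antichain[OF Dm D(3)]) (use that in auto)
  qed (use D finA in \<open>auto simp: oD\<close>)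
  then have EA: "em E ?A = ennreal (a + h * (real n - 1))" unfolding oD a(1) n_def using a(2) by simp
  show ?thesis
  proof (cases "n = 0")
   case True
   then show ?thesis unfolding cuts EA a(1) n_def[symmetric] using h a(2) by (simp add: ennreal_minus)
  next
   case False
   have "0 <= h * (real n - 1)" using h False by simp
   then have "ennreal (a + h * (real n - 1)) + ennreal c * of_nat n = ennreal (a + h * (real n - 1) + c * real n)"
    using a(2) c by (simp add: ennreal_plus ennreal_mult ennreal_of_nat_eq_real_of_nat)
   moreover have "ennreal a + ennreal (c + h) * of_nat n - ennreal h = ennreal (a + (c + h) * real n - h)"
    using a(2) c h by (simp add: ennreal_plus[symmetric] ennreal_mult[symmetric] ennreal_of_nat_eq_real_of_nat ennreal_minus del: ennreal_plus)
   moreover have "a + h * (real n - 1) + c * real n = a + (c + h) * real n - h" by (simp add: algebra_simps)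
   ultimately show ?thesis unfolding cuts EA a(1) n_def[symmetric] by simp
  qed
 next
  case False
  have e: "?D = {}" using R_below[OF _ si(1)] D(2) False by blast
  have AA: "?A = up si" using oD unfolding e off_def using above_subset by auto
  have "em mu (up si) <= ennreal h" using False si(1) unfolding R_erase_def by (auto simp: not_le)
  then show ?thesis unfolding cuts AA e using erase_outside[OF si(1) False] h
   by (cases "em mu (up si)") (auto simp: ennreal_minus ennreal_le_iff ennreal_neg top_unique)
 qed
qed

text \<open>The cone is cut at the heavy points of a high level. At least one of them lies over
  \<open>b\<close>, so the erased mass of this region is no less than its \<open>mu\<close>-mass,
  and the latter is unbounded as the level increases.\<close>

lemma erase_heavy:
 assumes b: "b : Pt" "0 < ht b" "em mu (up b) = \<infinity>"
 shows "em E (up b) = \<infinity>"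
proof -
 have bR: "b : R" using b unfolding R_erase_def by simp
 define B where "B k = up b Int {x : Pt. ht x <= ht b + real k}" for k
 have le: "em mu (B k) <= em E (up b)" for k
 proof -
  define s where "s = ht b + real k + 1"
  define H where "H = heavy_at mu s"
  have s: "0 < s" "ht b < s" unfolding s_def using b(2) by auto
  have H: "finite H" "H <= R" "H <= Pt" "!!d. d : H ==> ht d = s" "em mu (off H) < \<infinity>"
   unfolding H_def using adm_heavy[OF s(1)] heavy_subset_R by (auto simp: heavy_at_def)
  let ?A = "up b Int off H"
  have oH: "up b Int off (H Int up b) = ?A" by (rule off_above[OF b(1) H(3)]) (use H(4) s(2) in simp)
  have finA: "em mu ?A < \<infinity>"
   using emeasure_mono[of ?A "off H" mu] off_borel[OF H(1,3)] adm_sets H(5) by simp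
  have ne: "H Int up b ~= {}"
  proof
   assume e: "H Int up b = {}"
   have "?A = up b" using oH unfolding e off_def using above_subset by auto
   then show False using finA b(3) by simp
  qed
  then have "1 <= card (H Int up b)" using H(1) by (simp add: Suc_le_eq card_gt_0_iff)
  then have pos: "0 <= h * (real (card (H Int up b)) - 1)" using h by simp
  have "em E (up b Int off (H Int up b)) =
    ennreal (enn2real (em mu (up b Int off (H Int up b))) + h * (real (card (H Int up b)) - 1))"
  proof (rule erase_region[OF bR])
   show "b ~: H Int up b" using H(4) s(2) by auto
   show "q = p" if "p : H Int up b" "q : H Int up b" "q : up p" for p q
    by (rule level_antichain[OF H(3,4)]) (use that in auto)
  qed (use H finA in \<open>auto simp: oH\<close>)
  then have EA: "em E ?A = ennreal (enn2real (em mu ?A) + h * (real (card (H Int up b)) - 1))" unfolding oH .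
  have "B k <= ?A" unfolding B_def off_def using above_ht H(3,4) unfolding s_def by fastforce
  then have "em mu (B k) <= em mu ?A" using above_borel[OF b(1)] off_borel[OF H(1,3)] adm_sets by (intro emeasure_mono) auto
  also have "... = ennreal (enn2real (em mu ?A))" using finA by simp
  also have "... <= em E ?A" unfolding EA using pos by (intro ennreal_leI) simp
  also have "... <= em E (up b)" using above_borel[OF b(1)] sets_erase by (intro emeasure_mono) auto
  finally show ?thesis .
 qed
 have "incseq B" unfolding B_def by (rule incseq_SucI) auto
 moreover have "B k : Bor" for k unfolding B_def by (intro sets.Int above_borel[OF b(1)] ht_borel_le)
 then have "range B <= sets mu" by (simp add: image_subset_iff adm_sets)
 ultimately have "(SUP k. em mu (B k)) = em mu (UN k. B k)" by (intro SUP_emeasure_incseq)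
 also have "(UN k. B k) = up b"
 proof (intro equalityI subsetI)
  fix x assume x: "x : up b"
  obtain k :: nat where "ht x - ht b < real k" using reals_Archimedean2 by blast
  then show "x : (UN k. B k)" unfolding B_def using x above_subset by (intro UN_I[of k]) auto
 qed (auto simp: B_def)
 finally have S: "(SUP k. em mu (B k)) = em mu (up b)" .
 have "(SUP k. em mu (B k)) <= em E (up b)" by (rule SUP_least) (rule le)
 then show ?thesis unfolding S b(3) by (simp add: top_unique)
qed

lemma erase_off_finite:
 assumes s: "0 < s" shows "em E (off (heavy_at mu s)) < \<infinity>"
proof -
 have o: "up ro Int off (heavy_at mu s) = off (heavy_at mu s)" unfolding off_def by auto
 have "em E (up ro Int off (heavy_at mu s)) =
   ennreal (enn2real (em mu (up ro Int off (heavy_at mu s))) + h * (real (card (heavy_at mu s)) - 1))"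
 proof (rule erase_region[OF R_in(2) adm_heavy(1)[OF s] heavy_subset_R])
  show "q = p" if "p : heavy_at mu s" "q : heavy_at mu s" "q : up p" for p q
   by (rule level_antichain[of "heavy_at mu s" s]) (use that in \<open>auto simp: heavy_at_def\<close>)
  show "ro ~: heavy_at mu s" "!!d. d : heavy_at mu s ==> d : up ro" using s unfolding heavy_at_def by auto
 qed (use adm_heavy(2)[OF s] in \<open>simp only: o\<close>)
 then show ?thesis unfolding o by simp
qed

lemma erase_heavy_at: "0 < s ==> heavy_at E s = heavy_at mu s"
proof (intro equalityI subsetI)
 fix x assume s: "0 < s" and x: "x : heavy_at E s"
 then have xm: "x : Pt" "ht x = s" "em E (up x) = \<infinity>" unfolding heavy_at_def by auto
 show "x : heavy_at mu s"
 proof (rule ccontr)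
  assume n: "x ~: heavy_at mu s"
  have "up x <= off (heavy_at mu s)"
  proof
   fix z assume z: "z : up x"
   have "z ~: up d" if "d : heavy_at mu s" for d
    using above_disjoint[OF xm(1) _ _ z, of d] that n xm(2) unfolding heavy_at_def by auto
   then show "z : off (heavy_at mu s)" unfolding off_def using z above_subset by blast
  qed
  then have "em E (up x) <= em E (off (heavy_at mu s))"
   using off_borel[OF adm_heavy(1)[OF s]] sets_erase by (intro emeasure_mono) (auto simp: heavy_at_def)
  then show False using xm(3) erase_off_finite[OF s] by simp
 qed
qed (use erase_heavy in \<open>auto simp: heavy_at_def\<close>)

lemma erase_admissible: "admissible E"
 unfolding admissible_def using sets_erase erase_heavy_at adm_heavy(1) erase_off_finite by simp

text \<open>The region between \<open>b\<close> and the point \<open>y\<close> of a short infinite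
  edge has exactly one cut point, so by \<open>erase_region\<close> erasure does not change its
  mass, which is arbitrarily small.\<close>

lemma erase_point:
 assumes b: "b : Pt" "0 < ht b" "em mu (up b) = \<infinity>" "em mu {b} = 0"
  and nb: "!!x y. x : up b ==> x ~= b ==> y : up b ==> y ~= b ==> ht b < gp x y"
 shows "em E {b} = 0"
proof -
 have bR: "b : R" using b unfolding R_erase_def by simp
 have "em E {b} <= 0 + ennreal et" if et: "0 < et" for et
 proof -
  obtain t0 where t0: "ht b < t0" "!!t. ht b < t ==> t < t0 ==> EX y:up b. ht y = t & em mu (up y) = \<infinity> &
   em mu (up b - up y) <= ennreal et"
   using infinite_edge_above[OF adm b nb et] by blast
  obtain t where "ht b < t" "t < t0" using t0(1) dense by blast
  then obtain y where y: "y : up b" "ht y = t" "em mu (up y) = \<infinity>"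
   "em mu (up b - up y) <= ennreal et" "ht b < ht y" using t0(2) by blast
  have ym: "y : Pt" using y(1) above_subset by auto
  have yR: "y : R" using ym y(3) unfolding R_erase_def by simp
  have o: "up b Int off {y} = up b - up y" unfolding off_def using above_subset by auto
  have fin: "em mu (up b - up y) < \<infinity>" using y(4) by (rule order_le_less_trans) simp
  have "em E (up b Int off {y}) = ennreal (enn2real (em mu (up b Int off {y})) + h * (real (card {y}) - 1))"
   by (rule erase_region[OF bR]) (use y yR fin in \<open>auto simp: o\<close>)
  then have "em E (up b - up y) = em mu (up b - up y)" unfolding o using fin by simp
  moreover have "em E {b} <= em E (up b - up y)"
   using above_borel[OF b(1)] above_borel[OF ym] sets_erase above_self[OF b(1)] above_ht[OF ym, of b] y(5) by (intro emeasure_mono) auto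
  ultimately show ?thesis using y(4) by simp
 qed
 then have "em E {b} <= 0" by (rule ennreal_le_epsilon)
 then show ?thesis by simp
qed

text \<open>Above level \<open>t\<close> and off \<open>D\<close>, the erased measure lives on the
  cones over points of \<open>R\<close> at this level. If the tail has finite mass there are
  finitely many of them, each carrying at least \<open>h\<close>, and \<open>erase_above\<close>
  only lowers the mass of their cones.\<close>

lemma erase_tail_le:
 assumes D: "finite D" "D <= Pt" "!!d. d : D ==> ht d < t" and t: "0 < t"
 shows "em E ((hi t) Int off D) <= em mu ((hi t) Int off D)"
proof (cases "em mu ((hi t) Int off D) < \<infinity>")
 case True
 let ?U = "(hi t) Int off D"
 have Ub: "?U : Bor" using ht_borel_ge off_borel[OF D(1,2)] by auto
 define W where "W = {si : R Int off D. ht si = t}"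
 have Wm: "si : Pt" "ht si = t" "si : R" "si ~= ro" if "si : W" for si using that R_in(1) t unfolding W_def by auto
 have sub: "up si <= ?U" if si: "si : W" for si
 proof
  fix z assume z: "z : up si"
  have "z ~: up d" if d: "d : D" for d
  proof
   assume zd: "z : up d"
   have dm: "d : Pt" using d D(2) by auto
   have "si : up d" using common_above_comparable[OF dm Wm(1)[OF si] zd z] D(3)[OF d] Wm(2)[OF si] by simp
   then show False using si d unfolding W_def off_def by auto
  qed
  then show "z : ?U" unfolding off_def using z above_subset above_ht[OF Wm(1)[OF si] z] Wm(2)[OF si] by auto
 qed
 have disj: "disjoint_family_on up F" if "F <= W" for F
  by (rule above_same_level_disjoint[of F t]) (use that Wm in auto)
 have Ws: "up si : Bor" if "si : W" for si using above_borel[OF Wm(1)[OF that]] .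
 have sum_le: "(SUM si:F. em mu (up si)) <= em mu ?U" if F: "finite F" "F <= W" for F
 proof -
  have "(SUM si:F. em mu (up si)) = em mu (UN si:F. up si)"
   by (rule sum_emeasure[OF _ disj[OF F(2)] F(1)]) (use Ws F(2) adm_sets in auto)
  also have "... <= em mu ?U" using sub F(2) Ub adm_sets by (intro emeasure_mono) auto
  finally show ?thesis .
 qed
 have finW: "finite W"
 proof (rule ccontr)
  assume inf: "infinite W"
  obtain a where a: "em mu ?U = ennreal a" "0 <= a" using True by (cases "em mu ?U") auto
  obtain k :: nat where k: "a / h < real k" using reals_Archimedean2 by blast
  obtain F where F: "F <= W" "finite F" "card F = k" using infinite_arbitrarily_large[OF inf] by blast
  have "of_nat k * ennreal h = (SUM f:F. ennreal h)" using F(3) by simp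
  also have "... <= (SUM f:F. em mu (up f))" using F(1) by (intro sum_mono R_mass Wm(3,4)) auto
  also have "... <= em mu ?U" by (rule sum_le[OF F(2,1)])
  finally have "ennreal (real k * h) <= ennreal a" using a(1) h by (simp add: ennreal_mult ennreal_of_nat_eq_real_of_nat)
  then show False using k a(2) h by (simp add: ennreal_le_iff field_simps)
 qed
 let ?V = "UN si:W. up si"
 have Vb: "?V : Bor" using Ws finW by auto
 have "em E ?U <= em E (?V Un (?U - ?V))" using Vb Ub sets_erase by (intro emeasure_mono) auto
 also have "... <= em E ?V + em E (?U - ?V)" by (rule emeasure_subadditive) (use Vb Ub sets_erase in auto)
 also have "em E (?U - ?V) = 0"
 proof (rule erase_null)
  show "?U - ?V : Bor" using Vb Ub by auto
  have False if x: "x : ?U" "x ~: ?V" "x : R" for x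
  proof -
   have xm: "x : Pt" "t <= ht x" using x by auto
   note a = anc[OF xm(1) less_imp_le[OF t] xm(2)] anc_above[OF xm(1) less_imp_le[OF t] xm(2)]
   have "anc x t : R" using R_in(3)[OF x(3)] t xm(2) by simp
   moreover have "anc x t : off D" using x(1) above_trans[OF _ _ a(4)] D(2) a(1) unfolding off_def by blast
   ultimately have "anc x t : W" unfolding W_def using a(2) by simp
   then show False using x(2) a(4) by blast
  qed
  then show "(?U - ?V) Int R = {}" by blast
 qed
 also have "em E ?V = (SUM si:W. em E (up si))"
  by (rule sum_emeasure[symmetric, OF _ disj finW]) (use Ws sets_erase in auto)
 also have "... <= (SUM si:W. em mu (up si))"
 proof (rule sum_mono)
  fix si assume si: "si : W"
  have "em mu (up si) < \<infinity>" using emeasure_mono[OF sub[OF si], of mu] Ub adm_sets True by simp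
  show "em E (up si) <= em mu (up si)"
   unfolding erase_above[OF Wm(3)[OF si] \<open>emeasure mu (up si) < \<infinity>\<close>] by (rule diff_le_self_ennreal)
 qed
 also have "... <= em mu ?U" by (rule sum_le[OF finW order_refl])
 finally show ?thesis by simp
qed (simp add: not_less top_unique)

abbreviation Rp where "Rp == R_erase_plus m ro mu h"

lemma Rp_closed: "closedin (mtopology_of m) Rp"
 unfolding R_erase_plus_def by (rule closedin_closure_of)

lemma Rp_subtree: "subtree Rp"
proof -
 let ?U = "\<Union>h'\<in>{h<..}. R_erase m ro mu h'"
 have st: "subtree (R_erase m ro mu h')" for h'
  unfolding R_erase_def using superlevel_subtree[OF adm_sets, of "ennreal h'"] by simp
 have U: "?U <= Pt" "ro : ?U" "!!x s. x : ?U ==> 0 <= s ==> s <= ht x ==> anc x s : ?U"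
  using st gt_ex[of h] unfolding subtree_def by blast+
 have "anc x s : Rp" if x: "x : Rp" and s: "0 <= s" "s <= ht x" for x s
  unfolding R_erase_plus_def closure_of_mtopology_of
 proof (intro CollectI conjI allI impI)
  have xm: "x : Pt" and cl: "!!e. e > 0 ==> EX y:?U. y : Pt & mdist m x y < e"
   using x unfolding R_erase_plus_def closure_of_mtopology_of by auto
  show am: "anc x s : Pt" using anc_in[OF xm s] .
  fix e :: real assume e: "0 < e"
  obtain y where y: "y : ?U" "y : Pt" "mdist m x y < e" using cl[OF e] by blast
  define s' where "s' = min s (ht y)"
  have s': "0 <= s'" "s' <= ht y" "s' <= s" using s(1) unfolding s'_def by auto
  have "mdist m (anc x s) (anc y s') = s + s' - 2 * min (min s s') (gp x y)"
   using dist_gp[of "anc x s" "anc y s'"] gp_anc2[OF xm y(2) s s'(1,2)] ht_anc[OF xm s] ht_anc[OF y(2) s'(1,2)] by simp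
  also have "... <= mdist m x y"
   using dist_gp[of x y] gp_le[OF xm y(2)] s s' unfolding s'_def by (auto simp: min_def split: if_splits)
  finally show "EX y:?U. y : Pt & mdist m (anc x s) y < e"
   using U(3)[OF y(1) s'(1,2)] anc_in[OF y(2) s'(1,2)] y(3) by (intro bexI[of _ "anc y s'"]) auto
 qed
 moreover have "?U <= Rp" unfolding R_erase_plus_def using U(1) by (intro closure_of_subset) simp
 moreover have "Rp <= Pt" using Rp_closed unfolding closedin_mtopology_of by simp
 ultimately show ?thesis unfolding subtree_def using U(2) by blast
qed

text \<open>A point outside \<open>R_erase_plus\<close> has a neighbourhood inside a cone of mass at
  most \<open>h\<close>, and such a cone is erased completely, even if its mass is exactly
  \<open>h\<close>.\<close>

lemma erase_outside_plus:
 assumes sc: "second_countable_metric m"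
 shows "em E (Pt - Rp) = 0"
proof (rule locally_null[OF sc sets_erase])
 show "Pt - Rp : sets E" using borel_closed[OF Rp_closed] sets.top[of "mb m"] sets_erase by auto
 fix x assume x: "x : Pt - Rp"
 then have xm: "x : Pt" by simp
 obtain e where e: "e > 0" "ALL y:Rp. e <= mdist m x y" using Rp_closed x unfolding closedin_mtopology_of by blast
 have "ro : Rp" using Rp_subtree unfolding subtree_def by simp
 then have ex: "e <= ht x" using e(2) mdist_commute[of m x ro] unfolding ht_def by auto
 define p where "p = anc x (ht x - e / 2)"
 have p: "p : Pt" "mdist m x p = e / 2"
  unfolding p_def using anc_in[OF xm, of "ht x - e / 2"] dist_anc[OF xm ht_nonneg order_refl, of "ht x - e / 2"] anc_eqI[OF xm xm above_self[OF xm]] e(1) ex by auto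
 have light: "em mu (up p) <= ennreal h"
 proof (rule ccontr)
  assume "~ em mu (up p) <= ennreal h"
  then obtain c where c: "ennreal h < c" "c < em mu (up p)" using dense[of "ennreal h"] by (auto simp: not_le)
  obtain h' where h': "c = ennreal h'" "0 <= h'" using c(2) by (cases c) auto
  have "p : (\<Union>h'\<in>{h<..}. R_erase m ro mu h')" using c h' h p(1) unfolding R_erase_def by (intro UN_I[of h']) (auto simp: ennreal_less_iff)
  moreover have "(\<Union>h'\<in>{h<..}. R_erase m ro mu h') <= Rp"
   unfolding R_erase_plus_def by (rule closure_of_subset) (auto simp: R_erase_def)
  ultimately show False using e p(2) by force
 qed
 have "em E (up p) = 0"
 proof (cases "p : R")
  case True
  have "em mu (up p) < \<infinity>" using light by (rule order_le_less_trans) simp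
  then show ?thesis using erase_above[OF True] light h by (cases "em mu (up p)") (auto simp: ennreal_minus ennreal_le_iff ennreal_neg)
 qed (rule erase_outside[OF p(1)])
 moreover have "y : up p" if "y : Pt" "mdist m x y < e / 2" for y
  unfolding p_def using near_above_anc[OF xm _ _ that(1), of "e / 2"] that(2) e(1) ex by simp
 ultimately show "EX e>0. EX N:sets E. em E N = 0 & (ALL y:Pt. mdist m x y < e --> y : N)"
  using e(1) above_borel[OF p(1)] sets_erase by (intro exI[of _ "e / 2"] conjI bexI[of _ "up p"]) auto
qed

end

section \<open>Matching cut-off measures\<close>

lemma near_real:
 assumes "near et a b" "a < \<infinity>" "b < \<infinity>" "0 <= et" shows "\<bar>enn2real a - enn2real b\<bar> <= et"
 using assms unfolding near_def
 by (cases a; cases b) (auto simp: ennreal_plus[symmetric] abs_le_iff simp del: ennreal_plus)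

context rooted_tree
begin

lemma slab_sets: "si : Pt ==> slab si t R : Bor"
 unfolding slab_def by (rule slab_borel)

lemma slab_emeasure_finite:
 assumes "sets mu = Bor" "em mu (lo R) < \<infinity>"
 shows "em mu (slab si t R) < \<infinity>"
proof -
 have "em mu (slab si t R) <= em mu (lo R)"
  using ht_borel_le assms(1) by (intro emeasure_mono) (auto simp: slab_def)
 then show ?thesis using assms(2) by simp
qed

lemma slab_fmeasurable:
 assumes "sets mu = Bor" "em mu (lo R) < \<infinity>" "si : Pt"
 shows "slab si t R : fmeasurable mu"
 using slab_sets[OF assms(3)] slab_emeasure_finite[OF assms(1,2)] assms(1) by (auto simp: fmeasurable_def)

lemma slab_measure_mono:
 assumes "sets mu = Bor" "em mu (lo R) < \<infinity>" "si : Pt" "ta : up si"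
 shows "measure mu (slab ta t R) <= measure mu (slab si t R)"
proof (rule measure_mono_fmeasurable[OF _ _ slab_fmeasurable[OF assms(1-3)]])
 have ta: "ta : Pt" using assms(4) above_subset by auto
 show "slab ta t R <= slab si t R" using above_mono[OF assms(3,4)] by (auto simp: slab_above[OF ta] slab_above[OF assms(3)])
 show "slab ta t R : sets mu" using slab_sets[OF ta] assms(1) by simp
qed

lemma measure_cutm:
 assumes "sets mu = Bor" "finite D" "D <= Pt" "em mu (off D) < \<infinity>" "A : Bor"
 shows "measure (cutm mu D c) A = measure mu (A Int off D) + max 0 c * real (card (D Int A))"
proof -
 have "em mu (A Int off D) < \<infinity>"
  using emeasure_mono[of "A Int off D" "off D" mu] off_borel[OF assms(2,3)] assms(1,4) by simp
 moreover have "enn2real (ennreal c * of_nat k) = max 0 c * real k" for k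
  by (cases "0 <= c") (auto simp: enn2real_mult ennreal_neg)
 moreover have "ennreal c * of_nat k < \<infinity>" for k by (simp add: ennreal_mult_less_top ennreal_of_nat_eq_real_of_nat)
 ultimately show ?thesis unfolding measure_def emeasure_cutm[OF assms(1-3,5)] by (subst enn2real_plus) simp_all
qed

text \<open>The cut cone is the slab up to height \<open>R\<close> without the slabs over the cut
  points, plus the part beyond \<open>R\<close>, which tightness makes small. So the cut mass is
  expressed by quantities that \<open>matched\<close> controls.\<close>

lemma cut_mass_split:
 assumes mu: "sets mu = Bor" "em mu (lo R) < \<infinity>" "em mu (off D) < \<infinity>"
  and D: "finite D" "D <= Pt" "!!d. d : D ==> ht d = r" and si: "si : Pt" "ht si <= r" and R: "R1 <= R"
 shows "EX e. 0 <= e & e <= measure mu ((hi R1) Int off D) &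
  measure mu ({x : up si. t <= ht x} Int off D) =
   measure mu (slab si t R) - (SUM b:D Int up si. measure mu (slab b t R)) + e"
proof -
 let ?A = "{x : up si. t <= ht x}" and ?D = "D Int up si"
 let ?W = "slab si t R" and ?P = "UN b:D Int up si. slab b t R"
 have oD: "off D : fmeasurable mu" using off_borel[OF D(1,2)] mu(1,3) by (simp add: fmeasurable_def)
 have A_eq: "?A = up si Int (hi t)" using above_subset by auto
 have As: "?A : sets mu" unfolding A_eq using above_borel[OF si(1)] ht_borel_ge mu(1) by simp
 note fm = slab_fmeasurable[OF mu(1,2)]
 let ?T = "?A Int off D Int {x : Pt. R < ht x}"
 have sl: "slab b t R = {x : up b. t <= ht x & ht x <= R}" if "b : D" for b using slab_above[of b] D(2) that by auto
 have split: "?A Int off D = (?W - ?P) Un ?T"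
  unfolding off_above[OF si(1) D(2), symmetric] slab_above[OF si(1)]
 proof -
  have oe: "up si Int off ?D = up si Int off D" by (rule off_above[OF si(1) D(2)]) (use D(3) si(2) in simp)
  have "x : ?A Int off D \<longleftrightarrow> x : (?W - ?P) Un ?T" for x
  proof (cases "x : ?A")
   case True
   then have x: "x : up si" "t <= ht x" "x : Pt" using above_subset by auto
   have "x : off D \<longleftrightarrow> x : off ?D" using oe x(1) by blast
   also have "... \<longleftrightarrow> (ALL d:?D. x ~: up d)" unfolding off_def using x(3) by blast
   finally have o: "x : off D \<longleftrightarrow> (ALL d:?D. x ~: up d)" .
   show ?thesis
   proof (cases "ht x <= R")
    case True
    then show ?thesis using x o sl unfolding slab_above[OF si(1)] by auto
   next
    case False
    then show ?thesis using x unfolding slab_above[OF si(1)] by auto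
   qed
  qed (auto simp: slab_above[OF si(1)])
  then show "?A Int off D = ({x : up si. t <= ht x & ht x <= R} - ?P) Un ?T" unfolding slab_above[OF si(1)] by blast
 qed
 have PW: "?P <= ?W" using sl above_mono[OF si(1)] unfolding slab_above[OF si(1)] by auto
 have Ps: "?P : fmeasurable mu" using fm D by (intro fmeasurable.finite_UN) auto
 have Ts: "?T : fmeasurable mu"
  by (rule fmeasurableI2[OF oD]) (use As oD ht_borel_gr mu(1) in auto)
 have "measure mu (?A Int off D) = measure mu ((?W - ?P) Un ?T)" by (rule arg_cong[OF split])
 also have "... = measure mu (?W - ?P) + measure mu ?T"
 proof (rule measure_Union)
  show "em mu (?W - ?P) ~= \<infinity>" "?W - ?P : sets mu"
   using fmeasurable.Diff[OF fm[OF si(1)] Ps] fmeasurableD2 fmeasurableD by (metis infinity_ennreal_def)+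
  show "em mu ?T ~= \<infinity>" "?T : sets mu" using fmeasurableD2[OF Ts] fmeasurableD[OF Ts] by simp_all
 qed (auto simp: slab_def)
 also have "measure mu (?W - ?P) = measure mu ?W - measure mu ?P"
  by (rule measure_Diff) (use fmeasurableD2[OF fm[OF si(1)]] fmeasurableD[OF fm[OF si(1)]] fmeasurableD[OF Ps] PW in simp_all)
 also have "measure mu ?P = (SUM b:?D. measure mu (slab b t R))"
 proof (rule measure_finite_Union)
  show "disjoint_family_on (%b. slab b t R) ?D"
   unfolding disjoint_family_on_def using above_disjoint D sl by (auto simp: subset_iff)
  show "em mu (slab b t R) ~= \<infinity>" for b using slab_emeasure_finite[OF mu(1,2), of b t] by simp
 qed (use D fm in \<open>auto simp: fmeasurable_def\<close>)
 finally have eq: "measure mu (?A Int off D) = measure mu ?W - (SUM b:?D. measure mu (slab b t R)) + measure mu ?T" .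
 have "measure mu ?T <= measure mu ((hi R1) Int off D)"
  by (rule measure_mono_fmeasurable) (use Ts R oD fmeasurableI2[OF oD] ht_borel_ge mu(1) in auto)
 then show ?thesis using eq by (intro exI[of _ "measure mu ?T"]) simp
qed

end

section \<open>Two trees with matched nodes, both cut at level \<open>r\<close>\<close>

locale cut_pair = T: rooted_tree m ro + T': rooted_tree m' ro'
 for m :: "'a metric" and ro and m' :: "'b metric" and ro' +
 fixes mu mu' D D' b1 b2 bt and S :: "real set" and V Q and t1 r t2 R1 R ka ta C :: real
 assumes mu: "sets mu = sets (mb m)" "em mu {x : mspace m. T.ht x <= R} < \<infinity>" "em mu (T.off D) < \<infinity>"
  and mu': "sets mu' = sets (mb m')" "em mu' {x : mspace m'. T'.ht x <= R} < \<infinity>" "em mu' (T'.off D') < \<infinity>"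
  and levels: "t1 < r" "r < t2" "t2 <= R1" "R1 <= R" "0 < t1" "t1 : S"
  and D: "finite D" "D <= mspace m" "!!b. b : D ==> T.ht b = r"
  and D': "finite D'" "D' <= mspace m'" "!!b. b : D' ==> T'.ht b = r" "card D' <= card D"
  and b1: "!!b. b : D ==> b1 b : V & b1 b : mspace m & T.ht (b1 b) = t1 & b : above m ro (b1 b)"
  and b2: "!!b. b : D ==> b2 b : V & b2 b : mspace m & T.ht (b2 b) = t2 & b2 b : above m ro b"
  and edge: "!!b. b : D ==> em mu (above m ro (b1 b) - above m ro (b2 b)) <= ennreal ka"
  and apart: "!!b c. b : D ==> c : D ==> b ~= c ==> T.gp b c < t1"
  and bt: "matched ka S V Q R m ro mu m' ro' mu' bt" and Q: "R1 : Q" "-1 : Q"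
  and big: "!!b. b : D ==> ennreal (C + 3) <= em mu (T.slab (b2 b) R1 R)"
  and tail': "em mu' ({x : mspace m'. R1 <= T'.ht x} Int T'.off D') <= ennreal ta"
  and tail: "em mu ({x : mspace m. R1 <= T.ht x} Int T.off D) <= ennreal ta"
  and bounds: "0 <= ka" "ka <= 1" "0 <= ta" "ta <= 1" "0 <= C"
begin

lemma bt_node:
 assumes "si : V" shows "bt si : mspace m'" "T'.ht (bt si) = T.ht si"
  and "!!t. t : Q ==> near ka (em mu' (T'.slab (bt si) t R)) (em mu (T.slab si t R))"
 using bt assms unfolding matched_def T.ht_def T'.ht_def by auto

lemma bt_gp: "x : V ==> y : V ==> s : S ==> s <= T.gp x y \<longleftrightarrow> s <= T'.gp (bt x) (bt y)"
 using bt unfolding matched_def by blast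

text \<open>The counterpart of \<open>b\<close> is read off from the matched node
  \<open>b2 b\<close> just above it; the node \<open>b1 b\<close> just below it serves to bound from
  above the mass over \<open>dd b\<close>.\<close>

definition dd :: "'a => 'b" where "dd b = T'.anc (bt (b2 b)) r"

lemma r_pos: "0 <= r" "r <= R" using levels by auto

lemma b_anc: "b : D ==> T.anc (b2 b) r = b"
 using T.anc_eqI[of "b2 b" b] b2[of b] D by auto

lemma dd:
 assumes b: "b : D"
 shows "dd b : mspace m'" "T'.ht (dd b) = r" "bt (b2 b) : above m' ro' (dd b)" "dd b : above m' ro' (bt (b1 b))"
proof -
 note n2 = bt_node(1,2)[of "b2 b"] and n1 = bt_node(1,2)[of "b1 b"]
 have n: "bt (b2 b) : mspace m'" "T'.ht (bt (b2 b)) = t2" "bt (b1 b) : mspace m'" "T'.ht (bt (b1 b)) = t1"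
  using n1 n2 b1[OF b] b2[OF b] by auto
 have rr: "0 <= r" "r <= T'.ht (bt (b2 b))" using levels n(2) by auto
 show d: "dd b : mspace m'" "T'.ht (dd b) = r" "bt (b2 b) : above m' ro' (dd b)"
  unfolding dd_def using T'.anc[OF n(1) rr] T'.anc_above[OF n(1) rr] by auto
 have "b2 b : above m ro (b1 b)" using T.above_trans b1[OF b] b2[OF b] by blast
 then have "t1 <= T.gp (b1 b) (b2 b)" using T.above_iff b1[OF b] by auto
 then have "t1 <= T'.gp (bt (b1 b)) (bt (b2 b))" using bt_gp b1[OF b] b2[OF b] levels(6) by blast
 then have "bt (b2 b) : above m' ro' (bt (b1 b))" using T'.above_iff_ge[OF n(3)] n by simp
 then show "dd b : above m' ro' (bt (b1 b))"
  using T'.common_above_comparable[OF n(3) d(1) _ d(3)] n(4) d(2) levels(1) by simp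
qed

text \<open>The cone over \<open>b2 b\<close> has mass at least \<open>C + 3\<close> beyond height
  \<open>R1\<close>, so its counterpart has at least \<open>C + 2\<close> there. If
  \<open>dd b\<close> were not a cut point, all this mass would escape the cut, although at most
  \<open>ta <= 1\<close> does so beyond \<open>R1\<close>.\<close>

lemma dd_in_D': assumes b: "b : D" shows "dd b : D'"
proof (rule ccontr)
 assume no: "dd b ~: D'"
 have n: "bt (b2 b) : mspace m'" using bt_node(1)[of "b2 b"] b2[OF b] by auto
 have sub: "T'.slab (bt (b2 b)) R1 R <= {x : mspace m'. R1 <= T'.ht x} Int T'.off D'"
 proof
  fix z assume "z : T'.slab (bt (b2 b)) R1 R"
  then have z: "z : above m' ro' (bt (b2 b))" "R1 <= T'.ht z" "z : mspace m'" unfolding T'.slab_above[OF n] using T'.above_subset by auto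
  have zd: "z : above m' ro' (dd b)" using T'.above_trans[OF dd(1,3)[OF b] z(1)] .
  have "z ~: above m' ro' d" if d: "d : D'" for d
   using T'.above_disjoint[OF dd(1)[OF b] _ _ zd, of d] dd(2)[OF b] D'(2,3) d no by auto
  then show "z : {x : mspace m'. R1 <= T'.ht x} Int T'.off D'" unfolding T'.off_def using z by blast
 qed
 have "ennreal (C + 3) <= em mu (T.slab (b2 b) R1 R)" by (rule big[OF b])
 also have "... <= em mu' (T'.slab (bt (b2 b)) R1 R) + ennreal ka"
  using bt_node(3)[of "b2 b"] b2[OF b] Q(1) unfolding near_def by blast
 also have "... <= em mu' ({x : mspace m'. R1 <= T'.ht x} Int T'.off D') + ennreal ka"
  using T'.ht_borel_ge T'.off_borel[OF D'(1,2)] mu'(1) by (intro add_right_mono emeasure_mono[OF sub]) auto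
 also have "... <= ennreal ta + ennreal ka" by (rule add_right_mono[OF tail'])
 also have "... = ennreal (ta + ka)" using bounds by simp
 finally show False using bounds by (simp add: ennreal_le_iff del: ennreal_plus)
qed

lemma dd_inj: "inj_on dd D"
proof (rule inj_onI, rule ccontr)
 fix b c assume bc: "b : D" "c : D" "dd b = dd c" "b ~= c"
 have nm: "bt (b2 b) : mspace m'" "bt (b2 c) : mspace m'" using bt_node(1) b2 bc(1,2) by auto
 have "r <= T'.gp (bt (b2 b)) (dd b)" "r <= T'.gp (dd b) (bt (b2 c))"
  using dd(3)[OF bc(1)] dd(3)[OF bc(2)] T'.above_iff[OF dd(1)[OF bc(1)]] dd(2)[OF bc(1)] bc(3) T'.gp_commute[of "bt (b2 b)"] by auto
 then have "r <= T'.gp (bt (b2 b)) (bt (b2 c))" by (rule T'.gp_ge_trans[OF nm(1) dd(1)[OF bc(1)] nm(2)])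
 then have "t1 <= T'.gp (bt (b2 b)) (bt (b2 c))" using levels(1) by simp
 then have g: "t1 <= T.gp (b2 b) (b2 c)" using bt_gp b2 bc(1,2) levels(6) by blast
 have "T.gp (T.anc (b2 b) r) (T.anc (b2 c) r) = min (min r r) (T.gp (b2 b) (b2 c))"
  using b2[OF bc(1)] b2[OF bc(2)] levels by (intro T.gp_anc2) auto
 then show False using apart[OF bc(1,2,4)] g levels(1) unfolding b_anc[OF bc(1)] b_anc[OF bc(2)] by simp
qed

lemma dd_image: "dd ` D = D'"
proof (rule card_seteq[OF D'(1)])
 show "dd ` D <= D'" using dd_in_D' by blast
 show "card D' <= card (dd ` D)" using D'(4) card_image[OF dd_inj] by simp
qed

lemma card_D': "card D' = card D" using dd_image card_image[OF dd_inj] by simp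

lemma heavy': assumes d: "d : D'" shows "ennreal C <= em mu' (above m' ro' d)"
proof -
 obtain b where b: "b : D" "d = dd b" using d dd_image by blast
 have n: "bt (b2 b) : mspace m'" using bt_node(1)[of "b2 b"] b2[OF b(1)] by auto
 have "ennreal (C + 3) <= em mu (T.slab (b2 b) R1 R)" by (rule big[OF b(1)])
 also have "... <= em mu' (T'.slab (bt (b2 b)) R1 R) + ennreal ka"
  using bt_node(3)[of "b2 b"] b2[OF b(1)] Q(1) unfolding near_def by blast
 also have "... <= em mu' (above m' ro' d) + ennreal ka"
  using T'.above_trans[OF dd(1,3)[OF b(1)]] T'.above_borel[OF dd(1)[OF b(1)]] mu'(1) b(2)
  by (intro add_right_mono emeasure_mono) (auto simp: T'.slab_above[OF n])
 finally show ?thesis using bounds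
  by (cases "em mu' (above m' ro' d)") (auto simp: ennreal_plus[symmetric] ennreal_le_iff simp del: ennreal_plus)
qed

lemma slab_finite: "em mu (T.slab x t R) < \<infinity>" "em mu' (T'.slab y t R) < \<infinity>"
 using T.slab_emeasure_finite[OF mu(1,2)] T'.slab_emeasure_finite[OF mu'(1,2)] by auto

lemma node_near: "si : V ==> t : Q ==> \<bar>measure mu' (T'.slab (bt si) t R) - measure mu (T.slab si t R)\<bar> <= ka"
 unfolding measure_def by (rule near_real[OF bt_node(3) slab_finite(2,1) bounds(1)])

lemma edge_slab: assumes b: "b : D" shows "measure mu (T.slab (b1 b) t R) <= measure mu (T.slab (b2 b) t R) + ka"
proof -
 have m: "b1 b : mspace m" "b2 b : mspace m" using b1[OF b] b2[OF b] by auto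
 let ?X = "above m ro (b1 b) - above m ro (b2 b)"
 have sets: "?X : sets mu" "T.slab (b1 b) t R : sets mu" "T.slab (b2 b) t R : sets mu"
  using T.above_borel m T.slab_sets mu(1) by auto
 have "em mu (T.slab (b1 b) t R) <= em mu (T.slab (b2 b) t R Un ?X)"
  using sets by (intro emeasure_mono) (auto simp: T.slab_above[OF m(1)] T.slab_above[OF m(2)])
 also have "... <= em mu (T.slab (b2 b) t R) + em mu ?X" using sets by (intro emeasure_subadditive)
 also have "... <= em mu (T.slab (b2 b) t R) + ennreal ka" by (intro add_left_mono edge[OF b])
 finally show ?thesis unfolding measure_def using slab_finite(1)[of "b1 b" t] slab_finite(1)[of "b2 b" t] bounds(1)
  by (cases "em mu (T.slab (b1 b) t R)"; cases "em mu (T.slab (b2 b) t R)")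
   (auto simp: ennreal_plus[symmetric] simp del: ennreal_plus)
qed

text \<open>Slab masses decrease along \<open>b1 b\<close>, \<open>b\<close>, \<open>b2 b\<close>,
  and likewise along their counterparts. The two outer ones are matched up to \<open>ka\<close>, and
  in the first tree they differ by at most \<open>ka\<close>.\<close>

lemma bullet_slab:
 assumes b: "b : D" and t: "t : Q"
 shows "\<bar>measure mu' (T'.slab (dd b) t R) - measure mu (T.slab b t R)\<bar> <= 2 * ka"
  and "measure mu' (T'.slab (bt (b1 b)) t R) - measure mu' (T'.slab (bt (b2 b)) t R) <= 3 * ka"
proof -
 have m: "b1 b : mspace m" "b : mspace m" "b : above m ro (b1 b)" "b2 b : above m ro b" "b1 b : V" "b2 b : V"
  using b1[OF b] b2[OF b] D(2) b by auto
 have "measure mu (T.slab (b2 b) t R) <= measure mu (T.slab b t R)" "measure mu (T.slab b t R) <= measure mu (T.slab (b1 b) t R)"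
  using T.slab_measure_mono[OF mu(1,2)] m by blast+
 moreover have "measure mu' (T'.slab (bt (b2 b)) t R) <= measure mu' (T'.slab (dd b) t R)"
  "measure mu' (T'.slab (dd b) t R) <= measure mu' (T'.slab (bt (b1 b)) t R)"
  using T'.slab_measure_mono[OF mu'(1,2)] dd[OF b] bt_node(1)[OF m(5)] by blast+
 ultimately show "\<bar>measure mu' (T'.slab (dd b) t R) - measure mu (T.slab b t R)\<bar> <= 2 * ka"
  "measure mu' (T'.slab (bt (b1 b)) t R) - measure mu' (T'.slab (bt (b2 b)) t R) <= 3 * ka"
  using node_near[OF m(5) t] node_near[OF m(6) t] edge_slab[OF b, of t] by linarith+
qed

text \<open>The point \<open>dd b\<close> belongs to the cone of the lower node but not to that of
  the upper one, and these have slabs whose masses differ by at most \<open>3 * ka\<close>.\<close>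

lemma cut_points_small: "measure mu' D' <= 3 * ka * real (card D)"
proof -
 have pt: "measure mu' {dd b} <= 3 * ka" if b: "b : D" for b
 proof -
  let ?x = "bt (b1 b)" and ?y = "bt (b2 b)"
  have n: "?x : mspace m'" "?y : mspace m'" "T'.ht ?y = t2" using bt_node(1,2) b1[OF b] b2[OF b] by auto
  have y: "?y : above m' ro' ?x" using T'.above_trans[OF n(1) dd(4)[OF b] dd(3)[OF b]] .
  note fm = T'.slab_fmeasurable[OF mu'(1,2)]
  have pf: "{dd b} : fmeasurable mu'"
   by (rule fmeasurableI2[OF fm[OF dd(1)[OF b], of "-1"]]) (use T'.singleton_borel[OF dd(1)[OF b]] mu'(1) T'.above_self[OF dd(1)[OF b]] dd(2)[OF b] r_pos in \<open>auto simp: T'.slab_above[OF dd(1)[OF b], of "-1" R]\<close>)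
  have "dd b ~: T'.slab ?y (-1) R"
   using T'.above_ht[OF n(2), of "dd b"] dd(2)[OF b] n(3) levels(2) unfolding T'.slab_above[OF n(2)] by auto
  then have "measure mu' {dd b} + measure mu' (T'.slab ?y (-1) R) = measure mu' ({dd b} Un T'.slab ?y (-1) R)"
   by (intro measure_Union[symmetric]) (use fmeasurableD2[OF pf] fmeasurableD[OF pf] fmeasurableD2[OF fm[OF n(2)]] fmeasurableD[OF fm[OF n(2)]] in simp_all)
  also have "... <= measure mu' (T'.slab ?x (-1) R)"
  proof (rule measure_mono_fmeasurable[OF _ _ fm[OF n(1)]])
   show "{dd b} Un T'.slab ?y (-1) R <= T'.slab ?x (-1) R"
    using T'.above_mono[OF n(1) y] dd(2,4)[OF b] r_pos by (auto simp: T'.slab_above[OF n(1)] T'.slab_above[OF n(2)])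
   show "{dd b} Un T'.slab ?y (-1) R : sets mu'" using fmeasurableD[OF pf] fmeasurableD[OF fm[OF n(2)]] by (rule sets.Un)
  qed
  finally show ?thesis using bullet_slab(2)[OF b Q(2)] by simp
 qed
 have "measure mu' D' = measure mu' (UN b:D. {dd b})" unfolding dd_image[symmetric] by (simp add: UNION_singleton_eq_range)
 also have "... <= (SUM b:D. measure mu' {dd b})"
  by (rule measure_UNION_le[OF D(1)]) (use T'.singleton_borel dd(1) mu'(1) in auto)
 also have "... <= real (card D) * (3 * ka)" by (rule sum_bounded_above) (use pt in simp)
 finally show ?thesis by (simp add: mult.commute)
qed

text \<open>Both relations can be read off at the node \<open>b2 b\<close>, because
  \<open>si\<close> is lower than \<open>r\<close>; there they agree by the matching.\<close>

lemma node_bullets: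
 assumes si: "si : V" "T.ht si : S" "T.ht si < t1" "si : mspace m" and b: "b : D"
 shows "dd b : above m' ro' (bt si) \<longleftrightarrow> b : above m ro si"
proof -
 let ?y = "b2 b"
 have y: "?y : mspace m" "?y : V" "T.ht ?y = t2" "bt ?y : mspace m'" "T'.ht (bt ?y) = t2"
  using b2[OF b] bt_node(1,2)[of ?y] by auto
 have bm: "b : mspace m" using D(2) b by auto
 have "T.gp b si = min r (T.gp ?y si)" using T.gp_anc_left[OF y(1) si(4), of r] b_anc[OF b] levels y(3) by simp
 then have 1: "b : above m ro si \<longleftrightarrow> T.ht si <= T.gp si ?y"
  using T.above_iff_ge[OF si(4)] bm si(3) levels T.gp_commute[of b si] T.gp_commute[of ?y si] by (auto simp: min_def)
 have "T'.gp (dd b) (bt si) = min r (T'.gp (bt ?y) (bt si))"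
  unfolding dd_def using T'.gp_anc_left[OF y(4) bt_node(1)[OF si(1)], of r] levels y(5) by simp
 then have "dd b : above m' ro' (bt si) \<longleftrightarrow> T.ht si <= T'.gp (bt si) (bt ?y)"
  using T'.above_iff_ge[OF bt_node(1)[OF si(1)]] dd(1)[OF b] bt_node(2)[OF si(1)] si(3) levels
   T'.gp_commute[of "dd b" "bt si"] T'.gp_commute[of "bt ?y" "bt si"] by (auto simp: min_def)
 then show ?thesis using 1 bt_gp[OF si(1) y(2) si(2)] by simp
qed

text \<open>The errors are \<open>ka\<close> for the slab of the node, \<open>2 * ka\<close> for the
  slab over each cut point, and \<open>ta\<close> for the difference of the two tails beyond
  \<open>R\<close>, both of which lie between 0 and \<open>ta\<close>.\<close>

lemma cut_compare_aux:
 assumes si: "si : mspace m" "T.ht si <= r" and si': "si' : mspace m'" "T'.ht si' <= r"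
  and bul: "!!b. b : D ==> dd b : above m' ro' si' \<longleftrightarrow> b : above m ro si"
  and near: "\<bar>measure mu' (T'.slab si' t R) - measure mu (T.slab si t R)\<bar> <= ka" and t: "t : Q"
 shows "\<bar>measure (T'.cutm mu' D' c) {x : above m' ro' si'. t <= T'.ht x} - measure (T.cutm mu D c) {x : above m ro si. t <= T.ht x}\<bar>
  <= ka + 2 * ka * real (card D) + ta"
proof -
 let ?A = "{x : above m ro si. t <= T.ht x}" and ?A' = "{x : above m' ro' si'. t <= T'.ht x}"
 have mu_tail: "measure mu ({x : mspace m. R1 <= T.ht x} Int T.off D) <= ta" "measure mu' ({x : mspace m'. R1 <= T'.ht x} Int T'.off D') <= ta"
  unfolding measure_def using tail tail' bounds(3) by (auto intro: enn2real_leI)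
 obtain e where e: "0 <= e" "e <= ta" "measure mu (?A Int T.off D) =
   measure mu (T.slab si t R) - (SUM b:D Int above m ro si. measure mu (T.slab b t R)) + e"
  using T.cut_mass_split[OF mu D si levels(4), of t] mu_tail(1) by force
 obtain e' where e': "0 <= e'" "e' <= ta" "measure mu' (?A' Int T'.off D') =
   measure mu' (T'.slab si' t R) - (SUM b:D' Int above m' ro' si'. measure mu' (T'.slab b t R)) + e'"
  using T'.cut_mass_split[OF mu' D'(1-3) si' levels(4), of t] mu_tail(2) by force
 have img: "D' Int above m' ro' si' = dd ` (D Int above m ro si)" using dd_image bul by auto
 have inj: "inj_on dd (D Int above m ro si)" using dd_inj by (rule inj_on_subset) auto
 have S: "(SUM b:D' Int above m' ro' si'. measure mu' (T'.slab b t R)) = (SUM b:D Int above m ro si. measure mu' (T'.slab (dd b) t R))"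
  unfolding img by (simp add: sum.reindex[OF inj])
 have "\<bar>(SUM b:D Int above m ro si. measure mu' (T'.slab (dd b) t R)) - (SUM b:D Int above m ro si. measure mu (T.slab b t R))\<bar>
   <= (SUM b:D Int above m ro si. \<bar>measure mu' (T'.slab (dd b) t R) - measure mu (T.slab b t R)\<bar>)"
  unfolding sum_subtractf[symmetric] by (rule sum_abs)
 also have "... <= real (card (D Int above m ro si)) * (2 * ka)"
  by (rule sum_bounded_above) (use bullet_slab(1)[OF _ t] in blast)
 also have "... <= real (card D) * (2 * ka)" using bounds(1) D(1) by (intro mult_right_mono) (auto intro: card_mono)
 finally have B: "\<bar>(SUM b:D Int above m ro si. measure mu' (T'.slab (dd b) t R)) - (SUM b:D Int above m ro si. measure mu (T.slab b t R))\<bar>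
   <= 2 * ka * real (card D)" by (simp add: mult_ac)
 have cd: "card (D' Int ?A') = card (D Int ?A)"
 proof -
  have "D' Int ?A' = dd ` (D Int ?A)" using img dd(2) D(3) D'(3) dd_image bul by auto
  then show ?thesis using card_image[OF inj_on_subset[OF dd_inj, of "D Int ?A"]] by auto
 qed
 have As: "?A : sets (mb m)" "?A' : sets (mb m')"
 proof -
  have "?A = above m ro si Int {x : mspace m. t <= T.ht x}" using T.above_subset by auto
  then show "?A : sets (mb m)" using T.above_borel[OF si(1)] T.ht_borel_ge by simp
  have "?A' = above m' ro' si' Int {x : mspace m'. t <= T'.ht x}" using T'.above_subset by auto
  then show "?A' : sets (mb m')" using T'.above_borel[OF si'(1)] T'.ht_borel_ge by simp
 qed
 note M = T.measure_cutm[OF mu(1) D(1,2) mu(3) As(1), of c] and M' = T'.measure_cutm[OF mu'(1) D'(1,2) mu'(3) As(2), of c]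
 show ?thesis unfolding M M' cd e(3) e'(3) S using B e(1,2) e'(1,2) near by linarith
qed

lemma cut_compare:
 assumes "si : V" "T.ht si : S" "T.ht si < t1" "si : mspace m" "t : Q"
 shows "\<bar>measure (T'.cutm mu' D' c) {x : above m' ro' (bt si). t <= T'.ht x} - measure (T.cutm mu D c) {x : above m ro si. t <= T.ht x}\<bar>
  <= ka + 2 * ka * real (card D) + ta"
 by (rule cut_compare_aux[OF assms(4) _ bt_node(1)[OF assms(1)] _ node_bullets[OF assms(1-4)] node_near[OF assms(1,5)] assms(5)])
  (use assms(3) levels(1) bt_node(2)[OF assms(1)] in auto)

lemma cut_compare_root:
 assumes t: "t : Q"
 shows "\<bar>measure (T'.cutm mu' D' c) {x : mspace m'. t <= T'.ht x} - measure (T.cutm mu D c) {x : mspace m. t <= T.ht x}\<bar>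
  <= ka + 2 * ka * real (card D) + ta"
proof -
 have "near ka (em mu' (T'.slab ro' t R)) (em mu (T.slab ro t R))" using bt t unfolding matched_def by blast
 then have n: "\<bar>measure mu' (T'.slab ro' t R) - measure mu (T.slab ro t R)\<bar> <= ka"
  unfolding measure_def by (rule near_real[OF _ slab_finite(2,1) bounds(1)])
 have "\<bar>measure (T'.cutm mu' D' c) {x : above m' ro' ro'. t <= T'.ht x} - measure (T.cutm mu D c) {x : above m ro ro. t <= T.ht x}\<bar>
  <= ka + 2 * ka * real (card D) + ta"
  by (rule cut_compare_aux[OF T.root_in _ T'.root_in _ _ n t]) (use r_pos D(2) dd(1) in auto)
 then show ?thesis by simp
qed

end

section \<open>Matching of cut-off measures along a sequence of trees\<close>

context rooted_tree
begin

text \<open>As \<open>t\<close> increases to \<open>r\<close>, the sets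
  \<open>up (anc b t) - up b\<close> shrink to the empty set. For \<open>t\<close> close to
  \<open>r\<close> they avoid the cones of the other cut points, so their mass is finite and
  continuity from above applies.\<close>

lemma edge_below:
 assumes mu: "sets mu = Bor" "em mu (off D) < \<infinity>" and D: "finite D" "D <= Pt" "!!d. d : D ==> ht d = r"
  and b: "b : D" and r: "0 < r" and et: "0 < et"
 shows "\<forall>\<^sub>F t in at_left r. em mu (up (anc b t) - up b) <= ennreal et"
proof -
 have bm: "b : Pt" "ht b = r" using b D by auto
 have "\<forall>\<^sub>F t in at_left r. ALL d:D - {b}. gp b d < t"
 proof (rule eventually_ball_finite, use D(1) in simp, rule ballI)
  fix d assume d: "d : D - {b}"
  then have dm: "d : Pt" "ht d = r" using D by auto
  have "gp b d < r"
  proof (rule ccontr)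
   assume "~ gp b d < r"
   then have "d : up b" using above_iff_ge[OF bm(1)] bm(2) dm by simp
   then show False using above_disjoint[OF bm(1) dm(1) _ _ above_self[OF dm(1)]] bm(2) dm(2) d by simp
  qed
  then show "\<forall>\<^sub>F t in at_left r. gp b d < t" by (auto simp: eventually_at_left_field)
 qed
 then obtain a where a: "a < r" "!!t d. a < t ==> t < r ==> d : D ==> d ~= b ==> gp b d < t" by (auto simp: eventually_at_left_field)
 define a' where "a' = max a 0"
 have a': "0 <= a'" "a <= a'" "a' < r" unfolding a'_def using a(1) r by auto
 have iff: "z : up (anc b t) - up b \<longleftrightarrow> z : Pt & t <= gp b z & gp b z < r" if t: "a' < t" "t < r" for z t
 proof -
  have t': "0 <= t" "t <= ht b" using t a' bm by auto
  have "z : Pt ==> gp (anc b t) z = min t (gp b z)" by (rule gp_anc_left[OF bm(1) _ t'])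
  then show ?thesis using above_iff_ge[OF anc_in[OF bm(1) t']] ht_anc[OF bm(1) t'] above_iff_ge[OF bm(1)] bm(2) t(2) by (cases "z : Pt") (auto simp: min_def split: if_splits)
 qed
 have sub: "up (anc b t) - up b <= off D" if t: "a' < t" "t < r" for t
 proof
  fix z assume z: "z : up (anc b t) - up b"
  then have z': "z : Pt" "t <= gp b z" unfolding iff[OF t] by auto
  have "z ~: up d" if d: "d : D" for d
  proof
   assume zd: "z : up d"
   have dm: "d : Pt" "ht d = r" using d D by auto
   have "t <= gp z d" using zd above_iff[OF dm(1)] dm(2) t gp_commute[of z d] by simp
   then have "t <= gp b d" using gp_ge_trans[OF bm(1) z'(1) dm(1) z'(2)] by simp
   then show False using a(2)[OF _ t(2) d] t(1) a'(2) zd z by force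
  qed
  then show "z : off D" unfolding off_def using z' by blast
 qed
 define e where "e k = (r - a') / real (k + 2)" for k :: nat
 have e: "0 < e k" "e k < r - a'" for k using a'(3) divide_strict_left_mono[of 1 "real (k + 2)" "r - a'"] unfolding e_def by auto
 have e0: "e \<longlonglongrightarrow> 0" unfolding e_def by (intro LIMSEQ_ignore_initial_segment[of "%k. (r - a') / real k"] lim_const_over_n)
 have tk: "a' < r - e k" "r - e k < r" for k using e[of k] by auto
 let ?A = "%k. up (anc b (r - e k)) - up b"
 have As: "?A k : sets mu" for k
  using above_borel[OF bm(1)] above_borel[OF anc_in[OF bm(1), of "r - e k"]] tk[of k] a' bm(2) mu(1) by auto
 have "EV k. em mu (?A k) <= em mu {} + ennreal et"
 proof (rule eventually_outer[OF _ _ _ _ _ et])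
  show "decseq ?A"
  proof (rule antimonoI)
   fix i j :: nat assume "i <= j"
   then have "e j <= e i" unfolding e_def using a' by (intro divide_left_mono) auto
   then show "?A j <= ?A i" by (auto simp only: subset_iff iff[OF tk])
  qed
  show "(INT k. ?A k) <= {}"
  proof
   fix z assume "z : (INT k. ?A k)"
   then have z: "r - e k <= gp b z" "gp b z < r" for k using iff[OF tk] by blast+
   have "r - gp b z <= 0" by (rule LIMSEQ_le_const[OF e0]) (use z(1) in \<open>auto simp: algebra_simps\<close>)
   then show "z : {}" using z(2) by simp
  qed
  show "em mu (?A k) < \<infinity>" for k
   using emeasure_mono[OF sub[OF tk], of mu k] off_borel[OF D(1,2)] mu by simp
 qed (use As in auto)
 then obtain k where k: "em mu (?A k) <= ennreal et" by (auto dest: eventually_happens)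
 have "em mu (up (anc b t) - up b) <= ennreal et" if t: "r - e k < t" "t < r" for t
  by (smt (verit) t tk k subset_iff iff emeasure_mono As order_trans)
 then show ?thesis unfolding eventually_at_left_field using e(1)[of k] by (intro exI[of _ "r - e k"]) auto
qed

lemma slab_exhausts:
 assumes mu: "sets mu = Bor" and si: "si : Pt" and c: "c < em mu {x : up si. t <= ht x}"
 shows "\<forall>\<^sub>F R in at_top. c < em mu (slab si t R)"
proof -
 have S: "slab si t R : sets mu" for R using slab_sets[OF si] mu by simp
 have mono: "slab si t R <= slab si t R'" if "R <= R'" for R R' unfolding slab_def using that by auto
 have "(SUP k. em mu (slab si t (real k))) = em mu (UN k. slab si t (real k))"
  by (rule SUP_emeasure_incseq) (use S mono in \<open>auto simp: incseq_def\<close>)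
 also have "(UN k. slab si t (real k)) = {x : up si. t <= ht x}"
  unfolding slab_above[OF si] using real_arch_simple by auto
 finally have "c < (SUP k. em mu (slab si t (real k)))" using c by simp
 then obtain k :: nat where k: "c < em mu (slab si t (real k))" unfolding less_SUP_iff by auto
 show ?thesis unfolding eventually_at_top_linorder
  using emeasure_mono[OF mono S] k by (intro exI[of _ "real k"]) (auto intro: less_le_trans)
qed

text \<open>The order of choices makes the requirements of \<open>cut_pair\<close> compatible: the
  tolerances \<open>ka\<close> and \<open>ta\<close> precede the levels \<open>t1 < r < t2\<close>,
  between which little mass surrounds each cut point; \<open>R1\<close> is taken where both tails
  are small; \<open>R\<close> comes last, so large that the infinite cones show mass
  \<open>C + 3\<close> between \<open>R1\<close> and \<open>R\<close>. Only then is the matching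
  invoked.\<close>

theorem cut_matching:
 fixes ms :: "nat => 'b metric" and ros mus Ds
 assumes G: "!!a b. 0 <= a ==> a < b ==> EX s:G. a < s & s < b" "!!s. s : G ==> no_branching s"
   "!!s. s : G ==> em mu (lev s) = 0" "!!s. s : G ==> 0 < s"
  and adm: "admissible mu" and r: "0 < r" and D: "D = heavy_at mu r" and D0: "!!b. b : D ==> em mu {b} = 0"
  and nb: "!!b x y. b : D ==> x : up b ==> x ~= b ==> y : up b ==> y ~= b ==> r < gp x y"
  and seq: "!!n. rooted_tree (ms n) (ros n)" "!!n. sets (mus n) = sets (mb (ms n))"
   "!!n R. em (mus n) {x : mspace (ms n). mdist (ms n) (ros n) x <= R} < \<infinity>"
  and conv: "!!R dl. 0 < dl ==> EV n. EX s>=R. EX C. close_by dl m ro (mrestr mu (tball m ro s)) (ms n) (ros n) (mrestr (mus n) (tball (ms n) (ros n) s)) C"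
  and Ds: "!!n. finite (Ds n)" "!!n. Ds n <= tsphere (ms n) (ros n) r" "!!n. card (Ds n) <= card D"
  and tight: "!!ze. 0 < ze ==> EX R. EV n. em (mus n) ({x : mspace (ms n). R <= mdist (ms n) (ros n) x} Int rooted_tree.off (ms n) (ros n) (Ds n)) <= ennreal ze"
  and S: "finite S" "S <= G" "!!s. s : S ==> s < r" and V: "finite V" "V <= Pt" "!!si. si : V ==> ht si : S"
   "!!si. si : V ==> 0 < em (cutm mu D c) (up si)"
  and Q: "finite Q" "!!t. t : Q ==> em mu (lev t) = 0" and et: "0 < et" and C: "0 <= C"
 shows "EV n. finite_measure (rooted_tree.cutm (ms n) (ros n) (mus n) (Ds n) c) &
  (EX bt. node_matched et S V m ro (cutm mu D c) (ms n) (ros n) (rooted_tree.cutm (ms n) (ros n) (mus n) (Ds n) c) bt) &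
  (ALL t:Q. near et (em (rooted_tree.cutm (ms n) (ros n) (mus n) (Ds n) c) {x : mspace (ms n). t <= mdist (ms n) (ros n) x})
   (em (cutm mu D c) (hi t))) &
  card (Ds n) = card D & (ALL d:Ds n. ennreal C <= em (mus n) (above (ms n) (ros n) d)) &
  measure (mus n) (Ds n) <= et & em (mus n) (rooted_tree.off (ms n) (ros n) (Ds n)) < \<infinity>"
proof -
 have mu: "sets mu = Bor" "finite D" "em mu (off D) < \<infinity>"
  using adm r unfolding admissible_def D by auto
 have Dm: "D <= Pt" "!!d. d : D ==> ht d = r" "!!d. d : D ==> em mu (up d) = \<infinity>"
  unfolding D heavy_at_def by auto
 \<comment> \<open>Chosen so that \<open>ka + 2 * ka * card D + ta\<close>, the error in
   \<open>cut_compare\<close>, and \<open>3 * ka * card D\<close>, the bound for the mass of the cut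
   points, are at most \<open>et\<close>.\<close>
 define ka where "ka = min 1 (et / (4 * (real (card D) + 1)))"
 define ta where "ta = min 1 (et / 4)"
 have ka: "0 < ka" "ka <= 1" "0 < ta" "ta <= 1" unfolding ka_def ta_def using et by auto
 have "ka <= et / (4 * (real (card D) + 1))" unfolding ka_def by simp
 then have k1: "ka * (real (card D) + 1) <= et / 4" by (simp add: field_simps)
 have k2: "0 <= ka * real (card D)" using ka by simp
 have kaet: "ka + 2 * ka * real (card D) + ta <= et" "3 * ka * real (card D) <= et"
  using k1 k2 ka(1) et unfolding ta_def by (auto simp: algebra_simps min_def)
 have "\<forall>\<^sub>F t in at_left r. (ALL b:D. em mu (up (anc b t) - up b) <= ennreal (ka / 2)) &
   (ALL p:{(b, c) : D \<times> D. b ~= c}. gp (fst p) (snd p) < t) & (ALL s:S. s < t)"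
 proof (intro eventually_conj eventually_ball_finite ballI)
  show "\<forall>\<^sub>F t in at_left r. em mu (up (anc b t) - up b) <= ennreal (ka / 2)" if "b : D" for b
   by (rule edge_below[OF mu(1,3,2) Dm(1,2) that r]) (use ka in auto)
  show "\<forall>\<^sub>F t in at_left r. gp (fst p) (snd p) < t" if p: "p : {(b, c) : D \<times> D. b ~= c}" for p
  proof -
   obtain b c where bc: "p = (b, c)" "b : D" "c : D" "b ~= c" using p by auto
   have bm: "b : Pt" "c : Pt" using bc Dm by auto
   have "gp b c < r"
   proof (rule ccontr)
    assume "~ gp b c < r"
    then have "c : up b" using above_iff_ge[OF bm(1)] Dm(2)[OF bc(2)] bm by simp
    then show False using level_antichain[OF Dm(1,2) bc(2,3)] bc(4) by simp
   qed
   then show ?thesis unfolding bc(1) by (auto simp: eventually_at_left_field)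
  qed
  show "\<forall>\<^sub>F t in at_left r. s < t" if "s : S" for s using S(3)[OF that] by (auto simp: eventually_at_left_field)
  show "finite {(b, c) : D \<times> D. b ~= c}" by (rule finite_subset[of _ "D \<times> D"]) (use mu(2) in auto)
 qed (use mu S in auto)
 then obtain a where a: "a < r" "!!t. a < t ==> t < r ==> (ALL b:D. em mu (up (anc b t) - up b) <= ennreal (ka / 2)) &
   (ALL p:{(b, c) : D \<times> D. b ~= c}. gp (fst p) (snd p) < t) & (ALL s:S. s < t)"
  unfolding eventually_at_left_field by blast
 obtain t1 where t1: "t1 : G" "max a 0 < t1" "t1 < r" using G(1)[of "max a 0" r] a(1) r by auto
 have t1': "!!b. b : D ==> em mu (up (anc b t1) - up b) <= ennreal (ka / 2)"
  "!!b c. b : D ==> c : D ==> b ~= c ==> gp b c < t1" "!!s. s : S ==> s < t1" "0 < t1"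
  using a(2)[of t1] t1 by auto
 have "\<forall>\<^sub>F t in at_right r. ALL b:D. EX y:up b. ht y = t & em mu (up y) = \<infinity> &
   em mu (up b - up y) <= ennreal (ka / 2)"
 proof (rule eventually_ball_finite[OF mu(2)], rule ballI)
  fix b assume b: "b : D"
  have bm: "b : Pt" "ht b = r" using Dm b by auto
  show "\<forall>\<^sub>F t in at_right r. EX y:up b. ht y = t & em mu (up y) = \<infinity> &
   em mu (up b - up y) <= ennreal (ka / 2)"
   unfolding eventually_at_right_field bm(2)[symmetric]
   using infinite_edge_above[OF adm bm(1) _ Dm(3)[OF b] D0[OF b] nb[OF b, folded bm(2)], of "ka / 2"] r bm(2) ka(1) by auto
 qed
 then obtain u where u: "r < u" "!!t. r < t ==> t < u ==> ALL b:D. EX y:up b. ht y = t & em mu (up y) = \<infinity> &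
   em mu (up b - up y) <= ennreal (ka / 2)" unfolding eventually_at_right_field by blast
 obtain t2 where t2: "t2 : G" "r < t2" "t2 < u" using G(1)[of r u] u(1) r by auto
 obtain b2 where b2: "!!b. b : D ==> b2 b : up b & ht (b2 b) = t2 & em mu (up (b2 b)) = \<infinity> &
   em mu (up b - up (b2 b)) <= ennreal (ka / 2)"
  using bchoice[of D "%b y. y : up b & ht y = t2 & em mu (up y) = \<infinity> &
   em mu (up b - up y) <= ennreal (ka / 2)"] u(2)[OF t2(2,3)] by blast
 define b1 where "b1 b = anc b t1" for b
 have b1: "b1 b : Pt" "ht (b1 b) = t1" "b : up (b1 b)" if "b : D" for b
  unfolding b1_def using anc[of b t1] anc_above[of b t1] Dm(1,2) that t1 t1'(4) by auto
 have b2m: "b2 b : Pt" if "b : D" for b using b2[OF that] above_subset by blast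
 have oD: "off D : sets mu" using off_borel[OF mu(2) Dm(1)] mu(1) by simp
 have ball: "em mu (lo R) < \<infinity>" for R by (rule admissible_ball[OF adm])
 obtain R0 where R0: "EV n. em (mus n) ({x : mspace (ms n). R0 <= mdist (ms n) (ros n) x} Int rooted_tree.off (ms n) (ros n) (Ds n)) <= ennreal ta"
  using tight[OF ka(3)] by blast
 let ?B = "%k::nat. (hi (real k)) Int off D"
 have "EV k. em mu (?B k) <= em mu {} + ennreal ta"
 proof (rule eventually_outer[OF _ _ _ _ _ ka(3)])
  show "range ?B <= sets mu" using ht_borel_ge mu(1) oD by (auto simp only: image_subset_iff intro!: sets.Int)
  show "(INT k. ?B k) <= {}"
   using reals_Archimedean2 not_less by fastforce
  show "em mu (?B k) < \<infinity>" for k using emeasure_mono[of "?B k" "off D" mu] oD mu(3) by simp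
 qed (auto simp: decseq_def)
 then obtain k where k: "em mu (?B k) <= ennreal ta" by (auto dest: eventually_happens)
 define K where "K = max (max R0 (real k)) t2"
 have K: "R0 <= K" "real k <= K" "t2 <= K" "0 <= K" unfolding K_def using t2 r by auto
 obtain R1 where R1: "R1 : G" "K < R1" using G(1)[of K "K + 1"] K(4) by auto
 have tail: "em mu ((hi R1) Int off D) <= ennreal ta"
  by (rule order_trans[OF emeasure_mono k]) (use K R1 ht_borel_ge mu(1) oD in auto)
 have big: "\<forall>\<^sub>F R in at_top. ALL b:D. ennreal (C + 3) < em mu (slab (b2 b) R1 R)"
 proof (rule eventually_ball_finite[OF mu(2)], rule ballI)
  fix b assume b: "b : D"
  have "em mu {x : up (b2 b). R1 <= ht x} = \<infinity>"
  proof (rule ccontr)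
   assume fin: "em mu {x : up (b2 b). R1 <= ht x} ~= \<infinity>"
   have eq: "{x : up (b2 b). R1 <= ht x} = up (b2 b) Int (hi R1)" using above_subset by auto
   have sb: "{x : up (b2 b). R1 <= ht x} : sets mu" unfolding eq using above_borel[OF b2m[OF b]] ht_borel_ge mu(1) by simp
   have "em mu (up (b2 b)) <= em mu ({x : up (b2 b). R1 <= ht x} Un (lo R1))"
    using sb ht_borel_le mu(1) above_subset by (intro emeasure_mono) auto
   also have "... <= em mu {x : up (b2 b). R1 <= ht x} + em mu (lo R1)"
    using sb ht_borel_le mu(1) by (intro emeasure_subadditive) auto
   finally show False using b2[OF b] fin ball[of R1] by (simp add: top_unique)
  qed
  then show "\<forall>\<^sub>F R in at_top. ennreal (C + 3) < em mu (slab (b2 b) R1 R)"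
   by (intro slab_exhausts[OF mu(1) b2m[OF b]]) simp
 qed
 have pos: "\<forall>\<^sub>F R in at_top. ALL si:V. 0 < em mu (slab si (-1) R)"
 proof (rule eventually_ball_finite[OF V(1)], rule ballI)
  fix si assume si: "si : V"
  have sim: "si : Pt" using V(2) si by auto
  have eq: "{x : up si. -1 <= ht x} = up si" using ht_nonneg by (auto intro: order_trans[of "-1" 0])
  \<comment> \<open>Positivity is assumed after the cut only. If the cone were null for
    \<open>mu\<close>, it would contain no cut point, as these have infinite cones, and its cut mass
    would vanish too.\<close>
  have "0 < em mu (up si)"
  proof (rule ccontr)
   assume "~ 0 < em mu (up si)"
   then have z: "em mu (up si) = 0" by (simp add: not_gr_zero)
   have "D Int up si = {}"
    using emeasure_mono[OF above_mono[OF sim], of _ mu] above_borel[OF sim] mu(1) z Dm(3) by fastforce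
   moreover have "em mu (up si Int off D) <= em mu (up si)"
    using above_borel[OF sim] mu(1) by (intro emeasure_mono) auto
   ultimately show False using V(4)[OF si] emeasure_cutm[OF mu(1,2) Dm(1) above_borel[OF sim], of c] z by simp
  qed
  then show "\<forall>\<^sub>F R in at_top. 0 < em mu (slab si (-1) R)" using slab_exhausts[OF mu(1) sim, of 0 "-1"] unfolding eq by simp
 qed
 obtain K2 where K2: "!!R. K2 <= R ==> (ALL b:D. ennreal (C + 3) < em mu (slab (b2 b) R1 R)) & (ALL si:V. 0 < em mu (slab si (-1) R))"
  using eventually_conj[OF big pos] unfolding eventually_at_top_linorder by blast
 obtain R where R: "R : G" "max K2 R1 < R" using G(1)[of "max K2 R1" "max K2 R1 + 1"] K(4) R1(2) by (auto simp: le_max_iff_disj)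
 note big = K2[of R, THEN conjunct1, rule_format] and pos = K2[of R, THEN conjunct2, rule_format]
 \<comment> \<open>The nodes enclosing the cut points, with their levels, are matched along with the
   given ones.\<close>
 let ?S = "S Un {t1, t2}" and ?V = "V Un b1 ` D Un b2 ` D" and ?Q = "insert R1 (insert (-1) Q)"
 have SG: "?S <= G" using S t1 t2 by auto
 have htV: "ht si : ?S" "si : Pt" if "si : ?V" for si using that V b1 b2 b2m by auto
 have slabpos: "0 < em mu (slab si (-1) R)" if si: "si : ?V" for si
 proof -
  have p2: "0 < em mu (slab (b2 b) (-1) R)" if b: "b : D" for b
  proof -
   have "0 < ennreal (C + 3)" using C by (simp del: ennreal_plus)
   also have "... < em mu (slab (b2 b) R1 R)" using big[OF _ b] R(2) by simp
   also have "... <= em mu (slab (b2 b) (-1) R)"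
    using slab_sets[OF b2m[OF b]] mu(1) K(4) R1(2) by (intro emeasure_mono) (auto simp: slab_def)
   finally show ?thesis .
  qed
  have p1: "0 < em mu (slab (b1 b) (-1) R)" if b: "b : D" for b
  proof -
   have "b2 b : up (b1 b)" using above_trans[OF b1(1,3)[OF b]] b2[OF b] by blast
   then have "slab (b2 b) (-1) R <= slab (b1 b) (-1) R"
    using above_mono[OF b1(1)[OF b]] by (auto simp: slab_above[OF b1(1)[OF b]] slab_above[OF b2m[OF b]])
   then have "em mu (slab (b2 b) (-1) R) <= em mu (slab (b1 b) (-1) R)"
    using slab_sets[OF b1(1)[OF b]] mu(1) by (intro emeasure_mono) auto
   then show ?thesis using p2[OF b] by simp
  qed
  show ?thesis using si pos R(2) p1 p2 by auto
 qed
 have "EX dl>0. ALL m' (ro' :: 'b) mu' C r. rooted_tree m' ro' --> sets mu' = sets (mb m') --> R + 1 <= r -->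
   close_by dl m ro (mrestr mu (tball m ro r)) m' ro' (mrestr mu' (tball m' ro' r)) C -->
   (EX bt. matched ka ?S ?V ?Q R m ro mu m' ro' mu' bt)"
 proof (rule matching_exists[OF mu(1) ball])
  show "em mu (lev t) = 0" if "t : ?Q" for t using that Q(2) G(3)[OF R1(1)] null_neg by blast
  show "finite ?V" "finite ?S" "finite ?Q" using V(1) S(1) Q(1) mu(2) by simp_all
  show "si : Pt" "0 < ht si" if "si : ?V" for si using htV[OF that] SG G(4) by blast+
  show "no_branching s" if "s : ?S" for s using G(2) SG that by blast
  show "ht si : ?S" "0 < em mu (slab si (-1) R)" if "si : ?V" for si using htV(1) slabpos that by blast+
  show "em mu (lev (ht si)) = 0" if "si : ?V" for si using G(3) SG htV(1)[OF that] by blast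
  show "em mu (lev R) = 0" "0 < ka" using G(3)[OF R(1)] ka(1) by simp_all
 qed
 then obtain dl where dl: "0 < dl" "!!m' (ro' :: 'b) mu' C r. rooted_tree m' ro' ==> sets mu' = sets (mb m') ==> R + 1 <= r ==>
   close_by dl m ro (mrestr mu (tball m ro r)) m' ro' (mrestr mu' (tball m' ro' r)) C ==>
   (EX bt. matched ka ?S ?V ?Q R m ro mu m' ro' mu' bt)" by blast
 show ?thesis
  using R0 conv[OF dl(1), of "R + 1"]
 proof eventually_elim
  case (elim n)
  interpret T': rooted_tree "ms n" "ros n" by (rule seq(1))
  obtain s C' where s: "R + 1 <= s" "close_by dl m ro (mrestr mu (tball m ro s)) (ms n) (ros n) (mrestr (mus n) (tball (ms n) (ros n) s)) C'"
   using elim(2) by blast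
  obtain bt where bt: "matched ka ?S ?V ?Q R m ro mu (ms n) (ros n) (mus n) bt"
   using dl(2)[OF seq(1,2) s] by blast
  have D': "Ds n <= mspace (ms n)" "!!d. d : Ds n ==> T'.ht d = r" using Ds(2)[of n] unfolding T'.tsphere_eq by auto
  have oD': "T'.off (Ds n) : sets (mus n)" using T'.off_borel[OF Ds(1) D'(1)] seq(2) by simp
  have tail': "em (mus n) ({x : mspace (ms n). R1 <= T'.ht x} Int T'.off (Ds n)) <= ennreal ta"
   by (rule order_trans[OF emeasure_mono elim(1)]) (use K R1 T'.ht_borel_ge[of R0] oD' seq(2) in \<open>auto simp: T'.ht_def\<close>)
  have fin': "em (mus n) (T'.off (Ds n)) < \<infinity>"
  proof -
   let ?X = "{x : mspace (ms n). R1 <= T'.ht x} Int T'.off (Ds n)" and ?Y = "{x : mspace (ms n). T'.ht x <= R1}"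
   have X: "?X : sets (mus n)" "?Y : sets (mus n)" using T'.ht_borel_ge T'.ht_borel_le oD' seq(2) by auto
   have "em (mus n) (T'.off (Ds n)) <= em (mus n) (?X Un ?Y)"
    using X by (intro emeasure_mono) (auto simp: T'.off_def)
   also have "... <= em (mus n) ?X + em (mus n) ?Y" using X by (intro emeasure_subadditive)
   also have "... <= ennreal ta + em (mus n) ?Y" by (intro add_right_mono tail')
   also have "... < \<infinity>" using seq(3)[where n = n and R = R1] unfolding T'.ht_def[symmetric] by (simp add: less_top)
   finally show ?thesis .
  qed
  interpret P: cut_pair m ro "ms n" "ros n" mu "mus n" D "Ds n" b1 b2 bt ?S ?V ?Q t1 r t2 R1 R ka ta C
  proof unfold_locales
   show "em mu (lo R) < \<infinity>" by (rule ball)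
   show "em (mus n) {x : mspace (ms n). T'.ht x <= R} < \<infinity>" using seq(3) unfolding T'.ht_def .
   show "t1 < r" "r < t2" "t2 <= R1" "R1 <= R" "0 < t1" "t1 : ?S" using t1 t2 R1 K R t1' by auto
   show "b1 b : ?V & b1 b : Pt & ht (b1 b) = t1 & b : up (b1 b)" if "b : D" for b using b1[OF that] that by auto
   show "b2 b : ?V & b2 b : Pt & ht (b2 b) = t2 & b2 b : up b" if "b : D" for b using b2[OF that] b2m[OF that] that by auto
   show "em mu (up (b1 b) - up (b2 b)) <= ennreal ka" if b: "b : D" for b
   proof -
    have bm: "b : Pt" using Dm(1) b by auto
    have "em mu (up (b1 b) - up (b2 b)) <= em mu ((up (b1 b) - up b) Un (up b - up (b2 b)))"
     using above_borel bm b1[OF b] b2m[OF b] mu(1) by (intro emeasure_mono) auto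
    also have "... <= em mu (up (b1 b) - up b) + em mu (up b - up (b2 b))"
     using above_borel bm b1[OF b] b2m[OF b] mu(1) by (intro emeasure_subadditive) auto
    also have "... <= ennreal (ka / 2) + ennreal (ka / 2)" using t1'(1)[OF b] b2[OF b] unfolding b1_def by (intro add_mono) auto
    also have "... = ennreal ka" using ka(1) by (simp add: ennreal_plus[symmetric] del: ennreal_plus)
    finally show ?thesis .
   qed
   show "ennreal (C + 3) <= em mu (slab (b2 b) R1 R)" if "b : D" for b using big[OF _ that] R(2) by simp
  qed (use mu Dm seq(2)[of n] fin' Ds(1,3)[of n] D' t1' bt tail tail' ka C in auto)
  have fm: "finite_measure (cutm mu D c)" "finite_measure (T'.cutm (mus n) (Ds n) c)"
   using finite_cutm[OF mu(1,2) Dm(1) mu(3)] T'.finite_cutm[OF seq(2) Ds(1) D'(1) fin'] by auto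
  have all: "{x : up si. -1 <= ht x} = up si" "{x : above (ms n) (ros n) si'. -1 <= T'.ht x} = above (ms n) (ros n) si'" for si si'
   using ht_nonneg T'.ht_nonneg by (auto intro: order_trans[of "-1" 0])
  have "node_matched et S V m ro (cutm mu D c) (ms n) (ros n) (T'.cutm (mus n) (Ds n) c) bt"
   unfolding node_matched_def
  proof (intro conjI ballI)
   fix si assume si: "si : V"
   then have v: "si : ?V" "ht si : ?S" "ht si < t1" "si : Pt" using V t1'(3) by auto
   show "bt si : mspace (ms n)" "mdist (ms n) (ros n) (bt si) = mdist m ro si"
    using P.bt_node(1,2)[OF v(1)] unfolding ht_def T'.ht_def by auto
   show "near et (em (T'.cutm (mus n) (Ds n) c) (above (ms n) (ros n) (bt si))) (em (cutm mu D c) (up si))"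
    using P.cut_compare[OF v P.Q(2), of c] kaet(1) unfolding all by (intro near_measureI[OF fm]) (simp add: abs_minus_commute)
  next
   fix si si' s assume "si : V" "si' : V" "s : S"
   then show "s <= gp si si' \<longleftrightarrow> s <= T'.gp (bt si) (bt si')" using P.bt_gp[of si si' s] by blast
  qed
  moreover have "near et (em (T'.cutm (mus n) (Ds n) c) {x : mspace (ms n). t <= mdist (ms n) (ros n) x})
   (em (cutm mu D c) (hi t))" if "t : Q" for t
   using P.cut_compare_root[of t c] that kaet(1) unfolding T'.ht_def[symmetric] by (intro near_measureI[OF fm]) (simp add: abs_minus_commute)
  ultimately show ?case using fm(2) P.card_D' P.heavy' order_trans[OF P.cut_points_small kaet(2)] fin' by blast
 qed
qed

end

section \<open>Convergence of nodes and levels\<close>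

locale tree_sequence = rooted_tree m ro for m :: "'a metric" and ro +
 fixes ms :: "nat => 'b metric" and ros :: "nat => 'b"
 assumes trees: "rooted_tree (ms n) (ros n)"
begin

sublocale Tn: rooted_tree "ms n" "ros n" for n by (rule trees)

definition nodes_conv :: "real set => 'a measure => (nat => 'b measure) => bool" where
 "nodes_conv G M Ms \<longleftrightarrow> (ALL et>0. ALL S V. finite S --> S <= G --> finite V -->
   V <= {x : Pt. ht x : S & 0 < em M (up x)} -->
   (EV n. EX bt. node_matched et S V m ro M (ms n) (ros n) (Ms n) bt))"

definition levels_conv :: "real set => 'a measure => (nat => 'b measure) => bool" where
 "levels_conv G M Ms \<longleftrightarrow> (ALL et>0. ALL t:G. EV n.
   near et (em (Ms n) {x : mspace (ms n). t <= Tn.ht n x}) (em M (hi t)))"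

lemma nodes_convD:
 assumes "nodes_conv G M Ms" "0 < et" "finite S" "S <= G" "finite V" "V <= {x : Pt. ht x : S & 0 < em M (up x)}"
 shows "EV n. EX bt. node_matched et S V m ro M (ms n) (ros n) (Ms n) bt"
 using assms unfolding nodes_conv_def by blast

lemma node_matchedD:
 assumes "node_matched et S V m ro M (ms n) (ros n) M' bt" "si : V"
 shows "bt si : mspace (ms n)" "Tn.ht n (bt si) = ht si"
  "near et (em M' (above (ms n) (ros n) (bt si))) (em M (up si))"
  "ta : V ==> s : S ==> s <= gp si ta \<longleftrightarrow> s <= Tn.gp n (bt si) (bt ta)"
 using assms unfolding node_matched_def ht_def Tn.ht_def by auto

text \<open>Both trees are cut into cells of height at most \<open>ep/3\<close>, with enough nodes
  per level that little mass is lost. The mass of a cell is, up to this loss, a combination of cone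
  masses of its node and of the nodes over it, so matched nodes have cells of nearly equal mass. In
  the n-th tree the loss is bounded by subtracting the cone masses from the mass above the level;
  this is where convergence of levels enters.\<close>

theorem GP_small:
 assumes sc: "second_countable_metric m" and M: "finite_measure M" "sets M = Bor"
  and Ms: "EV n. finite_measure (Ms n)" "!!n. sets (Ms n) = sets (mb (ms n))"
  and G: "!!a b. 0 <= a ==> a < b ==> EX s:G. a < s & s < b" "!!s. s : G ==> em M (lev s) = 0"
  and conv: "nodes_conv {s:G. s < rr} M Ms" "levels_conv (insert 0 {s:G. s < rr}) M Ms"
  and r: "r : G" "0 < r" "r < rr" and ep: "0 < ep"
  and Y: "represents Y m ro (mrestr M (tball m ro r))" "!!n. represents (Ys n) (ms n) (ros n) (mrestr (Ms n) (tball (ms n) (ros n) r))"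
 shows "EV n. GP_dist (Ys n) Y <= ennreal ep"
proof -
 interpret finite_measure M by fact
 from level_grid[OF G(1) r(2), of "ep/3"] ep obtain J s where J: "0 < J" and s0: "s 0 = (0::real)" "s J = r"
  and step: "!!j. j < J ==> s j < s (Suc j) & s (Suc j) <= s j + ep/3" and sG': "!!j. 0 < j ==> j < J ==> s j : G" by force
 have smono: "s i <= s j" if "i <= j" "j <= J" for i j
  using that by (induction j rule: dec_induct) (auto intro: order_trans[OF _ less_imp_le[OF conjunct1[OF step]]])
 have spos: "0 < s j" if "0 < j" "j <= J" for j using smono[of 1 j] step[of 0] that s0 by simp
 have sG: "s j : G" if "0 < j" "j <= J" for j using sG'[of j] s0(2) r(1) that by (cases "j = J") auto
 \<comment> \<open>Half of the budget \<open>ep\<close>. The lost mass \<open>ze\<close> enters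
   \<open>3 * J + 1\<close> times: per level twice through the errors of the cells and once through
   the uncovered part, and once more for the sphere.\<close>
 define ze where "ze = ep / (2 * (3 * real J + 1))"
 have ze: "0 < ze" "(3 * real J + 1) * ze = ep / 2" unfolding ze_def using ep by (auto simp: field_simps)
 have hi: "(hi c) : sets M" for c unfolding M(2) by (rule ht_borel_ge)
 \<comment> \<open>The sphere of radius \<open>r\<close> is null in the limit tree only. In the n-th
   tree its mass is bounded by the mass between \<open>r\<close> and a level \<open>s'\<close> just
   above, which is controlled by convergence of levels.\<close>
 obtain s' where s': "s' : G" "r < s'" "s' < rr" "measure M ((hi r) - (hi s')) <= ze"
 proof -
  let ?A = "%k::nat. (hi r) - {x : Pt. r + 1 / Suc k <= ht x}"
  have "EV k. em M (?A k) <= em M (lev r) + ennreal ze"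
  proof (rule eventually_outer)
   show "decseq ?A"
    by (intro monoI[of "%k. _ :: 'a set", folded decseq_def] decseq_SucI) (auto simp: field_simps)
   show "(INT k. ?A k) <= (lev r)"
   proof
    fix x assume x: "x : (INT k. ?A k)"
    have "~ 0 < ht x - r"
    proof
     assume "0 < ht x - r"
     then obtain k :: nat where "1 / Suc k < ht x - r" using nat_approx_posE by blast
     moreover have "x : ?A k" using x by blast
     ultimately show False by auto
    qed
    then show "x : (lev r)" using x by auto
   qed
   show "(lev r) : sets M" unfolding M(2) by (rule ht_borel_eq)
  qed (use hi ze in \<open>auto simp: less_top[symmetric]\<close>)
  then obtain k :: nat where k: "em M (?A k) <= ennreal ze" using G(2)[OF r(1)] by (auto dest: eventually_happens)
  obtain t where t: "t : G" "r < t" "t < min rr (r + 1 / Suc k)" using G(1)[of r "min rr (r + 1 / Suc k)"] r by auto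
  have "em M ((hi r) - (hi t)) <= em M (?A k)" using hi t by (intro emeasure_mono) auto
  then show ?thesis using that[of t] t k ze by (simp add: emeasure_eq_measure ennreal_le_iff)
 qed
 define good where "good j V \<longleftrightarrow> finite V & V <= {si : Pt. ht si = s j & 0 < em M (up si)} &
  measure M (residual (s j) V) <= ze" for j V
 have "EX V. 0 < j --> j <= J --> good j V" for j
  using residual_small[OF sc M _ _ ze(1)] spos[of j] G(2)[OF sG[of j]] unfolding good_def by (meson less_imp_le)
 then obtain U where "!!j. 0 < j ==> j <= J ==> good j (U j)" by metis
 note U = this[unfolded good_def]
 define V where "V j = (if j = 0 then {ro} else U j)" for j
 define VV where "VV = (UN j:{1..J}. U j)"
 define S where "S = insert s' (s ` {1..J})"
 have V: "finite (V j)" "!!si. si : V j ==> si : Pt" "!!si. si : V j ==> ht si = s j" if "j <= J" for j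
  using U[of j] that s0 by (auto simp: V_def split: if_splits)
 have sS: "s j : S" "V j <= VV" if "0 < j" "j <= J" for j unfolding S_def VV_def V_def using that by (auto intro!: bexI[of _ j])
 have VV: "finite VV" "VV <= {si : Pt. ht si : S & 0 < em M (up si)}"
 proof -
  have "U j <= {si : Pt. ht si : S & 0 < em M (up si)} & finite (U j)" if "j : {1..J}" for j
   using U[of j] sS(1)[of j] that by auto
  then show "finite VV" "VV <= {si : Pt. ht si : S & 0 < em M (up si)}" unfolding VV_def by blast+
 qed
 have "s j < rr" if "j <= J" for j using smono[of j J] that s0 r by simp
 then have S: "finite S" "S <= {s:G. s < rr}" unfolding S_def using sG s' by auto
 interpret A: node_grid m ro M J s V "%si. si"
  by unfold_locales (use M s0 step V in \<open>auto simp: V_def\<close>)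
 define K where "K = real (card VV) + 1"
 have K: "1 <= K" "real (card (V j)) <= K - 1" if "0 < j" "j <= J" for j
  unfolding K_def using card_mono[OF VV(1) sS(2)[OF that]] by simp_all
 define N where "N = real (card A.Idx)"
 \<comment> \<open>The other half of the budget: \<open>et\<close> is the error per matched cone or
   level, \<open>N\<close> the number of cells, and \<open>K\<close> exceeds the number of nodes on
   each positive level.\<close>
 define et where "et = ep / (2 * (N * K + 2 * real J * K + 2))"
 have "0 < N * K + 2 * real J * K + 2" unfolding N_def K_def by (intro add_nonneg_pos add_nonneg_nonneg mult_nonneg_nonneg) auto
 then have et: "0 < et" "(N * K + 2 * real J * K + 2) * et = ep / 2" unfolding et_def using ep by (auto simp: field_simps)
 have lostA: "A.lost j <= ze" if "0 < j" "j <= J" for j using U[OF that] that unfolding A.lost_def V_def by simp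
 have "EV n. ALL t:insert 0 S. near et (em (Ms n) {x : mspace (ms n). t <= Tn.ht n x}) (em M (hi t))"
  using conv(2) et(1) S unfolding levels_conv_def by (intro eventually_ball_finite) auto
 with Ms(1) nodes_convD[OF conv(1) et(1) S VV] show ?thesis
 proof eventually_elim
  case (elim n)
  then obtain bt where nm: "node_matched et S VV m ro M (ms n) (ros n) (Ms n) bt" by blast
  interpret M': finite_measure "Ms n" by (rule elim(1))
  have lev: "\<bar>measure M (hi t) - measure (Ms n) {x : mspace (ms n). t <= Tn.ht n x}\<bar> <= et" if "t : insert 0 S" for t
   using near_measure[OF M(1) elim(1) bspec[OF elim(3) that]] et by simp
  \<comment> \<open>The matching concerns positive levels. At level 0 the roots correspond, and
    their cones are compared through the level 0 included in \<open>levels_conv\<close>.\<close>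
  define b where "b si = (if si = ro then ros n else bt si)" for si
  have nr: "si : VV" "si ~= ro" "b si = bt si" if "si : V j" "0 < j" "j <= J" for si j
   using V(3)[OF that(3,1)] spos[OF that(2,3)] sS(2)[OF that(2,3)] that by (auto simp: b_def)
  have b: "b si : mspace (ms n)" "Tn.ht n (b si) = s j" "\<bar>measure M (up si) - measure (Ms n) (above (ms n) (ros n) (b si))\<bar> <= et"
   if "si : V j" "j <= J" for si j
  proof (atomize (full), cases "j = 0")
   case True
   then have "si = ro" "b si = ros n" using that by (auto simp: V_def b_def)
   then show "b si : mspace (ms n) & Tn.ht n (b si) = s j & \<bar>measure M (up si) - measure (Ms n) (above (ms n) (ros n) (b si))\<bar> <= et"
    using lev[of 0] True s0(1) by simp
  next
   case False
   note v = nr[OF that(1) _ that(2)]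
   then show "b si : mspace (ms n) & Tn.ht n (b si) = s j & \<bar>measure M (up si) - measure (Ms n) (above (ms n) (ros n) (b si))\<bar> <= et"
    using node_matchedD(1-3)[OF nm] near_measure[OF M(1) elim(1)] et(1) V(3)[OF that(2,1)] False by simp
  qed
  have gb: "s i <= gp si ta \<longleftrightarrow> s i <= Tn.gp n (b si) (b ta)" if st: "si : V j" "ta : V k" "j <= J" "k <= J" "i <= J" for i j k si ta
  proof (cases "j = 0 | k = 0 | i = 0")
   case True
   have "0 <= gp si ta" "0 <= Tn.gp n (b si) (b ta)" "gp si ta <= min (s j) (s k)" "Tn.gp n (b si) (b ta) <= min (s j) (s k)"
    using gp_le[of si ta] Tn.gp_le[of "b si" n "b ta"] V(2,3) b(1,2) st by auto
   then show ?thesis using True s0(1) spos[of i] st by (cases "i = 0") auto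
  next
   case False
   then show ?thesis using nr[OF st(1) _ st(3)] nr[OF st(2) _ st(4)] node_matchedD(4)[OF nm, of si ta "s i"] sS(1)[of i] st(5) by simp
  qed
  interpret B: node_grid "ms n" "ros n" "Ms n" J s V b
  proof
   show "inj_on b (V j)" if j: "j <= J" for j
   proof (rule inj_onI)
    fix si ta assume st: "si : V j" "ta : V j" "b si = b ta"
    have "s j <= gp si ta" using st b[OF st(1) j] gb[OF st(1,2) j j j] by simp
    then show "si = ta" using above_iff_ge[of si ta] above_disjoint[of si ta ta] above_self V(2,3)[OF j] st by simp
   qed
  qed (use elim(1) Ms(2) s0 step V b in \<open>auto simp: V_def\<close>)
  have lostB: "B.lost j <= ze + K * et" if j: "0 < j" "j <= J" for j
  proof -
   have "(SUM ta:V j. measure M (up ta) - et) <= (SUM ta:V j. measure (Ms n) (above (ms n) (ros n) (b ta)))"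
   proof (rule sum_mono)
    fix ta assume "ta : V j"
    from b(3)[OF this j(2)] show "measure M (up ta) - et <= measure (Ms n) (above (ms n) (ros n) (b ta))" by linarith
   qed
   moreover have "real (card (V j)) * et <= (K - 1) * et" using K(2)[OF j] et by (intro mult_right_mono) auto
   ultimately show ?thesis using B.lost_eq[OF j(2)] A.lost_eq[OF j(2)] lostA[OF j] lev[of "s j"] sS(1)[OF j]
    by (simp add: sum_subtractf algebra_simps abs_le_iff)
  qed
  define th where "th = (%(j, i). K * et + A.loss j i + B.loss j i)"
  have loss0: "0 <= A.loss j i" "0 <= B.loss j i" for j i unfolding A.loss_def B.loss_def by auto
  have mass: "near (th (j, si)) (em (Ms n) (B.cell (j, si))) (em M (A.cell (j, si)))" if j: "j < J" "si : V j" for j si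
  proof (rule near_measureI[OF M(1) elim(1)])
   let ?P = "{k : V (Suc j). s j <= gp si k}"
   have P: "?P = {k : V (Suc j). s j <= Tn.gp n (b si) (b k)}" using gb[OF j(2), of _ "Suc j" j] j(1) by auto
   have 1: "\<bar>(SUM ta:?P. measure M (up ta)) - (SUM ta:?P. measure (Ms n) (above (ms n) (ros n) (b ta)))\<bar> <= (SUM ta:?P. et)"
    unfolding sum_subtractf[symmetric] by (rule order_trans[OF sum_abs], rule sum_mono) (use b(3) j(1) in auto)
   have "(SUM ta:?P. et) <= (K - 1) * et"
    using K(2)[of "Suc j"] card_mono[of "V (Suc j)" ?P] V(1)[of "Suc j"] j(1) et(1) by (auto intro!: mult_right_mono)
   with 1 have "\<bar>(SUM ta:?P. measure M (up ta)) - (SUM ta:?P. measure (Ms n) (above (ms n) (ros n) (b ta)))\<bar> <= (K - 1) * et" by linarith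
   moreover have "th (j, si) = (K - 1) * et + et + A.loss j si + B.loss j si" unfolding th_def by (simp add: algebra_simps)
   ultimately show "\<bar>measure M (A.cell (j, si)) - measure (Ms n) (B.cell (j, si))\<bar> <= th (j, si)"
    using b(3)[OF j(2) less_imp_le[OF j(1)]] loss0[of j si] unfolding A.cell_measure[OF j] B.cell_measure[OF j] P[symmetric] by linarith
  qed
  have sumth: "sum th A.Idx <= N * (K * et) + real J * (2 * ze + K * et)"
  proof -
   have "sum (%(j, si). f j si) A.Idx = (SUM j<J. SUM si:V j. f j si)" for f :: "nat => 'a => real"
    by (rule sum.Sigma[symmetric]) (use V(1) in auto)
   note S = this[of A.loss] this[of B.loss]
   have "sum th A.Idx = N * (K * et) + sum (%(j, si). A.loss j si) A.Idx + sum (%(j, si). B.loss j si) A.Idx"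
    unfolding th_def N_def by (simp add: sum.distrib case_prod_beta)
   moreover have "(SUM j<J. SUM si:V j. A.loss j si) <= (SUM j<J. ze)"
    by (rule sum_mono) (use order_trans[OF A.sum_loss lostA] in auto)
   moreover have "(SUM j<J. SUM si:V j. B.loss j si) <= (SUM j<J. ze + K * et)"
    by (rule sum_mono) (use order_trans[OF B.sum_loss lostB] in auto)
   ultimately show ?thesis unfolding S by (simp add: algebra_simps)
  qed
  \<comment> \<open>The grid levels not above the Gromov product are the same in both trees, so the
    two products fall into the same grid interval.\<close>
  have gp_close: "\<bar>gp si ta - Tn.gp n (b si) (b ta)\<bar> <= ep/3" if st: "si : V j" "ta : V k" "j < J" "k < J" for j k si ta
  proof -
   have jk: "j <= J" "k <= J" using st by auto
   have "gp si ta <= s j" "0 <= gp si ta" using gp_le[of si ta] V(2,3) st jk by auto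
   then obtain i where i: "i < J" "s i <= gp si ta" "gp si ta < s (Suc i)"
    using grid_cell[of s "gp si ta" J] s0(1) step[OF st(3)] smono[of "Suc j" J] st(3) by force
   then show ?thesis using gb[OF st(1,2) jk, of i] gb[OF st(1,2) jk, of "Suc i"] step[OF i(1)] unfolding abs_le_iff by simp
  qed
  have V0: "V 0 = {ro}" "b ro = ros n" by (auto simp: V_def b_def)
  \<comment> \<open>Distances of nodes differ by twice the error of the Gromov product, that is by
    at most \<open>ep/3\<close> per end, so bridges of this length are admissible. Distances to the
    root agree exactly, so its bridge may have length 0.\<close>
  have glue: "glued (ms n) (ros n) m ro A.Idx (0, ro) (%(j, si). b si) (%(j, si). si) (%(j, si). if j = 0 then 0 else ep/3)"
  proof
   show "\<bar>mdist (ms n) (case i of (j, si) => b si) (case k of (j, si) => b si) - mdist m (case i of (j, si) => si) (case k of (j, si) => si)\<bar>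
     <= (case i of (j, si) => if j = 0 then 0 else ep/3) + (case k of (j, si) => if j = 0 then 0 else ep/3)"
    if ik: "i : A.Idx" "k : A.Idx" for i k
   proof -
    obtain j si l ta where j: "i = (j, si)" "k = (l, ta)" "si : V j" "ta : V l" "j < J" "l < J" using ik by auto
    have jl: "j <= J" "l <= J" using j by auto
    note hh = V(2)[OF jl(1) j(3)] V(2)[OF jl(2) j(4)] V(3)[OF jl(1) j(3)] V(3)[OF jl(2) j(4)]
     b(1)[OF j(3) jl(1)] b(1)[OF j(4) jl(2)] b(2)[OF j(3) jl(1)] b(2)[OF j(4) jl(2)]
    have eq: "mdist (ms n) (b si) (b ta) - mdist m si ta = 2 * (gp si ta - Tn.gp n (b si) (b ta))"
     using dist_gp[of si ta] Tn.dist_gp[of n "b si" "b ta"] hh by simp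
    show ?thesis
    proof (cases "j = 0 | l = 0")
     case True
     then have "gp si ta = 0" "Tn.gp n (b si) (b ta) = 0"
      using gp_le[OF hh(1,2)] Tn.gp_le[OF hh(5,6)] hh s0(1) by auto
     then show ?thesis using eq j ep by simp
    next
     case False
     moreover have "\<bar>mdist (ms n) (b si) (b ta) - mdist m si ta\<bar> <= ep/3 + ep/3" using gp_close[OF j(3-6)] eq by argo
     ultimately show ?thesis using j(1,2) by simp
    qed
   qed
  qed (use J V(2)[OF less_imp_le] b(1)[OF _ less_imp_le] ep A.Idx_finite V0 in \<open>auto split: prod.split\<close>)
  have sphere: "measure (Ms n) {x : mspace (ms n). Tn.ht n x = r} <= ze + 2 * et"
  proof -
   have "measure (Ms n) {x : mspace (ms n). Tn.ht n x = r} <= measure (Ms n) ({x : mspace (ms n). r <= Tn.ht n x} - {x : mspace (ms n). s' <= Tn.ht n x})"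
    using s'(2) by (intro M'.finite_measure_mono) (auto simp: Ms(2) Tn.ht_borel_ge)
   also have "... = measure (Ms n) {x : mspace (ms n). r <= Tn.ht n x} - measure (Ms n) {x : mspace (ms n). s' <= Tn.ht n x}"
    using s'(2) by (intro M'.finite_measure_Diff) (auto simp: Ms(2) Tn.ht_borel_ge)
   also have "... <= measure M (hi r) - measure M (hi s') + 2 * et"
    using lev[of r] lev[of s'] sS(1)[of J] J s0(2) unfolding abs_le_iff S_def by auto
   also have "measure M (hi r) - measure M (hi s') = measure M ((hi r) - (hi s'))"
    using s'(2) hi by (intro finite_measure_Diff[symmetric]) auto
   finally show ?thesis using s'(4) by simp
  qed
  have sums: "(SUM j:{1..<J}. B.lost j) <= real J * (ze + K * et)" "(SUM j:{1..<J}. A.lost j) <= real J * (ze + K * et)"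
  proof -
   have c: "0 <= ze" "0 <= K * et" "real (J - 1) <= real J" using ze et unfolding K_def by auto
   have "(SUM j:{1..<J}. L j) <= real J * (ze + K * et)" if "!!j. j : {1..<J} ==> L j <= ze + K * et" for L
   proof -
    have "(SUM j:{1..<J}. L j) <= real (card {1..<J}) * (ze + K * et)" by (rule sum_bounded_above) (rule that)
    also have "... <= real J * (ze + K * et)" using c by (intro mult_right_mono) auto
    finally show ?thesis .
   qed
   then show "(SUM j:{1..<J}. B.lost j) <= real J * (ze + K * et)" "(SUM j:{1..<J}. A.lost j) <= real J * (ze + K * et)"
    using lostB order_trans[OF lostA, of _ "ze + K * et"] c by auto
  qed
  have null: "measure M (lev r) = 0" using G(2)[OF r(1)] by (simp add: measure_def)
  define ka where "ka = real J * (ze + K * et) + ze + 2 * et"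
  have rest: "em (mrestr M (tball m ro r)) (Pt - (UN k:A.Idx. A.cell k)) <= ennreal ka"
   "em (mrestr (Ms n) (tball (ms n) (ros n) r)) (mspace (ms n) - (UN k:A.Idx. B.cell k)) <= ennreal ka"
   using sphere sums null ze et unfolding ka_def
   by (intro order_trans[OF A.uncovered[unfolded s0(2)] ennreal_leI] order_trans[OF B.uncovered[unfolded s0(2)] ennreal_leI]; simp)+
  have "sum th A.Idx + ka <= (3 * real J + 1) * ze + (N * K + 2 * real J * K + 2) * et" using sumth unfolding ka_def by (simp add: algebra_simps)
  then have budget: "sum th A.Idx + ka <= ep" unfolding ze(2) et(2) by simp
  have K0: "0 <= K * et" "0 <= ka" unfolding ka_def K_def using ze et by auto
  show "GP_dist (Ys n) Y <= ennreal ep"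
  proof (rule glued.GP_dist_le[OF glue Y(2,1) B.cell_sets B.cell_disjoint A.cell_sets A.cell_disjoint, where e = "ep/3" and et = th and ka = ka])
   show "mdist (ms n) a (case i of (j, si) => b si) <= ep/3" if "i : A.Idx" "a : B.cell i" for i a
    using that B.cellD step by (fastforce simp: mdist_commute)
   show "mdist m (case i of (j, si) => si) a <= ep/3" if "i : A.Idx" "a : A.cell i" for i a
    using that A.cellD step by fastforce
   fix i assume i: "i : A.Idx"
   show "em (mrestr (Ms n) (tball (ms n) (ros n) r)) (B.cell i) <= em (mrestr M (tball m ro r)) (A.cell i) + ennreal (th i)"
    "em (mrestr M (tball m ro r)) (A.cell i) <= em (mrestr (Ms n) (tball (ms n) (ros n) r)) (B.cell i) + ennreal (th i)"
    using mass i A.cell_truncate[OF i] B.cell_truncate[OF i] unfolding s0(2) near_def by auto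
   show "0 <= th i" using loss0 K0 unfolding th_def by (auto split: prod.split)
  qed (use ep rest budget K0 in \<open>auto split: prod.split\<close>)
 qed
qed

end

section \<open>Erasure as a shift of cone masses\<close>

context rooted_tree
begin

text \<open>What erasure of mass \<open>h\<close> does to cut-off measures below the cut-off level \<open>r\<close>.\<close>
definition shifted :: "real => real => 'a measure => 'a measure => bool" where
 "shifted h r M M' \<longleftrightarrow> (ALL si:Pt. ht si < r --> em M' (up si) = em M (up si) - ennreal h) &
   (ALL s V. 0 < s --> s < r --> finite V --> V <= (lev s) --> em M (residual s V) < ennreal h -->
    em M' (residual s V) = 0)"

lemma level_mass:
 assumes "finite V" "V <= (lev s)" "sets M = Bor" "0 <= s"
 shows "em M (hi s) = (SUM si:V. em M (up si)) + em M (residual s V)"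
proof -
 have V: "V <= Pt" "!!si. si : V ==> ht si = s" using assms by auto
 have b: "!!si. si : V ==> up si : sets M" using above_borel V(1) assms(3) by auto
 have "(hi s) = (UN si:V. up si) Un residual s V"
  using above_subset above_ht V unfolding residual_def by fastforce
 then have "em M (hi s) = em M (UN si:V. up si) + em M (residual s V)"
  using residual_borel[OF assms(1) V(1)] b assms(1,3) by (subst plus_emeasure) (auto simp: residual_def)
 also have "em M (UN si:V. up si) = (SUM si:V. em M (up si))"
  by (rule sum_emeasure[OF _ above_same_level_disjoint[OF V] assms(1), symmetric]) (use b in auto)
 finally show ?thesis .
qed

end

text \<open>Truncated subtraction is a contraction, so a cone that is erased completely in one tree
  and not in the other causes no additional error.\<close>

lemma near_diff:
 assumes "near et a b" shows "near et (a - ennreal h) (b - ennreal h)"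
proof -
 have "a - c <= b - c + e" if "a <= b + e" "c ~= top" for a b c e :: ennreal
 proof -
  have "b <= c + (b - c)" by (cases "c <= b") (auto simp: add_diff_inverse_ennreal add_increasing2)
  then have "a <= c + (b - c + e)" using that by (metis add.assoc add_right_mono order_trans)
  then show ?thesis using that by (auto simp: ennreal_minus_le_iff)
 qed
 then show ?thesis using assms unfolding near_def by auto
qed

lemma near_add: "near et a b ==> near et (a + c) (b + c)"
 unfolding near_def by (metis add.assoc add.commute add_right_mono)

lemma near_mono: "near et a b ==> et <= et' ==> near et' a b"
 unfolding near_def by (meson add_left_mono ennreal_leI order_trans)

lemma near_sum:
 assumes "!!i. i : I ==> near et (a i) (b i)" "0 <= et"
 shows "near (real (card I) * et) (sum a I) (sum b I)"
proof -
 have "sum a I <= sum b I + ennreal (real (card I) * et)" if "!!i. i : I ==> a i <= b i + ennreal et" for a b :: "_ => ennreal"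
 proof -
  have "sum a I <= (SUM i:I. b i + ennreal et)" by (rule sum_mono) (rule that)
  then show ?thesis using assms(2) by (simp add: sum.distrib ennreal_mult ennreal_of_nat_eq_real_of_nat)
 qed
 then show ?thesis using assms(1) unfolding near_def by blast
qed

context tree_sequence
begin

lemma matched_inj:
 assumes "node_matched et S V m ro M (ms n) (ros n) M' bt" "V <= (lev s)" "s : S"
 shows "inj_on bt V"
proof (rule inj_onI)
 fix x y assume xy: "x : V" "y : V" "bt x = bt y"
 have "s <= Tn.gp n (bt x) (bt y)" using node_matchedD[OF assms(1) xy(1)] assms(2) xy by auto
 then have "s <= gp x y" using node_matchedD(4)[OF assms(1) xy(1,2) assms(3)] by simp
 then have "y : up x" using assms(2) xy above_iff_ge by auto
 moreover have "y : up y" "x : Pt" "y : Pt" "ht x = ht y" using assms(2) xy above_self by auto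
 ultimately show "x = y" using above_disjoint by blast
qed

text \<open>Cones shift by \<open>h\<close>, which settles the nodes. For a positive level, nodes
  are chosen so that only a small part of \<open>h\<close> remains outside their cones; in the n-th
  tree this remainder is then eventually below \<open>h\<close>. Such a remainder disappears under
  erasure, and the erased mass above the level becomes a finite sum of shifted cone masses. Level 0
  is the cone of the root.\<close>

lemma shifted_conv:
 assumes sc: "second_countable_metric m" and fin: "finite_measure M" "EV n. finite_measure (Ms n)"
  and sets: "sets M = Bor" "sets M' = Bor"
   "!!n. sets (Ms n) = sets (mb (ms n))" "!!n. sets (Ms' n) = sets (mb (ms n))"
  and sh: "shifted h r M M'" "EV n. Tn.shifted n h r (Ms n) (Ms' n)" and h: "0 < h" and r: "0 < r"
  and G: "!!s. s : G ==> 0 < s & s < r & em M (lev s) = 0"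
  and conv: "nodes_conv G M Ms" "levels_conv (insert 0 G) M Ms"
 shows "nodes_conv G M' Ms'" "levels_conv (insert 0 G) M' Ms'"
proof -
 show "nodes_conv G M' Ms'" unfolding nodes_conv_def
 proof (intro allI impI)
  fix et :: real and S V
  assume *: "0 < et" "finite S" "S <= G" "finite V" and V: "V <= {x : Pt. ht x : S & 0 < em M' (up x)}"
  have V': "em M' (up si) = em M (up si) - ennreal h" "si : Pt" "ht si < r" if "si : V" for si
   using sh(1) V that G *(3) unfolding shifted_def by blast+
  have "V <= {x : Pt. ht x : S & 0 < em M (up x)}"
   using V V'(1) by (force simp: zero_less_iff_neq_zero)
  from nodes_convD[OF conv(1) * this] sh(2)
  show "EV n. EX bt. node_matched et S V m ro M' (ms n) (ros n) (Ms' n) bt"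
  proof eventually_elim
   case (elim n)
   then obtain bt where bt: "node_matched et S V m ro M (ms n) (ros n) (Ms n) bt" by blast
   have "near et (em (Ms' n) (above (ms n) (ros n) (bt si))) (em M' (up si))" if "si : V" for si
    using node_matchedD[OF bt that] V'[OF that] elim(2) near_diff unfolding Tn.shifted_def by simp
   then show ?case using bt unfolding node_matched_def by blast
  qed
 qed
 show "levels_conv (insert 0 G) M' Ms'" unfolding levels_conv_def
 proof (intro allI impI ballI)
  fix et :: real and s assume et: "0 < et" and s: "s : insert 0 G"
  show "EV n. near et (em (Ms' n) {x : mspace (ms n). s <= Tn.ht n x}) (em M' (hi s))"
  proof (cases "s = 0")
   case True
   have e: "(hi 0) = Pt" "!!n. {x : mspace (ms n). 0 <= Tn.ht n x} = mspace (ms n)"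
    by auto
   have "EV n. near et (em (Ms n) {x : mspace (ms n). 0 <= Tn.ht n x}) (em M (hi 0))"
    using conv(2) et unfolding levels_conv_def by blast
   with sh(2) show ?thesis unfolding True
   proof eventually_elim
    case (elim n)
    then show ?case
     using conjunct1[OF sh(1)[unfolded shifted_def], rule_format, of ro] r near_diff[OF elim(2), of h]
      conjunct1[OF elim(1)[unfolded Tn.shifted_def], rule_format, of "ros n"] unfolding e by simp
   qed
  next
   case False
   then have s: "s : G" "0 < s" "s < r" "em M (lev s) = 0" using s G by auto
   from residual_small[OF sc fin(1) sets(1) less_imp_le[OF s(2)] s(4), of "h/3"]
   obtain V where V: "finite V" "V <= {si : Pt. ht si = s & 0 < em M (up si)}" "measure M (residual s V) <= h/3"
    using h by auto
   have V': "V <= (lev s)" using V by auto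
   define k where "k = real (card V) + 1"
   \<comment> \<open>One third of \<open>h\<close> is for the remainder in the limit and one third
     for the errors of cones and level, which keeps the remainder in the n-th tree below
     \<open>h\<close>. The bound \<open>et / k\<close> serves the final comparison of sums.\<close>
   define et' where "et' = min (et / k) (h / (3 * k))"
   have k: "0 < k" "real (card V) <= k" "real (card V) = k - 1" unfolding k_def by auto
   have et': "0 < et'" "k * et' <= et" "k * et' <= h/3"
    using et h k(1) unfolding et'_def by (auto simp: min_def field_simps)
   have et2: "real (card V) * et' <= et" "real (card V) * et' + et' <= h/3" using et' unfolding k_def by (auto simp: algebra_simps)
   have res: "em M (residual s V) <= ennreal (h/3)"
    using V(3) h by (simp add: finite_measure.emeasure_eq_measure[OF fin(1)] ennreal_leI)
   have nd: "EV n. EX bt. node_matched et' {s} V m ro M (ms n) (ros n) (Ms n) bt"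
    by (rule nodes_convD[OF conv(1) et'(1)]) (use V s in auto)
   have lv: "EV n. near et' (em (Ms n) {x : mspace (ms n). s <= Tn.ht n x}) (em M (hi s))"
    using conv(2) et'(1) s unfolding levels_conv_def by blast
   show ?thesis using nd lv sh(2) fin(2)
   proof eventually_elim
    case (elim n)
    from elim(1) obtain bt where bt: "node_matched et' {s} V m ro M (ms n) (ros n) (Ms n) bt" by blast
    note btD = node_matchedD[OF bt]
    have inj: "inj_on bt V" using matched_inj[OF bt V'] by simp
    have W: "finite (bt ` V)" "bt ` V <= {x : mspace (ms n). Tn.ht n x = s}" using V btD(1,2) by auto
    let ?f = "%N. SUM si:V. em N (up si)" and ?g = "%N. SUM si:V. em N (above (ms n) (ros n) (bt si))"
    have lm: "em N (hi s) = ?f N + em N (residual s V)" if "sets N = Bor" for N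
     by (rule level_mass[OF V(1) V' that]) (use s in simp)
    have lm': "em N {x : mspace (ms n). s <= Tn.ht n x} = ?g N + em N (Tn.residual n s (bt ` V))"
     if "sets N = sets (mb (ms n))" for N
     using Tn.level_mass[OF W that] s by (simp add: sum.reindex[OF inj])
    have nf: "near (real (card V) * et') (?g (Ms n)) (?f M)"
     by (rule near_sum) (use btD(3) et' in auto)
    have fin': "?g (Ms n) ~= top" using finite_measure.emeasure_finite[OF elim(4)] V(1) by (auto simp: less_top)
    have "?g (Ms n) + em (Ms n) (Tn.residual n s (bt ` V)) <= (?f M + em M (residual s V)) + ennreal et'"
     using elim(2) unfolding near_def lm[OF sets(1)] lm'[OF sets(3)] by simp
    also have "... <= ((?g (Ms n) + ennreal (real (card V) * et')) + ennreal (h/3)) + ennreal et'"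
     using nf res unfolding near_def by (intro add_mono) auto
    also have "... = ?g (Ms n) + ennreal (real (card V) * et' + et' + h/3)"
     using et' h by (simp add: add.assoc add.commute[of "ennreal (h/3)"] ennreal_plus[symmetric] del: ennreal_plus)
    finally have "em (Ms n) (Tn.residual n s (bt ` V)) <= ennreal (real (card V) * et' + et' + h/3)"
     using fin' by (simp add: ennreal_add_left_cancel_le)
    also have "... < ennreal h" using et2 h by (intro ennreal_lessI) auto
    finally have "em (Ms' n) (Tn.residual n s (bt ` V)) = 0"
     using elim(3) s W unfolding Tn.shifted_def by blast
    moreover have "em M' (residual s V) = 0"
    proof -
     have "ennreal (h/3) < ennreal h" using h by (simp add: ennreal_lessI)
     then show ?thesis using sh(1) s V(1) V' order.strict_trans1[OF res] unfolding shifted_def by blast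
    qed
    moreover have "near (real (card V) * et') (?g (Ms' n)) (?f M')"
    proof (rule near_sum)
     fix si assume si: "si : V"
     then have "si : Pt" "ht si < r" using V' s by auto
     then show "near et' (em (Ms' n) (above (ms n) (ros n) (bt si))) (em M' (up si))"
      using near_diff[OF btD(3)[OF si]] btD(1,2)[OF si] sh(1) elim(3) unfolding shifted_def Tn.shifted_def by simp
    qed (use et' in simp)
    ultimately show ?case using near_mono[OF _ et2(1)] unfolding lm[OF sets(2)] lm'[OF sets(4)] by simp
   qed
  qed
 qed
qed

text \<open>Nodes have positive mass, so for \<open>h\<close> smaller than all masses involved the
  subtraction of \<open>h\<close> can be undone in the limit tree. It can be undone in the n-th tree
  as well, because the shifted mass stays positive if its error is at most
  \<open>c - h\<close>.\<close>

lemma unshifted_nodes: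
 assumes "!!h. 0 < h ==> h <= hh ==> EX h':H. 0 < h' & h' < h" and hh: "0 < hh"
  and sh: "!!h. h : H ==> h < hh ==> shifted h r M (M' h)" "!!h. h : H ==> h < hh ==> EV n. Tn.shifted n h r (Ms n) (Ms' h n)"
  and G: "!!s. s : G ==> s < r" and conv: "!!h. h : H ==> h < hh ==> nodes_conv G (M' h) (Ms' h)"
 shows "nodes_conv G M Ms"
 unfolding nodes_conv_def
proof (intro allI impI)
 fix et :: real and S V
 assume *: "0 < et" "finite S" "S <= G" "finite V" and V: "V <= {x : Pt. ht x : S & 0 < em M (up x)}"
 have "EX c>0. ALL si:V. ennreal c < em M (up si)"
  by (rule finite_ennreal_lower_bound[OF *(4)]) (use V in auto)
 then obtain c where c: "0 < c" "!!si. si : V ==> ennreal c < em M (up si)" by blast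
 obtain h where h: "h : H" "0 < h" "h < c" "h < hh" using assms(1)[of "min c hh"] c(1) hh by auto
 have V': "em (M' h) (up si) = em M (up si) - ennreal h" "ennreal (c - h) < em (M' h) (up si)"
  "ennreal h <= em M (up si)" "ht si < r" if si: "si : V" for si
 proof -
  show r: "ht si < r" using si V *(3) G by auto
  show e: "em (M' h) (up si) = em M (up si) - ennreal h"
   using sh(1)[OF h(1,4)] r si V unfolding shifted_def by auto
  show "ennreal (c - h) < em (M' h) (up si)"
   unfolding e ennreal_minus[OF less_imp_le[OF h(2)], symmetric]
   using c(2)[OF si] h ennreal_mono_minus by (cases "em M (up si)") (auto simp: ennreal_minus ennreal_less_iff top_unique)
  show "ennreal h <= em M (up si)" using c(2)[OF si] h(3) ennreal_leI[of h c] by auto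
 qed
 define ze where "ze = min et (c - h)"
 have ze: "0 < ze" "ze <= et" "ze <= c - h" using *(1) h unfolding ze_def by auto
 have "V <= {x : Pt. ht x : S & 0 < em (M' h) (up x)}" using V le_less_trans[OF zero_le V'(2)] by auto
 from nodes_convD[OF conv[OF h(1,4)] ze(1) *(2-4) this] sh(2)[OF h(1,4)]
 show "EV n. EX bt. node_matched et S V m ro M (ms n) (ros n) (Ms n) bt"
 proof eventually_elim
  case (elim n)
  then obtain bt where bt: "node_matched ze S V m ro (M' h) (ms n) (ros n) (Ms' h n) bt" by blast
  have "near et (em (Ms n) (above (ms n) (ros n) (bt si))) (em M (up si))" if si: "si : V" for si
  proof -
   let ?a = "em (Ms n) (above (ms n) (ros n) (bt si))"
   note D = node_matchedD[OF bt si]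
   have e: "em (Ms' h n) (above (ms n) (ros n) (bt si)) = ?a - ennreal h"
    using elim(2) D(1,2) V'(4)[OF si] unfolding Tn.shifted_def by simp
   have "ennreal ze < (?a - ennreal h) + ennreal ze"
    using order.strict_trans2[OF order.strict_trans1[OF ennreal_leI[OF ze(3)] V'(2)[OF si]]] D(3) unfolding near_def e by blast
   then have "?a - ennreal h ~= 0" by (metis add_0 order.irrefl)
   then have "ennreal h <= ?a" using diff_eq_0_ennreal[of ?a "ennreal h"] by (meson ennreal_less_top linear order.strict_trans1)
   then show ?thesis
    using near_add[OF D(3)[unfolded e V'(1)[OF si]], of "ennreal h"] V'(3)[OF si] near_mono[OF _ ze(2)]
    by (simp add: diff_add_cancel_ennreal)
  qed
  then show ?case using bt unfolding node_matched_def by blast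
 qed
qed

end

context erasing
begin

text \<open>The first claim is \<open>erase_cut_above\<close>. A remainder of mass below
  \<open>h\<close> contains no cut point, as each weighs at least \<open>h\<close>, and no point of
  \<open>R\<close> off the cut, since the cone over such a point would lie in the remainder and
  carry mass \<open>h\<close>. The erased measure, however, lives on \<open>R\<close>.\<close>

lemma erase_shifted:
 assumes D: "finite D" "D <= R" "!!d. d : D ==> ht d = r" and fin: "em mu (off D) < \<infinity>" and c: "0 <= c"
 shows "shifted h r (cutm mu D (c + h)) (cutm E D c)"
 unfolding shifted_def
proof (intro conjI ballI allI impI)
 show "em (cutm E D c) (up si) = em (cutm mu D (c + h)) (up si) - ennreal h"
  if "si : Pt" "ht si < r" for si by (rule erase_cut_above[OF D fin that c])
next
 fix s V assume s: "0 < s" "s < r" and V: "finite V" "V <= (lev s)"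
  and small: "em (cutm mu D (c + h)) (residual s V) < ennreal h"
 have Dm: "D <= Pt" using D(2) R_in(1) by auto
 have rb: "residual s V : Bor" using residual_borel V by auto
 have ob: "off D : Bor" using off_borel[OF D(1) Dm] .
 note cut = emeasure_cutm[OF _ D(1) Dm rb]
 have up: "y : residual s V" if x: "x : residual s V" "y : up x" for x y
 proof -
  have xm: "x : Pt" "s <= ht x" "y : Pt" using x above_subset unfolding residual_def by auto
  have "y ~: up ta" if "ta : V" for ta
   using common_above_comparable[of ta x y] that V(2) xm x unfolding residual_def by auto
  then show ?thesis using xm above_ht[OF xm(1) x(2)] unfolding residual_def by auto
 qed
 have D0: "D Int residual s V = {}"
 proof (rule ccontr)
  assume "D Int residual s V ~= {}"
  then have "1 <= card (D Int residual s V)" using D(1) by (simp add: Suc_leI card_gt_0_iff)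
  then have "ennreal h * 1 <= ennreal (c + h) * of_nat (card (D Int residual s V))"
   using c h by (intro mult_mono ennreal_leI) auto
  also have "... <= em (cutm mu D (c + h)) (residual s V)" unfolding cut[OF adm_sets] by simp
  finally show False using small by simp
 qed
 have "residual s V Int off D Int R = {}"
 proof (rule ccontr)
  assume "residual s V Int off D Int R ~= {}"
  then obtain x where x: "x : residual s V" "x : off D" "x : R" by auto
  have xm: "x : Pt" "x ~= ro" using x R_in(1) s(1) unfolding residual_def by auto
  have "up x <= residual s V Int off D"
  proof
   fix y assume y: "y : up x"
   have "y ~: up d" if d: "d : D" for d
   proof
    assume yd: "y : up d"
    have "d : up x | x : up d"
     using common_above_comparable[OF xm(1) _ y yd] common_above_comparable[OF _ xm(1) yd y] d Dm by force
    then show False using up[OF x(1)] D0 d x(2) unfolding off_def by auto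
   qed
   then show "y : residual s V Int off D" using up[OF x(1) y] y above_subset unfolding off_def by auto
  qed
  then have "em mu (up x) <= em mu (residual s V Int off D)"
   using rb ob adm_sets by (intro emeasure_mono) auto
  then show False using R_mass[OF x(3) xm(2)] small unfolding cut[OF adm_sets] D0 by simp
 qed
 then show "em (cutm E D c) (residual s V) = 0"
  using erase_null[OF sets.Int[OF rb ob]] unfolding cut[OF sets_erase] D0 by simp
qed

end

section \<open>Gromov--vague convergence\<close>

lemma close_by_sym: "close_by dl m ro nu m' ro' nu' C ==> close_by dl m' ro' nu' m ro nu (%y x. C x y)"
 unfolding close_by_def by (simp add: abs_minus_commute)

text \<open>If the truncations had distance at least \<open>dl\<close> at all radii beyond
  \<open>R\<close>, then one unit interval of radii would already contribute \<open>c\<close> to the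
  integral. The radius obtained may depend on n.\<close>

lemma GV_convergesD:
 assumes "GV_converges Xs X" "0 < dl"
 shows "EV n. EX s>=R. GP_dist (truncate_tree s (Xs n)) (truncate_tree s X) < ennreal dl"
proof -
 define R' where "R' = max R 0"
 define c where "c = exp (- (R' + 1)) * min 1 dl"
 have "0 < ennreal c" using assms(2) unfolding c_def by simp
 then have "EV n. GV_dist (Xs n) X < ennreal c"
  using assms(1) unfolding GV_converges_def by (simp add: order_tendstoD)
 then show ?thesis
 proof eventually_elim
  case (elim n)
  show ?case
  proof (rule ccontr)
   assume "~ ?thesis"
   then have ge: "ennreal dl <= GP_dist (truncate_tree s (Xs n)) (truncate_tree s X)" if "R <= s" for s
    using that by (auto simp: not_less)
   have "ennreal c * indicator {R'<..R' + 1} s <= ennreal (exp (- s)) * min 1 (GP_dist (truncate_tree s (Xs n)) (truncate_tree s X)) * indicator {0<..} s" for s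
   proof (cases "s : {R'<..R' + 1}")
    case True
    have "min 1 (ennreal dl) <= min 1 (GP_dist (truncate_tree s (Xs n)) (truncate_tree s X))"
     using ge[of s] True by (intro min.mono) (auto simp: R'_def)
    moreover have "ennreal (min 1 dl) = min 1 (ennreal dl)" using assms(2) by (auto simp: min_def ennreal_le_1 ennreal_1[symmetric] simp del: ennreal_1)
    ultimately show ?thesis
     using True assms(2) unfolding c_def by (auto simp: ennreal_mult R'_def intro!: mult_mono ennreal_leI)
   qed simp
   then have "(\<integral>\<^sup>+ s. ennreal c * indicator {R'<..R' + 1} s \<partial>lborel) <= GV_dist (Xs n) X"
    unfolding GV_dist_def by (intro nn_integral_mono)
   also have "(\<integral>\<^sup>+ s. ennreal c * indicator {R'<..R' + 1} s \<partial>lborel) = ennreal c" by (simp add: nn_integral_cmult_indicator)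
   finally show False using elim by simp
  qed
 qed
qed

text \<open>The integrand of \<open>GV_dist\<close> need not be measurable, so dominated convergence is applied to simple
 functions below it.\<close>
lemma GV_convergesI:
 assumes N: "countable N" and GP: "!!s ep. 0 < s ==> s ~: N ==> 0 < ep ==>
  EV n. GP_dist (truncate_tree s (Xs n)) (truncate_tree s X) <= ennreal ep"
 shows "GV_converges Xs X"
proof -
 define f where "f n s = ennreal (exp (- s)) * min 1 (GP_dist (truncate_tree s (Xs n)) (truncate_tree s X)) * indicator {0<..} s" for n s
 define w :: "real => ennreal" where "w s = ennreal (exp (- s)) * indicator {0..} s" for s
 have D: "((%s. - exp (- s)) has_real_derivative exp (- x)) (at x)" for x :: real by (auto intro!: derivative_eq_intros)
 have "((%s::real. - exp (- s)) \<longlongrightarrow> - 0) at_top"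
  by (intro tendsto_minus filterlim_compose[OF exp_at_bot] filterlim_uminus_at_bot_at_top)
 then have w: "w : borel_measurable lborel" "(\<integral>\<^sup>+ s. w s \<partial>lborel) < \<infinity>"
  using nn_integral_FTC_atLeast[of "%s. exp (- s)" 0 "%s. - exp (- s)" 0] D unfolding w_def by auto
 have fw: "f n s <= w s" for n s
  unfolding f_def w_def by (cases "0 < s") (auto intro: mult_left_le)
 \<comment> \<open>By definition the integral is a supremum over simple functions below the
   integrand. One of them comes within \<open>1 / Suc n\<close>, because the distance is
   finite.\<close>
 have "EX g. simple_function lborel g & g <= f n & GV_dist (Xs n) X <= (\<integral>\<^sup>+ s. g s \<partial>lborel) + ennreal (1 / Suc n)" for n
 proof (rule ccontr)
  assume no: "~ ?thesis"
  have d: "GV_dist (Xs n) X = (SUP g\<in>{g. simple_function lborel g & g <= f n}. integral\<^sup>S lborel g)"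
   unfolding GV_dist_def f_def[symmetric] nn_integral_def ..
  have "integral\<^sup>S lborel g + ennreal (1 / Suc n) <= GV_dist (Xs n) X" if "simple_function lborel g" "g <= f n" for g
   using no that nn_integral_eq_simple_integral[OF that(1)] by (auto simp: not_le less_imp_le)
  then have "(SUP g\<in>{g. simple_function lborel g & g <= f n}. integral\<^sup>S lborel g + ennreal (1 / Suc n)) <= GV_dist (Xs n) X"
   by (intro SUP_least) auto
  moreover have "(SUP g\<in>{g. simple_function lborel g & g <= f n}. integral\<^sup>S lborel g + ennreal (1 / Suc n)) = GV_dist (Xs n) X + ennreal (1 / Suc n)"
   unfolding d by (rule ennreal_SUP_add_left) (auto intro!: exI[of _ "%_. 0"] simp: le_fun_def)
  moreover have "GV_dist (Xs n) X < \<infinity>"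
   using nn_integral_mono[of lborel "f n" w] fw w(2) unfolding GV_dist_def f_def[symmetric] by (auto intro: le_less_trans)
  ultimately have "GV_dist (Xs n) X + ennreal (1 / Suc n) <= GV_dist (Xs n) X + 0" "GV_dist (Xs n) X < \<infinity>" by simp_all
  then show False unfolding ennreal_add_left_cancel_le by simp
 qed
 then obtain g where g: "!!n. simple_function lborel (g n)" "!!n. g n <= f n"
  "!!n. GV_dist (Xs n) X <= (\<integral>\<^sup>+ s. g n s \<partial>lborel) + ennreal (1 / Suc n)"
  by metis
 have "(%n. \<integral>\<^sup>+ s. g n s \<partial>lborel) \<longlonglongrightarrow> (\<integral>\<^sup>+ s. 0 \<partial>(lborel :: real measure))"
 proof (rule nn_integral_dominated_convergence[of _ _ _ w])
  show "AE s in lborel. g n s <= w s" for n using order_trans[OF le_funD[OF g(2)] fw] by simp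
  have "N : null_sets lborel" using N countable_imp_null_set_lborel by blast
  then show "AE s in lborel. (%n. g n s) \<longlonglongrightarrow> 0"
  proof (rule AE_I')
   show "{s : space lborel. ~ (%n. g n s) \<longlonglongrightarrow> 0} <= N"
   proof (rule ccontr, elim notE, intro subsetI)
    fix s assume s: "s : {s : space lborel. ~ (%n. g n s) \<longlonglongrightarrow> 0}"
    show "s : N"
    proof (rule ccontr)
     assume sN: "s ~: N"
     have "(%n. g n s) \<longlonglongrightarrow> 0"
     proof (rule order_tendstoI)
      fix a :: ennreal assume "0 < a"
      then obtain z where z: "0 < z" "z < a" using dense by blast
      then obtain e where "z = ennreal e" by (cases z) auto
      then have e: "0 < e" "ennreal e < a" using z by auto
      show "EV n. g n s < a"
      proof (cases "0 < s")
       case True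
       have "EV n. GP_dist (truncate_tree s (Xs n)) (truncate_tree s X) <= ennreal (e/2)"
        by (rule GP[OF True sN]) (use e in simp)
       then show ?thesis
       proof eventually_elim
        case (elim n)
        have "g n s <= f n s" using g(2) by (simp add: le_fun_def)
        also have "... <= 1 * ennreal (e/2) * 1" unfolding f_def using True elim
         by (intro mult_mono) (auto simp: min.coboundedI2)
        also have "... <= ennreal e" using e by (simp add: ennreal_leI)
        also have "... < a" by (rule e)
        finally show ?case .
       qed
      next
       case False
       then have "g n s = 0" for n using g(2)[of n] unfolding le_fun_def f_def by (metis (no_types) False greaterThan_iff indicator_simps(2) le_zero_eq mult_zero_right)
       then show ?thesis using \<open>0 < a\<close> by simp
      qed
     qed simp
     then show False using s by simp
    qed
   qed
  qed
 qed (use borel_measurable_simple_function[OF g(1)] w in auto)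
 moreover have "(%n. ennreal (1 / Suc n)) \<longlonglongrightarrow> ennreal 0"
  by (intro tendsto_ennrealI LIMSEQ_Suc lim_1_over_n)
 ultimately have *: "(%n. (\<integral>\<^sup>+ s. g n s \<partial>lborel) + ennreal (1 / Suc n)) \<longlonglongrightarrow> 0" using tendsto_add by fastforce
 show ?thesis unfolding GV_converges_def
  by (rule tendsto_sandwich[OF _ _ tendsto_const *]) (use g(3) in auto)
qed

section \<open>Exceptional heights are countable\<close>

context rooted_tree
begin

text \<open>If \<open>x\<close> and \<open>y\<close> part at height \<open>s\<close>, points of a
  countable dense set sufficiently close to them part at the same height, so \<open>s\<close> is one
  of countably many Gromov products.\<close>

lemma countable_branching:
 assumes "second_countable_metric m" shows "countable {s. ~ no_branching s}"
proof -
 obtain \<C> where C: "countable \<C>" "ALL C:\<C>. openin (mtopology_of m) C"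
   "ALL x:Pt. ALL e>0. EX C:\<C>. x : C & (ALL y:C. mdist m x y < e)"
  using assms unfolding second_countable_metric_def by (elim exE conjE)
 define p where "p C = (SOME x. x : C)" for C :: "'a set"
 have near: "EX x':p ` \<C>. x' : Pt & s < gp x x'" if x: "x : Pt" "s < ht x" for x s
 proof -
  obtain C where C': "C : \<C>" "x : C" "ALL y:C. mdist m x y < ht x - s" using bspec[OF C(3) x(1)] x(2) by (metis diff_gt_0_iff_gt)
  have pC: "p C : C" unfolding p_def using C'(2) by (rule someI)
  then have "p C : Pt" using C(2) C'(1) unfolding openin_mtopology_of by blast
  then show ?thesis using gp_near[OF x(1), of "p C"] C' pC by (intro bexI[of _ "p C"]) force+
 qed
 have "s : (%(x, y). gp x y) ` (p ` \<C> \<times> p ` \<C>)" if nb: "~ no_branching s" for s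
 proof -
  obtain x y where xy: "x : Pt" "y : Pt" "s < ht x" "s < ht y" "gp x y = s"
   using nb unfolding no_branching_def by blast
  obtain x' y' where x': "x' : p ` \<C>" "x' : Pt" "s < gp x x'" "y' : p ` \<C>" "y' : Pt" "s < gp y y'"
   using near[OF xy(1,3)] near[OF xy(2,4)] by blast
  have "s <= gp x' y'"
   using gp_ge_trans[OF x'(2) xy(1) x'(5)] gp_ge_trans[OF xy(1,2) x'(5)] xy(5) x'(3,6) by (simp add: gp_commute less_imp_le)
  moreover have "~ s < gp x' y'"
   using gp_gr_trans[OF xy(1) x'(2) xy(2), of s] gp_gr_trans[OF x'(2,5) xy(2), of s] xy(5) x'(3,6) by (auto simp: gp_commute)
  ultimately show ?thesis using x' by (intro image_eqI[of _ _ "(x', y')"]) auto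
 qed
 then have "{s. ~ no_branching s} <= (%(x, y). gp x y) ` (p ` \<C> \<times> p ` \<C>)" by blast
 then show ?thesis using C(1) by (meson countable_SIGMA countable_image countable_subset)
qed

text \<open>These heights are atoms of the images under \<open>ht\<close> of the restrictions of
  \<open>nu\<close> to balls of integer radius, which are finite measures.\<close>

lemma countable_levels:
 assumes nu: "sets nu = Bor" "!!R. em nu (lo R) < \<infinity>"
 shows "countable {s. em nu (lev s) ~= 0}"
proof -
 define nuR where "nuR k = distr (mrestr nu (lo (real k))) borel ht" for k :: nat
 have b: "(lo (real k)) : sets nu" "(lev s) : sets nu" for k s using ht_borel_le ht_borel_eq nu(1) by auto
 have sp: "space nu = Pt" using sets_eq_imp_space_eq[OF nu(1)] by simp
 have meas: "ht : measurable (mrestr nu A) borel" for A using ht_measurable nu(1) by (simp cong: measurable_cong_sets)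
 have fin: "finite_measure (nuR k)" for k
 proof (rule finite_measureI)
  show "em (nuR k) (space (nuR k)) ~= \<infinity>"
   using emeasure_distr[OF meas] emeasure_mrestr[OF b(1), of "space nu"] nu(2)[of k] sp b(1)[of k] sets.top[of nu]
   by (simp add: nuR_def Int_absorb1 less_top)
 qed
 have "{s. em nu (lev s) ~= 0} <= (UN k. {s. measure (nuR k) {s} ~= 0})"
 proof
  fix s assume s: "s : {s. em nu (lev s) ~= 0}"
  obtain k :: nat where k: "s <= real k" using real_arch_simple by blast
  have "em (nuR k) {s} = em (mrestr nu (lo (real k))) (lev s)"
   unfolding nuR_def by (subst emeasure_distr[OF meas]) (auto simp: sp intro!: arg_cong2[where f = emeasure])
  also have "... = em nu (lev s)"
   unfolding emeasure_mrestr[OF b] using k by (intro arg_cong2[where f = emeasure]) auto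
  finally have "em (nuR k) {s} ~= 0" using s by simp
  then show "s : (UN k. {s. measure (nuR k) {s} ~= 0})"
   using finite_measure.emeasure_eq_measure[OF fin] by (intro UN_I[of k]) auto
 qed
 then show ?thesis using finite_measure.countable_support[OF fin] by (meson countable_UN countable_subset countableI_type)
qed

end

lemma countable_complement_dense:
 fixes a b :: real
 assumes "countable N" "a < b" shows "EX s. s ~: N & a < s & s < b"
 using open_minus_countable[OF assms(1), of "{a<..<b}"] assms(2) by auto

section \<open>Weak convergence on the half-line\<close>

abbreviation halfline :: "real measure" where "halfline == restrict_space borel {0..}"

lemma halfline_sets: assumes "sets nu = sets halfline" shows "space nu = {0..}" "0 <= t ==> {t..} : sets nu" "A : sets borel ==> A <= {0..} ==> A : sets nu"
 using sets_eq_imp_space_eq[OF assms] assms by (auto simp: space_restrict_space sets_restrict_space_iff)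

lemma halfline_integrable:
 assumes "sets nu = sets halfline" "finite_measure nu" "continuous_on {0..} f" "!!x. 0 <= x ==> \<bar>f x\<bar> <= B"
 shows "integrable nu (f :: real => real)"
proof (rule finite_measure.integrable_const_bound[OF assms(2), of _ B])
 show "f : borel_measurable nu" unfolding measurable_cong_sets[OF assms(1) refl]
  by (rule borel_measurable_continuous_on_restrict[OF assms(3)])
qed (use assms(4) halfline_sets(1)[OF assms(1)] in auto)

text \<open>The step function with values \<open>f (s j)\<close> has an integral that is a linear
  combination of tail masses; the error is \<open>e\<close> below \<open>s J\<close> and at most
  \<open>B\<close> beyond. Convergence of tails at a dense set of levels thereby gives weak
  convergence.\<close>

lemma step_integral:
 fixes f :: "real => real" and s :: "nat => real"
 assumes nu: "sets nu = sets halfline" "finite_measure nu" and f: "continuous_on {0..} f" "!!x. 0 <= x ==> \<bar>f x\<bar> <= B"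
  and s: "s 0 = 0" "!!j. j < J ==> s j < s (Suc j)" "!!j x. j < J ==> s j <= x ==> x < s (Suc j) ==> \<bar>f x - f (s j)\<bar> <= e"
  and e: "0 <= e"
 shows "\<bar>integral\<^sup>L nu f - (SUM j<J. f (s j) * (measure nu {s j..} - measure nu {s (Suc j)..}))\<bar> <= e * measure nu {0..} + B * measure nu {s J..}"
proof -
 interpret finite_measure nu by fact
 note hs = halfline_sets[OF nu(1)]
 have mono: "s i <= s j" if "i <= j" "j <= J" for i j
  using that by (induction j rule: dec_induct) (auto intro: order_trans[OF _ less_imp_le[OF s(2)]])
 have pos: "0 <= s j" if "j <= J" for j using mono[of 0 j] that s(1) by simp
 define g where "g x = (SUM j<J. f (s j) * (indicator {s j..} x - indicator {s (Suc j)..} x))" for x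
 have int: "integrable nu (indicator {t..} :: real => real)" if "0 <= t" for t
  using hs(2)[OF that] by (intro integrable_real_indicator) (simp_all add: top.not_eq_extremum[symmetric])
 have g: "integrable nu g" unfolding g_def
  by (intro Bochner_Integration.integrable_sum integrable_mult_right Bochner_Integration.integrable_diff int pos) auto
 have "integral\<^sup>L nu g = (SUM j<J. f (s j) * (measure nu {s j..} - measure nu {s (Suc j)..}))"
  unfolding g_def using int pos hs(1) by (subst Bochner_Integration.integral_sum) (auto intro!: sum.cong simp: Int_absorb2)
 moreover have fi: "integrable nu f" by (rule halfline_integrable[OF nu f])
 moreover have "\<bar>integral\<^sup>L nu (%x. f x - g x)\<bar> <= integral\<^sup>L nu (%x. e + B * indicator {s J..} x)"
 proof (rule order_trans[OF integral_abs_bound], rule integral_mono)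
  show "integrable nu (%x. \<bar>f x - g x\<bar>)" using fi g by auto
  show "integrable nu (%x. e + B * indicator {s J..} x)" using int[OF pos] by auto
  fix x assume "x : space nu"
  then have x: "0 <= x" using hs(1) by auto
  show "\<bar>f x - g x\<bar> <= e + B * indicator {s J..} x"
  proof (cases "x < s J")
   case True
   then obtain j where j: "j < J" "s j <= x" "x < s (Suc j)" using grid_cell[of s x J] s(1) x by blast
   have "g x = (SUM i<J. if i = j then f (s j) else 0)" unfolding g_def
   proof (rule sum.cong)
    fix i assume "i : {..<J}"
    then show "f (s i) * (indicator {s i..} x - indicator {s (Suc i)..} x) = (if i = j then f (s j) else 0)"
     using j mono[of i j] mono[of "Suc i" j] mono[of "Suc j" i] mono[of i "Suc i"] by (cases i j rule: linorder_cases) auto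
   qed simp
   then show ?thesis using s(3)[OF j] j(1) True by simp
  next
   case False
   then have "s j <= x" if "j <= J" for j using mono[OF that] by simp
   then have "g x = 0" unfolding g_def by (intro sum.neutral) (simp add: Suc_le_eq)
   then show ?thesis using f(2)[OF x] False e by simp
  qed
 qed
 moreover have "integral\<^sup>L nu (%x. e + B * indicator {s J..} x) = e * measure nu {0..} + B * measure nu {s J..}"
  using int[OF pos, of J] hs(1) pos[of J] by (simp add: Int_absorb2 mult.commute)
 ultimately show ?thesis using g by simp
qed

lemma halfline_tail:
 assumes "sets nu = sets halfline" "finite_measure nu" "0 < ep"
 shows "EX k::nat. measure nu {real k..} < ep"
proof -
 interpret finite_measure nu by fact
 have "(%k. measure nu {real k..}) \<longlonglongrightarrow> measure nu (INT k. {real k..})"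
  by (rule finite_Lim_measure_decseq) (use halfline_sets(2)[OF assms(1)] in \<open>auto simp: decseq_def\<close>)
 moreover have "x ~: (INT k. {real k..})" for x using reals_Archimedean2[of x] by (auto simp: not_le)
 then have "(INT k. {real k..}) = {}" by blast
 ultimately have "EV k. measure nu {real k..} < ep" using assms(3) by (intro order_tendstoD(2)[where y = 0]) auto
 then show ?thesis by (auto dest: eventually_happens)
qed

lemma weak_convergesI:
 assumes sets: "sets nu = sets halfline" "!!n. sets (nus n) = sets halfline"
  and fin: "finite_measure nu" "EV n. finite_measure (nus n)"
  and G: "!!a b. 0 <= a ==> a < b ==> EX s:G. a < s & s < b"
  and conv: "!!t. t : insert 0 G ==> (%n. measure (nus n) {t..}) \<longlonglongrightarrow> measure nu {t..}"
 shows "weak_converges nus nu"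
 unfolding weak_converges_def
proof (intro conjI allI impI fin)
 fix f :: "real => real" assume f: "continuous_on {0..} f" and "bounded (f ` {0..})"
 then obtain B where B: "0 < B" "!!x. 0 <= x ==> \<bar>f x\<bar> <= B" unfolding bounded_pos by auto
 show "(%n. integral\<^sup>L (nus n) f) \<longlonglongrightarrow> integral\<^sup>L nu f"
 proof (rule LIMSEQ_I)
  fix ep :: real assume ep: "0 < ep"
  define L where "L = measure nu {0..} + 1"
  have L: "0 < L" "measure nu {0..} <= L" unfolding L_def using measure_nonneg[of nu "{0..}"] by linarith+
  define e where "e = ep / (6 * L)"
  have e: "0 < e" "e * L = ep / 6" using ep L unfolding e_def by auto
  interpret finite_measure nu by fact
  obtain k where k: "measure nu {real k..} < ep / (12 * B)" using halfline_tail[OF sets(1) fin(1), of "ep / (12 * B)"] ep B(1) by auto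
  obtain K where K: "K : G" "real k < K" using G[of "real k" "real k + 1"] by auto
  have "measure nu {K..} <= measure nu {real k..}" using K halfline_sets(2)[OF sets(1)] by (intro finite_measure_mono) auto
  then have Kt: "measure nu {K..} < ep / (12 * B)" using k by simp
  have "uniformly_continuous_on {0..K} f" by (rule compact_uniformly_continuous[OF continuous_on_subset[OF f]]) auto
  then obtain d where d: "0 < d" "!!x y. 0 <= x ==> x <= y ==> y <= K ==> y - x < d ==> \<bar>f y - f x\<bar> < e"
   using e(1) unfolding uniformly_continuous_on_def dist_real_def by force
  from level_grid[OF G, of K "d/2"] K d(1) obtain J s where J: "s 0 = (0::real)" "s J = K" "!!j. j < J ==> s j < s (Suc j) & s (Suc j) <= s j + d/2"
   "!!j. 0 < j ==> j < J ==> s j : G" by force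
  have mono: "s i <= s j" if "i <= j" "j <= J" for i j
   using that by (induction j rule: dec_induct) (auto intro: order_trans[OF _ less_imp_le[OF conjunct1[OF J(3)]]])
  have sG: "s j : insert 0 G" if "j <= J" for j using J(1,2,4) K(1) that by (cases "j = 0"; cases "j = J") auto
  have osc: "\<bar>f x - f (s j)\<bar> <= e" if "j < J" "s j <= x" "x < s (Suc j)" for j x
   using d(2)[of "s j" x] mono[of 0 j] mono[of "Suc j" J] J that d(1) by fastforce
  let ?S = "%N. SUM j<J. f (s j) * (measure N {s j..} - measure N {s (Suc j)..})"
  have st: "\<bar>integral\<^sup>L N f - ?S N\<bar> <= e * measure N {0..} + B * measure N {K..}" if "sets N = sets halfline" "finite_measure N" for N
   unfolding J(2)[symmetric] by (rule step_integral[OF that f]) (use B J osc e(1) in auto)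
  have "(%n. ?S (nus n)) \<longlonglongrightarrow> ?S nu" by (intro tendsto_intros conv sG) auto
  then have "EV n. dist (?S (nus n)) (?S nu) < ep / 6" using ep by (intro tendstoD) auto
  moreover have "EV n. measure (nus n) {0..} < L" by (rule order_tendstoD(2)[OF conv]) (auto simp: L_def)
  moreover have "EV n. measure (nus n) {K..} < ep / (12 * B)" by (rule order_tendstoD(2)[OF conv Kt]) (use K in auto)
  ultimately have "EV n. norm (integral\<^sup>L (nus n) f - integral\<^sup>L nu f) < ep" using fin(2)
  proof eventually_elim
   case (elim n)
   have bd: "e * measure N {0..} + B * measure N {K..} <= ep / 6 + ep / 12" if "measure N {0..} <= L" "measure N {K..} <= ep / (12 * B)" for N :: "real measure"
    using mult_left_mono[OF that(1), of e] mult_left_mono[OF that(2), of B] e B(1) by simp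
   show ?case using st[OF sets(1) fin(1)] st[OF sets(2) elim(4)] bd[OF L(2) less_imp_le[OF Kt]] bd[OF less_imp_le[OF elim(2)] less_imp_le[OF elim(3)]] elim(1) ep
    unfolding dist_real_def real_norm_def by argo
  qed
  then show "EX no. ALL n>=no. norm (integral\<^sup>L (nus n) f - integral\<^sup>L nu f) < ep" unfolding eventually_sequentially .
 qed
qed

lemma weak_converges_total:
 assumes "weak_converges nus nu" "sets nu = sets halfline" "!!n. sets (nus n) = sets halfline"
 shows "(%n. measure (nus n) {0..}) \<longlonglongrightarrow> measure nu {0..}"
proof -
 have "bounded ((%_. 1 :: real) ` {0 :: real..})" by (rule boundedI[of _ 1]) auto
 then have "(%n. integral\<^sup>L (nus n) (%_. 1 :: real)) \<longlonglongrightarrow> integral\<^sup>L nu (%_. 1)"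
  using assms(1) unfolding weak_converges_def by (blast intro: continuous_on_const)
 then show ?thesis using halfline_sets(1)[OF assms(2)] halfline_sets(1)[OF assms(3)] by simp
qed

text \<open>The portmanteau inequality for closed sets, by continuous functions
  \<open>1 - k * infdist\<close>, cut off at 0, which decrease to the indicator of
  \<open>A\<close>.\<close>

lemma weak_converges_closed:
 assumes wk: "weak_converges nus nu" and sets: "sets nu = sets halfline" "!!n. sets (nus n) = sets halfline"
  and A: "closed A" "A ~= {}" "A <= {0..}" and et: "0 < et"
 shows "EV n. measure (nus n) A <= measure nu A + et"
proof -
 have fin: "finite_measure nu" "EV n. finite_measure (nus n)" using wk unfolding weak_converges_def by auto
 define f :: "nat => real => real" where "f k x = max 0 (1 - real k * infdist x A)" for k x
 have fc: "continuous_on {0..} (f k)" for k unfolding f_def by (intro continuous_intros)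
 have f01: "0 <= f k x" "f k x <= 1" for k x unfolding f_def using infdist_nonneg[of x A] by auto
 have fA: "f k x = 1" if "x : A" for k x unfolding f_def using that by simp
 have fint: "integrable N (f k)" if "sets N = sets halfline" "finite_measure N" for N k
  by (rule halfline_integrable[OF that fc]) (use f01 in simp)
 have As: "A : sets N" if "sets N = sets halfline" for N using halfline_sets(3)[OF that] A by simp
 have "(%k. integral\<^sup>L nu (f k)) \<longlonglongrightarrow> integral\<^sup>L nu (indicator A)"
 proof (rule integral_dominated_convergence[where w = "%_. 1"])
  show "AE x in nu. (%k. f k x) \<longlonglongrightarrow> indicator A x"
  proof (rule AE_I2)
   fix x
   show "(%k. f k x) \<longlonglongrightarrow> indicator A x"
   proof (cases "x : A")
    case False
    then have "0 < infdist x A" using in_closed_iff_infdist_zero[OF A(1,2)] infdist_nonneg[of x A] by force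
    then obtain k0 :: nat where "1 / infdist x A < real k0" using reals_Archimedean2 by blast
    then have "1 - real k * infdist x A <= 0" if "k0 <= k" for k
     using that \<open>0 < infdist x A\<close> by (simp add: field_simps) (meson less_imp_le mult_right_mono of_nat_mono order_trans)
    then have "EV k. f k x = 0" unfolding f_def eventually_sequentially by (intro exI[of _ k0]) simp
    then show ?thesis using False by (simp add: tendsto_eventually)
   qed (simp add: fA)
  qed
  show "integrable nu (%_. 1 :: real)" using fin(1) by (simp add: finite_measure.integrable_const)
  show "f k : borel_measurable nu" for k using fint[OF sets(1) fin(1)] by blast
  show "AE x in nu. norm (f k x) <= 1" for k using f01 by simp
 qed (use As[OF sets(1)] in simp)
 then have "EV k. integral\<^sup>L nu (f k) < measure nu A + et"
  using et sets.sets_into_space[OF As[OF sets(1)]] by (intro order_tendstoD(2)) (auto simp: Int_absorb2)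
 then obtain k where k: "integral\<^sup>L nu (f k) < measure nu A + et" by (auto dest: eventually_happens)
 have "bounded (f k ` {0..})" using f01[of k] by (intro boundedI[of _ 1]) auto
 then have "(%n. integral\<^sup>L (nus n) (f k)) \<longlonglongrightarrow> integral\<^sup>L nu (f k)" using wk fc unfolding weak_converges_def by blast
 from order_tendstoD(2)[OF this k] fin(2) show ?thesis
 proof eventually_elim
  case (elim n)
  interpret finite_measure "nus n" by (rule elim(2))
  have "measure (nus n) A = integral\<^sup>L (nus n) (indicator A)"
   using sets.sets_into_space[OF As[OF sets(2)]] by (simp add: Int_absorb2)
  also have "... <= integral\<^sup>L (nus n) (f k)"
   using As[OF sets(2)] fint[OF sets(2) elim(2)] f01 fA
   by (intro integral_mono integrable_real_indicator) (auto simp: top.not_eq_extremum[symmetric] indicator_def)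
  finally show ?case using elim(1) by simp
 qed
qed

text \<open>For \<open>t > 0\<close> the closed set \<open>{t..}\<close> gives the upper bound, and
  the closed set \<open>{0..t}\<close> together with the total mass gives the lower one, as the
  point \<open>t\<close> has limit mass 0. For \<open>t = 0\<close> the tail is the total
  mass.\<close>

lemma weak_converges_tail:
 assumes wk: "weak_converges nus nu" and sets: "sets nu = sets halfline" "!!n. sets (nus n) = sets halfline"
  and t: "0 <= t" "t = 0 | measure nu {t} = 0"
 shows "(%n. measure (nus n) {t..}) \<longlonglongrightarrow> measure nu {t..}"
proof (cases "t = 0")
 case True
 then show ?thesis using weak_converges_total[OF assms(1-3)] by simp
next
 case False
 show ?thesis
 proof (rule LIMSEQ_I)
  fix et :: real assume et: "0 < et"
  have fin: "finite_measure nu" "EV n. finite_measure (nus n)" using wk unfolding weak_converges_def by auto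
  have split: "measure N {0..} = measure N {t..} + measure N {0..<t}" "measure N {0..t} = measure N {t} + measure N {0..<t}"
   if "sets N = sets halfline" "finite_measure N" for N
  proof -
   have e: "{t..} Un {0..<t} = {0..}" "{t} Un {0..<t} = {0..t}" "{t..} Int {0..<t} = {}" "{0..<t} <= {0..}" using t(1) by auto
   show "measure N {0..} = measure N {t..} + measure N {0..<t}" "measure N {0..t} = measure N {t} + measure N {0..<t}"
    using finite_measure.finite_measure_Union[OF that(2), of "{t..}" "{0..<t}"] finite_measure.finite_measure_Union[OF that(2), of "{t}" "{0..<t}"]
     halfline_sets(3)[OF that(1), of "{t..}"] halfline_sets(3)[OF that(1), of "{t}"] halfline_sets(3)[OF that(1), of "{0..<t}"] t(1)
    e(3,4) unfolding e(1,2) by auto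
  qed
  have "EV n. dist (measure (nus n) {0..}) (measure nu {0..}) < et / 3"
   using weak_converges_total[OF assms(1-3)] et by (intro tendstoD) auto
  moreover have "EV n. measure (nus n) {0..t} <= measure nu {0..t} + et / 3"
   by (rule weak_converges_closed[OF wk sets]) (use t(1) et in auto)
  moreover have "EV n. measure (nus n) {t..} <= measure nu {t..} + et / 3"
   by (rule weak_converges_closed[OF wk sets]) (use t(1) et in auto)
  ultimately have "EV n. norm (measure (nus n) {t..} - measure nu {t..}) < et" using fin(2)
  proof eventually_elim
   case (elim n)
   have "0 <= measure (nus n) {t}" by simp
   then show ?case using elim(1-3) split[OF sets(1) fin(1)] split[OF sets(2) elim(4)] t(2) False et unfolding dist_real_def real_norm_def by argo
  qed
  then show "EX no. ALL n>=no. norm (measure (nus n) {t..} - measure nu {t..}) < et" unfolding eventually_sequentially .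
 qed
qed

section \<open>Cut-off sequences\<close>

lemma represents_cong:
 assumes "represents Y m ro nu" "sets nu' = sets (mb m)" "!!B. B : sets (mb m) ==> em nu' B = em nu B"
 shows "represents Y m ro nu'"
 using assms unfolding represents_def by auto

lemma T_min_diD:
 assumes "X : T_min_di"
 shows "rooted_tree (tmet X) (troot X)" "rooted_tree.admissible (tmet X) (troot X) (tmeas X)"
  "mcomplete_of (tmet X)" "second_countable_metric (tmet X)"
proof -
 have X: "rtree (tmet X) (troot X)" "polish_metric (tmet X)" "tmeas X : M_di (tmet X) (troot X)"
  using assms unfolding T_min_di_def minimal_polish_rtree_def by auto
 show "rooted_tree (tmet X) (troot X)" using X(1) by unfold_locales
 then show "rooted_tree.admissible (tmet X) (troot X) (tmeas X)" by (rule rooted_tree.M_di_admissible[OF _ X(3)])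
 show "mcomplete_of (tmet X)" "second_countable_metric (tmet X)"
  using X(2) second_countable_metricI unfolding polish_metric_def by auto
qed

lemma truncate_represents:
 assumes "X : T_min_di" shows "represents (truncate_tree s X) (tmet X) (troot X) (mrestr (tmeas X) (tball (tmet X) (troot X) s))"
proof -
 interpret rooted_tree "tmet X" "troot X" by (rule T_min_diD[OF assms])
 show ?thesis unfolding truncate_tree_def
  by (rule spanned_tree_represents[OF T_min_diD(4)[OF assms]])
   (use T_min_diD(2)[OF assms] in \<open>auto simp: admissible_def intro: seg_self\<close>)
qed

text \<open>The space of an erased tree is \<open>R_erase_plus\<close>. As the erased measure does
  not charge the complement, its truncations can be studied inside the original tree.\<close>

lemma truncate_erase_represents:
 assumes X: "X : T_min_di" and h: "0 < h"
 shows "represents (truncate_tree s (erase_tree h X)) (tmet X) (troot X)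
  (mrestr (erase (tmet X) (troot X) h (tmeas X)) (tball (tmet X) (troot X) s))"
proof -
 let ?m = "tmet X" and ?ro = "troot X"
 interpret rooted_tree ?m ?ro by (rule T_min_diD[OF X])
 interpret erasing ?m ?ro "tmeas X" h by unfold_locales (use T_min_diD[OF X] h in auto)
 note sc = T_min_diD(4)[OF X]
 have Rp: "Rp : sets (mb ?m)" "Rp <= mspace ?m" "?ro : Rp"
  using Rp_closed Rp_subtree unfolding subtree_def by auto
 have Es: "Rp Int space E : sets E" using Rp(1,2) by (simp add: sets_erase space_erase Int_absorb2)
 have rs: "sets (restrict_space E Rp) = sets (mb (submetric ?m Rp))"
  unfolding sets_restrict_space sets_erase sets_metric_borel_submetric[OF Rp(2)] ..
 have ms: "mspace (submetric ?m Rp) = Rp" using Rp(2) by auto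
 have sg: "seg ?m ?ro x <= Rp" if "x : Rp" for x
 proof
  fix y assume "y : seg ?m ?ro x"
  then have y: "y : mspace ?m" "gp y x = ht y" using seg_iff that Rp(2) by auto
  then have "x : above ?m ?ro y" using above_iff[OF y(1)] that Rp(2) by auto
  then have "anc x (ht y) = y" "ht y <= ht x" using anc_eqI[of x y] above_ht[OF y(1)] y(1) that Rp(2) by auto
  then show "y : Rp" using Rp_subtree that unfolding subtree_def by (metis ht_nonneg)
 qed
 have tb: "tball (submetric ?m Rp) ?ro s = tball ?m ?ro s Int Rp" unfolding tball_def using Rp(2) by auto
 show ?thesis unfolding truncate_tree_def erase_tree_def Let_def select_convs
 proof (rule represents_trans[OF spanned_tree_represents Rp(1)])
  show "second_countable_metric (submetric ?m Rp)" by (rule second_countable_submetric[OF sc])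
  show "?ro : mspace (submetric ?m Rp)" using Rp(3) ms by simp
  show "x : seg (submetric ?m Rp) ?ro x" if "x : mspace (submetric ?m Rp)" for x
   using that seg_self Rp(2) unfolding ms by (subst seg_submetric[OF Rp(2) sg]) auto
  fix B assume B: "B : sets (mb ?m)"
  have e: "em E (B Int tball ?m ?ro s) = em E (B Int tball ?m ?ro s Int Rp)"
  proof (rule emeasure_eq_AE)
   have "mspace ?m - Rp : null_sets E"
    using erase_outside_plus[OF sc] sets.compl_sets[OF Rp(1)] by (auto simp: null_sets_def sets_erase)
   then show "AE x in E. (x : B Int tball ?m ?ro s) = (x : B Int tball ?m ?ro s Int Rp)"
    by (rule AE_I') (auto simp: space_erase)
  qed (use B Rp tball_borel in \<open>auto simp: sets_erase\<close>)
  show "em (mrestr (restrict_space E Rp) (tball (submetric ?m Rp) ?ro s)) (B Int Rp) = em (mrestr E (tball ?m ?ro s)) B"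
  proof -
   have "B Int Rp Int (tball ?m ?ro s Int Rp) = B Int tball ?m ?ro s Int Rp" by auto
   moreover have "em (mrestr (restrict_space E Rp) (tball ?m ?ro s Int Rp)) (B Int Rp) = em (restrict_space E Rp) (B Int Rp Int (tball ?m ?ro s Int Rp))"
    by (rule emeasure_mrestr) (use B Rp tball_borel[of s] in \<open>auto simp: sets_erase sets_restrict_space_iff[OF Es]\<close>)
   moreover have "em (mrestr E (tball ?m ?ro s)) B = em E (B Int tball ?m ?ro s)"
    by (rule emeasure_mrestr) (use B tball_borel[of s] in \<open>auto simp: sets_erase\<close>)
   ultimately show ?thesis unfolding tb e by (simp add: emeasure_restrict_space[OF Es])
  qed
 qed (simp_all add: rs sets_erase)
qed

context rooted_tree
begin

text \<open>A point above level \<open>r\<close> is kept precisely if its ancestor at level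
  \<open>r\<close> is no cut point; at level \<open>r\<close> itself every point is kept, including
  those of \<open>D\<close>.\<close>

lemma Cut_eq:
 assumes X: "tmet X = m" "troot X = ro" and D: "D <= tsphere m ro r" and r: "0 < r"
 shows "Cut X r D = off D Un D" "D Int off D = {}"
proof -
 have Dm: "d : Pt" "ht d = r" if "d : D" for d using D that tsphere_iff by auto
 have 1: "x : off D Un D" if x: "x : Pt" "ht x <= r" for x
 proof (cases "x : off D")
  case False
  then obtain d where d: "d : D" "x : up d" using x unfolding off_def by auto
  then have "x = d" using above_strict[OF Dm(1)[OF d(1)] d(2)] Dm(2)[OF d(1)] x(2) by auto
  then show ?thesis using d by simp
 qed simp
 have 2: "x : off D" if x: "x : up si" "si : tsphere m ro r" "si ~: D" for x si
  using x Dm above_subset above_disjoint[of si] unfolding tsphere_iff off_def by fastforce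
 have 3: "x : (UN si:tsphere m ro r - D. up si)" if x: "x : off D" "r < ht x" for x
  using x anc[of x r] anc_above[of x r] r unfolding off_def by (intro UN_I[of "anc x r"]) (auto simp: tsphere_iff)
 show "Cut X r D = off D Un D" unfolding Cut_def X
 proof (intro equalityI subsetI)
  fix x assume x: "x : off D Un D"
  show "x : tball m ro r Un (UN si:tsphere m ro r - D. up si)"
  proof (cases "ht x <= r")
   case True
   then show ?thesis using x Dm by (auto simp: tball_iff off_def)
  next
   case False
   then show ?thesis using 3[of x] x Dm by auto
  qed
 qed (use 1 2 in \<open>auto simp: tball_iff\<close>)
 show "D Int off D = {}" using Dm above_self unfolding off_def by auto
qed

lemma finite_borel: "finite D ==> D <= Pt ==> D : Bor"
 using sets.finite_UN[of D "%x. {x}" "mb m"] singleton_borel by force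

text \<open>The height measure of a cut-off tree sees the cut-off points themselves, which \<open>cutm\<close> omits.\<close>
lemma height_cut:
 assumes X: "tmet X = m" "troot X = ro" "tmeas X = mu" and sc: "second_countable_metric m" and mu: "sets mu = Bor"
  and D: "finite D" "D <= tsphere m ro r" and r: "0 < r" and A: "A : sets borel" "A <= {0..}"
 shows "sets (height_measure (cut_tree hh X r D)) = sets halfline"
  "em (height_measure (cut_tree hh X r D)) A =
   em (cutm mu D hh) {x : Pt. ht x : A} + em mu (if r : A then D else {})"
proof -
 let ?Y = "cut_tree hh X r D" and ?S = "{x : Pt. ht x : A}"
 show "sets (height_measure ?Y) = sets halfline" unfolding height_measure_def by simp
 have Dm: "D <= Pt" "!!d. d : D ==> ht d = r" using D(2) tsphere_iff by auto
 note C = Cut_eq[OF X(1,2) D(2) r]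
 have b: "off D : sets mu" "D : sets mu" "?S : Bor"
  using off_borel[OF D(1) Dm(1)] finite_borel[OF D(1) Dm(1)] mu measurable_sets[OF ht_measurable A(1)]
  by (auto simp: vimage_def Int_def conj_commute)
 have cm: "cut_measure hh X r D = cut_at (Cut X r D) mu D hh" unfolding cut_measure_def cut_at_def X ..
 have rep: "represents ?Y m ro (cut_at (Cut X r D) mu D hh)"
  unfolding cut_tree_def cm X by (rule spanned_tree_represents[OF sc]) (auto intro: seg_self)
 have h: "mdist (tmet ?Y) (troot ?Y) x = ht x" for x unfolding represents_dist[OF rep] represents_root(2)[OF rep] ht_def ..
 have "em (height_measure ?Y) A = em (tmeas ?Y) (?S Int mspace (tmet ?Y))"
  unfolding height_measure_def h
 proof (subst emeasure_distr)
  have idm: "(%x. x) : measurable (tmeas ?Y) (mb m)"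
   unfolding measurable_cong_sets[OF represents_sets(1)[OF rep] refl]
   by (rule measurable_lipschitz) (use represents_subset[OF rep] represents_dist[OF rep] in auto)
  have "ht : measurable (tmeas ?Y) borel" using measurable_compose[OF idm ht_measurable] by simp
  then show "ht : measurable (tmeas ?Y) halfline" by (rule measurable_restrict_space2[rotated]) auto
  show "A : sets halfline" using A by (simp add: sets_restrict_space_iff)
  show "em (tmeas ?Y) (ht -` A Int space (tmeas ?Y)) = em (tmeas ?Y) (?S Int mspace (tmet ?Y))"
   unfolding represents_space[OF rep] using represents_subset[OF rep] by (intro arg_cong2[where f = emeasure]) auto
 qed
 also have "... = em mu (?S Int (off D Un D)) + ennreal hh * of_nat (card (D Int ?S))"
  unfolding represents_emeasure[OF rep b(3)] C(1) by (rule emeasure_cut_at[OF mu _ D(1) b(3)]) (use b in auto)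
 also have "?S Int (off D Un D) = (?S Int off D) Un (?S Int D)" by auto
 also have "em mu ... = em mu (?S Int off D) + em mu (?S Int D)"
  using b C(2) mu by (subst plus_emeasure) auto
 also have "?S Int D = (if r : A then D else {})" using Dm by auto
 finally show "em (height_measure ?Y) A = em (cutm mu D hh) ?S + em mu (if r : A then D else {})"
  unfolding emeasure_cutm[OF mu D(1) Dm(1) b(3)] by (simp add: add_ac)
qed

text \<open>Heights that may serve as grid levels. By \<open>generic_countable\<close> they omit at
  most countably many positive heights, so countably many such conditions can be imposed at
  once.\<close>

definition generic :: "'a measure => real set" where
 "generic mu = {s. 0 < s & no_branching s & em mu (lev s) = 0}"

lemma generic_countable:
 assumes "second_countable_metric m" "admissible mu" shows "countable ({0<..} - generic mu)"
proof -
 have "{0<..} - generic mu <= {s. ~ no_branching s} Un {s. em mu (lev s) ~= 0}"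
  unfolding generic_def by auto
 moreover have "sets mu = Bor" using assms(2) unfolding admissible_def by blast
 ultimately show ?thesis
  using countable_Un[OF countable_branching[OF assms(1)] countable_levels[OF _ admissible_ball[OF assms(2)]]] countable_subset by blast
qed

end

lemma dense_of_countable:
 fixes G :: "real set"
 assumes "countable ({0<..} - G)" "0 <= a" "a < b" shows "EX s:G. a < s & s < b"
 using countable_complement_dense[OF assms(1,3)] assms(2) by force

text \<open>The difference between strict and weak inequality is bridged by increasing the radius by
  one, and the cut points, which \<open>Cut\<close> keeps, all lie in the ball of radius
  \<open>r\<close>.\<close>

lemma b_tight_iff:
 assumes Xs: "!!n. rooted_tree (tmet (Xs n)) (troot (Xs n))" and r: "0 < r"
  and D: "!!n. finite (Ds n)" "!!n. Ds n <= tsphere (tmet (Xs n)) (troot (Xs n)) r"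
  and nu: "!!n. sets (nu n) = sets (mb (tmet (Xs n)))"
 shows "b_tight Xs (%n. mrestr (nu n) (Cut (Xs n) r (Ds n))) \<longleftrightarrow>
  (ALL ze>0. EX R. EV n. em (nu n) ({x : mspace (tmet (Xs n)). R <= mdist (tmet (Xs n)) (troot (Xs n)) x} Int
    rooted_tree.off (tmet (Xs n)) (troot (Xs n)) (Ds n)) <= ennreal ze)" (is "?L \<longleftrightarrow> ?R")
proof -
 interpret T: rooted_tree "tmet (Xs n)" "troot (Xs n)" for n by (rule Xs)
 let ?a = "%R n. em (mrestr (nu n) (Cut (Xs n) r (Ds n))) (mspace (tmet (Xs n)) - tball (tmet (Xs n)) (troot (Xs n)) R)"
 let ?b = "%R n. em (nu n) ({x : mspace (tmet (Xs n)). R <= T.ht n x} Int T.off n (Ds n))"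
 have Dm: "Ds n <= mspace (tmet (Xs n))" "!!d. d : Ds n ==> T.ht n d = r" for n
  using D(2)[of n] unfolding T.tsphere_eq by auto
 have s: "T.off n (Ds n) : sets (nu n)" "Ds n : sets (nu n)" "{x : mspace (tmet (Xs n)). R <= T.ht n x} : sets (nu n)"
  "mspace (tmet (Xs n)) - tball (tmet (Xs n)) (troot (Xs n)) R : sets (nu n)" for n R
  using T.off_borel[OF D(1) Dm(1)] T.finite_borel[OF D(1) Dm(1)] T.ht_borel_ge sets.compl_sets[OF T.tball_borel] nu by auto
 have a: "?a R n = em (nu n) ({x : mspace (tmet (Xs n)). R < T.ht n x} Int (T.off n (Ds n) Un Ds n))" for R n
  unfolding T.Cut_eq(1)[OF refl refl D(2) r] using s
  by (subst emeasure_mrestr) (auto simp: T.tball_iff intro!: arg_cong2[where f = emeasure])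
 have ab: "?a R n <= ?b R n" if "r <= R" for R n
  unfolding a using s Dm that by (intro emeasure_mono) auto
 have ba: "?b R' n <= ?a R n" if "R < R'" for R R' n
  unfolding a using s that by (intro emeasure_mono) (auto intro!: sets.Int sets.Un T.ht_borel_gr simp: nu)
 show ?thesis
 proof
  assume L: ?L
  show ?R
  proof (intro allI impI)
   fix ze :: real assume "0 < ze"
   then have "\<forall>\<^sub>F R in at_top. limsup (?a R) < ennreal ze" using L unfolding b_tight_def by (intro order_tendstoD(2)) auto
   then obtain R where "limsup (?a R) < ennreal ze" by (auto dest: eventually_happens)
   then have "EV n. ?a R n < ennreal ze" by (rule Limsup_lessD)
   then have "EV n. ?b (R + 1) n <= ennreal ze"
    by eventually_elim (use ba[of R "R + 1"] in \<open>auto intro: order_trans less_imp_le\<close>)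
   then show "EX R. EV n. em (nu n) ({x : mspace (tmet (Xs n)). R <= mdist (tmet (Xs n)) (troot (Xs n)) x} Int T.off n (Ds n)) <= ennreal ze"
    unfolding T.ht_def by blast
  qed
 next
  assume R: ?R
  show ?L unfolding b_tight_def
  proof (rule order_tendstoI)
   fix z :: ennreal assume "0 < z"
   then obtain z' where z: "0 < z'" "z' < z" using dense by blast
   then obtain ze where "z' = ennreal ze" by (cases z') auto
   then have ze: "0 < ze" "ennreal ze < z" using z by auto
   obtain R0 where R0: "EV n. ?b R0 n <= ennreal ze" using R ze(1) unfolding T.ht_def by blast
   have "limsup (?a R') < z" if R': "max r R0 <= R'" for R'
   proof -
    have "EV n. ?a R' n <= ennreal ze" using R0
    proof eventually_elim
     case (elim n)
     have "?a R' n <= ?b R' n" using ab R' by simp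
     also have "... <= ?b R0 n" using s R' by (intro emeasure_mono) auto
     finally show ?case using elim by simp
    qed
    then show ?thesis by (rule le_less_trans[OF Limsup_bounded ze(2)])
   qed
   then show "\<forall>\<^sub>F R' in at_top. limsup (?a R') < z" unfolding eventually_at_top_linorder by blast
  qed simp
 qed
qed

text \<open>The measures are arbitrary admissible ones, so that the results apply to the given
  measures and to their erasures alike.\<close>

locale cut_sequence = tree_sequence m ro ms ros for m :: "'a metric" and ro and ms :: "nat => 'b metric" and ros +
 fixes mu :: "'a measure" and mus :: "nat => 'b measure" and r :: real and Ds :: "nat => 'b set"
 assumes adm: "admissible mu" and adms: "rooted_tree.admissible (ms n) (ros n) (mus n)" and r: "0 < r" and sc: "second_countable_metric m"
  and bullet_null: "b : heavy_at mu r ==> em mu {b} = 0"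
  and bullet_simple: "b : heavy_at mu r ==> x : above m ro b ==> x ~= b ==> y : above m ro b ==> y ~= b ==> r < gp x y"
  and Ds: "finite (Ds n)" "Ds n <= tsphere (ms n) (ros n) r" "card (Ds n) <= card (heavy_at mu r)"
begin

definition D where "D = heavy_at mu r"

abbreviation "cutM c == cutm mu D c"
abbreviation "cutMs c == (%n. Tn.cutm n (mus n) (Ds n) c)"

lemma set_facts: "sets mu = Bor" "sets (mus n) = sets (mb (ms n))" "finite D" "em mu (off D) < \<infinity>"
 "D <= Pt" "!!d. d : D ==> ht d = r" "Ds n <= mspace (ms n)" "!!d. d : Ds n ==> Tn.ht n d = r"
 using adm adms[of n] r Ds[of n] unfolding admissible_def Tn.admissible_def D_def heavy_at_def Tn.tsphere_eq by auto

lemma cut_conv: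
 assumes conv: "ALL R. ALL dl>0. EV n. EX s>=R. EX C. close_by dl m ro (mrestr mu (tball m ro s)) (ms n) (ros n) (mrestr (mus n) (tball (ms n) (ros n) s)) C"
  and tight: "ALL ze>0. EX R. EV n. em (mus n) ({x : mspace (ms n). R <= mdist (ms n) (ros n) x} Int Tn.off n (Ds n)) <= ennreal ze"
 shows "nodes_conv {s:generic mu. s < r} (cutM c) (cutMs c)"
  "levels_conv (insert 0 {t. em mu (lev t) = 0}) (cutM c) (cutMs c)"
  "EV n. finite_measure (cutMs c n)"
  "EV n. card (Ds n) = card D"
  "0 <= C ==> EV n. ALL d:Ds n. ennreal C <= em (mus n) (above (ms n) (ros n) d)"
  "0 < et ==> EV n. measure (mus n) (Ds n) <= et"
  "EV n. em (mus n) (Tn.off n (Ds n)) < \<infinity>"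
proof -
 have P: "EV n. finite_measure (cutMs c n) & (EX bt. node_matched et S V m ro (cutM c) (ms n) (ros n) (cutMs c n) bt) &
  (ALL t:Q. near et (em (cutMs c n) {x : mspace (ms n). t <= mdist (ms n) (ros n) x}) (em (cutM c) (hi t))) &
  card (Ds n) = card D & (ALL d:Ds n. ennreal C <= em (mus n) (above (ms n) (ros n) d)) &
  measure (mus n) (Ds n) <= et & em (mus n) (Tn.off n (Ds n)) < \<infinity>"
  if "finite S" "S <= {s:generic mu. s < r}" "finite V" "V <= {x : Pt. ht x : S & 0 < em (cutM c) (up x)}"
   "finite Q" "!!t. t : Q ==> em mu (lev t) = 0" "0 < et" "0 <= C" for S V Q et C
  by (rule cut_matching[where G = "generic mu" and r = r])
   (use that dense_of_countable[OF generic_countable[OF sc adm]] adm r bullet_null bullet_simple trees set_facts Ds conv tight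
     Tn.admissible_ball[OF adms] in \<open>auto simp: generic_def D_def Tn.ht_def\<close>)
 note P0 = P[of "{}" "{}", simplified]
 show "nodes_conv {s:generic mu. s < r} (cutM c) (cutMs c)"
  unfolding nodes_conv_def by (intro allI impI eventually_mono[OF P[of _ _ "{}" _ 0]]) auto
 have lev: "EV n. near et (em (cutMs c n) {x : mspace (ms n). t <= Tn.ht n x}) (em (cutM c) (hi t))"
  if "0 < et" "em mu (lev t) = 0" for et t
  using P0[of "{t}" et 0] that unfolding Tn.ht_def by (auto elim: eventually_mono)
 from lev[OF _ null_neg] have "EV n. near et (em (cutMs c n) {x : mspace (ms n). 0 <= Tn.ht n x}) (em (cutM c) (hi 0))"
  if "0 < et" for et using that order_trans[OF _ ht_nonneg, of "-1"] order_trans[OF _ Tn.ht_nonneg, of "-1"] by simp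
 then show "levels_conv (insert 0 {t. em mu (lev t) = 0}) (cutM c) (cutMs c)"
  unfolding levels_conv_def using lev by blast
 show "EV n. finite_measure (cutMs c n)" "EV n. card (Ds n) = card D"
  "EV n. em (mus n) (Tn.off n (Ds n)) < \<infinity>"
  using P0[of "{}" 1 0] by (auto elim: eventually_mono)
 show "0 < et ==> EV n. measure (mus n) (Ds n) <= et" using P0[of "{}" et 0] by (auto elim: eventually_mono)
 show "0 <= C ==> EV n. ALL d:Ds n. ennreal C <= em (mus n) (above (ms n) (ros n) d)"
  using P0[of "{}" 1 C] by (auto elim: eventually_mono)
qed

text \<open>All cones over level \<open>r\<close> miss the ball of radius \<open>s < r\<close>.
  Distances of truncations may therefore be estimated through the cut measures, even where the
  original ones are infinite.\<close>

lemma cut_below: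
 assumes "s < r"
 shows "B : Bor ==> em (mrestr (cutM c) (tball m ro s)) B = em (mrestr mu (tball m ro s)) B"
  and "B' : sets (mb (ms n)) ==> em (mrestr (cutMs c n) (tball (ms n) (ros n) s)) B' = em (mrestr (mus n) (tball (ms n) (ros n) s)) B'"
proof -
 have "x ~: up d" if "d : D" "ht x <= s" for x d using above_ht[of d x] set_facts(5,6) assms that by force
 then have "B Int tball m ro s Int off D = B Int tball m ro s" "D Int (B Int tball m ro s) = {}" for B
  using set_facts(6) assms by (auto simp: off_def tball_iff)
 then show "em (mrestr (cutM c) (tball m ro s)) B = em (mrestr mu (tball m ro s)) B" if "B : Bor"
  using that tball_borel[of s] set_facts(1,3,5)
  by (subst (1 2) emeasure_mrestr) (auto simp: emeasure_cutm)
 have "x ~: above (ms n) (ros n) d" if "d : Ds n" "Tn.ht n x <= s" for x d using Tn.above_ht[of d n x] set_facts(7)[of n] set_facts(8)[of _ n] assms that by force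
 then have "B Int tball (ms n) (ros n) s Int Tn.off n (Ds n) = B Int tball (ms n) (ros n) s" "Ds n Int (B Int tball (ms n) (ros n) s) = {}" for B
  using set_facts(8)[of _ n] assms by (auto simp: Tn.off_def Tn.tball_iff)
 then show "em (mrestr (cutMs c n) (tball (ms n) (ros n) s)) B' = em (mrestr (mus n) (tball (ms n) (ros n) s)) B'"
  if "B' : sets (mb (ms n))"
  using that Tn.tball_borel[of n s] set_facts(2,7)[of n] Ds(1)[of n]
  by (subst (1 2) emeasure_mrestr) (auto simp: Tn.emeasure_cutm)
qed

lemma GP_small_cut:
 assumes fin: "EV n. finite_measure (cutMs c n)" and G: "G <= generic mu" "countable ({0<..} - G)"
  and conv: "nodes_conv {s:G. s < r} (cutM c) (cutMs c)" "levels_conv (insert 0 {s:G. s < r}) (cutM c) (cutMs c)"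
  and s: "s : G" "s < r" and ep: "0 < ep"
  and Y: "represents Y m ro (mrestr mu (tball m ro s))" "!!n. represents (Ys n) (ms n) (ros n) (mrestr (mus n) (tball (ms n) (ros n) s))"
 shows "EV n. GP_dist (Ys n) Y <= ennreal ep"
proof -
 have G': "{s : G. s ~= r & s < r} = {s : G. s < r}" by auto
 \<comment> \<open>The cut points may put atoms on level \<open>r\<close>, so this height must not
   serve as a grid level.\<close>
 have "countable ({0<..} - (G - {r}))" using countable_Un[OF G(2), of "{r}"] by (rule countable_subset[rotated]) auto
 note dense = dense_of_countable[OF this]
 show ?thesis
 proof (rule GP_small[OF sc, where G = "G - {r}" and M = "cutM c" and Ms = "cutMs c" and rr = r and r = s])
  show "finite_measure (cutM c)" by (rule finite_cutm[OF set_facts(1,3,5,4)])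
  show "em (cutM c) (lev t) = 0" if "t : G - {r}" for t
  proof -
   have "D Int (lev t) = {}" using that set_facts(6) by auto
   moreover have "em mu ((lev t) Int off D) <= em mu (lev t)"
    using ht_borel_eq set_facts(1) by (intro emeasure_mono) auto
   ultimately show ?thesis using that G(1) unfolding emeasure_cutm[OF set_facts(1,3,5) ht_borel_eq] generic_def by auto
  qed
  show "represents Y m ro (mrestr (cutM c) (tball m ro s))"
   by (rule represents_cong[OF Y(1)]) (use cut_below(1)[OF s(2)] in auto)
  show "represents (Ys n) (ms n) (ros n) (mrestr (cutMs c n) (tball (ms n) (ros n) s))" for n
   by (rule represents_cong[OF Y(2)]) (use cut_below(2)[OF s(2)] in auto)
 qed (use fin conv s ep dense G(1) in \<open>auto simp: G' generic_def\<close>)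
qed

end

context rooted_tree
begin

text \<open>Two directions above \<open>b\<close>, together with the one towards the root, would
  make three components, and \<open>b\<close> would be a branch point.\<close>

lemma simple_point:
 assumes b: "b : Pt" "b ~= ro" "b ~: Bp m ro" and x: "x : up b" "x ~= b" and y: "y : up b" "y ~= b"
 shows "ht b < gp x y"
proof (rule ccontr)
 assume ng: "~ ht b < gp x y"
 have xm: "x : Pt" "y : Pt" using x(1) y(1) above_subset by auto
 have h: "ht b < ht x" "ht b < ht y" using above_strict[OF b(1)] x y by auto
 have o: "over {x, y} b = {x, y}" using x y unfolding over_def by auto
 have "block {x, y} b x = {x}" "block {x, y} b y = {y}" "x ~= y"
  using ng h xm gp_commute[of x y] unfolding block_def by auto
 then have "branches {x, y} b = 2" unfolding branches_def o by simp
 moreover have "subtree (Pt)" unfolding subtree_def using anc_in by auto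
 ultimately have "(3 :: ennreal) <= ncomp (submetric m (Pt)) b"
  using ncomp_ge_branches[of "Pt" b "{x, y}"] b xm o by simp
 then show False using b by (simp add: Bp_def submetric_mspace)
qed

end

text \<open>The hypotheses of the theorem for a single cut-off level.\<close>
locale cut_off =
 fixes X :: "'a mtree" and Xs :: "nat => 'b mtree" and r :: real and Ds :: "nat => 'b set"
 assumes X: "X : T_min_di" and Xs: "Xs n : T_min_di" and nice: "nice_radius X r" and compatible: "compatible_cut_points X (Xs n) r (Ds n)"
begin

abbreviation "m == tmet X"
abbreviation "ro == troot X"
abbreviation "ms n == tmet (Xs n)"
abbreviation "ros n == troot (Xs n)"
abbreviation "mu == tmeas X"
abbreviation "mus n == tmeas (Xs n)"
abbreviation "E h == erase m ro h mu"
abbreviation "Es h n == erase (ms n) (ros n) h (mus n)"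

sublocale tree_sequence m ro ms ros
 using T_min_diD(1)[OF X] T_min_diD(1)[OF Xs] by (intro tree_sequence.intro tree_sequence_axioms.intro)

lemma bullet_facts:
 shows "0 < r" "bullet X r = heavy_at mu r" "b : heavy_at mu r ==> em mu {b} = 0"
  "b : heavy_at mu r ==> x : above m ro b ==> x ~= b ==> y : above m ro b ==> y ~= b ==> r < gp x y"
  "finite (Ds n)" "Ds n <= tsphere (ms n) (ros n) r" "card (Ds n) <= card (heavy_at mu r)"
  "em mu {x : mspace m. ht x = r} = 0"
proof -
 show r: "0 < r" using nice unfolding nice_radius_def by simp
 show b: "bullet X r = heavy_at mu r" unfolding bullet_def heavy_at_eq[OF r] ..
 note adm = T_min_diD(2)[OF X]
 have s: "sets mu = sets (mb m)" "finite (heavy_at mu r)" using adm r unfolding admissible_def by auto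
 show n0: "em mu {x : mspace m. ht x = r} = 0" using nice unfolding nice_radius_def tsphere_eq by simp
 show "em mu {b} = 0" if "b : heavy_at mu r"
  using that emeasure_mono[of "{b}" "{x : mspace m. ht x = r}" mu] n0 ht_borel_eq s(1) unfolding heavy_at_def by auto
 show "r < gp x y" if "b : heavy_at mu r" "x : above m ro b" "x ~= b" "y : above m ro b" "y ~= b"
  using simple_point[of b x y] that nice r unfolding heavy_at_def nice_radius_def tsphere_eq by force
 show f: "finite (Ds n)" "Ds n <= tsphere (ms n) (ros n) r" using compatible[of n] unfolding compatible_cut_points_def by auto
 have "ecard (Ds n) <= ecard (heavy_at mu r)" using compatible[of n] unfolding compatible_cut_points_def b by simp
 then show "card (Ds n) <= card (heavy_at mu r)" using f(1) s(2) unfolding ecard_def by (simp add: emeasure_count_space_finite)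
qed

lemma erasing: "0 < h ==> erasing m ro mu h" "0 < h ==> erasing (ms n) (ros n) (mus n) h"
 using T_min_diD[OF X] T_min_diD[OF Xs] by (auto intro!: erasing.intro erasing_axioms.intro)

sublocale mu: cut_sequence m ro ms ros mu mus r Ds
 using T_min_diD[OF X] T_min_diD[OF Xs] bullet_facts by unfold_locales auto

abbreviation "D == mu.D"

text \<open>Erasure preserves the points with infinite cones (\<open>erase_heavy_at\<close>) and
  puts no mass on the bullets (\<open>erase_point\<close>), so the erased measures satisfy the same
  requirements with the same cut points.\<close>

lemma erased_cut_sequence:
 assumes h: "0 < h" shows "cut_sequence m ro ms ros (E h) (Es h) r Ds" "cut_sequence.D m ro (E h) r = D"
proof -
 interpret e: erasing m ro mu h by (rule erasing(1)[OF h])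
 interpret en: erasing "ms n" "ros n" "mus n" h for n by (rule erasing(2)[OF h])
 have H: "heavy_at (E h) r = heavy_at mu r" by (rule e.erase_heavy_at[OF bullet_facts(1)])
 have "em (E h) {b} = 0" if b: "b : heavy_at mu r" for b
  by (rule e.erase_point) (use b bullet_facts(1,3,4) in \<open>auto simp: heavy_at_def\<close>)
 then show cs: "cut_sequence m ro ms ros (E h) (Es h) r Ds"
  using e.erase_admissible en.erase_admissible T_min_diD(4)[OF X] bullet_facts by unfold_locales (auto simp: H)
 show "cut_sequence.D m ro (E h) r = D" unfolding cut_sequence.D_def[OF cs] mu.D_def H ..
qed

lemma close_by_of_GV:
 fixes Y :: "'a mtree" and Ys :: "nat => 'b mtree"
 assumes "GV_converges Ys Y" and rep: "!!s. represents (truncate_tree s Y) m ro (mrestr nu (tball m ro s))"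
  "!!n s. represents (truncate_tree s (Ys n)) (ms n) (ros n) (mrestr (nus n) (tball (ms n) (ros n) s))"
 shows "ALL R. ALL dl>0. EV n. EX s>=R. EX C. close_by dl m ro (mrestr nu (tball m ro s)) (ms n) (ros n) (mrestr (nus n) (tball (ms n) (ros n) s)) C"
proof (intro allI impI)
 fix R dl :: real assume "0 < dl"
 from GV_convergesD[OF assms(1) this, of R]
 show "EV n. EX s>=R. EX C. close_by dl m ro (mrestr nu (tball m ro s)) (ms n) (ros n) (mrestr (nus n) (tball (ms n) (ros n) s)) C"
 proof eventually_elim
  case (elim n)
  then obtain s where s: "R <= s" "GP_dist (truncate_tree s (Ys n)) (truncate_tree s Y) < ennreal dl" by blast
  from GP_dist_close_by[OF rep(2,1) s(2)] obtain C
   where C: "close_by dl (ms n) (ros n) (mrestr (nus n) (tball (ms n) (ros n) s)) m ro (mrestr nu (tball m ro s)) C" by blast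
  show ?case using s(1) close_by_sym[OF C] by (intro exI[of _ s] conjI exI[of _ "%y x. C x y"])
 qed
qed

lemma tight_iff:
 assumes "!!n. sets (nu n) = sets (mb (ms n))"
 shows "b_tight Xs (%n. mrestr (nu n) (Cut (Xs n) r (Ds n))) \<longleftrightarrow>
  (ALL ze>0. EX R. EV n. em (nu n) ({x : mspace (ms n). R <= mdist (ms n) (ros n) x} Int Tn.off n (Ds n)) <= ennreal ze)"
 by (rule b_tight_iff) (use trees bullet_facts assms in auto)

text \<open>Cut points must lie in \<open>R\<close>. In the limit tree their cones are infinite; in
  the n-th tree cone masses of at least \<open>h\<close> are a hypothesis, which is later shown to
  hold eventually.\<close>

lemma shifted_below:
 assumes h: "0 < h" and c: "0 <= c"
 shows "shifted h r (cutm mu D (c + h)) (cutm (E h) D c)"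
  and "(!!d. d : Ds n ==> ennreal h <= em (mus n) (above (ms n) (ros n) d)) ==> em (mus n) (Tn.off n (Ds n)) < \<infinity> ==>
   Tn.shifted n h r (Tn.cutm n (mus n) (Ds n) (c + h)) (Tn.cutm n (Es h n) (Ds n) c)"
proof -
 interpret e: erasing m ro mu h by (rule erasing(1)[OF h])
 interpret en: erasing "ms n" "ros n" "mus n" h for n by (rule erasing(2)[OF h])
 show "shifted h r (cutm mu D (c + h)) (cutm (E h) D c)"
  by (rule e.erase_shifted) (use mu.set_facts e.heavy_subset_R c in \<open>auto simp: mu.D_def\<close>)
 show "Tn.shifted n h r (Tn.cutm n (mus n) (Ds n) (c + h)) (Tn.cutm n (Es h n) (Ds n) c)"
  if "!!d. d : Ds n ==> ennreal h <= em (mus n) (above (ms n) (ros n) d)" "em (mus n) (Tn.off n (Ds n)) < \<infinity>"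
  by (rule en.erase_shifted) (use mu.set_facts(7)[of n] mu.set_facts(8)[of _ n] bullet_facts(5) that c in \<open>auto simp: R_erase_def\<close>)
qed

lemma height_measure_cut:
 assumes A: "A : sets borel" "A <= {0..}"
 shows "sets (height_measure (cut_tree hh X r D)) = sets halfline" "sets (height_measure (cut_tree hh (Xs n) r (Ds n))) = sets halfline"
  "em (height_measure (cut_tree hh X r D)) A = em (cutm mu D hh) {x : mspace m. ht x : A}"
  "em (height_measure (cut_tree hh (Xs n) r (Ds n))) A =
   em (Tn.cutm n (mus n) (Ds n) hh) {x : mspace (ms n). Tn.ht n x : A} + em (mus n) (if r : A then Ds n else {})"
proof -
 have D: "finite D" "D <= tsphere m ro r" using mu.set_facts(3,5,6) tsphere_iff by auto
 note H = height_cut[OF refl refl refl T_min_diD(4)[OF X] mu.set_facts(1) D bullet_facts(1) A, of hh]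
 note H' = Tn.height_cut[OF refl refl refl T_min_diD(4)[OF Xs] mu.set_facts(2) bullet_facts(5,6,1) A, where hh = hh]
 have "em mu D <= em mu {x : mspace m. ht x = r}"
  using mu.set_facts(1,5,6) ht_borel_eq by (intro emeasure_mono) auto
 then have "em mu D = 0" using bullet_facts(8) by simp
 then show "em (height_measure (cut_tree hh X r D)) A = em (cutm mu D hh) {x : mspace m. ht x : A}"
  unfolding H(2) by simp
 show "sets (height_measure (cut_tree hh X r D)) = sets halfline" by (rule H(1))
 show "sets (height_measure (cut_tree hh (Xs n) r (Ds n))) = sets halfline" by (rule H'(1))
 show "em (height_measure (cut_tree hh (Xs n) r (Ds n))) A =
   em (Tn.cutm n (mus n) (Ds n) hh) {x : mspace (ms n). Tn.ht n x : A} + em (mus n) (if r : A then Ds n else {})" by (rule H'(2))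
qed

lemma cut_points_finite: "em (mus n) (Ds n) < \<infinity>"
proof -
 have "em (mus n) (Ds n) <= em (mus n) {x : mspace (ms n). Tn.ht n x <= r}"
  using Tn.ht_borel_le mu.set_facts(2)[of n] mu.set_facts(7)[of n] mu.set_facts(8)[of _ n] by (intro emeasure_mono) auto
 then show ?thesis using Tn.admissible_ball[OF T_min_diD(2)[OF Xs], of n r] by (rule order.strict_trans1)
qed

section \<open>From Gromov-vague convergence to erasures and heights\<close>

context
 assumes GV: "GV_converges Xs X" and tight: "b_tight Xs (%n. mrestr (mus n) (Cut (Xs n) r (Ds n)))"
begin

lemmas mu_conv = mu.cut_conv[OF close_by_of_GV[OF GV truncate_represents[OF X] truncate_represents[OF Xs]]
 tight[unfolded tight_iff[OF mu.set_facts(2)]]]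

lemma erase_tight: assumes h: "0 < h" shows "b_tight Xs (%n. mrestr (Es h n) (Cut (Xs n) r (Ds n)))"
proof -
 interpret en: erasing "ms n" "ros n" "mus n" h for n by (rule erasing(2)[OF h])
 show ?thesis unfolding tight_iff[of "Es h", OF en.sets_erase]
 proof (intro allI impI)
  fix ze :: real assume "0 < ze"
  then obtain R where R: "EV n. em (mus n) ({x : mspace (ms n). R <= Tn.ht n x} Int Tn.off n (Ds n)) <= ennreal ze"
   using tight[unfolded tight_iff[OF mu.set_facts(2)]] unfolding Tn.ht_def by blast
  define t where "t = max R (r + 1)"
  have "EV n. em (Es h n) ({x : mspace (ms n). t <= Tn.ht n x} Int Tn.off n (Ds n)) <= ennreal ze" using R
  proof eventually_elim
   case (elim n)
   have "em (Es h n) ({x : mspace (ms n). t <= Tn.ht n x} Int Tn.off n (Ds n)) <= em (mus n) ({x : mspace (ms n). t <= Tn.ht n x} Int Tn.off n (Ds n))"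
    by (rule en.erase_tail_le) (use mu.set_facts(7)[of n] mu.set_facts(8)[of _ n] bullet_facts(1,5) in \<open>auto simp: t_def\<close>)
   also have "... <= em (mus n) ({x : mspace (ms n). R <= Tn.ht n x} Int Tn.off n (Ds n))"
    using Tn.off_borel[OF bullet_facts(5) mu.set_facts(7)] Tn.ht_borel_ge mu.set_facts(2) by (intro emeasure_mono) (auto simp: t_def)
   finally show ?case using elim by simp
  qed
  then show "EX R. EV n. em (Es h n) ({x : mspace (ms n). R <= mdist (ms n) (ros n) x} Int Tn.off n (Ds n)) <= ennreal ze"
   unfolding Tn.ht_def by blast
 qed
qed

text \<open>The cut measures with weight \<open>h\<close> converge in nodes and levels. Erasure
  turns this weight into 0, and \<open>shifted_conv\<close> carries both kinds of convergence over
  to the erased cut measures.\<close>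

lemma erase_GP:
 assumes h: "0 < h" and s: "s : generic mu Int generic (E h)" "s < r" and ep: "0 < ep"
 shows "EV n. GP_dist (truncate_tree s (erase_tree h (Xs n))) (truncate_tree s (erase_tree h X)) <= ennreal ep"
proof -
 interpret e: erasing m ro mu h by (rule erasing(1)[OF h])
 interpret en: erasing "ms n" "ros n" "mus n" h for n by (rule erasing(2)[OF h])
 interpret C: cut_sequence m ro ms ros "E h" "Es h" r Ds by (rule erased_cut_sequence[OF h])
 have CD: "C.D = D" by (rule erased_cut_sequence(2)[OF h])
 define G where "G = generic mu Int generic (E h)"
 have cG: "countable ({0<..} - G)" unfolding G_def
  using countable_Un[OF generic_countable[OF mu.sc mu.adm] generic_countable[OF C.sc C.adm]] by (simp add: Diff_Int)
 have sh: "EV n. Tn.shifted n h r (mu.cutMs h n) (C.cutMs 0 n)"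
  using mu_conv(5)[OF less_imp_le[OF h]] mu_conv(7) by eventually_elim (use shifted_below(2)[OF h, of 0] in simp)
 have fm: "finite_measure (cutm mu D h)" by (rule finite_cutm[OF mu.set_facts(1,3,5,4)])
 have G: "0 < t & t < r & em (cutm mu D h) {x : mspace m. ht x = t} = 0" if "t : {s : G. s < r}" for t
 proof -
  have "D Int {x : mspace m. ht x = t} = {}" using that mu.set_facts(6) by auto
  moreover have "em mu ({x : mspace m. ht x = t} Int off D) <= em mu {x : mspace m. ht x = t}"
   using ht_borel_eq mu.set_facts(1) by (intro emeasure_mono) auto
  ultimately show ?thesis using that unfolding emeasure_cutm[OF mu.set_facts(1,3,5) ht_borel_eq] G_def generic_def by auto
 qed
 have nc: "nodes_conv {s : G. s < r} (cutm mu D h) (mu.cutMs h)"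
  using mu_conv(1)[of h] unfolding nodes_conv_def G_def by (blast intro: subset_trans)
 have lc: "levels_conv (insert 0 {s : G. s < r}) (cutm mu D h) (mu.cutMs h)"
  using mu_conv(2)[of h] unfolding levels_conv_def G_def generic_def by blast
 note sc = shifted_conv[OF mu.sc fm mu_conv(3) _ _ _ _ shifted_below(1)[of h 0, simplified] sh h bullet_facts(1) G nc lc]
 have nl: "nodes_conv {s : G. s < r} (C.cutM 0) (C.cutMs 0)" "levels_conv (insert 0 {s : G. s < r}) (C.cutM 0) (C.cutMs 0)"
  using sc h by (simp_all add: CD)
 have fin: "EV n. finite_measure (C.cutMs 0 n)"
  using sh mu_conv(3)[of h]
 proof eventually_elim
  case (elim n)
  have "em (C.cutMs 0 n) (mspace (ms n)) = em (mu.cutMs h n) (mspace (ms n)) - ennreal h"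
   using conjunct1[OF elim(1)[unfolded Tn.shifted_def], rule_format, of "ros n"] bullet_facts(1) by simp
  also have "... <= em (mu.cutMs h n) (mspace (ms n))" by (simp add: diff_le_self_ennreal)
  finally show ?case using finite_measure.emeasure_finite[OF elim(2)] by (intro finite_measureI) (auto simp: top_unique)
 qed
 show ?thesis
  by (rule C.GP_small_cut[OF fin _ cG nl _ s(2) ep truncate_erase_represents[OF X h] truncate_erase_represents[OF Xs h]])
   (use s in \<open>auto simp: G_def\<close>)
qed

text \<open>A tail of the height measure is the cut mass above a level plus, for levels up to
  \<open>r\<close>, the original mass of the cut points, which tends to 0.\<close>

lemma heights_converge:
 assumes hh: "0 < hh"
 shows "weak_converges (%n. height_measure (cut_tree hh (Xs n) r (Ds n))) (height_measure (cut_tree hh X r D))"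
proof -
 let ?nu = "height_measure (cut_tree hh X r D)" and ?nus = "%n. height_measure (cut_tree hh (Xs n) r (Ds n))"
 let ?M = "cutm mu D hh" and ?Ms = "mu.cutMs hh"
 note H = height_measure_cut[of _ hh]
 have sets: "sets ?nu = sets halfline" "sets (?nus n) = sets halfline" for n using H(1,2)[of "{}"] by auto
 have fm: "finite_measure ?M" by (rule finite_cutm[OF mu.set_facts(1,3,5,4)])
 have fin: "finite_measure ?nu"
  using H(3)[of "{0..}"] finite_measure.emeasure_finite[OF fm] halfline_sets(1)[OF sets(1)] by (intro finite_measureI) auto
 have fin': "finite_measure (?nus n)" if "finite_measure (?Ms n)" for n
 proof (rule finite_measureI)
  show "em (?nus n) (space (?nus n)) ~= \<infinity>"
   using H(4)[of "{0..}" n] finite_measure.emeasure_finite[OF that] cut_points_finite[of n] halfline_sets(1)[OF sets(2)] by auto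
 qed
 show ?thesis
 proof (rule weak_convergesI[OF sets fin])
  show "EV n. finite_measure (?nus n)" using mu_conv(3)[of hh] by eventually_elim (rule fin')
  show "EX s:generic mu. a < s & s < b" if "0 <= a" "a < b" for a b
   by (rule dense_of_countable[OF generic_countable[OF mu.sc mu.adm] that])
  fix t assume t: "t : insert 0 (generic mu)"
  then have t0: "0 <= t" unfolding generic_def by auto
  show "(%n. measure (?nus n) {t..}) \<longlonglongrightarrow> measure ?nu {t..}"
  proof (rule LIMSEQ_I)
   fix ep :: real assume ep: "0 < ep"
   have "EV n. near (ep/3) (em (?Ms n) {x : mspace (ms n). t <= Tn.ht n x}) (em ?M {x : mspace m. t <= ht x})"
    using mu_conv(2)[of hh] t ep unfolding levels_conv_def generic_def by auto
   moreover have "EV n. measure (mus n) (Ds n) <= ep/3" by (rule mu_conv(6)) (use ep in simp)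
   ultimately have "EV n. norm (measure (?nus n) {t..} - measure ?nu {t..}) < ep" using mu_conv(3)[of hh]
   proof eventually_elim
    case (elim n)
    have "measure ?nu {t..} = measure ?M {x : mspace m. t <= ht x}" using H(3)[of "{t..}"] t0 by (simp add: measure_def)
    moreover have "measure (?nus n) {t..} = measure (?Ms n) {x : mspace (ms n). t <= Tn.ht n x} + measure (mus n) (if r : {t..} then Ds n else {})"
     using H(4)[of "{t..}" n] t0 finite_measure.emeasure_finite[OF elim(3)] cut_points_finite[of n]
     by (auto simp: measure_def enn2real_plus less_top)
    moreover have "\<bar>measure ?M {x : mspace m. t <= ht x} - measure (?Ms n) {x : mspace (ms n). t <= Tn.ht n x}\<bar> <= ep/3"
     by (rule near_measure[OF fm elim(3,1)]) (use ep in simp)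
    moreover have "0 <= measure (mus n) (if r : {t..} then Ds n else {})" "measure (mus n) (if r : {t..} then Ds n else {}) <= ep/3"
     using elim(2) ep by auto
    ultimately show ?case using ep unfolding real_norm_def by argo
   qed
   then show "EX no. ALL n>=no. norm (measure (?nus n) {t..} - measure ?nu {t..}) < ep" unfolding eventually_sequentially .
  qed
 qed
qed

end

end

section \<open>From erasures and heights back to the measures\<close>

context cut_off
begin

lemma bullet_eq: "bullet X r = D" unfolding bullet_facts(2) mu.D_def ..

context
 fixes hh :: real
 assumes GVE: "GV_erasure_converges Xs X" and hh: "0 < hh"
  and tightE: "0 < h ==> b_tight Xs (%n. mrestr (Es h n) (Cut (Xs n) r (Ds n)))"
  and heights: "weak_converges (%n. height_measure (cut_tree hh (Xs n) r (Ds n))) (height_measure (cut_tree hh X r D))"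
begin

abbreviation "nu == height_measure (cut_tree hh X r D)"
abbreviation "nus n == height_measure (cut_tree hh (Xs n) r (Ds n))"

lemmas H = height_measure_cut[of _ hh]

lemma nu_sets: "sets nu = sets halfline" "sets (nus n) = sets halfline" using H(1,2)[of "{}"] by auto

lemma nu_finite: "finite_measure nu" "EV n. finite_measure (nus n)"
 using heights unfolding weak_converges_def by auto

text \<open>The erased sequence is itself a cut sequence. A cut point whose erased cone has positive
  mass lies in \<open>R\<close>, so its original cone has mass at least \<open>h\<close>; in this
  way the erased trees show that the cut points are heavy enough for
  \<open>shifted_below\<close>.\<close>

lemma erased_conv:
 assumes h: "0 < h"
 shows "nodes_conv {s:generic (E h). s < r} (cutm (E h) D c) (%n. Tn.cutm n (Es h n) (Ds n) c)"
  "EV n. card (Ds n) = card D"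
  "EV n. ALL d:Ds n. ennreal h <= em (mus n) (above (ms n) (ros n) d)"
proof -
 interpret en: erasing "ms n" "ros n" "mus n" h for n by (rule erasing(2)[OF h])
 interpret C: cut_sequence m ro ms ros "E h" "Es h" r Ds by (rule erased_cut_sequence[OF h])
 have CD: "C.D = D" by (rule erased_cut_sequence(2)[OF h])
 have "GV_converges (%n. erase_tree h (Xs n)) (erase_tree h X)" using GVE h unfolding GV_erasure_converges_def by blast
 note P = C.cut_conv[OF close_by_of_GV[OF this truncate_erase_represents[OF X h] truncate_erase_represents[OF Xs h]]
   tightE[OF h, unfolded tight_iff[of "Es h", OF en.sets_erase]], unfolded CD]
 show "nodes_conv {s:generic (E h). s < r} (cutm (E h) D c) (%n. Tn.cutm n (Es h n) (Ds n) c)"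
  "EV n. card (Ds n) = card D" by (rule P)+
 show "EV n. ALL d:Ds n. ennreal h <= em (mus n) (above (ms n) (ros n) d)"
  using P(5)[of 1, simplified]
 proof eventually_elim
  case (elim n)
  show ?case
  proof
   fix d assume d: "d : Ds n"
   then have dm: "d : mspace (ms n)" "d ~= ros n" using mu.set_facts(7)[of n] mu.set_facts(8)[of d n] bullet_facts(1) by auto
   have "em (Es h n) (above (ms n) (ros n) d) ~= 0" using elim d by fastforce
   then have "d : en.R n" using en.erase_outside[OF dm(1)] by blast
   then show "ennreal h <= em (mus n) (above (ms n) (ros n) d)" by (rule en.R_mass[OF _ dm(2)])
  qed
 qed
qed

lemma cutMs_finite: "finite_measure (nus n) ==> finite_measure (mu.cutMs hh n)"
 "finite_measure (nus n) ==> em (mus n) (Tn.off n (Ds n)) < \<infinity>"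
proof -
 assume f: "finite_measure (nus n)"
 have "em (nus n) {0..} < \<infinity>" using finite_measure.emeasure_finite[OF f] by (simp add: less_top)
 then have s: "em (mu.cutMs hh n) (mspace (ms n)) < \<infinity>" using H(4)[of "{0..}" n] by simp
 then show "finite_measure (mu.cutMs hh n)" by (intro finite_measureI) simp
 have "Tn.off n (Ds n) Int Tn.off n (Ds n) = mspace (ms n) Int Tn.off n (Ds n)" unfolding Tn.off_def by auto
 then show "em (mus n) (Tn.off n (Ds n)) < \<infinity>"
  using s Tn.emeasure_cutm[OF mu.set_facts(2) bullet_facts(5) mu.set_facts(7) sets.top[of "mb (ms n)"], where c = hh]
  by (auto simp: less_top)
qed

lemma nu_measure:
 assumes A: "A : sets borel" "A <= {0..}"
 shows "measure nu A = measure (cutm mu D hh) {x : Pt. ht x : A}"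
  "finite_measure (nus n) ==> measure (nus n) A =
   measure (mu.cutMs hh n) {x : mspace (ms n). Tn.ht n x : A} + measure (mus n) (if r : A then Ds n else {})"
proof -
 show "measure nu A = measure (cutm mu D hh) {x : Pt. ht x : A}" using H(3)[OF A] by (simp add: measure_def)
 assume "finite_measure (nus n)"
 from finite_measure.emeasure_finite[OF cutMs_finite(1)[OF this]]
 show "measure (nus n) A = measure (mu.cutMs hh n) {x : mspace (ms n). Tn.ht n x : A} + measure (mus n) (if r : A then Ds n else {})"
  using H(4)[OF A, of n] cut_points_finite[of n] by (auto simp: measure_def enn2real_plus less_top)
qed

lemma nu_null: "t ~= r ==> em mu (lev t) = 0 ==> measure (cutm mu D hh) (lev t) = 0"
 "measure (cutm mu D hh) (lev r) = hh * real (card D)"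
proof -
 have 0: "measure mu ((lev t) Int off D) = 0" if "em mu (lev t) = 0" for t
  using that emeasure_mono[of "(lev t) Int off D" "lev t" mu] ht_borel_eq mu.set_facts(1)
  by (simp add: measure_def)
 note M = measure_cutm[OF mu.set_facts(1,3,5,4) ht_borel_eq, of hh]
 have D: "D Int (lev t) = (if t = r then D else {})" for t using mu.set_facts(5,6) by auto
 show "measure (cutm mu D hh) (lev t) = 0" if "t ~= r" "em mu (lev t) = 0"
  unfolding M D using 0 that by simp
 show "measure (cutm mu D hh) (lev r) = hh * real (card D)"
  unfolding M D using 0[OF bullet_facts(8)] hh by simp
qed

text \<open>In the limit the level \<open>r\<close> carries nothing but the atoms put on the cut-off points.\<close>
lemma cut_points_vanish:
 assumes et: "0 < et" shows "EV n. measure (mus n) (Ds n) <= et"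
proof -
 have r: "{r} : sets borel" "{r} <= {0..}" using bullet_facts(1) by auto
 have "EV n. measure (nus n) {r} <= measure nu {r} + et"
  by (rule weak_converges_closed[OF heights nu_sets]) (use r et in auto)
 with erased_conv(2)[OF zero_less_one] nu_finite(2) show ?thesis
 proof eventually_elim
  case (elim n)
  have "Ds n Int {x : mspace (ms n). Tn.ht n x = r} = Ds n" using mu.set_facts(7)[of n] mu.set_facts(8)[of _ n] by auto
  \<comment> \<open>The numbers of cut points agree, so the atoms of weight \<open>hh\<close>
    already account for the whole limit mass of level \<open>r\<close>, and at most
    \<open>et\<close> is left for the original mass of the cut points.\<close>
  then have "hh * real (card (Ds n)) <= measure (mu.cutMs hh n) {x : mspace (ms n). Tn.ht n x = r}"
   using Tn.measure_cutm[OF mu.set_facts(2) bullet_facts(5) mu.set_facts(7) cutMs_finite(2)[OF elim(2)] Tn.ht_borel_eq, of hh r] hh by simp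
  then show ?case using elim(1,3) nu_measure(1)[OF r] nu_measure(2)[OF r elim(2)] nu_null(2) by simp
 qed
qed

text \<open>The mass off the cut cones beyond height \<open>t\<close> is a tail of the height
  measure once \<open>t > r\<close> keeps the cut points out.\<close>

lemma recovered_tight: "b_tight Xs (%n. mrestr (mus n) (Cut (Xs n) r (Ds n)))"
 unfolding tight_iff[OF mu.set_facts(2)]
proof (intro allI impI)
 fix ze :: real assume ze: "0 < ze"
 obtain k :: nat where k: "measure nu {real k..} < ze/2" using halfline_tail[OF nu_sets(1) nu_finite(1), of "ze/2"] ze by auto
 define t where "t = max (real k) (r + 1)"
 have t: "0 <= t" "~ t <= r" "{t..} : sets borel" "{t..} <= {0..}" unfolding t_def using bullet_facts(1) by auto
 have "measure nu {t..} <= measure nu {real k..}"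
  by (rule finite_measure.finite_measure_mono[OF nu_finite(1)]) (use halfline_sets(2)[OF nu_sets(1)] in \<open>auto simp: t_def\<close>)
 have "EV n. measure (nus n) {t..} <= measure nu {t..} + ze/2"
  by (rule weak_converges_closed[OF heights nu_sets]) (use t ze in auto)
 with nu_finite(2) have "EV n. em (mus n) ({x : mspace (ms n). t <= Tn.ht n x} Int Tn.off n (Ds n)) <= ennreal ze"
 proof eventually_elim
  case (elim n)
  have "em (mus n) ({x : mspace (ms n). t <= Tn.ht n x} Int Tn.off n (Ds n)) <= em (mu.cutMs hh n) {x : mspace (ms n). t <= Tn.ht n x}"
   unfolding Tn.emeasure_cutm[OF mu.set_facts(2) bullet_facts(5) mu.set_facts(7) Tn.ht_borel_ge] by simp
  also have "... = ennreal (measure (nus n) {t..})"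
   using nu_measure(2)[OF t(3,4) elim(1)] t(2) finite_measure.emeasure_eq_measure[OF cutMs_finite(1)[OF elim(1)]] by simp
  also have "... <= ennreal ze" using elim(2) k \<open>measure nu {t..} <= measure nu {real k..}\<close> by (intro ennreal_leI) simp
  finally show ?case .
 qed
 then show "EX R. EV n. em (mus n) ({x : mspace (ms n). R <= mdist (ms n) (ros n) x} Int Tn.off n (Ds n)) <= ennreal ze"
  unfolding Tn.ht_def by blast
qed

text \<open>For \<open>t < r\<close> the tail of the height measure also contains the original mass
  of the cut points, which \<open>cutm\<close> omits and which vanishes in the limit.\<close>

lemma recovered_levels:
 assumes t: "t : insert 0 {s : generic mu. s < r}" and et: "0 < et"
 shows "EV n. near et (em (mu.cutMs hh n) {x : mspace (ms n). t <= Tn.ht n x}) (em (cutm mu D hh) (hi t))"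
proof -
 have t': "0 <= t" "t < r" "{t..} : sets borel" "{t..} <= {0..}" "{t} : sets borel" "{t} <= {0..}"
  using t bullet_facts(1) unfolding generic_def by auto
 have "t = 0 | measure nu {t} = 0" using t t'(2) nu_null(1)[of t] unfolding nu_measure(1)[OF t'(5,6)] generic_def by auto
 then have "(%n. measure (nus n) {t..}) \<longlonglongrightarrow> measure nu {t..}" by (rule weak_converges_tail[OF heights nu_sets t'(1)])
 then have "EV n. dist (measure (nus n) {t..}) (measure nu {t..}) < et/2" using et by (intro tendstoD) auto
 moreover have "EV n. measure (mus n) (Ds n) <= et/2" by (rule cut_points_vanish) (use et in simp)
 ultimately show ?thesis using nu_finite(2)
 proof eventually_elim
  case (elim n)
  have "measure (nus n) {t..} = measure (mu.cutMs hh n) {x : mspace (ms n). t <= Tn.ht n x} + measure (mus n) (Ds n)"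
   using nu_measure(2)[OF t'(3,4) elim(3)] t'(2) by simp
  moreover have "measure nu {t..} = measure (cutm mu D hh) (hi t)" using nu_measure(1)[OF t'(3,4)] by simp
  moreover have "0 <= measure (mus n) (Ds n)" by simp
  ultimately have "\<bar>measure (cutm mu D hh) (hi t) - measure (mu.cutMs hh n) {x : mspace (ms n). t <= Tn.ht n x}\<bar> <= et"
   using elim(1,2) unfolding dist_real_def by argo
  then show ?case
   by (rule near_measureI[OF finite_cutm[OF mu.set_facts(1,3,5,4)] cutMs_finite(1)[OF elim(3)]])
 qed
qed

text \<open>Levels must be generic for the erased measures too, and these vary with
  \<open>h\<close>; using only \<open>h = 1 / Suc j\<close> keeps the exceptional set
  countable.\<close>

definition "erasure_levels = generic mu Int (INT j. generic (E (1 / real (Suc j))))"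

lemma erasure_levels_countable: "countable ({0<..} - erasure_levels)"
proof -
 have "countable ({0<..} - generic (E (1 / real (Suc j))))" for j
  by (rule generic_countable[OF mu.sc]) (use erased_cut_sequence(1)[of "1 / real (Suc j)"] in \<open>auto simp: cut_sequence_def cut_sequence_axioms_def\<close>)
 then have "countable (({0<..} - generic mu) Un (UN j. {0<..} - generic (E (1 / real (Suc j)))))"
  by (intro countable_Un countable_UN generic_countable[OF mu.sc mu.adm]) auto
 then show ?thesis by (rule countable_subset[rotated]) (auto simp: erasure_levels_def)
qed

lemma recovered_GP:
 assumes s: "s : erasure_levels" "s < r" and ep: "0 < ep"
 shows "EV n. GP_dist (truncate_tree s (Xs n)) (truncate_tree s X) <= ennreal ep"
proof -
 have nodes: "nodes_conv {s : erasure_levels. s < r} (cutm mu D hh) (mu.cutMs hh)"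
 \<comment> \<open>Cut points of weight \<open>hh - h\<close> after erasure correspond to weight
   \<open>hh\<close> before it, so the same unerased measure is reached for all
   \<open>h < hh\<close>.\<close>
 proof (rule unshifted_nodes[where H = "range (%j. 1 / real (Suc j))" and hh = hh and r = r
    and M' = "%h. cutm (E h) D (hh - h)" and Ms' = "%h n. Tn.cutm n (Es h n) (Ds n) (hh - h)"])
  show "EX h':range (%j. 1 / real (Suc j)). 0 < h' & h' < h" if "0 < h" for h :: real
   using reals_Archimedean[OF that] by (auto simp: inverse_eq_divide)
  fix h assume h: "h : range (%j. 1 / real (Suc j))" "h < hh"
  then have h': "0 < h" "0 <= hh - h" by auto
  show "shifted h r (cutm mu D hh) (cutm (E h) D (hh - h))" using shifted_below(1)[OF h'] by simp
  show "EV n. Tn.shifted n h r (mu.cutMs hh n) (Tn.cutm n (Es h n) (Ds n) (hh - h))"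
   using erased_conv(3)[OF h'(1)] nu_finite(2) by eventually_elim (use shifted_below(2)[OF h'] cutMs_finite(2) in simp)
  show "nodes_conv {s : erasure_levels. s < r} (cutm (E h) D (hh - h)) (%n. Tn.cutm n (Es h n) (Ds n) (hh - h))"
  proof -
   have "{s : erasure_levels. s < r} <= {s : generic (E h). s < r}" using h(1) unfolding erasure_levels_def by auto
   then show ?thesis using erased_conv(1)[OF h'(1), of "hh - h"] unfolding nodes_conv_def by (meson subset_trans)
  qed
 qed (use hh in auto)
 have levels: "levels_conv (insert 0 {s : erasure_levels. s < r}) (cutm mu D hh) (mu.cutMs hh)"
  unfolding levels_conv_def by (intro allI impI ballI recovered_levels) (auto simp: erasure_levels_def)
 have fin: "EV n. finite_measure (mu.cutMs hh n)" using nu_finite(2) by eventually_elim (rule cutMs_finite(1))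
 show ?thesis
  by (rule mu.GP_small_cut[OF fin _ erasure_levels_countable nodes levels s ep truncate_represents[OF X] truncate_represents[OF Xs]])
   (auto simp: erasure_levels_def)
qed

end

end

theorem theorem2p20:
  fixes X :: "'a mtree" and Xs :: "nat \<Rightarrow> 'b mtree"
    and r :: "nat \<Rightarrow> real" and D :: "nat \<Rightarrow> real \<Rightarrow> 'b set" and h0 :: real
  assumes "X \<in> T_min_di"
    and "\<And>n. Xs n \<in> T_min_di"
    and "incseq r" and "filterlim r at_top sequentially"
    and "\<And>k. nice_radius X (r k)"
    and "\<And>n k. compatible_cut_points X (Xs n) (r k) (D n (r k))"
    and "h0 > 0"
  shows
    "GV_converges Xs X \<and>
     (\<forall>k. b_tight Xs (\<lambda>n. mrestr (tmeas (Xs n)) (Cut (Xs n) (r k) (D n (r k)))))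
     \<longleftrightarrow>
     GV_erasure_converges Xs X \<and>
     (\<forall>h>0. \<forall>k. b_tight Xs (\<lambda>n. mrestr (erase (tmet (Xs n)) (troot (Xs n)) h (tmeas (Xs n)))
        (Cut (Xs n) (r k) (D n (r k))))) \<and>
     (\<forall>k. weak_converges (\<lambda>n. height_measure (cut_tree h0 (Xs n) (r k) (D n (r k))))
        (height_measure (cut_tree h0 X (r k) (bullet X (r k)))))"
    (is "?a \<longleftrightarrow> ?b")
proof -
 interpret T: rooted_tree "tmet X" "troot X" by (rule T_min_diD(1)[OF assms(1)])
 interpret C: cut_off X Xs "r k" "%n. D n (r k)" for k by unfold_locales (rule assms)+
 have above: "EX k. s < r k" for s using assms(4) unfolding filterlim_at_top_dense by (meson eventually_happens' sequentially_bot)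
 show ?thesis
 proof
  assume a: ?a
  have "GV_converges (%n. erase_tree h (Xs n)) (erase_tree h X)" if h: "0 < h" for h
  proof (rule GV_convergesI)
   let ?G = "T.generic (tmeas X) Int T.generic (erase (tmet X) (troot X) h (tmeas X))"
   have "{0<..} - ?G = ({0<..} - T.generic (tmeas X)) Un ({0<..} - T.generic (erase (tmet X) (troot X) h (tmeas X)))" by auto
   then show "countable ({0<..} - ?G)"
    using T.generic_countable[OF T_min_diD(4)[OF assms(1)]] T_min_diD(2)[OF assms(1)] erasing.erase_admissible[OF C.erasing(1)[OF h]] by simp
   fix s \<epsilon> :: real assume s: "0 < s" "s ~: {0<..} - ?G" "0 < \<epsilon>"
   \<comment> \<open>Any cut-off level above \<open>s\<close> decides the truncations at
     \<open>s\<close>, and since \<open>r\<close> tends to infinity there is one.\<close>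
   obtain k where "s < r k" using above by blast
   then show "EV n. GP_dist (truncate_tree s (erase_tree h (Xs n))) (truncate_tree s (erase_tree h X)) <= ennreal \<epsilon>"
    using C.erase_GP[of k h s \<epsilon>] a h s by simp
  qed
  then show ?b unfolding GV_erasure_converges_def C.bullet_eq
   using a C.erase_tight C.heights_converge assms(7) by blast
 next
  assume b: ?b
  note B = conjunct1[OF b] assms(7) conjunct1[OF conjunct2[OF b], rule_format] conjunct2[OF conjunct2[OF b], rule_format, unfolded C.bullet_eq]
  have "GV_converges Xs X"
  proof (rule GV_convergesI)
   show "countable ({0<..} - C.erasure_levels)" by (rule C.erasure_levels_countable[OF B])
   fix s \<epsilon> :: real assume s: "0 < s" "s ~: {0<..} - C.erasure_levels" "0 < \<epsilon>"
   obtain k where k: "s < r k" using above by blast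
   show "EV n. GP_dist (truncate_tree s (Xs n)) (truncate_tree s X) <= ennreal \<epsilon>"
    by (rule C.recovered_GP[OF B _ k s(3)]) (use s in auto)
  qed
  then show ?a using C.recovered_tight[OF B] by blast
 qed
qed

end
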